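(* Let $k\ge 4$ be even and $N$ square-free. Then $1\ll \sup(J^{cusp}_{k,1}(N))\ll N^{1/2}$, the implied constants depending only on $k$.
   Context: $J^{cusp}_{k,1}(N)$ is the space of holomorphic Jacobi cusp forms of weight $k$, index $1$ for $\Gamma_0(N)\ltimes\mathbf Z^2$ on $\mathbf H\times\mathbf C$. For $\phi$ of index $m$, with $\tau=u+iv$, $z=x+iy$, set $\widetilde\phi(\tau,z)=v^{k/2}e^{-2\pi m y^2/v}|\phi(\tau,z)|$. $\sup(J^{cusp}_{k,1}(N)):=\sup_{(\tau,z)\in\mathbf H\times\mathbf C}\sum_{\phi}\widetilde\phi(\tau,z)^2$, the sum over an orthonormal basis of $J^{cusp}_{k,1}(N)$ with respect to the Petersson inner product over $\Gamma_0(N)^J\backslash(\mathbf H\times\mathbf C)$ (not normalized by volume).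
   Formalization: The lower bound 1 ≪ sup is stated for all sufficiently large square-free N (depending on k), since for small N the space can be zero, e.g. k = 4, N = 1, where the sup is 0. *)

theory Defs
  imports "HOL-Analysis.Analysis" "HOL-Computational_Algebra.Squarefree"
begin

definition upper_half_plane :: "complex set" where
  "upper_half_plane = {\<tau>. Im \<tau> > 0}"

abbreviation jacobi_domain :: "(complex \<times> complex) set" where
  "jacobi_domain \<equiv> upper_half_plane \<times> UNIV"

definition SL2Z :: "(int ^ 2 ^ 2) set" where
  "SL2Z = {A. det A = 1}"

definition Gamma0 :: "nat \<Rightarrow> (int ^ 2 ^ 2) set" where
  "Gamma0 N = {A \<in> SL2Z. int N dvd A $ 2 $ 1}"

definition ee :: "complex \<Rightarrow> complex" where
  "ee w = exp (2 * of_real pi * \<i> * w)"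

definition mob_num :: "int ^ 2 ^ 2 \<Rightarrow> complex \<Rightarrow> complex" where
  "mob_num A \<tau> = of_int (A $ 1 $ 1) * \<tau> + of_int (A $ 1 $ 2)"

definition mob_den :: "int ^ 2 ^ 2 \<Rightarrow> complex \<Rightarrow> complex" where
  "mob_den A \<tau> = of_int (A $ 2 $ 1) * \<tau> + of_int (A $ 2 $ 2)"

definition jacobi_act :: "int ^ 2 ^ 2 \<Rightarrow> int \<Rightarrow> int \<Rightarrow> complex \<times> complex \<Rightarrow> complex \<times> complex" where
  "jacobi_act A l \<mu> = (\<lambda>(\<tau>, z).
     (mob_num A \<tau> / mob_den A \<tau>, (z + of_int l * \<tau> + of_int \<mu>) / mob_den A \<tau>))"

definition slash :: "nat \<Rightarrow> nat \<Rightarrow> (complex \<times> complex \<Rightarrow> complex) \<Rightarrow> int ^ 2 ^ 2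
    \<Rightarrow> complex \<times> complex \<Rightarrow> complex" where
  "slash k m \<phi> A = (\<lambda>(\<tau>, z).
     ee (- of_nat m * of_int (A $ 2 $ 1) * z ^ 2 / mob_den A \<tau>) / mob_den A \<tau> ^ k
       * \<phi> (jacobi_act A 0 0 (\<tau>, z)))"

text \<open>Holomorphy in two variables: complex Frechet differentiability.\<close>

definition holomorphic2_on :: "(complex \<times> complex \<Rightarrow> complex) \<Rightarrow> (complex \<times> complex) set \<Rightarrow> bool" where
  "holomorphic2_on \<phi> S \<longleftrightarrow>
     (\<forall>p\<in>S. \<exists>a b. (\<phi> has_derivative (\<lambda>(s, t). a * s + b * t)) (at p within S))"

text \<open>A form is represented by a function that is zero off \<open>jacobi_domain\<close>, so that equality of
  functions is equality of forms. In the expansions at the cusps, the exponents of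
  \<open>ee \<tau>\<close> lie in \<open>(1/w) \<int>\<close> for a cusp width \<open>w\<close> dividing \<open>N\<close>; they
  are written here as \<open>n / N\<close> at every cusp. The exponents \<open>r\<close> of
  \<open>ee z\<close> are integers since \<open>SL2Z\<close> preserves the lattice \<open>\<int>\<^sup>2\<close>.\<close>

definition jacobi_cusp_forms :: "nat \<Rightarrow> nat \<Rightarrow> nat \<Rightarrow> (complex \<times> complex \<Rightarrow> complex) set" where
  "jacobi_cusp_forms k m N = {\<phi>.
     (\<forall>p. p \<notin> jacobi_domain \<longrightarrow> \<phi> p = 0) \<and>
     holomorphic2_on \<phi> jacobi_domain \<and>
     (\<forall>A\<in>Gamma0 N. \<forall>p\<in>jacobi_domain. slash k m \<phi> A p = \<phi> p) \<and>
     (\<forall>l \<mu> :: int. \<forall>\<tau>\<in>upper_half_plane. \<forall>z.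
        ee (of_nat m * (of_int l ^ 2 * \<tau> + 2 * of_int l * z))
          * \<phi> (\<tau>, z + of_int l * \<tau> + of_int \<mu>) = \<phi> (\<tau>, z)) \<and>
     (\<forall>A\<in>SL2Z. \<exists>a :: int \<Rightarrow> int \<Rightarrow> complex.
        (\<forall>n r. a n r \<noteq> 0 \<longrightarrow> real_of_int (r ^ 2) < 4 * real m * (real_of_int n / real N)) \<and>
        (\<forall>\<tau>\<in>upper_half_plane. \<forall>z.
           ((\<lambda>(n, r). a n r * ee (of_int n / of_nat N * \<tau> + of_int r * z))
              has_sum slash k m \<phi> A (\<tau>, z)) UNIV))}"

text \<open>A fundamental domain for the Jacobi group \<open>Gamma0 N \<ltimes> \<int>\<^sup>2\<close> meets every
  orbit, and almost every orbit only once. Note that minus the identity acts by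
  \<open>(\<tau>, z) \<mapsto> (\<tau>, - z)\<close>, so that the fibre over a generic \<open>\<tau>\<close> is half
  a period parallelogram.\<close>

definition jacobi_orbit :: "nat \<Rightarrow> complex \<times> complex \<Rightarrow> (complex \<times> complex) set" where
  "jacobi_orbit N p = {jacobi_act A l \<mu> p | A l \<mu>. A \<in> Gamma0 N}"

definition jacobi_fundamental_domain :: "nat \<Rightarrow> (complex \<times> complex) set \<Rightarrow> bool" where
  "jacobi_fundamental_domain N F \<longleftrightarrow>
     F \<in> sets borel \<and> F \<subseteq> jacobi_domain \<and>
     (\<forall>p\<in>jacobi_domain. jacobi_orbit N p \<inter> F \<noteq> {}) \<and>
     {p \<in> F. \<exists>q\<in>F. q \<noteq> p \<and> q \<in> jacobi_orbit N p} \<in> null_sets lborel"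

text \<open>The Petersson product integrates against the invariant measure
  \<open>v\<^sup>-\<^sup>3 du dv dx dy\<close>, where \<open>\<tau> = u + iv\<close> and \<open>z = x + iy\<close>.
  For cusp forms the integrand is invariant and integrable, so the value does not depend on the
  chosen fundamental domain.\<close>

definition petersson :: "nat \<Rightarrow> nat \<Rightarrow> nat \<Rightarrow> (complex \<times> complex \<Rightarrow> complex)
    \<Rightarrow> (complex \<times> complex \<Rightarrow> complex) \<Rightarrow> complex" where
  "petersson k m N \<phi> \<psi> =
     set_lebesgue_integral lborel (SOME F. jacobi_fundamental_domain N F)
       (\<lambda>(\<tau>, z). \<phi> (\<tau>, z) * cnj (\<psi> (\<tau>, z))
          * of_real (Im \<tau> ^ k * exp (- 4 * pi * real m * Im z ^ 2 / Im \<tau>) / Im \<tau> ^ 3))"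

definition jacobi_orthonormal_basis ::
    "nat \<Rightarrow> nat \<Rightarrow> nat \<Rightarrow> (complex \<times> complex \<Rightarrow> complex) set \<Rightarrow> bool" where
  "jacobi_orthonormal_basis k m N B \<longleftrightarrow>
     finite B \<and> B \<subseteq> jacobi_cusp_forms k m N \<and>
     (\<forall>\<phi>\<in>B. \<forall>\<psi>\<in>B. petersson k m N \<phi> \<psi> = (if \<phi> = \<psi> then 1 else 0)) \<and>
     (\<forall>\<phi>\<in>jacobi_cusp_forms k m N. \<exists>a. \<phi> = (\<lambda>p. \<Sum>\<psi>\<in>B. a \<psi> * \<psi> p))"

definition jacobi_tilde :: "nat \<Rightarrow> nat \<Rightarrow> (complex \<times> complex \<Rightarrow> complex) \<Rightarrow> complex \<times> complex \<Rightarrow> real" where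
  "jacobi_tilde k m \<phi> = (\<lambda>(\<tau>, z).
     Im \<tau> powr (real k / 2) * exp (- 2 * pi * real m * Im z ^ 2 / Im \<tau>) * cmod (\<phi> (\<tau>, z)))"

text \<open>The sum does not depend on the orthonormal basis. The supremum is taken in the extended reals,
  so that an upper bound for it includes its finiteness.\<close>

definition jacobi_sup :: "nat \<Rightarrow> nat \<Rightarrow> nat \<Rightarrow> ereal" where
  "jacobi_sup k m N =
     (SUP p\<in>jacobi_domain.
        ereal (\<Sum>\<phi>\<in>(SOME B. jacobi_orthonormal_basis k m N B). jacobi_tilde k m \<phi> p ^ 2))"

end

theory Submission
  imports Defs "HOL-Complex_Analysis.Conformal_Mappings" "HOL-Real_Asymp.Real_Asymp"
begin

text \<open>
  Both bounds compare the reproducing kernel \<open>\<Sum>\<^sub>\<phi> \<phi>\<^sup>~(p)\<^sup>2\<close> with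
  evaluation at \<open>p\<close>.

  Upper bound: the kernel is at most \<open>K\<close> as soon as
  \<open>\<phi>\<^sup>~(p)\<^sup>2 \<le> K \<parallel>\<phi>\<parallel>\<^sup>2\<close> for every form. Move \<open>p\<close> to
  \<open>Im \<tau> \<ge> 3/4\<close> with \<open>A \<in> SL2Z\<close> and expand \<open>\<phi>|A\<close> at its cusp, of
  width \<open>w\<close>. Unfolding the norm over a Siegel set, which covers the fundamental domain at most
  eight times, bounds the norm from below by \<open>w \<Sum> |a(n,r)|\<^sup>2 D\<^sup>-\<^sup>k\<^sup>+\<^sup>3\<^sup>/\<^sup>2\<close> up to exponential factors,
  where the discriminants \<open>D = 4n - r\<^sup>2\<close> lie in \<open>(1/w) \<int>\<close>. The theta decomposition leaves only
  two residues \<open>r\<close>, and Cauchy-Schwarz over the discriminants \<open>j/w\<close> gives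
  \<open>K \<lless> w\<^sup>1\<^sup>/\<^sup>2 \<le> N\<^sup>1\<^sup>/\<^sup>2\<close>.

  Lower bound: the kernel at \<open>p\<close> is at least \<open>P\<^sup>~(p)\<^sup>2 / \<parallel>P\<parallel>\<^sup>2\<close> for
  any form \<open>P\<close>. Take the Poincare series \<open>P = \<Sum> h|A\<close> over the coprime bottom rows
  \<open>(c,d)\<close> of \<open>\<Gamma>\<^sub>0(N)\<close>, with
  \<open>h = e(\<tau>) \<Sum>\<^sub>l e(l\<^sup>2\<tau> + 2lz)\<close>. Since \<open>h\<^sup>~ \<lless> min 1 v\<^sup>3\<^sup>/\<^sup>2\<close>, comparison
  with the full sum over coprime rows bounds \<open>P\<^sup>~\<close> independently of \<open>N\<close>, and unfolding one factor of
  \<open>|P|\<^sup>2\<close> does the same for the norm. At \<open>(\<i>,0)\<close> the rows with \<open>c \<noteq> 0\<close> have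
  \<open>|c| \<ge> N\<close>, so that \<open>P(\<i>,0)\<close> tends to \<open>2h(\<i>,0) \<noteq> 0\<close>.
\<close>

section \<open>The Jacobi group and its action\<close>

definition mat2 :: "int \<Rightarrow> int \<Rightarrow> int \<Rightarrow> int \<Rightarrow> int ^ 2 ^ 2" where
  "mat2 a b c d = vector [vector [a, b], vector [c, d]]"

lemma mat2_nth [simp]:
  "mat2 a b c d $ 1 $ 1 = a" "mat2 a b c d $ 1 $ 2 = b"
  "mat2 a b c d $ 2 $ 1 = c" "mat2 a b c d $ 2 $ 2 = d"
  by (simp_all add: mat2_def)

lemma mat2_eq_iff: "A = B \<longleftrightarrow> A$1$1 = B$1$1 \<and> A$1$2 = B$1$2 \<and> A$2$1 = B$2$1 \<and> A$2$2 = B$2$2"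
  for A B :: "'a ^ 2 ^ 2"
  by (auto simp: vec_eq_iff forall_2)

lemma mul2_nth:
  fixes A B :: "int ^ 2 ^ 2"
  shows "(A ** B) $ 1 $ 1 = A$1$1 * B$1$1 + A$1$2 * B$2$1"
    "(A ** B) $ 1 $ 2 = A$1$1 * B$1$2 + A$1$2 * B$2$2"
    "(A ** B) $ 2 $ 1 = A$2$1 * B$1$1 + A$2$2 * B$2$1"
    "(A ** B) $ 2 $ 2 = A$2$1 * B$1$2 + A$2$2 * B$2$2"
  by (simp_all add: matrix_matrix_mult_def sum_2)

lemma SL2Z_iff: "A \<in> SL2Z \<longleftrightarrow> A$1$1 * A$2$2 - A$1$2 * A$2$1 = 1"
  by (simp add: SL2Z_def det_2)

definition inv2 :: "int ^ 2 ^ 2 \<Rightarrow> int ^ 2 ^ 2" where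
  "inv2 A = mat2 (A$2$2) (- A$1$2) (- A$2$1) (A$1$1)"

lemma mat1_nth [simp]: "(mat 1 :: int^2^2) $ 1 $ 1 = 1" "(mat 1 :: int^2^2) $ 1 $ 2 = 0"
  "(mat 1 :: int^2^2) $ 2 $ 1 = 0" "(mat 1 :: int^2^2) $ 2 $ 2 = 1"
  by (simp_all add: mat_def)

lemma SL2Z_mult: "A \<in> SL2Z \<Longrightarrow> B \<in> SL2Z \<Longrightarrow> A ** B \<in> SL2Z"
  by (simp add: SL2Z_def det_mul)

lemma SL2Z_one: "mat 1 \<in> SL2Z"
  by (simp add: SL2Z_def)

lemma SL2Z_inv2: "A \<in> SL2Z \<Longrightarrow> inv2 A \<in> SL2Z"
  by (simp add: SL2Z_iff inv2_def algebra_simps)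

lemma inv2_mult: "A \<in> SL2Z \<Longrightarrow> inv2 A ** A = mat 1" "A \<in> SL2Z \<Longrightarrow> A ** inv2 A = mat 1"
  by (auto simp: SL2Z_iff inv2_def mat2_eq_iff mul2_nth algebra_simps)

lemma Gamma0_SL2Z: "A \<in> Gamma0 N \<Longrightarrow> A \<in> SL2Z"
  by (simp add: Gamma0_def)

lemma Gamma0_mult: "A \<in> Gamma0 N \<Longrightarrow> B \<in> Gamma0 N \<Longrightarrow> A ** B \<in> Gamma0 N"
  by (auto simp: Gamma0_def SL2Z_mult mul2_nth)

lemma Gamma0_one: "mat 1 \<in> Gamma0 N"
  by (simp add: Gamma0_def SL2Z_one)

lemma Gamma0_inv2: "A \<in> Gamma0 N \<Longrightarrow> inv2 A \<in> Gamma0 N"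
  by (auto simp: Gamma0_def SL2Z_inv2) (simp add: inv2_def)

abbreviation mob :: "int ^ 2 ^ 2 \<Rightarrow> complex \<Rightarrow> complex" where
  "mob A \<tau> \<equiv> mob_num A \<tau> / mob_den A \<tau>"

lemma lattice_nonzero:
  assumes "Im \<tau> > 0" "c \<noteq> 0 \<or> d \<noteq> 0"
  shows "of_int c * \<tau> + of_int d \<noteq> 0"
  using assms by (auto simp: complex_eq_iff)

lemma mob_den_nonzero:
  assumes "A \<in> SL2Z" "Im \<tau> > 0"
  shows "mob_den A \<tau> \<noteq> 0"
  unfolding mob_den_def using assms by (intro lattice_nonzero) (auto simp: SL2Z_iff)

lemma mob_det:
  assumes "A \<in> SL2Z"
  shows "of_int (A$1$1) * mob_den A \<tau> - of_int (A$2$1) * mob_num A \<tau> = 1"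
proof -
  have "of_int (A$1$1) * mob_den A \<tau> - of_int (A$2$1) * mob_num A \<tau>
      = of_int (A$1$1 * A$2$2 - A$1$2 * A$2$1)"
    by (simp add: mob_den_def mob_num_def algebra_simps)
  also have "A$1$1 * A$2$2 - A$1$2 * A$2$1 = 1" using assms by (simp add: SL2Z_iff)
  finally show ?thesis by simp
qed

lemma Im_mob:
  assumes "A \<in> SL2Z" "Im \<tau> > 0"
  shows "Im (mob A \<tau>) = Im \<tau> / (cmod (mob_den A \<tau>))\<^sup>2"
proof -
  have "Im (mob_num A \<tau> * cnj (mob_den A \<tau>)) = real_of_int (A$1$1 * A$2$2 - A$1$2 * A$2$1) * Im \<tau>"
    by (simp add: mob_num_def mob_den_def algebra_simps)
  also have "A$1$1 * A$2$2 - A$1$2 * A$2$1 = 1"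
    using assms by (simp add: SL2Z_iff)
  finally show ?thesis
    by (subst complex_div_cnj) (simp add: Im_divide_of_real flip: of_real_power)
qed

lemma Im_mob_pos: "A \<in> SL2Z \<Longrightarrow> Im \<tau> > 0 \<Longrightarrow> Im (mob A \<tau>) > 0"
  using Im_mob mob_den_nonzero by simp

lemma mob_mult:
  assumes "B \<in> SL2Z" "Im \<tau> > 0"
  shows "mob_den (A ** B) \<tau> = mob_den A (mob B \<tau>) * mob_den B \<tau>"
    and "mob_num (A ** B) \<tau> = mob_num A (mob B \<tau>) * mob_den B \<tau>"
proof -
  have e: "mob B \<tau> * mob_den B \<tau> = mob_num B \<tau>"
    using mob_den_nonzero[OF assms] by simp
  have "mob_den A (mob B \<tau>) * mob_den B \<tau> = of_int (A$2$1) * (mob B \<tau> * mob_den B \<tau>) + of_int (A$2$2) * mob_den B \<tau>"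
    by (simp only: mob_den_def[of A] distrib_right mult.assoc)
  then show "mob_den (A ** B) \<tau> = mob_den A (mob B \<tau>) * mob_den B \<tau>"
    unfolding e by (simp only: mob_den_def mob_num_def mul2_nth of_int_add of_int_mult algebra_simps)
  have "mob_num A (mob B \<tau>) * mob_den B \<tau> = of_int (A$1$1) * (mob B \<tau> * mob_den B \<tau>) + of_int (A$1$2) * mob_den B \<tau>"
    by (simp only: mob_num_def[of A] distrib_right mult.assoc)
  then show "mob_num (A ** B) \<tau> = mob_num A (mob B \<tau>) * mob_den B \<tau>"
    unfolding e by (simp only: mob_den_def mob_num_def mul2_nth of_int_add of_int_mult algebra_simps)
qed

lemma mob_mult':
  assumes "A \<in> SL2Z" "B \<in> SL2Z" "Im \<tau> > 0"
  shows "mob (A ** B) \<tau> = mob A (mob B \<tau>)"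
  using mob_mult[OF assms(2,3)] mob_den_nonzero[OF assms(2,3)] by simp

lemma mob_one [simp]: "mob_num (mat 1) \<tau> = \<tau>" "mob_den (mat 1) \<tau> = 1"
  by (simp_all add: mob_num_def mob_den_def)

lemma upper_half_plane_iff [simp]: "\<tau> \<in> upper_half_plane \<longleftrightarrow> Im \<tau> > 0"
  by (simp add: upper_half_plane_def)

lemma jacobi_act_domain: "A \<in> SL2Z \<Longrightarrow> p \<in> jacobi_domain \<Longrightarrow> jacobi_act A l m p \<in> jacobi_domain"
  by (cases p) (auto simp: jacobi_act_def Im_mob_pos)

type_synonym jac = "(int ^ 2 ^ 2) \<times> int \<times> int"

definition jact :: "jac \<Rightarrow> complex \<times> complex \<Rightarrow> complex \<times> complex" where
  "jact g = jacobi_act (fst g) (fst (snd g)) (snd (snd g))"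

definition jmul :: "jac \<Rightarrow> jac \<Rightarrow> jac" where
  "jmul = (\<lambda>(A, l, m) (B, l', m').
     (A ** B, l' + l * B$1$1 + m * B$2$1, m' + l * B$1$2 + m * B$2$2))"

definition jinv :: "jac \<Rightarrow> jac" where
  "jinv = (\<lambda>(A, l, m). (inv2 A, m * A$2$1 - l * A$2$2, l * A$1$2 - m * A$1$1))"

definition jone :: jac where "jone = (mat 1, 0, 0)"

definition JG :: "nat \<Rightarrow> jac set" where
  "JG N = Gamma0 N \<times> UNIV"

lemma countable_JG [simp]: "countable (JG N)"
  by (rule countableI_type)

lemma JG_SL2Z: "g \<in> JG N \<Longrightarrow> fst g \<in> SL2Z"
  by (auto simp: JG_def Gamma0_SL2Z)

lemma jact_Pair: "jact (A, l, m) (\<tau>, z) = (mob A \<tau>, (z + of_int l * \<tau> + of_int m) / mob_den A \<tau>)"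
  by (simp add: jact_def jacobi_act_def)

lemma jact_domain: "fst g \<in> SL2Z \<Longrightarrow> p \<in> jacobi_domain \<Longrightarrow> jact g p \<in> jacobi_domain"
  unfolding jact_def by (rule jacobi_act_domain)

lemma jact_jmul:
  assumes "fst g \<in> SL2Z" "fst h \<in> SL2Z" "p \<in> jacobi_domain"
  shows "jact (jmul g h) p = jact g (jact h p)"
proof -
  obtain A l m B l' m' \<tau> z where [simp]: "g = (A, l, m)" "h = (B, l', m')" "p = (\<tau>, z)"
    by (metis prod.exhaust)
  have t: "Im \<tau> > 0" and A: "A \<in> SL2Z" and B: "B \<in> SL2Z" using assms by simp_all
  have nz: "mob_den B \<tau> \<noteq> 0" "mob_den A (mob B \<tau>) \<noteq> 0"
    using mob_den_nonzero A B t Im_mob_pos by blast+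
  have "(z + of_int (l' + l * B$1$1 + m * B$2$1) * \<tau> + of_int (m' + l * B$1$2 + m * B$2$2))
     = (z + of_int l' * \<tau> + of_int m') + of_int l * mob_num B \<tau> + of_int m * mob_den B \<tau>"
    by (simp add: mob_num_def mob_den_def algebra_simps)
  also have "\<dots> = ((z + of_int l' * \<tau> + of_int m') / mob_den B \<tau> + of_int l * mob B \<tau> + of_int m) * mob_den B \<tau>"
    using nz by (simp add: field_simps)
  finally show ?thesis
    using nz by (simp add: jmul_def jact_Pair mob_mult[OF B t])
qed

lemma jmul_JG: "g \<in> JG N \<Longrightarrow> h \<in> JG N \<Longrightarrow> jmul g h \<in> JG N"
  by (auto simp: JG_def jmul_def Gamma0_mult)

lemma jinv_JG: "g \<in> JG N \<Longrightarrow> jinv g \<in> JG N"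
  by (auto simp: JG_def jinv_def Gamma0_inv2)

lemma jone_JG [simp]: "jone \<in> JG N"
  by (auto simp: JG_def jone_def Gamma0_one)

lemma jact_jone [simp]: "jact jone p = p"
  by (cases p) (simp add: jone_def jact_Pair)

lemma jmul_jinv:
  assumes "fst g \<in> SL2Z"
  shows "jmul g (jinv g) = jone" "jmul (jinv g) g = jone"
proof -
  obtain A l m where g [simp]: "g = (A, l, m)" by (metis prod.exhaust)
  have A: "A \<in> SL2Z" using assms by simp
  have d: "A$1$1 * A$2$2 = 1 + A$1$2 * A$2$1" using A by (simp add: SL2Z_iff)
  show "jmul g (jinv g) = jone" 
    using A by (simp add: jmul_def jinv_def jone_def inv2_mult) (simp add: inv2_def algebra_simps)
  have "l + (m * A$2$1 - l * A$2$2) * A$1$1 + (l * A$1$2 - m * A$1$1) * A$2$1 = 0"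
       "m + (m * A$2$1 - l * A$2$2) * A$1$2 + (l * A$1$2 - m * A$1$1) * A$2$2 = 0"
    using d by algebra+
  then show "jmul (jinv g) g = jone"
    using A by (simp add: jmul_def jinv_def jone_def inv2_mult)
qed

lemma jinv_jinv: "jinv (jinv g) = g" if "fst g \<in> SL2Z"
proof -
  obtain A l m where g [simp]: "g = (A, l, m)" by (metis prod.exhaust)
  have d: "A$1$1 * A$2$2 = 1 + A$1$2 * A$2$1" using that by (simp add: SL2Z_iff)
  have "inv2 (inv2 A) = A" by (simp add: inv2_def mat2_eq_iff)
  moreover have "(l * A$1$2 - m * A$1$1) * (- A$2$1) - (m * A$2$1 - l * A$2$2) * A$1$1 = l"
    "(m * A$2$1 - l * A$2$2) * (- A$1$2) - (l * A$1$2 - m * A$1$1) * A$2$2 = m"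
    using d by algebra+
  ultimately show ?thesis by (simp add: jinv_def) (simp add: inv2_def)
qed

lemma fst_jinv: "fst g \<in> SL2Z \<Longrightarrow> fst (jinv g) \<in> SL2Z"
  by (cases g) (auto simp: jinv_def SL2Z_inv2)

lemma fst_jmul: "fst g \<in> SL2Z \<Longrightarrow> fst h \<in> SL2Z \<Longrightarrow> fst (jmul g h) \<in> SL2Z"
  by (cases g; cases h) (auto simp: jmul_def SL2Z_mult)

lemma jact_jinv:
  assumes "fst g \<in> SL2Z" "p \<in> jacobi_domain"
  shows "jact (jinv g) (jact g p) = p" "jact g (jact (jinv g) p) = p"
  using assms by (simp_all add: fst_jinv jmul_jinv flip: jact_jmul)

lemma bij_betw_jinv: "bij_betw jinv (JG N) (JG N)"
  by (rule bij_betw_byWitness[where f' = jinv]) (auto simp: jinv_JG jinv_jinv JG_SL2Z)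

lemma jacobi_orbit_alt: "jacobi_orbit N p = (\<lambda>g. jact g p) ` JG N"
proof -
  have "q \<in> jacobi_orbit N p \<longleftrightarrow> q \<in> (\<lambda>g. jact g p) ` JG N" for q
    by (fastforce simp: jacobi_orbit_def JG_def jact_def image_iff mem_Collect_eq)
  then show ?thesis by blast
qed

lemma slash_mult:
  assumes "A \<in> SL2Z" "B \<in> SL2Z" "p \<in> jacobi_domain"
  shows "slash k m (slash k m \<phi> A) B p = slash k m \<phi> (A ** B) p"
proof -
  obtain \<tau> z where p: "p = (\<tau>, z)" by (cases p)
  have t: "Im \<tau> > 0" using assms p by simp
  define j where "j = mob_den B \<tau>"
  define j' where "j' = mob_den A (mob B \<tau>)"
  have nz: "j \<noteq> 0" "j' \<noteq> 0"
    unfolding j_def j'_def using mob_den_nonzero assms t Im_mob_pos by blast+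
  obtain w where w: "mob_num B \<tau> / j = w" "mob B \<tau> = w" by (simp add: j_def)
  have AB: "mob_den (A ** B) \<tau> = j' * j" "mob_num (A ** B) \<tau> = mob_num A (mob B \<tau>) * j"
    using mob_mult[OF assms(2) t] by (auto simp: j_def j'_def)
  have "of_int (A$2$1) * mob_num B \<tau> + of_int (A$2$2) * j = j' * j"
    using AB(1) by (simp add: mob_den_def mob_num_def mul2_nth j_def algebra_simps)
  moreover have "of_int (B$1$1) * j - of_int (B$2$1) * mob_num B \<tau> = 1"
    using mob_det[OF assms(2)] j_def by simp
  ultimately have "of_int ((A ** B)$2$1) * j = of_int (B$2$1) * (j' * j) + of_int (A$2$1)"
    by (simp add: mul2_nth) algebra
  then have e: "of_int ((A ** B)$2$1) / (j' * j) = of_int (B$2$1) / j + of_int (A$2$1) / (j^2 * j')"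
    using nz by (simp add: field_simps power2_eq_square)
  have "- of_nat m * of_int ((A ** B)$2$1) * z\<^sup>2 / (j' * j)
    = - of_nat m * z\<^sup>2 * (of_int ((A ** B)$2$1) / (j' * j))"
    by simp
  also have "\<dots> = - of_nat m * of_int (B$2$1) * z\<^sup>2 / j + - of_nat m * of_int (A$2$1) * (z/j)\<^sup>2 / j'"
    unfolding e distrib_left by (simp add: power_divide mult_ac)
  finally have "- of_nat m * of_int ((A ** B)$2$1) * z\<^sup>2 / (j' * j)
     = - of_nat m * of_int (B$2$1) * z\<^sup>2 / j + - of_nat m * of_int (A$2$1) * (z/j)\<^sup>2 / j'" .
  then have "ee (- of_nat m * of_int ((A ** B)$2$1) * z\<^sup>2 / (j' * j))
     = ee (- of_nat m * of_int (B$2$1) * z\<^sup>2 / j) * ee (- of_nat m * of_int (A$2$1) * (z/j)\<^sup>2 / j')"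
    by (simp only: ee_def exp_add[symmetric] distrib_left)
  then show ?thesis
    using nz by (simp add: p slash_def jacobi_act_def AB flip: j_def)
      (simp add: power_mult_distrib mult_ac w j'_def)
qed

lemma slash_one [simp]: "slash k m \<phi> (mat 1) p = \<phi> p"
  by (cases p) (simp add: slash_def jacobi_act_def ee_def)

lemma ee_add: "ee (x + y) = ee x * ee y"
  by (simp add: ee_def distrib_left exp_add)

lemma ee_int [simp]: "ee (of_int n) = 1"
  by (auto simp: ee_def exp_eq_1)

lemma ee_0 [simp]: "ee 0 = 1" by (simp add: ee_def)

lemma norm_ee: "cmod (ee w) = exp (- 2 * pi * Im w)"
  by (simp add: ee_def)

lemma ee_nonzero [simp]: "ee w \<noteq> 0" by (simp add: ee_def)

definition lattice_inv :: "(complex \<times> complex \<Rightarrow> complex) \<Rightarrow> bool" where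
  "lattice_inv \<phi> \<longleftrightarrow> (\<forall>l \<mu> :: int. \<forall>\<tau> z. Im \<tau> > 0 \<longrightarrow>
     ee (of_int l ^ 2 * \<tau> + 2 * of_int l * z) * \<phi> (\<tau>, z + of_int l * \<tau> + of_int \<mu>) = \<phi> (\<tau>, z))"

lemma lattice_inv_slash:
  assumes "lattice_inv \<phi>" "A \<in> SL2Z"
  shows "lattice_inv (slash k 1 \<phi> A)"
  unfolding lattice_inv_def
proof (intro allI impI)
  fix l m :: int and \<tau> z :: complex assume t: "Im \<tau> > 0"
  define l' where "l' = l * A$2$2 - m * A$2$1"
  define m' where "m' = m * A$1$1 - l * A$1$2"
  have d: "A$1$1 * A$2$2 = 1 + A$1$2 * A$2$1" using assms by (simp add: SL2Z_iff)
  have lm: "l = l' * A$1$1 + m' * A$2$1" "m = l' * A$1$2 + m' * A$2$2"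
    unfolding l'_def m'_def using d by algebra+
  define j where "j = mob_den A \<tau>"
  define t' where "t' = mob A \<tau>"
  define s where "s = of_int l' * t' + of_int m'"
  have nz: "j \<noteq> 0" unfolding j_def using mob_den_nonzero assms t by blast
  have t': "Im t' > 0" unfolding t'_def using Im_mob_pos assms t by blast
  have num: "mob_num A \<tau> = t' * j" using nz by (simp add: t'_def j_def)
  have js: "of_int l * \<tau> + of_int m = j * s"
  proof -
    have "of_int l * \<tau> + of_int m = of_int l' * mob_num A \<tau> + of_int m' * mob_den A \<tau>"
      by (simp add: lm mob_num_def mob_den_def algebra_simps)
    then show ?thesis by (simp add: num s_def j_def[symmetric] algebra_simps)
  qed
  have det: "of_int (A$1$1) * j - of_int (A$2$1) * (t' * j) = 1"
    using mob_det[OF assms(2), of \<tau>] num j_def by simp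
  have l: "of_int l * j = of_int (A$2$1) * j * s + of_int l'"
  proof -
    have "of_int l * j = of_int l' * (of_int (A$1$1) * j) + of_int m' * of_int (A$2$1) * j"
      by (simp add: lm algebra_simps)
    also have "of_int (A$1$1) * j = 1 + of_int (A$2$1) * (t' * j)" using det by algebra
    finally show ?thesis by (simp add: s_def algebra_simps)
  qed
  have "(- of_int (A$2$1) * (z + j * s)\<^sup>2 / j + (of_int l ^ 2 * \<tau> + 2 * of_int l * z)) * j
     = (- of_int (A$2$1) * z\<^sup>2 / j + of_int (l' * m' - l * m)
        + (of_int l' ^ 2 * t' + 2 * of_int l' * (z / j))) * j"
  proof -
    have e: "(- of_int (A$2$1) * (z + j * s)\<^sup>2 / j + (of_int l ^ 2 * \<tau> + 2 * of_int l * z)) * j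
      = - of_int (A$2$1) * (z + j * s)\<^sup>2 + (of_int l * j) * (of_int l * \<tau> + 2 * z)"
      using nz by (simp add: field_simps power2_eq_square)
    have e': "(- of_int (A$2$1) * z\<^sup>2 / j + of_int (l' * m' - l * m)
        + (of_int l' ^ 2 * t' + 2 * of_int l' * (z / j))) * j
      = - of_int (A$2$1) * z\<^sup>2 + (of_int l' * of_int m' - of_int l * of_int m) * j + of_int l' ^ 2 * t' * j + 2 * of_int l' * z"
      using nz by (simp add: field_simps power2_eq_square)
    have "of_int l * \<tau> = j * s - of_int m" using js by algebra
    then show ?thesis unfolding e e' using l s_def by algebra
  qed
  then have "- of_int (A$2$1) * (z + j * s)\<^sup>2 / j + (of_int l ^ 2 * \<tau> + 2 * of_int l * z)
     = - of_int (A$2$1) * z\<^sup>2 / j + of_int (l' * m' - l * m)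
        + (of_int l' ^ 2 * t' + 2 * of_int l' * (z / j))"
    using nz by (metis mult_cancel_right)
  then have E: "ee (- of_int (A$2$1) * (z + j * s)\<^sup>2 / j) * ee (of_int l ^ 2 * \<tau> + 2 * of_int l * z)
     = ee (- of_int (A$2$1) * z\<^sup>2 / j) * ee (of_int l' ^ 2 * t' + 2 * of_int l' * (z / j))"
    by (metis ee_add ee_int mult.right_neutral)
  have inv: "ee (of_int l' ^ 2 * t' + 2 * of_int l' * (z/j)) * \<phi> (t', z/j + s) = \<phi> (t', z/j)"
    using assms(1) t' unfolding lattice_inv_def s_def by (metis add.assoc)
  have arg: "z + of_int l * \<tau> + of_int m = z + j * s" using js by (simp add: add.assoc)
  have zj: "(z + j * s) / j = z / j + s" using nz by (simp add: field_simps)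
  have S: "slash k 1 \<phi> A (\<tau>, w) = ee (- of_int (A$2$1) * w\<^sup>2 / j) / j ^ k * \<phi> (t', w / j)" for w
    by (simp add: slash_def jacobi_act_def j_def t'_def)
  have "ee (of_int l ^ 2 * \<tau> + 2 * of_int l * z) * slash k 1 \<phi> A (\<tau>, z + of_int l * \<tau> + of_int m)
    = (ee (- of_int (A$2$1) * (z + j * s)\<^sup>2 / j) * ee (of_int l ^ 2 * \<tau> + 2 * of_int l * z)) / j ^ k * \<phi> (t', z / j + s)"
    unfolding S arg zj by (simp only: times_divide_eq_right times_divide_eq_left mult_ac)
  also have "\<dots> = ee (- of_int (A$2$1) * z\<^sup>2 / j) / j ^ k * (ee (of_int l' ^ 2 * t' + 2 * of_int l' * (z / j)) * \<phi> (t', z / j + s))"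
    unfolding E by (simp only: times_divide_eq_right times_divide_eq_left mult_ac)
  also have "\<dots> = slash k 1 \<phi> A (\<tau>, z)" unfolding inv S ..
  finally show "ee (of_int l ^ 2 * \<tau> + 2 * of_int l * z) * slash k 1 \<phi> A (\<tau>, z + of_int l * \<tau> + of_int m)
      = slash k 1 \<phi> A (\<tau>, z)" .
qed

lemma jacobi_tilde_nonneg: "jacobi_tilde k m \<phi> p \<ge> 0"
  by (cases p) (simp add: jacobi_tilde_def)

lemma tilde_slash:
  assumes "A \<in> SL2Z" "p \<in> jacobi_domain"
  shows "jacobi_tilde k 1 (slash k 1 \<phi> A) p = jacobi_tilde k 1 \<phi> (jacobi_act A 0 0 p)"
proof -
  obtain \<tau> z where p: "p = (\<tau>, z)" by (cases p)
  have t: "Im \<tau> > 0" using assms p by simp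
  define j where "j = mob_den A \<tau>"
  have nz: "j \<noteq> 0" unfolding j_def using mob_den_nonzero assms t by blast
  then have J: "cmod j > 0" by simp
  have v: "Im (mob A \<tau>) = Im \<tau> / (cmod j)\<^sup>2" using Im_mob[OF assms(1) t] by (simp add: j_def)
  have c1: "(Im \<tau> / (cmod j)\<^sup>2) powr (real k / 2) * cmod j ^ k = Im \<tau> powr (real k / 2)"
  proof -
    have "((cmod j)\<^sup>2) powr (real k / 2) = (cmod j powr 2) powr (real k / 2)"
      using J by simp
    also have "\<dots> = cmod j ^ k" unfolding powr_powr using J by (simp add: powr_realpow)
    finally show ?thesis using t J by (simp add: powr_divide)
  qed
  let ?c = "real_of_int (A$2$1)"
  have imj: "Im j = ?c * Im \<tau>" by (simp add: j_def mob_den_def)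
  have c2: "- 2 * pi * Im (- of_int (A$2$1) * z\<^sup>2 / j) + - 2 * pi * (Im z)\<^sup>2 / Im \<tau>
     = - 2 * pi * (Im (z / j))\<^sup>2 / (Im \<tau> / (cmod j)\<^sup>2)"
  proof -
    have a: "Im (- of_int (A$2$1) * z\<^sup>2 / j) = Im (- of_int (A$2$1) * z\<^sup>2 * cnj j) / (cmod j)\<^sup>2"
      by (subst complex_div_cnj) (simp only: Im_divide_of_real flip: of_real_power)
    have b: "Im (z / j) = Im (z * cnj j) / (cmod j)\<^sup>2"
      by (subst complex_div_cnj) (simp add: Im_divide_of_real flip: of_real_power)
    have n: "(cmod j)\<^sup>2 = (Re j)\<^sup>2 + (Im j)\<^sup>2" by (simp add: cmod_power2)
    have "Im \<tau> * Im (- of_int (A$2$1) * z\<^sup>2 * cnj j) + (Im z)\<^sup>2 * (cmod j)\<^sup>2 = (Im (z * cnj j))\<^sup>2"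
      unfolding n by (simp add: imj power2_eq_square algebra_simps)
    moreover have "P / n + y / T = (Q / n)\<^sup>2 / (T / n)" if "T * P + y * n = Q\<^sup>2" "T > 0" "n > 0" for P n y T Q :: real
    proof -
      have "(Q / n)\<^sup>2 / (T / n) = Q\<^sup>2 / (n * T)" using that by (simp add: field_simps power2_eq_square)
      then show ?thesis using that(2,3) by (simp add: field_simps flip: that(1))
    qed
    ultimately have "Im (- of_int (A$2$1) * z\<^sup>2 / j) + (Im z)\<^sup>2 / Im \<tau> = (Im (z / j))\<^sup>2 / (Im \<tau> / (cmod j)\<^sup>2)"
      unfolding a b using t J by simp
    then have "- 2 * pi * (Im (- of_int (A$2$1) * z\<^sup>2 / j) + (Im z)\<^sup>2 / Im \<tau>) = - 2 * pi * ((Im (z / j))\<^sup>2 / (Im \<tau> / (cmod j)\<^sup>2))"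
      by simp
    then show ?thesis by (simp add: algebra_simps)
  qed
  have c3: "exp (- 2 * pi * (Im z)\<^sup>2 / Im \<tau>) * cmod (ee (- of_int (A$2$1) * z\<^sup>2 / j))
    = exp (- 2 * pi * (Im (z / j))\<^sup>2 / (Im \<tau> / (cmod j)\<^sup>2))"
    by (simp only: norm_ee exp_add[symmetric] c2[symmetric] add.commute)
  have "jacobi_tilde k 1 (slash k 1 \<phi> A) p = Im \<tau> powr (real k / 2) *
     (exp (- 2 * pi * (Im z)\<^sup>2 / Im \<tau>) * cmod (ee (- of_int (A$2$1) * z\<^sup>2 / j))) / cmod j ^ k * cmod (\<phi> (mob A \<tau>, z / j))"
    by (simp add: p jacobi_tilde_def slash_def jacobi_act_def norm_mult norm_divide norm_power flip: j_def)
  also have "\<dots> = jacobi_tilde k 1 \<phi> (jacobi_act A 0 0 p)"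
    unfolding c3 c1[symmetric] using J
    by (simp add: p jacobi_tilde_def jacobi_act_def v[folded j_def] flip: j_def)
  finally show ?thesis .
qed

lemma tilde_lattice:
  assumes "lattice_inv \<phi>" "Im \<tau> > 0"
  shows "jacobi_tilde k 1 \<phi> (\<tau>, z + of_int l * \<tau> + of_int m) = jacobi_tilde k 1 \<phi> (\<tau>, z)"
proof -
  have "cmod (\<phi> (\<tau>, z)) = exp (- 2 * pi * Im (of_int l ^ 2 * \<tau> + 2 * of_int l * z)) * cmod (\<phi> (\<tau>, z + of_int l * \<tau> + of_int m))"
    using assms unfolding lattice_inv_def by (metis norm_mult norm_ee)
  moreover have "exp (- 2 * pi * (Im (z + of_int l * \<tau> + of_int m))\<^sup>2 / Im \<tau>)
    = exp (- 2 * pi * (Im z)\<^sup>2 / Im \<tau>) * exp (- 2 * pi * Im (of_int l ^ 2 * \<tau> + 2 * of_int l * z))"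
    unfolding exp_add[symmetric] using assms by (simp add: field_simps power2_eq_square flip: of_int_mult)
  ultimately show ?thesis by (simp add: jacobi_tilde_def)
qed

lemma tilde_jact:
  assumes "lattice_inv \<phi>" "\<And>p. p \<in> jacobi_domain \<Longrightarrow> slash k 1 \<phi> (fst g) p = \<phi> p"
     "fst g \<in> SL2Z" "p \<in> jacobi_domain"
  shows "jacobi_tilde k 1 \<phi> (jact g p) = jacobi_tilde k 1 \<phi> p"
proof -
  obtain A l m \<tau> z where [simp]: "g = (A, l, m)" "p = (\<tau>, z)" by (metis prod.exhaust)
  have t: "Im \<tau> > 0" and A: "A \<in> SL2Z" using assms by auto
  let ?q = "(\<tau>, z + of_int l * \<tau> + of_int m)"
  have "jacobi_tilde k 1 \<phi> (jact g p) = jacobi_tilde k 1 \<phi> (jacobi_act A 0 0 ?q)"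
    by (simp add: jact_Pair jacobi_act_def)
  also have "\<dots> = jacobi_tilde k 1 (slash k 1 \<phi> A) ?q"
    using A t by (subst tilde_slash) auto
  also have "\<dots> = jacobi_tilde k 1 \<phi> ?q"
    using assms(2)[of ?q] t by (simp add: jacobi_tilde_def)
  finally show ?thesis using tilde_lattice[OF assms(1) t] by simp
qed

lemma jacobi_cusp_formsD:
  assumes "\<phi> \<in> jacobi_cusp_forms k 1 N"
  shows "Im (fst p) \<le> 0 \<Longrightarrow> \<phi> p = 0" "holomorphic2_on \<phi> jacobi_domain"
    "A \<in> Gamma0 N \<Longrightarrow> p \<in> jacobi_domain \<Longrightarrow> slash k 1 \<phi> A p = \<phi> p"
    "lattice_inv \<phi>"
  using assms by (cases p; auto simp: jacobi_cusp_forms_def lattice_inv_def)+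

definition c2v :: "complex \<Rightarrow> real ^ 2" where "c2v z = vector [Re z, Im z]"
definition v2c :: "real ^ 2 \<Rightarrow> complex" where "v2c x = Complex (x $ 1) (x $ 2)"

lemma c2v_nth [simp]: "c2v z $ 1 = Re z" "c2v z $ 2 = Im z"
  by (simp_all add: c2v_def)

lemma v2c_c2v [simp]: "v2c (c2v z) = z" "c2v (v2c x) = x" "Re (v2c x) = x $ 1" "Im (v2c x) = x $ 2"
  by (auto simp: v2c_def vec_eq_iff forall_2)

lemma bounded_linear_c2v: "bounded_linear c2v"
  by (rule linear_conv_bounded_linear[THEN iffD1]) (rule linearI; simp add: vec_eq_iff forall_2)

lemma bounded_linear_v2c: "bounded_linear v2c"
  by (rule linear_conv_bounded_linear[THEN iffD1]) (rule linearI; simp add: complex_eq_iff)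

lemmas c2v_cont = bounded_linear.continuous_on[OF bounded_linear_c2v continuous_on_id]
lemmas v2c_cont = bounded_linear.continuous_on[OF bounded_linear_v2c continuous_on_id]

lemma borel_measurable_c2v [measurable]: "c2v \<in> borel_measurable borel"
  using c2v_cont by (auto intro!: borel_measurable_continuous_onI)

lemma borel_measurable_v2c [measurable]: "v2c \<in> borel_measurable borel"
  using v2c_cont by (auto intro!: borel_measurable_continuous_onI)

lemma lborel_complex_eq: "(lborel :: complex measure) = distr (lborel :: (real ^ 2) measure) borel v2c"
proof (rule lborel_eqI)
  fix l u :: complex assume le: "\<And>b. b \<in> Basis \<Longrightarrow> l \<bullet> b \<le> u \<bullet> b"
  have lu: "Re l \<le> Re u" "Im l \<le> Im u" using le[of 1] le[of \<i>] by (auto simp: Basis_complex_def)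
  have "v2c -` box l u = box (c2v l) (c2v u)"
    by (auto simp: box_def Basis_complex_def Basis_vec_def inner_axis forall_2 UNIV_2)
  then have "emeasure (distr lborel borel v2c) (box l u) = emeasure lborel (box (c2v l) (c2v u))"
    by (subst emeasure_distr) auto
  also have "\<dots> = (\<Prod>b\<in>Basis. (c2v u - c2v l) \<bullet> b)"
    using lu by (subst emeasure_lborel_box) (auto simp: Basis_vec_def inner_axis UNIV_2)
  also have "(\<Prod>b\<in>Basis. (c2v u - c2v l) \<bullet> b) = (Re u - Re l) * (Im u - Im l)"
    by (simp add: Basis_vec_def UNIV_2 inner_axis axis_eq_axis)
  also have "\<dots> = (\<Prod>b\<in>Basis. (u - l) \<bullet> b)"
    by (simp add: Basis_complex_def)
  finally show "emeasure (distr lborel borel v2c) (box l u) = ennreal (\<Prod>b\<in>Basis. (u - l) \<bullet> b)" .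
qed simp

lemma lborel_complex_prod:
  "(lborel :: complex measure) = distr ((lborel :: real measure) \<Otimes>\<^sub>M (lborel :: real measure)) borel (\<lambda>(x, y). Complex x y)"
proof -
  have m [measurable]: "(\<lambda>(x, y). Complex x y) \<in> borel_measurable borel"
    by (auto intro!: borel_measurable_continuous_onI continuous_intros simp: split_beta)
  have "(lborel :: complex measure) = distr (lborel :: (real \<times> real) measure) borel (\<lambda>(x, y). Complex x y)"
  proof (rule lborel_eqI)
    fix l u :: complex assume le: "\<And>b. b \<in> Basis \<Longrightarrow> l \<bullet> b \<le> u \<bullet> b"
    have lu: "Re l \<le> Re u" "Im l \<le> Im u" using le[of 1] le[of \<i>] by (auto simp: Basis_complex_def)
    have "(\<lambda>(x, y). Complex x y) -` box l u = box (Re l, Im l) (Re u, Im u)"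
      by (auto simp: box_def Basis_complex_def Basis_prod_def)
    then have "emeasure (distr lborel borel (\<lambda>(x, y). Complex x y)) (box l u) = emeasure lborel (box (Re l, Im l) (Re u, Im u))"
      by (subst emeasure_distr) auto
    also have "\<dots> = (\<Prod>b\<in>Basis. ((Re u, Im u) - (Re l, Im l)) \<bullet> b)"
      using lu by (subst emeasure_lborel_box) (auto simp: Basis_prod_def)
    also have "(\<Prod>b\<in>Basis. ((Re u, Im u) - (Re l, Im l)) \<bullet> b) = (Re u - Re l) * (Im u - Im l)"
      by (simp add: Basis_prod_def)
    also have "\<dots> = (\<Prod>b\<in>Basis. (u - l) \<bullet> b)"
      by (simp add: Basis_complex_def)
    finally show "emeasure (distr lborel borel (\<lambda>(x, y). Complex x y)) (box l u) = ennreal (\<Prod>b\<in>Basis. (u - l) \<bullet> b)" .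
  qed simp
  then show ?thesis by (simp add: lborel_prod)
qed

lemma nn_integral_complex:
  assumes [measurable]: "f \<in> borel_measurable borel"
  shows "(\<integral>\<^sup>+z. f z \<partial>lborel) = (\<integral>\<^sup>+x. \<integral>\<^sup>+y. f (Complex x y) \<partial>lborel \<partial>lborel)"
proof -
  have m [measurable]: "(\<lambda>(x, y). Complex x y) \<in> borel_measurable borel"
    by (auto intro!: borel_measurable_continuous_onI continuous_intros simp: split_beta)
  have m': "(\<lambda>(x, y). Complex x y) \<in> lborel \<Otimes>\<^sub>M lborel \<rightarrow>\<^sub>M borel"
    using m by (simp add: lborel_prod)
  have "(\<integral>\<^sup>+z. f z \<partial>lborel) = (\<integral>\<^sup>+p. f (case p of (x, y) \<Rightarrow> Complex x y) \<partial>(lborel \<Otimes>\<^sub>M lborel))"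
    by (subst lborel_complex_prod, subst nn_integral_distr[OF m']) auto
  also have "\<dots> = (\<integral>\<^sup>+x. \<integral>\<^sup>+y. f (Complex x y) \<partial>lborel \<partial>lborel)"
    by (subst lborel.nn_integral_fst[symmetric]) (use m' in auto)
  finally show ?thesis .
qed

lemma emeasure_holomorphic_image:
  fixes f :: "complex \<Rightarrow> complex"
  assumes f: "f holomorphic_on S" "open S" "inj_on f S"
    and E: "E \<in> sets borel" "E \<subseteq> f ` S" "bounded E"
  shows "(\<integral>\<^sup>+z. indicator (S \<inter> f -` E) z * ennreal ((cmod (deriv f z))\<^sup>2) \<partial>lborel) = emeasure lborel E"
proof -
  define T where "T = S \<inter> f -` E"
  have ts: "T \<in> sets borel"
  proof -
    have "f -` E \<inter> S \<in> sets (restrict_space borel S)"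
      using measurable_sets[OF borel_measurable_continuous_on_restrict[OF holomorphic_on_imp_continuous_on[OF f(1)]] E(1)]
      by (simp add: space_restrict_space)
    then show ?thesis using f(2) unfolding T_def
      by (subst (asm) sets_restrict_space_iff) (auto simp: Int_commute)
  qed
  define T' where "T' = v2c -` T"
  have T'b: "T' \<in> sets borel" using ts measurable_sets[OF borel_measurable_v2c, of T] by (simp add: T'_def)
  define g where "g = c2v \<circ> f \<circ> v2c"
  define g' where "g' = (\<lambda>x h. c2v (deriv f (v2c x) * v2c h))"
  have der: "(g has_derivative g' x) (at x within T')" if "x \<in> T'" for x
  proof -
    have "v2c x \<in> S" using that by (auto simp: T'_def T_def)
    then have "(f has_field_derivative deriv f (v2c x)) (at (v2c x))"
      using f by (simp add: holomorphic_derivI)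
    then have 1: "(f has_derivative (*) (deriv f (v2c x))) (at (v2c x))"
      by (simp add: has_field_derivative_def)
    have 2: "(v2c has_derivative v2c) (at x)"
      by (rule bounded_linear_imp_has_derivative[OF bounded_linear_v2c])
    have 3: "(c2v has_derivative c2v) (at y)" for y
      by (rule bounded_linear_imp_has_derivative[OF bounded_linear_c2v])
    have "((c2v \<circ> (f \<circ> v2c)) has_derivative (c2v \<circ> ((*) (deriv f (v2c x)) \<circ> v2c))) (at x)"
      using 1 2 3 by (intro diff_chain_at) auto
    then show ?thesis
      by (auto simp: g_def g'_def o_def intro: has_derivative_at_withinI)
  qed
  have inj: "inj_on g T'"
  proof (rule inj_onI)
    fix x y assume h: "x \<in> T'" "y \<in> T'" "g x = g y"
    then have "f (v2c x) = f (v2c y)" unfolding g_def o_def by (metis v2c_c2v(1))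
    then have "v2c x = v2c y" using h f(3) by (auto simp: T'_def T_def dest: inj_onD)
    then show "x = y" by (metis v2c_c2v(2))
  qed
  have det: "\<bar>det (matrix (g' x))\<bar> = (cmod (deriv f (v2c x)))\<^sup>2" for x
  proof -
    have "v2c (axis 1 1) = 1" "v2c (axis 2 1) = \<i>" by (auto simp: complex_eq_iff axis_def)
    then have "det (matrix (g' x)) = (cmod (deriv f (v2c x)))\<^sup>2"
      by (simp add: det_2 matrix_def g'_def cmod_power2) (simp add: power2_eq_square axis_def)
    then show ?thesis by simp
  qed
  have im: "g ` T' = c2v ` E"
  proof -
    have "c2v ` E \<subseteq> g ` T'"
    proof
      fix y assume "y \<in> c2v ` E"
      then obtain e where e: "e \<in> E" "y = c2v e" by auto
      then obtain s where s: "s \<in> S" "e = f s" using E by auto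
      then have "c2v s \<in> T'" "y = g (c2v s)" using e by (auto simp: T'_def T_def g_def)
      then show "y \<in> g ` T'" by blast
    qed
    moreover have "g ` T' \<subseteq> c2v ` E" by (auto simp: g_def T'_def T_def)
    ultimately show ?thesis by blast
  qed
  have imv: "c2v ` E = v2c -` E"
    by (force intro: image_eqI[where x = "v2c _"])
  have mE: "c2v ` E \<in> lmeasurable"
  proof (rule bounded_set_imp_lmeasurable)
    show "bounded (c2v ` E)" by (rule bounded_linear_image[OF E(3) bounded_linear_c2v])
    show "c2v ` E \<in> sets lebesgue" unfolding imv using E(1) measurable_sets[OF borel_measurable_v2c, of E] by simp
  qed
  have "((\<lambda>x. \<bar>det (matrix (g' x))\<bar>) has_integral (measure lebesgue (c2v ` E))) T'"
    using has_measure_differentiable_image[of T' g g' "measure lebesgue (c2v ` E)", OF _ der inj] T'b mE im by auto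
  then have "((\<lambda>x. (cmod (deriv f (v2c x)))\<^sup>2) has_integral (measure lebesgue (c2v ` E))) T'"
    by (simp only: det)
  then have "(\<integral>\<^sup>+x. indicator T' x * ennreal ((cmod (deriv f (v2c x)))\<^sup>2) \<partial>lborel) = ennreal (measure lebesgue (c2v ` E))"
    using nn_integral_has_integral_lebesgue'[where f = "\<lambda>x. (cmod (deriv f (v2c x)))\<^sup>2" and \<Omega> = T']
    by (simp add: mult.commute)
  also have "\<dots> = emeasure lebesgue (c2v ` E)"
    using mE by (rule emeasure_eq_measure2[symmetric])
  also have "\<dots> = emeasure lborel (c2v ` E)"
    unfolding imv using E(1) measurable_sets[OF borel_measurable_v2c, of E] by (simp add: )
  also have "\<dots> = emeasure lborel E"
    unfolding imv by (subst lborel_complex_eq, subst emeasure_distr) (use E in auto)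
  finally have A: "(\<integral>\<^sup>+x. indicator T' x * ennreal ((cmod (deriv f (v2c x)))\<^sup>2) \<partial>lborel) = emeasure lborel E" .
  have m1: "(\<lambda>z. indicator T z * ennreal ((cmod (deriv f z))\<^sup>2)) \<in> borel_measurable borel"
  proof -
    have "continuous_on S (\<lambda>z. (cmod (deriv f z))\<^sup>2)"
      using f by (intro continuous_intros holomorphic_on_imp_continuous_on holomorphic_deriv)
    then have "(\<lambda>z. indicator S z *\<^sub>R (cmod (deriv f z))\<^sup>2) \<in> borel_measurable borel"
      using f(2) by (intro borel_measurable_continuous_on_indicator) auto
    then have [measurable]: "(\<lambda>z. ennreal (indicator S z * (cmod (deriv f z))\<^sup>2)) \<in> borel_measurable borel"
      by simp
    have "(\<lambda>z. indicator T z * ennreal (indicator S z * (cmod (deriv f z))\<^sup>2)) \<in> borel_measurable borel"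
      using ts by measurable
    moreover have "indicator T z * ennreal (indicator S z * (cmod (deriv f z))\<^sup>2) = indicator T z * ennreal ((cmod (deriv f z))\<^sup>2)" for z
      by (auto simp: T_def indicator_def)
    ultimately show ?thesis by simp
  qed
  have "(\<integral>\<^sup>+z. indicator T z * ennreal ((cmod (deriv f z))\<^sup>2) \<partial>lborel)
     = (\<integral>\<^sup>+x. indicator T' x * ennreal ((cmod (deriv f (v2c x)))\<^sup>2) \<partial>lborel)"
    by (subst lborel_complex_eq, subst nn_integral_distr) (use m1 in \<open>auto simp: T'_def indicator_def intro!: nn_integral_cong\<close>)
  then show ?thesis using A by (simp add: T_def)
qed

lemma nn_integral_holomorphic_subst:
  fixes f :: "complex \<Rightarrow> complex" and h :: "complex \<Rightarrow> ennreal"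
  assumes f: "f holomorphic_on S" "open S" "inj_on f S"
    and mf [measurable]: "f \<in> borel_measurable borel"
    and mh [measurable]: "h \<in> borel_measurable borel"
  shows "(\<integral>\<^sup>+z. indicator S z * ennreal ((cmod (deriv f z))\<^sup>2) * h (f z) \<partial>lborel)
       = (\<integral>\<^sup>+w. indicator (f ` S) w * h w \<partial>lborel)"
proof -
  have oS: "open (f ` S)" using open_mapping_thm3 f by blast
  have [measurable]: "S \<in> sets borel" "f ` S \<in> sets borel" using f(2) oS by auto
  have "continuous_on S (\<lambda>z. (cmod (deriv f z))\<^sup>2)"
    using f by (intro continuous_intros holomorphic_on_imp_continuous_on holomorphic_deriv)
  then have "(\<lambda>z. indicator S z *\<^sub>R (cmod (deriv f z))\<^sup>2) \<in> borel_measurable borel"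
    using f(2) by (intro borel_measurable_continuous_on_indicator) auto
  then have "(\<lambda>z. ennreal (indicator S z * (cmod (deriv f z))\<^sup>2)) \<in> borel_measurable borel"
    by simp
  then have D [measurable]: "(\<lambda>z. indicator S z * ennreal ((cmod (deriv f z))\<^sup>2)) \<in> borel_measurable borel"
    by (rule measurable_cong[THEN iffD1, rotated]) (auto simp: indicator_def)
  let ?M = "density lborel (\<lambda>z. indicator S z * ennreal ((cmod (deriv f z))\<^sup>2))"
  have fm [measurable]: "f \<in> ?M \<rightarrow>\<^sub>M borel" by simp
  have "distr ?M borel f = density lborel (indicator (f ` S))"
  proof (rule measure_eqI)
    fix E assume "E \<in> sets (distr ?M borel f)"
    then have E [measurable]: "E \<in> sets borel" by simp
    define En where "En = (\<lambda>n::nat. E \<inter> f ` S \<inter> ball 0 (real n))"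
    have En: "En n \<in> sets borel" for n unfolding En_def by measurable
    have inc: "incseq En" unfolding En_def incseq_def by (auto simp: )
    have un: "(\<Union>n. En n) = E \<inter> f ` S"
      unfolding En_def by (auto simp: reals_Archimedean2)
    have "emeasure (distr ?M borel f) (En n) = emeasure (density lborel (indicator (f ` S))) (En n)" for n
    proof -
      have "emeasure (distr ?M borel f) (En n) = (\<integral>\<^sup>+z. indicator S z * ennreal ((cmod (deriv f z))\<^sup>2) * indicator (f -` En n) z \<partial>lborel)"
        using En[of n] measurable_sets[OF mf En[of n]] by (simp add: emeasure_distr emeasure_density)
      also have "\<dots> = (\<integral>\<^sup>+z. indicator (S \<inter> f -` En n) z * ennreal ((cmod (deriv f z))\<^sup>2) \<partial>lborel)"
        by (intro nn_integral_cong) (auto simp: indicator_def)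
      also have "\<dots> = emeasure lborel (En n)"
        using f En[of n] by (intro emeasure_holomorphic_image) (auto simp: En_def)
      also have "\<dots> = (\<integral>\<^sup>+w. indicator (f ` S) w * indicator (En n) w \<partial>lborel)"
      proof -
        have "emeasure lborel (En n) = (\<integral>\<^sup>+w. indicator (En n) w \<partial>lborel)" using En[of n] by simp
        also have "\<dots> = (\<integral>\<^sup>+w. indicator (f ` S) w * indicator (En n) w \<partial>lborel)"
          by (intro nn_integral_cong) (auto simp: indicator_def En_def)
        finally show ?thesis .
      qed
      also have "\<dots> = emeasure (density lborel (indicator (f ` S))) (En n)"
        using En[of n] by (simp add: emeasure_density)
      finally show ?thesis .
    qed
    then have "(SUP n. emeasure (distr ?M borel f) (En n)) = (SUP n. emeasure (density lborel (indicator (f ` S))) (En n))"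
      by simp
    then have 1: "emeasure (distr ?M borel f) (E \<inter> f ` S) = emeasure (density lborel (indicator (f ` S))) (E \<inter> f ` S)"
      using En inc by (subst (asm) (1 2) SUP_emeasure_incseq) (auto simp: un)
    have 2: "emeasure (distr ?M borel f) (E \<inter> f ` S) = emeasure (distr ?M borel f) E"
    proof -
      have "emeasure (distr ?M borel f) X = (\<integral>\<^sup>+z. indicator S z * ennreal ((cmod (deriv f z))\<^sup>2) * indicator (f -` X) z \<partial>lborel)" if "X \<in> sets borel" for X
        using that measurable_sets[OF mf that] by (simp add: emeasure_distr emeasure_density)
      then show ?thesis by (auto simp: indicator_def intro!: nn_integral_cong)
    qed
    have 3: "emeasure (density lborel (indicator (f ` S))) (E \<inter> f ` S) = emeasure (density lborel (indicator (f ` S))) E"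
      by (simp add: emeasure_density) (auto simp: indicator_def intro!: nn_integral_cong)
    show "emeasure (distr ?M borel f) E = emeasure (density lborel (indicator (f ` S))) E"
      using 1 2 3 by simp
  qed simp
  then have "(\<integral>\<^sup>+w. h w \<partial>distr ?M borel f) = (\<integral>\<^sup>+w. h w \<partial>density lborel (indicator (f ` S)))" by simp
  then show ?thesis
    by (simp add: nn_integral_distr nn_integral_density)
qed

lemma finite_lattice_ball:
  assumes "Im \<tau> > 0"
  shows "finite {(a :: int, b :: int). cmod (of_int a * \<tau> + of_int b) \<le> R}"
proof -
  define M where "M = R / Im \<tau>"
  define K where "K = R + M * cmod \<tau>"
  have "{(a :: int, b :: int). cmod (of_int a * \<tau> + of_int b) \<le> R} \<subseteq> {\<lfloor>- M\<rfloor>..\<lceil>M\<rceil>} \<times> {\<lfloor>- K\<rfloor>..\<lceil>K\<rceil>}"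
  proof (rule subsetI)
    fix x :: "int \<times> int" assume "x \<in> {(a, b). cmod (of_int a * \<tau> + of_int b) \<le> R}"
    then obtain a b where x: "x = (a, b)" and h: "cmod (of_int a * \<tau> + of_int b) \<le> R" by auto
    have "\<bar>real_of_int a * Im \<tau>\<bar> \<le> R"
      using abs_Im_le_cmod[of "of_int a * \<tau> + of_int b"] h by simp
    then have a: "\<bar>real_of_int a\<bar> \<le> M" using assms by (simp add: M_def field_simps abs_mult)
    have "cmod (of_int b) \<le> cmod (of_int a * \<tau> + of_int b) + cmod (of_int a * \<tau>)"
      using norm_triangle_ineq4[of "of_int a * \<tau> + of_int b" "of_int a * \<tau>"] by simp
    also have "\<dots> \<le> R + M * cmod \<tau>"
      using h a by (intro add_mono) (auto simp: norm_mult intro!: mult_right_mono)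
    finally have b: "\<bar>real_of_int b\<bar> \<le> K" by (simp add: K_def)
    show "x \<in> {\<lfloor>- M\<rfloor>..\<lceil>M\<rceil>} \<times> {\<lfloor>- K\<rfloor>..\<lceil>K\<rceil>}"
      using a b unfolding x by (auto simp: floor_le_iff le_ceiling_iff abs_le_iff; linarith)
  qed
  then show ?thesis by (rule finite_subset) auto
qed

lemma finite_return:
  assumes p: "p \<in> jacobi_domain" and e: "e > 0"
  shows "finite {g. fst g \<in> SL2Z \<and> cmod (fst (jact g p)) \<le> R \<and> cmod (snd (jact g p)) \<le> R \<and> Im (fst (jact g p)) \<ge> e}"
    (is "finite ?G")
proof -
  obtain \<tau> z where pe: "p = (\<tau>, z)" by (cases p)
  have t: "Im \<tau> > 0" using p pe by simp
  define Q where "Q = sqrt (Im \<tau> / e)"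
  define L where "L = (\<lambda>R. {(a :: int, b :: int). cmod (of_int a * \<tau> + of_int b) \<le> R})"
  have fin: "finite (L R)" for R unfolding L_def by (rule finite_lattice_ball[OF t])
  define f where "f = (\<lambda>g :: jac. ((fst g $ 2 $ 1, fst g $ 2 $ 2), (fst g $ 1 $ 1, fst g $ 1 $ 2), snd g))"
  have inj: "inj f" by (auto simp: f_def inj_def mat2_eq_iff intro!: prod_eqI)
  have "f ` ?G \<subseteq> L Q \<times> L (R * Q) \<times> L (R * Q + cmod z)"
  proof (rule image_subsetI)
    fix g :: jac assume gG: "g \<in> ?G"
    obtain A l m where g: "g = (A, l, m)" by (metis prod.exhaust)
    from gG have A: "A \<in> SL2Z" and R: "cmod (mob A \<tau>) \<le> R" "cmod ((z + of_int l * \<tau> + of_int m) / mob_den A \<tau>) \<le> R"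
      "Im (mob A \<tau>) \<ge> e" by (auto simp: pe g jact_Pair)
    have J: "cmod (mob_den A \<tau>) > 0" using mob_den_nonzero[OF A t] by simp
    have "(cmod (mob_den A \<tau>))\<^sup>2 \<le> Im \<tau> / e"
      using R(3) e J unfolding Im_mob[OF A t] by (simp add: field_simps)
    then have j: "cmod (mob_den A \<tau>) \<le> Q" unfolding Q_def by (rule real_le_rsqrt)
    have R0: "R \<ge> 0" using R(1) norm_ge_zero order_trans by blast
    have n: "cmod (mob_num A \<tau>) \<le> R * Q"
    proof -
      have "cmod (mob_num A \<tau>) = cmod (mob A \<tau>) * cmod (mob_den A \<tau>)" using J by (simp add: norm_divide)
      also have "\<dots> \<le> R * Q" using R(1) j R0 by (intro mult_mono) auto
      finally show ?thesis .
    qed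
    have "cmod (z + of_int l * \<tau> + of_int m) = cmod ((z + of_int l * \<tau> + of_int m) / mob_den A \<tau>) * cmod (mob_den A \<tau>)"
      using J by (simp add: norm_divide)
    also have "\<dots> \<le> R * Q" using R(2) j R0 by (intro mult_mono) auto
    finally have "cmod (of_int l * \<tau> + of_int m) \<le> R * Q + cmod z"
      using norm_triangle_ineq4[of "z + of_int l * \<tau> + of_int m" z] by (simp add: add.assoc)
    then show "f g \<in> L Q \<times> L (R * Q) \<times> L (R * Q + cmod z)"
      using j n by (simp add: g f_def L_def mob_den_def mob_num_def)
  qed
  then have "finite (f ` ?G)" by (rule finite_subset) (use fin in auto)
  then show ?thesis using inj by (simp add: finite_image_iff inj_on_subset)
qed

lemma orbit_isolated:
  assumes "p \<in> jacobi_domain"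
  obtains e where "e > 0" "\<And>g. fst g \<in> SL2Z \<Longrightarrow> jact g p \<in> ball p e \<Longrightarrow> jact g p = p"
proof -
  obtain \<tau> z where pe: "p = (\<tau>, z)" by (cases p)
  have t: "Im \<tau> > 0" using assms pe by simp
  define S where "S = {g. fst g \<in> SL2Z \<and> cmod (fst (jact g p)) \<le> norm p + Im \<tau> \<and> cmod (snd (jact g p)) \<le> norm p + Im \<tau> \<and> Im (fst (jact g p)) \<ge> Im \<tau> / 2}"
  have "finite S" unfolding S_def using assms t by (intro finite_return) auto
  then have "finite ((\<lambda>g. dist p (jact g p)) ` {g\<in>S. jact g p \<noteq> p})" by simp
  then obtain d where d: "d > 0" "\<And>g. g \<in> S \<Longrightarrow> jact g p \<noteq> p \<Longrightarrow> d \<le> dist p (jact g p)"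
    using finite_set_avoid[of "(\<lambda>g. jact g p) ` {g\<in>S. jact g p \<noteq> p}" p] \<open>finite S\<close>
    by (auto simp: image_iff)
  show ?thesis
  proof (rule that[of "min d (Im \<tau> / 2)"])
    show "0 < min d (Im \<tau> / 2)" using d t by simp
    fix g :: jac assume g: "fst g \<in> SL2Z" "jact g p \<in> ball p (min d (Im \<tau> / 2))"
    have dd: "dist p (jact g p) < d" "dist p (jact g p) < Im \<tau> / 2" using g by auto
    have n: "norm (jact g p) \<le> norm p + Im \<tau>"
      using dd(2) norm_triangle_ineq[of p "jact g p - p"] t by (simp add: dist_norm norm_minus_commute)
    have "cmod (fst (jact g p)) \<le> norm p + Im \<tau>" "cmod (snd (jact g p)) \<le> norm p + Im \<tau>"
      using n norm_fst_le[of "fst (jact g p)" "snd (jact g p)"] norm_snd_le[of "snd (jact g p)" "fst (jact g p)"] by auto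
    moreover have "Im (fst (jact g p)) \<ge> Im \<tau> / 2"
    proof -
      have "\<bar>Im (fst p - fst (jact g p))\<bar> \<le> dist (fst p) (fst (jact g p))"
        unfolding dist_norm by (rule abs_Im_le_cmod)
      also have "\<dots> \<le> dist p (jact g p)" by (rule dist_fst_le)
      finally show ?thesis using dd(2) pe by (simp add: abs_le_iff)
    qed
    ultimately have "g \<in> S" using g by (simp add: S_def)
    then show "jact g p = p" using d(2) dd(1) by fastforce
  qed
qed

lemma open_jacobi_domain: "open jacobi_domain"
  unfolding upper_half_plane_def by (intro open_Times open_UNIV open_halfspace_Im_gt)

lemma borel_jacobi_domain [measurable]: "jacobi_domain \<in> sets borel"
  using open_jacobi_domain by auto

lemma borel_measurable_jact [measurable]: "jact g \<in> borel_measurable borel"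
proof -
  obtain A l m where g: "g = (A, l, m)" by (metis prod.exhaust)
  have [measurable]: "mob_num A \<in> borel_measurable borel" "mob_den A \<in> borel_measurable borel"
    unfolding mob_num_def mob_den_def by measurable
  have [measurable]: "fst \<in> borel_measurable (borel :: (complex \<times> complex) measure)"
     "snd \<in> borel_measurable (borel :: (complex \<times> complex) measure)"
    by (auto intro!: borel_measurable_continuous_onI continuous_intros)
  have "(\<lambda>p. (mob A (fst p), (snd p + of_int l * fst p + of_int m) / mob_den A (fst p))) \<in> borel_measurable borel"
    by (intro borel_measurable_Pair) measurable
  moreover have "jact g = (\<lambda>p. (mob A (fst p), (snd p + of_int l * fst p + of_int m) / mob_den A (fst p)))"
    by (auto simp: g jact_def jacobi_act_def)
  ultimately show ?thesis by simp
qed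

lemma sets_jact_vimage [measurable]: "E \<in> sets borel \<Longrightarrow> jact g -` E \<in> sets borel"
  using measurable_sets[OF borel_measurable_jact, of E g] by simp

lemma sets_jact_fixed: "{p. jact g p = p} \<in> sets borel"
proof -
  have "(\<lambda>p. jact g p - p) \<in> borel_measurable borel" by measurable
  from measurable_sets[OF this, of "{0}"] have "(\<lambda>p. jact g p - p) -` {0} \<in> sets borel" by simp
  moreover have "(\<lambda>p. jact g p - p) -` {0} = {p. jact g p = p}" by auto
  ultimately show ?thesis by simp
qed

lemma fundamental_domain_exists: "\<exists>F. jacobi_fundamental_domain N F"
proof -
  obtain B :: "(complex \<times> complex) set set" where B: "countable B" "topological_basis B"
    using ex_countable_basis by blast
  define b where "b = from_nat_into B"
  have Bne: "B \<noteq> {}" using B(2) topological_basisE[of B UNIV] by (metis UNIV_I empty_iff open_UNIV)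
  have ob: "open (b n)" for n unfolding b_def using B(2) from_nat_into[OF Bne] topological_basis_open by blast
  define U where "U = (\<lambda>n. {p \<in> jacobi_domain \<inter> b n. \<forall>g\<in>JG N. jact g p \<in> b n \<longrightarrow> jact g p = p})"
  define H where "H = (\<lambda>n. {p \<in> jacobi_domain. \<exists>g\<in>JG N. jact g p \<in> U n})"
  have Ub: "U n \<in> sets borel" for n
  proof -
    have "U n = (jacobi_domain \<inter> b n) \<inter> (\<Inter>g\<in>JG N. - (jact g -` b n) \<union> {p. jact g p = p})"
      by (auto simp: U_def)
    also have "\<dots> \<in> sets borel"
      using ob[of n] sets_jact_fixed sets_jact_vimage[of "b n"]
      by (intro sets.Int sets.countable_INT'' sets.Un) (auto intro!: borel_comp)
    finally show ?thesis .
  qed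
  have Hb: "H n \<in> sets borel" for n
  proof -
    have "H n = jacobi_domain \<inter> (\<Union>g\<in>JG N. jact g -` U n)" unfolding H_def by blast
    also have "\<dots> \<in> sets borel" using Ub sets_jact_vimage[of "U n"]
      by (intro sets.Int sets.countable_UN') auto
    finally show ?thesis .
  qed
  define F where "F = (\<Union>n. U n - (\<Union>m<n. H m))"
  have UX: "U n \<subseteq> jacobi_domain" for n by (auto simp: U_def)
  have Hinv: "jact g p \<in> H n \<longleftrightarrow> p \<in> H n" if g: "g \<in> JG N" and p: "p \<in> jacobi_domain" for g p n
  proof
    assume "jact g p \<in> H n"
    then obtain h where "h \<in> JG N" "jact h (jact g p) \<in> U n" by (auto simp: H_def)
    then show "p \<in> H n" using g p jact_jmul[of h g p] jmul_JG[of h N g] JG_SL2Z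
      unfolding H_def by (metis (mono_tags, lifting) mem_Collect_eq)
  next
    assume "p \<in> H n"
    then obtain h where h: "h \<in> JG N" "jact h p \<in> U n" by (auto simp: H_def)
    have "jact (jmul h (jinv g)) (jact g p) = jact h p"
      using g p h jact_jmul[of h "jinv g" "jact g p"] jact_jinv[of g p] JG_SL2Z jinv_JG jact_domain by metis
    then show "jact g p \<in> H n" using h g jmul_JG[OF h(1) jinv_JG[OF g]] jact_domain[OF JG_SL2Z[OF g] p]
      unfolding H_def by (metis (mono_tags, lifting) mem_Collect_eq)
  qed
  have cov: "\<exists>n. p \<in> U n" if p: "p \<in> jacobi_domain" for p
  proof -
    obtain e where e: "e > 0" "\<And>g. fst g \<in> SL2Z \<Longrightarrow> jact g p \<in> ball p e \<Longrightarrow> jact g p = p"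
      using orbit_isolated[OF p] by blast
    obtain V where V: "V \<in> B" "p \<in> V" "V \<subseteq> ball p e"
      using topological_basisE[OF B(2), of "ball p e" p] e by auto
    then obtain n where "V = b n" unfolding b_def using B(1) by (metis from_nat_into_surj)
    then have "p \<in> U n" using V e p JG_SL2Z by (auto simp: U_def)
    then show ?thesis by blast
  qed
  have "jacobi_fundamental_domain N F"
    unfolding jacobi_fundamental_domain_def
  proof (intro conjI ballI)
    show "F \<in> sets borel" unfolding F_def using Ub Hb by (intro sets.countable_UN' sets.Diff) auto
    show "F \<subseteq> jacobi_domain" using UX by (auto simp: F_def)
    show "jacobi_orbit N p \<inter> F \<noteq> {}" if p: "p \<in> jacobi_domain" for p
    proof -
      have "\<exists>n. p \<in> H n" using cov[OF p] p jact_jone jone_JG unfolding H_def by (metis (mono_tags, lifting) mem_Collect_eq)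
      define n where "n = (LEAST n. p \<in> H n)"
      have n: "p \<in> H n" "\<And>m. m < n \<Longrightarrow> p \<notin> H m"
        unfolding n_def using LeastI_ex[OF \<open>\<exists>n. p \<in> H n\<close>] not_less_Least by blast+
      obtain g where g: "g \<in> JG N" "jact g p \<in> U n" using n(1) by (auto simp: H_def)
      have "jact g p \<in> F" unfolding F_def using g n(2) Hinv[OF g(1) p] by blast
      then show ?thesis using g by (auto simp: jacobi_orbit_alt)
    qed
    have "q = p" if p: "p \<in> F" and q: "q \<in> F" and o: "q \<in> jacobi_orbit N p" for p q
    proof -
      obtain g where g: "g \<in> JG N" "q = jact g p" using o by (auto simp: jacobi_orbit_alt)
      obtain n where n: "p \<in> U n" "\<And>m. m < n \<Longrightarrow> p \<notin> H m" using p by (auto simp: F_def)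
      obtain m where m: "q \<in> U m" "\<And>i. i < m \<Longrightarrow> q \<notin> H i" using q by (auto simp: F_def)
      have pX: "p \<in> jacobi_domain" "q \<in> jacobi_domain" using n m UX by blast+
      have "r \<in> H i" if "r \<in> U i" for r i
        using that UX jact_jone jone_JG unfolding H_def by (metis (mono_tags, lifting) mem_Collect_eq subsetD)
      then have "q \<in> H m" "p \<in> H n" using n m by auto
      then have "\<not> m < n" "\<not> n < m" using Hinv[OF g(1) pX(1)] g(2) n(2) m(2) by blast+
      then have "m = n" by simp
      then show "q = p" using n(1) m(1) g by (auto simp: U_def)
    qed
    then have "{p \<in> F. \<exists>q\<in>F. q \<noteq> p \<and> q \<in> jacobi_orbit N p} = {}" by blast
    then show "{p \<in> F. \<exists>q\<in>F. q \<noteq> p \<and> q \<in> jacobi_orbit N p} \<in> null_sets lborel" by (simp only: null_sets.empty_sets)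
  qed
  then show ?thesis by blast
qed

section \<open>The invariant measure\<close>

definition jmeas :: "(complex \<times> complex) measure" where
  "jmeas = density lborel (\<lambda>p. ennreal (if Im (fst p) > 0 then 1 / Im (fst p) ^ 3 else 0))"

lemma sets_jmeas [measurable_cong, simp]: "sets jmeas = sets borel"
  by (simp add: jmeas_def)

lemma space_jmeas [simp]: "space jmeas = UNIV"
  by (simp add: jmeas_def)

lemma fst_snd_borel [measurable]: "fst \<in> borel_measurable (borel :: (complex \<times> complex) measure)"
     "snd \<in> borel_measurable (borel :: (complex \<times> complex) measure)"
  by (auto intro!: borel_measurable_continuous_onI continuous_intros)

lemma nn_integral_pair:
  fixes f :: "complex \<times> complex \<Rightarrow> ennreal"
  assumes [measurable]: "f \<in> borel_measurable borel"
  shows "(\<integral>\<^sup>+p. f p \<partial>lborel) = (\<integral>\<^sup>+\<tau>. \<integral>\<^sup>+z. f (\<tau>, z) \<partial>lborel \<partial>lborel)"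
proof -
  have "f \<in> borel_measurable (lborel \<Otimes>\<^sub>M lborel)" by (simp add: lborel_prod)
  from lborel.nn_integral_fst[OF this] show ?thesis by (simp add: lborel_prod)
qed

lemma borel_measurable_nn_integral_pair:
  fixes f :: "complex \<times> complex \<Rightarrow> ennreal"
  assumes [measurable]: "f \<in> borel_measurable borel"
  shows "(\<lambda>\<tau>. \<integral>\<^sup>+z. f (\<tau>, z) \<partial>lborel) \<in> borel_measurable borel"
proof -
  have "f \<in> borel_measurable (lborel \<Otimes>\<^sub>M lborel)" by (simp add: lborel_prod)
  from lborel.borel_measurable_nn_integral_fst[OF this] show ?thesis by simp
qed

lemma borel_measurable_slice:
  fixes f :: "complex \<times> complex \<Rightarrow> ennreal"
  assumes "f \<in> borel_measurable borel"
  shows "(\<lambda>z. f (\<tau>, z)) \<in> borel_measurable borel"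
proof -
  have "(\<lambda>z. (\<tau>, z)) \<in> borel_measurable (borel :: complex measure)"
    by (auto intro!: borel_measurable_continuous_onI continuous_intros)
  from measurable_compose[OF this assms] show ?thesis .
qed

lemma nn_integral_jmeas:
  assumes [measurable]: "f \<in> borel_measurable borel"
  shows "(\<integral>\<^sup>+p. f p \<partial>jmeas) = (\<integral>\<^sup>+\<tau>. indicator {\<tau>. Im \<tau> > 0} \<tau> * ennreal (1 / Im \<tau> ^ 3) * (\<integral>\<^sup>+z. f (\<tau>, z) \<partial>lborel) \<partial>lborel)"
proof -
  have "(\<integral>\<^sup>+p. f p \<partial>jmeas) = (\<integral>\<^sup>+p. ennreal (if Im (fst p) > 0 then 1 / Im (fst p) ^ 3 else 0) * f p \<partial>lborel)"
    unfolding jmeas_def by (subst nn_integral_density) auto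
  also have "\<dots> = (\<integral>\<^sup>+\<tau>. \<integral>\<^sup>+z. ennreal (if Im \<tau> > 0 then 1 / Im \<tau> ^ 3 else 0) * f (\<tau>, z) \<partial>lborel \<partial>lborel)"
    by (subst nn_integral_pair) (auto cong: if_cong)
  also have "\<dots> = (\<integral>\<^sup>+\<tau>. indicator {\<tau>. Im \<tau> > 0} \<tau> * ennreal (1 / Im \<tau> ^ 3) * (\<integral>\<^sup>+z. f (\<tau>, z) \<partial>lborel) \<partial>lborel)"
    using borel_measurable_slice[OF assms] by (intro nn_integral_cong) (auto simp: nn_integral_cmult indicator_def)
  finally show ?thesis .
qed

lemma nn_integral_affine:
  fixes h :: "complex \<Rightarrow> ennreal"
  assumes [measurable]: "h \<in> borel_measurable borel" and j: "j \<noteq> 0"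
  shows "(\<integral>\<^sup>+z. h ((z + b) / j) \<partial>lborel) = ennreal ((cmod j)\<^sup>2) * (\<integral>\<^sup>+z. h z \<partial>lborel)"
proof -
  have d: "deriv (\<lambda>z. (z + b) / j) z = 1 / j" for z
    using j by (intro DERIV_imp_deriv) (auto intro!: derivative_eq_intros)
  have "surj (\<lambda>z. (z + b) / j)" 
    using j by (auto simp: surj_def field_simps intro!: exI[of _ "_ * j - b"])
  moreover have "inj (\<lambda>z. (z + b) / j)" using j by (auto simp: inj_def)
  moreover have [measurable]: "(\<lambda>z. (z + b) / j) \<in> borel_measurable borel" by measurable
  moreover have "(\<lambda>z. (z + b) / j) holomorphic_on UNIV" using j by (intro holomorphic_intros) auto
  ultimately have "(\<integral>\<^sup>+z. ennreal ((cmod (1 / j))\<^sup>2) * h ((z + b) / j) \<partial>lborel) = (\<integral>\<^sup>+w. h w \<partial>lborel)"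
    using nn_integral_holomorphic_subst[of "\<lambda>z. (z + b) / j" UNIV h] d by simp
  then have "(\<integral>\<^sup>+w. h w \<partial>lborel) = ennreal ((cmod (1 / j))\<^sup>2) * (\<integral>\<^sup>+z. h ((z + b) / j) \<partial>lborel)"
    by (subst (asm) nn_integral_cmult) auto
  moreover have "ennreal ((cmod j)\<^sup>2) * ennreal ((cmod (1 / j))\<^sup>2) = 1"
    using j by (subst ennreal_mult[symmetric]) (auto simp: norm_divide power_divide)
  ultimately show ?thesis by (metis mult.assoc mult_1)
qed

lemma nn_integral_mob:
  fixes h :: "complex \<Rightarrow> ennreal"
  assumes A: "A \<in> SL2Z" and [measurable]: "h \<in> borel_measurable borel"
  shows "(\<integral>\<^sup>+\<tau>. indicator {\<tau>. Im \<tau> > 0} \<tau> * ennreal (1 / cmod (mob_den A \<tau>) ^ 4) * h (mob A \<tau>) \<partial>lborel)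
       = (\<integral>\<^sup>+\<tau>. indicator {\<tau>. Im \<tau> > 0} \<tau> * h \<tau> \<partial>lborel)"
proof -
  let ?S = "{\<tau>. Im \<tau> > 0}"
  have der: "(mob A has_field_derivative 1 / (mob_den A \<tau>)\<^sup>2) (at \<tau>)" if "\<tau> \<in> ?S" for \<tau>
  proof -
    have nz: "mob_den A \<tau> \<noteq> 0" using mob_den_nonzero A that by blast
    have "(mob A has_field_derivative (of_int (A$1$1) * mob_den A \<tau> - mob_num A \<tau> * of_int (A$2$1)) / (mob_den A \<tau> * mob_den A \<tau>)) (at \<tau>)"
      using nz unfolding mob_num_def mob_den_def
      by (intro DERIV_divide) (auto intro!: derivative_eq_intros)
    then show ?thesis using mob_det[OF A, of \<tau>] by (simp add: power2_eq_square mult.commute)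
  qed
  have hol: "mob A holomorphic_on ?S"
    using der by (auto simp: holomorphic_on_open open_halfspace_Im_gt)
  have i1: "mob (inv2 A) (mob A \<tau>) = \<tau>" if "\<tau> \<in> ?S" for \<tau>
    using mob_mult'[OF SL2Z_inv2[OF A] A, of \<tau>] that A by (simp add: inv2_mult)
  have i2: "mob A (mob (inv2 A) \<tau>) = \<tau>" if "\<tau> \<in> ?S" for \<tau>
    using mob_mult'[OF A SL2Z_inv2[OF A], of \<tau>] that A by (simp add: inv2_mult)
  have inj: "inj_on (mob A) ?S" by (rule inj_on_inverseI[of _ "mob (inv2 A)"]) (use i1 in auto)
  have im: "mob A ` ?S = ?S"
  proof -
    have "\<tau> \<in> mob A ` ?S" if "\<tau> \<in> ?S" for \<tau>
      using i2[OF that] Im_mob_pos[OF SL2Z_inv2[OF A], of \<tau>] that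
      by (metis (mono_tags, lifting) image_eqI mem_Collect_eq)
    then show ?thesis using Im_mob_pos[OF A] by auto
  qed
  have [measurable]: "mob A \<in> borel_measurable borel" unfolding mob_num_def mob_den_def by measurable
  have "(\<integral>\<^sup>+\<tau>. indicator ?S \<tau> * ennreal (1 / cmod (mob_den A \<tau>) ^ 4) * h (mob A \<tau>) \<partial>lborel)
    = (\<integral>\<^sup>+z. indicator ?S z * ennreal ((cmod (deriv (mob A) z))\<^sup>2) * h (mob A z) \<partial>lborel)"
  proof (intro nn_integral_cong)
    fix \<tau>
    have "(cmod (deriv (mob A) \<tau>))\<^sup>2 = 1 / cmod (mob_den A \<tau>) ^ 4" if "\<tau> \<in> ?S"
      unfolding DERIV_imp_deriv[OF der[OF that]] by (simp add: norm_divide norm_power power_divide flip: power_mult)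
    then show "indicator ?S \<tau> * ennreal (1 / cmod (mob_den A \<tau>) ^ 4) * h (mob A \<tau>) = indicator ?S \<tau> * ennreal ((cmod (deriv (mob A) \<tau>))\<^sup>2) * h (mob A \<tau>)"
      by (auto simp: indicator_def)
  qed
  also have "\<dots> = (\<integral>\<^sup>+\<tau>. indicator ?S \<tau> * h \<tau> \<partial>lborel)"
    using nn_integral_holomorphic_subst[OF hol open_halfspace_Im_gt inj, of h] im by simp
  finally show ?thesis .
qed

lemma nn_integral_jact:
  assumes g: "fst g \<in> SL2Z" and f [measurable]: "f \<in> borel_measurable borel"
  shows "(\<integral>\<^sup>+p. f (jact g p) \<partial>jmeas) = (\<integral>\<^sup>+p. f p \<partial>jmeas)"
proof -
  obtain A l m where ge: "g = (A, l, m)" by (metis prod.exhaust)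
  have A: "A \<in> SL2Z" using g ge by simp
  let ?S = "{\<tau>. Im \<tau> > 0}"
  define \<Phi> where "\<Phi> = (\<lambda>\<tau>. \<integral>\<^sup>+z. f (\<tau>, z) \<partial>lborel)"
  have P [measurable]: "\<Phi> \<in> borel_measurable borel" unfolding \<Phi>_def by (rule borel_measurable_nn_integral_pair[OF f])
  have "(\<integral>\<^sup>+p. f (jact g p) \<partial>jmeas) = (\<integral>\<^sup>+\<tau>. indicator ?S \<tau> * ennreal (1 / Im \<tau> ^ 3) * (\<integral>\<^sup>+z. f (jact g (\<tau>, z)) \<partial>lborel) \<partial>lborel)"
    by (rule nn_integral_jmeas) measurable
  also have "\<dots> = (\<integral>\<^sup>+\<tau>. indicator ?S \<tau> * ennreal (1 / cmod (mob_den A \<tau>) ^ 4) * (ennreal (1 / Im (mob A \<tau>) ^ 3) * \<Phi> (mob A \<tau>)) \<partial>lborel)"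
  proof (intro nn_integral_cong)
    fix \<tau>
    show "indicator ?S \<tau> * ennreal (1 / Im \<tau> ^ 3) * (\<integral>\<^sup>+z. f (jact g (\<tau>, z)) \<partial>lborel) =
         indicator ?S \<tau> * ennreal (1 / cmod (mob_den A \<tau>) ^ 4) * (ennreal (1 / Im (mob A \<tau>) ^ 3) * \<Phi> (mob A \<tau>))"
    proof (cases "Im \<tau> > 0")
      case True
      have nz: "mob_den A \<tau> \<noteq> 0" using mob_den_nonzero A True by blast
      have "(\<integral>\<^sup>+z. f (jact g (\<tau>, z)) \<partial>lborel) = (\<integral>\<^sup>+z. f (mob A \<tau>, (z + (of_int l * \<tau> + of_int m)) / mob_den A \<tau>) \<partial>lborel)"
        by (simp add: ge jact_Pair add.assoc)
      also have "\<dots> = ennreal ((cmod (mob_den A \<tau>))\<^sup>2) * \<Phi> (mob A \<tau>)"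
        unfolding \<Phi>_def using nz by (intro nn_integral_affine borel_measurable_slice f)
      finally have 1: "(\<integral>\<^sup>+z. f (jact g (\<tau>, z)) \<partial>lborel) = ennreal ((cmod (mob_den A \<tau>))\<^sup>2) * \<Phi> (mob A \<tau>)" .
      have 2: "1 / Im \<tau> ^ 3 * (cmod (mob_den A \<tau>))\<^sup>2 = 1 / cmod (mob_den A \<tau>) ^ 4 * (1 / Im (mob A \<tau>) ^ 3)"
        unfolding Im_mob[OF A True] using nz True by (simp add: field_simps flip: power_mult power_add)
      have "ennreal (1 / Im \<tau> ^ 3) * (ennreal ((cmod (mob_den A \<tau>))\<^sup>2) * \<Phi> (mob A \<tau>))
         = ennreal (1 / cmod (mob_den A \<tau>) ^ 4) * (ennreal (1 / Im (mob A \<tau>) ^ 3) * \<Phi> (mob A \<tau>))"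
        using True Im_mob_pos[OF A True] 2
        unfolding mult.assoc[symmetric] by (subst (1 2) ennreal_mult[symmetric]) auto
      then show ?thesis using 1 True by simp
    qed simp
  qed
  also have "\<dots> = (\<integral>\<^sup>+\<tau>. indicator ?S \<tau> * (ennreal (1 / Im \<tau> ^ 3) * \<Phi> \<tau>) \<partial>lborel)"
    by (intro nn_integral_mob A) measurable
  also have "\<dots> = (\<integral>\<^sup>+p. f p \<partial>jmeas)"
    by (subst nn_integral_jmeas) (auto simp: \<Phi>_def mult.assoc)
  finally show ?thesis .
qed

lemma null_sets_jmeasI:
  assumes "E \<in> null_sets lborel"
  shows "E \<in> null_sets jmeas"
proof -
  have "E \<in> sets lborel" using assms by blast
  then show ?thesis
    unfolding jmeas_def using AE_not_in[OF assms]
    by (subst null_sets_density_iff) (auto elim!: eventually_mono)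
qed

lemma AE_jmeas_domain: "AE p in jmeas. p \<in> jacobi_domain"
  unfolding jmeas_def by (subst AE_density) (auto simp: ennreal_eq_0_iff)

lemma fixed_points_null:
  assumes g: "fst g \<in> SL2Z" "g \<noteq> jone"
  shows "{p \<in> jacobi_domain. jact g p = p} \<in> null_sets lborel"
proof -
  obtain A l m where ge: "g = (A, l, m)" by (metis prod.exhaust)
  have A: "A \<in> SL2Z" using g ge by simp
  let ?E = "{p \<in> jacobi_domain. jact g p = p}"
  have "{p. jact g p = p} \<in> sets borel" by (rule sets_jact_fixed)
  moreover have "?E = jacobi_domain \<inter> {p. jact g p = p}" by auto
  ultimately have E: "?E \<in> sets borel" by (simp add: sets.Int)
  have sl: "emeasure lborel (Pair \<tau> -` ?E) = 0" for \<tau>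
  proof -
    have "Pair \<tau> -` ?E \<subseteq> {(of_int l * \<tau> + of_int m) / (mob_den A \<tau> - 1)}"
    proof
      fix z assume "z \<in> Pair \<tau> -` ?E"
      then have t: "Im \<tau> > 0" and e: "mob A \<tau> = \<tau>" "(z + of_int l * \<tau> + of_int m) / mob_den A \<tau> = z"
        by (auto simp: ge jact_Pair)
      have nz: "mob_den A \<tau> \<noteq> 0" using mob_den_nonzero A t by blast
      have e2: "z + of_int l * \<tau> + of_int m = z * mob_den A \<tau>" using e(2) nz by (simp add: field_simps)
      show "z \<in> {(of_int l * \<tau> + of_int m) / (mob_den A \<tau> - 1)}"
      proof (cases "mob_den A \<tau> = 1")
        case True
        then have c: "A$2$1 = 0" "A$2$2 = 1" using t by (auto simp: mob_den_def complex_eq_iff)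
        then have a: "A$1$1 = 1" using A by (simp add: SL2Z_iff)
        then have b: "A$1$2 = 0" using e(1) True by (simp add: mob_num_def)
        have "of_int l * \<tau> + of_int m = 0" using e2 True by (simp add: add.assoc)
        then have "l = 0" "m = 0" using lattice_nonzero[OF t, of l m] by blast+
        then have "g = jone" using a b c by (simp add: ge jone_def mat2_eq_iff)
        then show ?thesis using g by simp
      next
        case False
        have "z * (mob_den A \<tau> - 1) = of_int l * \<tau> + of_int m" using e2 by (simp add: algebra_simps)
        then show ?thesis using False by (simp add: field_simps)
      qed
    qed
    then have "countable (Pair \<tau> -` ?E)" by (rule countable_subset) simp
    then show ?thesis by (rule emeasure_lborel_countable)
  qed
  have "emeasure lborel ?E = emeasure (lborel \<Otimes>\<^sub>M lborel) ?E" by (simp add: lborel_prod)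
  also have "\<dots> = (\<integral>\<^sup>+\<tau>. emeasure lborel (Pair \<tau> -` ?E) \<partial>lborel)"
    using E by (intro lborel.emeasure_pair_measure_alt) (simp only: lborel_prod sets_lborel)
  also have "\<dots> = 0" using sl by simp
  finally show ?thesis using E by (simp add: null_sets_def)
qed

section \<open>Fundamental domains and unfolding\<close>

lemma AE_jmeas_null: "E \<in> null_sets lborel \<Longrightarrow> AE p in jmeas. p \<notin> E"
  using null_sets_jmeasI by (rule AE_not_in)

lemma null_sets_jact_vimage:
  assumes g: "fst g \<in> SL2Z" and E: "E \<in> null_sets jmeas"
  shows "jact g -` E \<in> null_sets jmeas"
proof -
  have [measurable]: "E \<in> sets borel" using E by (simp add: null_sets_def)
  have "emeasure jmeas (jact g -` E) = (\<integral>\<^sup>+p. indicator (jact g -` E) p \<partial>jmeas)" by simp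
  also have "\<dots> = (\<integral>\<^sup>+p. indicator E (jact g p) \<partial>jmeas)" by (simp only: indicator_vimage)
  also have "\<dots> = 0" using E nn_integral_jact[OF g, of "indicator E"] by (simp add: null_sets_def)
  finally show ?thesis by (simp add: null_sets_def)
qed

lemma AE_unique_return:
  assumes F: "jacobi_fundamental_domain N F"
  shows "AE p in jmeas. \<forall>g\<in>JG N. \<forall>h\<in>JG N. jact (jinv g) p \<in> F \<longrightarrow> jact (jinv h) p \<in> F \<longrightarrow> g = h"
proof -
  define E where "E = {p \<in> F. \<exists>q\<in>F. q \<noteq> p \<and> q \<in> jacobi_orbit N p}"
  have E: "E \<in> null_sets jmeas" using F by (auto simp: jacobi_fundamental_domain_def E_def intro: null_sets_jmeasI)
  have 1: "AE p in jmeas. \<forall>g\<in>JG N. jact (jinv g) p \<notin> E"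
  proof (rule AE_ball_countable[THEN iffD2, OF countable_JG], rule ballI)
    fix g assume "g \<in> JG N"
    then show "AE p in jmeas. jact (jinv g) p \<notin> E"
      using AE_not_in[OF null_sets_jact_vimage[OF _ E, of "jinv g"]] by (simp add: fst_jinv JG_SL2Z)
  qed
  have 2: "AE p in jmeas. \<forall>g\<in>JG N. g \<noteq> jone \<longrightarrow> \<not> (p \<in> jacobi_domain \<and> jact g p = p)"
  proof (rule AE_ball_countable[THEN iffD2, OF countable_JG], rule ballI)
    fix g assume "g \<in> JG N"
    then show "AE p in jmeas. g \<noteq> jone \<longrightarrow> \<not> (p \<in> jacobi_domain \<and> jact g p = p)"
      using AE_jmeas_null[OF fixed_points_null[of g]] by (cases "g = jone") (auto simp: JG_SL2Z)
  qed
  from 1 2 AE_jmeas_domain show ?thesis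
  proof eventually_elim
    case (elim p)
    show ?case
    proof (intro ballI impI)
      fix g h assume g: "g \<in> JG N" and h: "h \<in> JG N" and F': "jact (jinv g) p \<in> F" "jact (jinv h) p \<in> F"
      have gS: "fst g \<in> SL2Z" and hS: "fst h \<in> SL2Z" using g h JG_SL2Z by auto
      have "jact (jinv h) p = jact (jmul (jinv h) g) (jact (jinv g) p)"
        using gS hS elim(3) by (simp add: jact_jmul fst_jinv jact_domain jact_jinv)
      then have "jact (jinv h) p \<in> jacobi_orbit N (jact (jinv g) p)"
        using jmul_JG[OF jinv_JG[OF h] g] by (auto simp: jacobi_orbit_alt)
      then have eq: "jact (jinv h) p = jact (jinv g) p"
        using elim(1) g F' by (auto simp: E_def)
      have "jact (jmul g (jinv h)) p = p"
        using gS hS elim(3) by (simp add: jact_jmul fst_jinv eq jact_jinv)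
      then have "jmul g (jinv h) = jone"
        using elim(2) elim(3) jmul_JG[OF g jinv_JG[OF h]] by blast
      then have "\<forall>q\<in>jacobi_domain. jact g q = jact h q"
        using gS hS by (metis fst_jinv jact_domain jact_jinv(1) jact_jmul jact_jone)
      then show "g = h"
      proof -
        have "jmul (jmul g (jinv h)) h = jmul jone h" using \<open>jmul g (jinv h) = jone\<close> by simp
        moreover have "jmul jone h = h" by (cases h) (auto simp: jmul_def jone_def)
        moreover have "jmul (jmul g (jinv h)) h = jmul g (jmul (jinv h) h)"
          by (cases g; cases h) (auto simp: jmul_def jinv_def mul2_nth matrix_mul_assoc algebra_simps)
        moreover have "jmul g jone = g" by (cases g) (auto simp: jmul_def jone_def)
        ultimately show ?thesis using jmul_jinv(2)[OF hS] by simp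
      qed
    qed
  qed
qed

lemma unfold_upper:
  assumes F: "jacobi_fundamental_domain N F" and G [measurable]: "G \<in> borel_measurable borel"
  shows "(\<integral>\<^sup>+p. indicator F p * (\<integral>\<^sup>+g. G (jact g p) \<partial>count_space (JG N)) \<partial>jmeas) \<le> (\<integral>\<^sup>+p. G p \<partial>jmeas)"
proof -
  have [measurable]: "F \<in> sets borel" using F by (simp add: jacobi_fundamental_domain_def)
  have "(\<integral>\<^sup>+p. indicator F p * (\<integral>\<^sup>+g. G (jact g p) \<partial>count_space (JG N)) \<partial>jmeas)
     = (\<integral>\<^sup>+p. \<integral>\<^sup>+g. indicator F p * G (jact g p) \<partial>count_space (JG N) \<partial>jmeas)"
    by (intro nn_integral_cong) (simp add: nn_integral_cmult)
  also have "\<dots> = (\<integral>\<^sup>+g. \<integral>\<^sup>+p. indicator F p * G (jact g p) \<partial>jmeas \<partial>count_space (JG N))"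
    by (intro nn_integral_count_space_nn_integral) auto
  also have "\<dots> = (\<integral>\<^sup>+g. \<integral>\<^sup>+p. indicator F (jact (jinv g) p) * G p \<partial>jmeas \<partial>count_space (JG N))"
  proof (rule nn_integral_cong)
    fix g assume "g \<in> space (count_space (JG N))"
    then have g: "fst g \<in> SL2Z" using JG_SL2Z by auto
    have "(\<integral>\<^sup>+p. indicator F p * G (jact g p) \<partial>jmeas) = (\<integral>\<^sup>+p. indicator F (jact (jinv g) (jact g p)) * G (jact g p) \<partial>jmeas)"
      using AE_jmeas_domain by (intro nn_integral_cong_AE) (auto simp: jact_jinv[OF g] elim!: eventually_mono)
    also have "\<dots> = (\<integral>\<^sup>+p. indicator F (jact (jinv g) p) * G p \<partial>jmeas)"
      using nn_integral_jact[OF g, of "\<lambda>p. indicator F (jact (jinv g) p) * G p"] by simp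
    finally show "(\<integral>\<^sup>+p. indicator F p * G (jact g p) \<partial>jmeas) = (\<integral>\<^sup>+p. indicator F (jact (jinv g) p) * G p \<partial>jmeas)" .
  qed
  also have "\<dots> = (\<integral>\<^sup>+p. \<integral>\<^sup>+g. indicator F (jact (jinv g) p) * G p \<partial>count_space (JG N) \<partial>jmeas)"
    by (intro nn_integral_count_space_nn_integral[symmetric]) auto
  also have "\<dots> \<le> (\<integral>\<^sup>+p. G p \<partial>jmeas)"
  proof (rule nn_integral_mono_AE, rule eventually_mono[OF AE_unique_return[OF F]])
    fix p assume elim: "\<forall>g\<in>JG N. \<forall>h\<in>JG N. jact (jinv g) p \<in> F \<longrightarrow> jact (jinv h) p \<in> F \<longrightarrow> g = h"
    have "(\<integral>\<^sup>+g. indicator F (jact (jinv g) p) * G p \<partial>count_space (JG N)) \<le> G p"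
    proof (cases "\<exists>g\<in>JG N. jact (jinv g) p \<in> F")
      case True
      then obtain g0 where g0: "g0 \<in> JG N" "jact (jinv g0) p \<in> F" by blast
      have "(\<integral>\<^sup>+g. indicator F (jact (jinv g) p) * G p \<partial>count_space (JG N)) = (\<Sum>g\<in>{g0}. indicator F (jact (jinv g) p) * G p)"
        using g0 elim by (intro nn_integral_count_space') (auto simp: indicator_def)
      then show ?thesis using g0 by simp
    next
      case False
      then have "(\<integral>\<^sup>+g. indicator F (jact (jinv g) p) * G p \<partial>count_space (JG N)) = (\<integral>\<^sup>+g. 0 \<partial>count_space (JG N))"
        by (intro nn_integral_cong) auto
      then show ?thesis by simp
    qed
    then show "(\<integral>\<^sup>+g. indicator F (jact (jinv g) p) * G p \<partial>count_space (JG N)) \<le> G p" .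
  qed
  finally show ?thesis .
qed

lemma unfold_lower:
  assumes F: "jacobi_fundamental_domain N F" and G [measurable]: "G \<in> borel_measurable borel"
  shows "(\<integral>\<^sup>+p. G p \<partial>jmeas) \<le> (\<integral>\<^sup>+p. indicator F p * (\<integral>\<^sup>+g. G (jact g p) \<partial>count_space (JG N)) \<partial>jmeas)"
proof -
  have [measurable]: "F \<in> sets borel" using F by (simp add: jacobi_fundamental_domain_def)
  have "(\<integral>\<^sup>+p. G p \<partial>jmeas) \<le> (\<integral>\<^sup>+p. \<integral>\<^sup>+g. indicator F (jact g p) * G p \<partial>count_space (JG N) \<partial>jmeas)"
  proof (rule nn_integral_mono_AE, rule eventually_mono[OF AE_jmeas_domain])
    fix p :: "complex \<times> complex" assume elim: "p \<in> jacobi_domain"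
    have "jacobi_orbit N p \<inter> F \<noteq> {}" using F elim unfolding jacobi_fundamental_domain_def by blast
    then obtain g where g: "g \<in> JG N" "jact g p \<in> F"
      unfolding jacobi_orbit_alt by blast
    have "G p = (\<integral>\<^sup>+h. indicator {g} h * G p \<partial>count_space (JG N))"
      using g by (subst nn_integral_count_space'[of "{g}"]) (auto simp: indicator_def)
    also have "\<dots> \<le> (\<integral>\<^sup>+g. indicator F (jact g p) * G p \<partial>count_space (JG N))"
      using g by (intro nn_integral_mono) (auto simp: indicator_def)
    finally show "G p \<le> (\<integral>\<^sup>+g. indicator F (jact g p) * G p \<partial>count_space (JG N))" .
  qed
  also have "\<dots> = (\<integral>\<^sup>+g. \<integral>\<^sup>+p. indicator F (jact g p) * G p \<partial>jmeas \<partial>count_space (JG N))"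
    by (intro nn_integral_count_space_nn_integral) auto
  also have "\<dots> = (\<integral>\<^sup>+g. \<integral>\<^sup>+p. indicator F p * G (jact (jinv g) p) \<partial>jmeas \<partial>count_space (JG N))"
  proof (rule nn_integral_cong)
    fix g assume "g \<in> space (count_space (JG N))"
    then have g: "fst g \<in> SL2Z" using JG_SL2Z by auto
    have "(\<integral>\<^sup>+p. indicator F (jact g p) * G p \<partial>jmeas) = (\<integral>\<^sup>+p. indicator F (jact g p) * G (jact (jinv g) (jact g p)) \<partial>jmeas)"
      using AE_jmeas_domain by (intro nn_integral_cong_AE) (auto simp: jact_jinv[OF g] elim!: eventually_mono)
    also have "\<dots> = (\<integral>\<^sup>+p. indicator F p * G (jact (jinv g) p) \<partial>jmeas)"
      using nn_integral_jact[OF g, of "\<lambda>p. indicator F p * G (jact (jinv g) p)"] by simp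
    finally show "(\<integral>\<^sup>+p. indicator F (jact g p) * G p \<partial>jmeas) = (\<integral>\<^sup>+p. indicator F p * G (jact (jinv g) p) \<partial>jmeas)" .
  qed
  also have "\<dots> = (\<integral>\<^sup>+p. \<integral>\<^sup>+g. indicator F p * G (jact (jinv g) p) \<partial>count_space (JG N) \<partial>jmeas)"
    by (intro nn_integral_count_space_nn_integral[symmetric]) auto
  also have "\<dots> = (\<integral>\<^sup>+p. indicator F p * (\<integral>\<^sup>+g. G (jact (jinv g) p) \<partial>count_space (JG N)) \<partial>jmeas)"
    by (intro nn_integral_cong) (simp add: nn_integral_cmult)
  also have "\<dots> = (\<integral>\<^sup>+p. indicator F p * (\<integral>\<^sup>+g. G (jact g p) \<partial>count_space (JG N)) \<partial>jmeas)"
    by (intro nn_integral_cong arg_cong2[where f = "(*)"] refl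
        nn_integral_bij_count_space[OF bij_betw_jinv, where f = "\<lambda>g. G (jact g _)"])
  finally show ?thesis .
qed

lemma fundamental_domain_le:
  assumes F: "jacobi_fundamental_domain N F" and S [measurable]: "S \<in> sets borel"
    and cov: "\<And>p. p \<in> jacobi_domain \<Longrightarrow> \<exists>g\<in>JG N. jact g p \<in> S"
    and G [measurable]: "G \<in> borel_measurable borel"
    and inv: "\<And>g p. g \<in> JG N \<Longrightarrow> p \<in> jacobi_domain \<Longrightarrow> G (jact g p) = G p"
  shows "(\<integral>\<^sup>+p. indicator F p * G p \<partial>jmeas) \<le> (\<integral>\<^sup>+p. indicator S p * G p \<partial>jmeas)"
proof -
  have "(\<integral>\<^sup>+p. indicator F p * G p \<partial>jmeas) \<le> (\<integral>\<^sup>+p. indicator F p * (\<integral>\<^sup>+g. indicator S (jact g p) * G (jact g p) \<partial>count_space (JG N)) \<partial>jmeas)"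
  proof (intro nn_integral_mono)
    fix p :: "complex \<times> complex"
    show "indicator F p * G p \<le> indicator F p * (\<integral>\<^sup>+g. indicator S (jact g p) * G (jact g p) \<partial>count_space (JG N))"
    proof (cases "p \<in> F")
      case True
      then have p: "p \<in> jacobi_domain" using F by (auto simp: jacobi_fundamental_domain_def)
      obtain g where g: "g \<in> JG N" "jact g p \<in> S" using cov[OF p] by blast
      have "G p = (\<integral>\<^sup>+h. indicator {g} h * G p \<partial>count_space (JG N))"
        using g by (subst nn_integral_count_space'[of "{g}"]) (auto simp: indicator_def)
      also have "\<dots> \<le> (\<integral>\<^sup>+g. indicator S (jact g p) * G (jact g p) \<partial>count_space (JG N))"
        using g inv p by (intro nn_integral_mono) (auto simp: indicator_def)
      finally show ?thesis using True by simp
    qed simp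
  qed
  also have "\<dots> \<le> (\<integral>\<^sup>+p. indicator S p * G p \<partial>jmeas)"
    by (rule unfold_upper[OF F]) measurable
  finally show ?thesis .
qed

lemma siegel_le_fundamental_domain:
  assumes F: "jacobi_fundamental_domain N F" and S [measurable]: "S \<in> sets borel"
    and G [measurable]: "G \<in> borel_measurable borel"
    and inv: "\<And>g p. g \<in> JG N \<Longrightarrow> p \<in> jacobi_domain \<Longrightarrow> G (jact g p) = G p"
    and fin: "\<And>p. p \<in> jacobi_domain \<Longrightarrow> finite {g\<in>JG N. jact g p \<in> S}"
    and card: "\<And>p. p \<in> jacobi_domain \<Longrightarrow> card {g\<in>JG N. jact g p \<in> S} \<le> M"
  shows "(\<integral>\<^sup>+p. indicator S p * G p \<partial>jmeas) \<le> of_nat M * (\<integral>\<^sup>+p. indicator F p * G p \<partial>jmeas)"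
proof -
  have [measurable]: "F \<in> sets borel" using F by (simp add: jacobi_fundamental_domain_def)
  have "(\<integral>\<^sup>+p. indicator S p * G p \<partial>jmeas) \<le> (\<integral>\<^sup>+p. indicator F p * (\<integral>\<^sup>+g. indicator S (jact g p) * G (jact g p) \<partial>count_space (JG N)) \<partial>jmeas)"
    by (rule unfold_lower[OF F]) measurable
  also have "\<dots> \<le> (\<integral>\<^sup>+p. of_nat M * (indicator F p * G p) \<partial>jmeas)"
  proof (intro nn_integral_mono)
    fix p :: "complex \<times> complex"
    show "indicator F p * (\<integral>\<^sup>+g. indicator S (jact g p) * G (jact g p) \<partial>count_space (JG N)) \<le> of_nat M * (indicator F p * G p)"
    proof (cases "p \<in> F")
      case True
      then have p: "p \<in> jacobi_domain" using F by (auto simp: jacobi_fundamental_domain_def)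
      let ?T = "{g\<in>JG N. jact g p \<in> S}"
      have "(\<integral>\<^sup>+g. indicator S (jact g p) * G (jact g p) \<partial>count_space (JG N)) = (\<Sum>g\<in>?T. indicator S (jact g p) * G (jact g p))"
        by (intro nn_integral_count_space' fin p) auto
      also have "\<dots> = (\<Sum>g\<in>?T. G p)" using inv p by (intro sum.cong) auto
      also have "\<dots> = of_nat (card ?T) * G p" by simp
      also have "\<dots> \<le> of_nat M * G p" using card[OF p] by (intro mult_right_mono) auto
      finally show ?thesis using True by simp
    qed simp
  qed
  also have "\<dots> = of_nat M * (\<integral>\<^sup>+p. indicator F p * G p \<partial>jmeas)" by (rule nn_integral_cmult) measurable
  finally show ?thesis .
qed

section \<open>Reduction theory of SL2(Z)\<close>

lemma SL2Z_bottom_row: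
  assumes "coprime c d"
  obtains A where "A \<in> SL2Z" "A$2$1 = c" "A$2$2 = d"
proof -
  obtain u v where "u * c + v * d = 1" using bezout_int[of c d] assms by auto
  then have "mat2 v (- u) c d \<in> SL2Z" by (simp add: SL2Z_iff algebra_simps)
  then show ?thesis using that by auto
qed

lemma SL2Z_coprime: "A \<in> SL2Z \<Longrightarrow> coprime (A$2$1) (A$2$2)"
  unfolding SL2Z_iff by (rule coprimeI) (metis dvd_diff dvd_mult)

definition trans2 :: "int \<Rightarrow> int ^ 2 ^ 2" where "trans2 j = mat2 1 j 0 1"

lemma trans2_SL2Z [simp]: "trans2 j \<in> SL2Z"
  by (simp add: trans2_def SL2Z_iff)

lemma SL2Z_same_row:
  assumes "A \<in> SL2Z" "B \<in> SL2Z" "A$2$1 = B$2$1" "A$2$2 = B$2$2"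
  obtains j where "B = trans2 j ** A" "B ** inv2 A = trans2 j"
proof -
  define j where "j = B$1$2 * A$1$1 - B$1$1 * A$1$2"
  have d: "A$1$1 * A$2$2 - A$1$2 * A$2$1 = 1" "B$1$1 * A$2$2 - B$1$2 * A$2$1 = 1"
    using assms by (auto simp: SL2Z_iff)
  have "B$1$1 = A$1$1 + j * A$2$1" "B$1$2 = A$1$2 + j * A$2$2"
    unfolding j_def using d by algebra+
  then have e: "B = trans2 j ** A"
    using assms by (simp add: mat2_eq_iff mul2_nth trans2_def)
  then have "B ** inv2 A = trans2 j" by (simp add: inv2_mult assms flip: matrix_mul_assoc)
  then show ?thesis using that e by blast
qed

lemma mob_trans2: "mob (trans2 j ** A) \<tau> = mob A \<tau> + of_int j" if "A \<in> SL2Z" "Im \<tau> > 0"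
  using mob_mult'[OF trans2_SL2Z that, of j] by (simp add: trans2_def mob_num_def mob_den_def)

lemma SL2Z_reduction:
  assumes t: "Im \<tau> > 0"
  obtains A where "A \<in> SL2Z" "\<bar>Re (mob A \<tau>)\<bar> \<le> 1/2" "cmod (mob A \<tau>) \<ge> 1"
proof -
  define f where "f = (\<lambda>(c :: int, d :: int). cmod (of_int c * \<tau> + of_int d))"
  define S where "S = {(c :: int, d :: int). coprime c d \<and> cmod (of_int c * \<tau> + of_int d) \<le> 1}"
  have "finite S" using finite_lattice_ball[OF t, of 1] by (rule rev_finite_subset) (auto simp: S_def)
  moreover have "(0, 1) \<in> S" by (simp add: S_def)
  ultimately obtain q where q: "q \<in> S" "\<And>s. s \<in> S \<Longrightarrow> f q \<le> f s"
    using ex_is_arg_min_if_finite[of S f] unfolding is_arg_min_linorder by blast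
  obtain c d where cd: "q = (c, d)" by (cases q)
  have min: "cmod (of_int c * \<tau> + of_int d) \<le> cmod (of_int c' * \<tau> + of_int d')" if "coprime c' d'" for c' d'
  proof (cases "(c', d') \<in> S")
    case True
    then show ?thesis using q(2)[OF True] by (simp add: f_def cd)
  next
    case False
    then have "cmod (of_int c' * \<tau> + of_int d') > 1" using that by (simp add: S_def)
    moreover have "cmod (of_int c * \<tau> + of_int d) \<le> 1" using q(1) cd by (simp add: S_def)
    ultimately show ?thesis by simp
  qed
  have "coprime c d" using q cd by (simp add: S_def)
  then obtain A where A: "A \<in> SL2Z" "A$2$1 = c" "A$2$2 = d" by (rule SL2Z_bottom_row)
  define n where "n = round (Re (mob A \<tau>))"
  define B where "B = trans2 (- n) ** A"
  have B: "B \<in> SL2Z" unfolding B_def using A by (intro SL2Z_mult) auto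
  have mB: "mob B \<tau> = mob A \<tau> - of_int n" unfolding B_def using mob_trans2[OF A(1) t] by simp
  have "\<bar>Re (mob B \<tau>)\<bar> \<le> 1/2"
    unfolding mB n_def using of_int_round_abs_le[of "Re (mob A \<tau>)"] by (simp add: abs_minus_commute)
  moreover have "cmod (mob B \<tau>) \<ge> 1"
  proof -
    have "B$2$1 = c" "B$2$2 = d" using A by (simp_all add: B_def mul2_nth trans2_def)
    then have "cmod (mob_den B \<tau>) \<le> cmod (of_int (B$1$1) * \<tau> + of_int (B$1$2))"
    proof -
      assume e: "B$2$1 = c" "B$2$2 = d"
      have "coprime (B$1$1) (B$1$2)" using B unfolding SL2Z_iff
        by (intro coprimeI) (metis dvd_diff dvd_mult2)
      then show ?thesis using min by (simp add: mob_den_def e)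
    qed
    then have "cmod (mob_den B \<tau>) \<le> cmod (mob_num B \<tau>)" by (simp add: mob_num_def)
    moreover have "cmod (mob_den B \<tau>) > 0" using mob_den_nonzero[OF B t] by simp
    ultimately show ?thesis by (simp add: norm_divide)
  qed
  ultimately show ?thesis using that B by blast
qed

lemma Im_ge_of_reduced: "\<bar>Re w\<bar> \<le> 1/2 \<Longrightarrow> cmod w \<ge> 1 \<Longrightarrow> Im w > 0 \<Longrightarrow> Im w \<ge> 3/4"
proof -
  assume h: "\<bar>Re w\<bar> \<le> 1/2" "cmod w \<ge> 1" "Im w > 0"
  have "(Re w)\<^sup>2 \<le> (1/2)\<^sup>2" using h(1) by (metis abs_ge_zero power2_abs power_mono)
  moreover have "(Re w)\<^sup>2 + (Im w)\<^sup>2 \<ge> 1" using h(2) by (metis cmod_power2 one_le_power)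
  ultimately have "(Im w)\<^sup>2 \<ge> (3/4)\<^sup>2" by (simp add: power_divide)
  then show ?thesis using h(3) by (rule power2_le_imp_le[OF _ less_imp_le])
qed

lemma primitive_count:
  assumes t: "Im \<tau> > 0"
  shows "finite {(c :: int, d :: int). coprime c d \<and> (cmod (of_int c * \<tau> + of_int d))\<^sup>2 < 2 * Im \<tau>}" (is "finite ?P")
    and "card {(c :: int, d :: int). coprime c d \<and> (cmod (of_int c * \<tau> + of_int d))\<^sup>2 < 2 * Im \<tau>} \<le> 8"
proof -
  define h where "h = (\<lambda>(c :: int, d :: int). (c mod 2, d mod 2, c > 0 \<or> (c = 0 \<and> d > 0)))"
  have inj: "inj_on h ?P"
  proof (rule inj_onI)
    fix q q' assume q: "q \<in> ?P" "q' \<in> ?P" "h q = h q'"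
    obtain c d c' d' where e: "q = (c, d)" "q' = (c', d')" by (metis prod.exhaust)
    let ?a = "of_int c * \<tau> + of_int d" and ?b = "of_int c' * \<tau> + of_int d'"
    have cop: "coprime c d" "coprime c' d'" and lt: "(cmod ?a)\<^sup>2 < 2 * Im \<tau>" "(cmod ?b)\<^sup>2 < 2 * Im \<tau>"
      using q e by auto
    have ie: "Im (?a * cnj ?b) = real_of_int (c * d' - d * c') * Im \<tau>" by (simp add: algebra_simps)
    have "\<bar>real_of_int (c * d' - d * c')\<bar> * Im \<tau> \<le> cmod ?a * cmod ?b"
      using abs_Im_le_cmod[of "?a * cnj ?b"] t unfolding ie norm_mult complex_mod_cnj abs_mult by simp
    also have "cmod ?a * cmod ?b \<le> ((cmod ?a)\<^sup>2 + (cmod ?b)\<^sup>2) / 2"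
      using sum_squares_bound[of "cmod ?a" "cmod ?b"] by simp
    also have "\<dots> < 2 * Im \<tau>" using lt by simp
    finally have "\<bar>real_of_int (c * d' - d * c')\<bar> < 2" using t by simp
    then have "\<bar>c * d' - d * c'\<bar> < 2" by linarith
    moreover have "even (c * d' - d * c')"
      using q(3) by (simp add: h_def e) presburger
    moreover have "e = 0" if "\<bar>e\<bar> < 2" "even e" for e :: int using that by presburger
    ultimately have z: "c * d' = d * c'" by force
    have "c dvd c'" "c' dvd c" "d dvd d'" "d' dvd d"
      using cop z by (metis coprime_dvd_mult_right_iff dvd_triv_left dvd_triv_right coprime_commute mult.commute)+
    then have "\<bar>c\<bar> = \<bar>c'\<bar>" "\<bar>d\<bar> = \<bar>d'\<bar>" by (auto intro: zdvd_antisym_abs)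
    then have "(c = c' \<and> d = d') \<or> (c = - c' \<and> d = - d')"
      using z cop by (auto simp: abs_eq_iff)
    moreover have False if "c = - c'" "d = - d'" "(c, d) \<noteq> (c', d')"
    proof -
      have "c' > 0 \<or> (c' = 0 \<and> d' > 0) \<longleftrightarrow> c > 0 \<or> (c = 0 \<and> d > 0)"
        using q(3) by (auto simp: h_def e)
      moreover have "c \<noteq> 0 \<or> d \<noteq> 0" using cop by auto
      ultimately show False using that by auto
    qed
    ultimately show "q = q'" unfolding e by blast
  qed
  have sub: "h ` ?P \<subseteq> {0, 1} \<times> {0, 1} \<times> UNIV"
    by (auto simp: h_def)
  have f: "finite ({0, 1} \<times> {0, 1} \<times> (UNIV :: bool set) :: (int \<times> int \<times> bool) set)" by simp
  show "finite ?P" using finite_subset[OF sub f] inj by (simp add: finite_image_iff)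
  have "card ?P = card (h ` ?P)" using inj by (simp add: card_image)
  also have "\<dots> \<le> card ({0, 1} \<times> {0, 1} \<times> (UNIV :: bool set) :: (int \<times> int \<times> bool) set)"
    by (rule card_mono[OF f sub])
  also have "\<dots> = 8" by (simp add: card_cartesian_product)
  finally show "card ?P \<le> 8" .
qed

definition siegel :: "nat \<Rightarrow> (complex \<times> complex) set" where
  "siegel w = {p. 0 \<le> Re (fst p) \<and> Re (fst p) < real w \<and> Im (fst p) > 1/2 \<and>
      0 \<le> Re (snd p) \<and> Re (snd p) < 1 \<and> 0 \<le> Im (snd p) \<and> Im (snd p) < Im (fst p)}"

lemma sets_siegel [measurable]: "siegel w \<in> sets borel"
proof -
  have [measurable]: "fst \<in> borel_measurable (borel :: (complex \<times> complex) measure)"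
     "snd \<in> borel_measurable (borel :: (complex \<times> complex) measure)"
    by (auto intro!: borel_measurable_continuous_onI continuous_intros)
  have "{p \<in> space (borel :: (complex \<times> complex) measure). 0 \<le> Re (fst p) \<and> Re (fst p) < real w \<and> Im (fst p) > 1/2 \<and>
      0 \<le> Re (snd p) \<and> Re (snd p) < 1 \<and> 0 \<le> Im (snd p) \<and> Im (snd p) < Im (fst p)} \<in> sets borel" by measurable
  then show ?thesis by (simp add: siegel_def)
qed

lemma int_lt_1_unique:
  assumes "0 \<le> x + real_of_int a * v" "x + real_of_int a * v < v" "0 \<le> x + real_of_int b * v" "x + real_of_int b * v < v"
  shows "a = b"
proof -
  have v: "v > 0" using assms by linarith
  have "\<bar>real_of_int (a - b) * v\<bar> < v" using assms by (simp add: algebra_simps abs_less_iff)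
  then have "\<bar>real_of_int (a - b)\<bar> < 1" using v by (simp add: abs_mult)
  then show ?thesis by linarith
qed

lemma siegel_count:
  assumes A: "A \<in> SL2Z" and p: "p \<in> jacobi_domain"
    and w: "\<And>j. A ** trans2 j ** inv2 A \<in> Gamma0 N \<Longrightarrow> int w dvd j"
  shows "finite {g \<in> JG N. jact g p \<in> jact (inv2 A, 0, 0) -` siegel w}" (is "finite ?G")
    and "card {g \<in> JG N. jact g p \<in> jact (inv2 A, 0, 0) -` siegel w} \<le> 8"
proof -
  obtain \<tau> z where pe: "p = (\<tau>, z)" by (cases p)
  have t: "Im \<tau> > 0" using p pe by simp
  define P where "P = {(c :: int, d :: int). coprime c d \<and> (cmod (of_int c * \<tau> + of_int d))\<^sup>2 < 2 * Im \<tau>}"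
  define h where "h = (\<lambda>g :: jac. ((inv2 A ** fst g)$2$1, (inv2 A ** fst g)$2$2))"
  have iA: "inv2 A \<in> SL2Z" by (rule SL2Z_inv2[OF A])
  have key: "inv2 A ** B \<in> SL2Z \<and> jact (inv2 A ** B, l, m) p \<in> siegel w" if "(B, l, m) \<in> ?G" for B l m
  proof -
    have B: "B \<in> SL2Z" using that JG_SL2Z by force
    have "jmul (inv2 A, 0, 0) (B, l, m) = (inv2 A ** B, l, m)" by (simp add: jmul_def)
    then show ?thesis using that jact_jmul[of "(inv2 A, 0, 0)" "(B, l, m)" p] B iA p SL2Z_mult by auto
  qed
  have sub: "h ` ?G \<subseteq> P"
  proof (rule image_subsetI)
    fix g assume g: "g \<in> ?G"
    obtain B l m where ge: "g = (B, l, m)" by (metis prod.exhaust)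
    let ?C = "inv2 A ** B"
    have C: "?C \<in> SL2Z" and s: "jact (?C, l, m) p \<in> siegel w" using key g ge by auto
    have "Im (mob ?C \<tau>) > 1/2" using s by (simp add: siegel_def pe jact_Pair)
    then have "(cmod (mob_den ?C \<tau>))\<^sup>2 < 2 * Im \<tau>"
      using mob_den_nonzero[OF C t] unfolding Im_mob[OF C t] by (simp add: field_simps)
    then show "h g \<in> P" using SL2Z_coprime[OF C] by (simp add: P_def h_def ge mob_den_def)
  qed
  have inj: "inj_on h ?G"
  proof (rule inj_onI)
    fix g g' assume g: "g \<in> ?G" "g' \<in> ?G" "h g = h g'"
    obtain B l m B' l' m' where ge: "g = (B, l, m)" "g' = (B', l', m')" by (metis prod.exhaust)
    let ?C = "inv2 A ** B" and ?C' = "inv2 A ** B'"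
    have C: "?C \<in> SL2Z" "jact (?C, l, m) p \<in> siegel w" using key g ge by auto
    have C': "?C' \<in> SL2Z" "jact (?C', l', m') p \<in> siegel w" using key g ge by auto
    obtain j where j: "?C' = trans2 j ** ?C" "?C' ** inv2 ?C = trans2 j"
      using SL2Z_same_row[OF C(1) C'(1)] g(3) by (auto simp: h_def ge)
    have BG: "B \<in> Gamma0 N" "B' \<in> Gamma0 N" using g ge by (auto simp: JG_def)
    have "A ** ?C = B" "A ** ?C' = B'" using inv2_mult[OF A] by (simp_all add: matrix_mul_assoc)
    moreover have "inv2 ?C = inv2 B ** A"
      using A BG Gamma0_SL2Z[of B N] by (simp add: inv2_def mat2_eq_iff mul2_nth algebra_simps)
    ultimately have "A ** trans2 j ** inv2 A = B' ** inv2 B"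
      unfolding j(2)[symmetric] using inv2_mult[OF A] by (metis matrix_mul_assoc matrix_mul_rid)
    then have dj: "int w dvd j" using w Gamma0_mult[OF BG(2) Gamma0_inv2[OF BG(1)]] by metis
    have mm: "mob ?C' \<tau> = mob ?C \<tau> + of_int j" unfolding j(1) by (rule mob_trans2[OF C(1) t])
    obtain j' where j': "j = int w * j'" using dj by blast
    have "0 = j'"
    proof (rule int_lt_1_unique)
      show "0 \<le> Re (mob ?C \<tau>) + real_of_int 0 * real w" "Re (mob ?C \<tau>) + real_of_int 0 * real w < real w"
         "0 \<le> Re (mob ?C \<tau>) + real_of_int j' * real w" "Re (mob ?C \<tau>) + real_of_int j' * real w < real w"
        using C(2) C'(2) mm by (auto simp: siegel_def pe jact_Pair j' mult.commute)
    qed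
    then have CC: "?C = ?C'" using j' j(1) by (simp add: trans2_def mat2_eq_iff mul2_nth)
    then have BB: "B = B'" using \<open>A ** ?C = B\<close> \<open>A ** ?C' = B'\<close> by metis
    define J where "J = mob_den ?C \<tau>"
    have J0: "J \<noteq> 0" unfolding J_def by (rule mob_den_nonzero[OF C(1) t])
    define a where "a = l * A$1$1"
    obtain la nu :: int where ln: "l' - l = la * ?C$1$1 + nu * ?C$2$1" "m' - m = la * ?C$1$2 + nu * ?C$2$2"
    proof -
      have d: "?C$1$1 * ?C$2$2 - ?C$1$2 * ?C$2$1 = 1" using C(1) by (simp add: SL2Z_iff)
      have "l' - l = ((l' - l) * ?C$2$2 - (m' - m) * ?C$2$1) * ?C$1$1 + ((m' - m) * ?C$1$1 - (l' - l) * ?C$1$2) * ?C$2$1"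
        "m' - m = ((l' - l) * ?C$2$2 - (m' - m) * ?C$2$1) * ?C$1$2 + ((m' - m) * ?C$1$1 - (l' - l) * ?C$1$2) * ?C$2$2"
        using d by algebra+
      then show ?thesis using that by blast
    qed
    define Z where "Z = (z + of_int l * \<tau> + of_int m) / J"
    define T where "T = mob ?C \<tau>"
    have "z + of_int l' * \<tau> + of_int m' = (z + of_int l * \<tau> + of_int m) + (of_int (l' - l) * \<tau> + of_int (m' - m))"
      by (simp add: algebra_simps)
    also have "of_int (l' - l) * \<tau> + of_int (m' - m) = of_int la * mob_num ?C \<tau> + of_int nu * J"
      unfolding ln by (simp add: J_def mob_num_def mob_den_def algebra_simps)
    finally have X: "z + of_int l' * \<tau> + of_int m' = (z + of_int l * \<tau> + of_int m) + (of_int la * mob_num ?C \<tau> + of_int nu * J)" .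
    have Z': "(z + of_int l' * \<tau> + of_int m') / J = Z + of_int la * T + of_int nu"
      unfolding X add_divide_distrib Z_def T_def using J0 by (simp add: J_def)
    have s1: "jact (?C, l, m) p = (T, Z)" by (simp add: pe jact_Pair J_def Z_def T_def)
    have s2: "jact (?C', l', m') p = (T, Z + of_int la * T + of_int nu)"
      unfolding CC[symmetric] pe jact_Pair using Z' by (simp add: J_def T_def)
    have "0 = la"
    proof (rule int_lt_1_unique)
      show "0 \<le> Im Z + real_of_int 0 * Im T" "Im Z + real_of_int 0 * Im T < Im T"
        "0 \<le> Im Z + real_of_int la * Im T" "Im Z + real_of_int la * Im T < Im T"
        using C(2) C'(2) unfolding s1 s2 by (auto simp: siegel_def)
    qed
    moreover have "0 = nu"
    proof (rule int_lt_1_unique)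
      show "0 \<le> Re Z + real_of_int 0 * 1" "Re Z + real_of_int 0 * 1 < 1"
        "0 \<le> Re Z + real_of_int nu * 1" "Re Z + real_of_int nu * 1 < 1"
        using C(2) C'(2) \<open>0 = la\<close> unfolding s1 s2 by (auto simp: siegel_def)
    qed
    ultimately have "l' = l" "m' = m" using ln by auto
    then show "g = g'" using BB ge by simp
  qed
  have PP: "finite P" "card P \<le> 8" unfolding P_def using primitive_count[OF t] by auto
  show "finite ?G" using finite_subset[OF sub PP(1)] inj by (simp add: finite_image_iff)
  have "card ?G = card (h ` ?G)" using inj by (simp add: card_image)
  also have "\<dots> \<le> card P" by (rule card_mono[OF PP(1) sub])
  finally show "card ?G \<le> 8" using PP(2) by simp
qed

definition width :: "nat \<Rightarrow> int ^ 2 ^ 2 \<Rightarrow> nat" where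
  "width N A = nat (int N div gcd (int N) ((A$2$1)\<^sup>2))"

lemma width_iff:
  assumes "A \<in> SL2Z" "N > 0"
  shows "A ** trans2 j ** inv2 A \<in> Gamma0 N \<longleftrightarrow> int (width N A) dvd j"
proof -
  have "A ** trans2 j ** inv2 A \<in> SL2Z" using assms by (intro SL2Z_mult SL2Z_inv2) auto
  moreover have "(A ** trans2 j ** inv2 A)$2$1 = - ((A$2$1)\<^sup>2 * j)"
    by (simp add: mul2_nth trans2_def inv2_def power2_eq_square algebra_simps)
  ultimately have "A ** trans2 j ** inv2 A \<in> Gamma0 N \<longleftrightarrow> int N dvd (A$2$1)\<^sup>2 * j"
    by (simp add: Gamma0_def)
  also have "\<dots> \<longleftrightarrow> int N div gcd (int N) ((A$2$1)\<^sup>2) dvd j"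
  proof -
    define g where "g = gcd (int N) ((A$2$1)\<^sup>2)"
    have g: "g > 0" using assms by (simp add: g_def)
    have "g dvd int N" "g dvd (A$2$1)\<^sup>2" by (simp_all add: g_def)
    then obtain n c where n: "int N = g * n" and c: "(A$2$1)\<^sup>2 = g * c" by (auto elim!: dvdE)
    have "g = gcd (g * n) (g * c)" unfolding n[symmetric] c[symmetric] by (simp add: g_def)
    then have cop: "coprime n c" using g by (simp add: gcd_mult_left coprime_iff_gcd_eq_1 abs_mult)
    have "int N dvd (A$2$1)\<^sup>2 * j \<longleftrightarrow> g * n dvd g * (c * j)" unfolding n c by (simp only: mult.assoc)
    also have "\<dots> \<longleftrightarrow> n dvd c * j" using g by simp
    also have "\<dots> \<longleftrightarrow> n dvd j" using cop by (simp add: coprime_dvd_mult_right_iff)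
    also have "n = int N div g" unfolding n using g by simp
    finally show ?thesis unfolding g_def .
  qed
  also have "int N div gcd (int N) ((A$2$1)\<^sup>2) = int (width N A)"
    by (simp add: width_def pos_imp_zdiv_nonneg_iff assms)
  finally show ?thesis .
qed

lemma width_dvd: "N > 0 \<Longrightarrow> width N A dvd N"
proof -
  assume N: "N > 0"
  have "int (width N A) = int N div gcd (int N) ((A$2$1)\<^sup>2)"
    by (simp add: width_def pos_imp_zdiv_nonneg_iff N)
  also have "\<dots> dvd int N" by (metis dvd_div_mult_self dvd_triv_left gcd_dvd1)
  finally show ?thesis by simp
qed

lemma coset_reps:
  assumes "N > 0"
  shows "\<exists>R. finite R \<and> R \<subseteq> SL2Z \<and> (\<forall>A\<in>SL2Z. \<exists>B\<in>R. \<exists>G\<in>Gamma0 N. A = G ** B)"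
proof -
  define f where "f = (\<lambda>A :: int ^ 2 ^ 2. (A$2$1 mod int N, A$2$2 mod int N))"
  define R where "R = inv_into SL2Z f ` (f ` SL2Z)"
  have "f ` SL2Z \<subseteq> {0..<int N} \<times> {0..<int N}" using assms by (auto simp: f_def)
  then have "finite (f ` SL2Z)" by (rule finite_subset) auto
  then have "finite R" unfolding R_def by (rule finite_imageI)
  moreover have "R \<subseteq> SL2Z" by (auto simp: R_def intro: inv_into_into)
  moreover have "\<exists>B\<in>R. \<exists>G\<in>Gamma0 N. A = G ** B" if A: "A \<in> SL2Z" for A
  proof -
    define B where "B = inv_into SL2Z f (f A)"
    have B: "B \<in> R" "B \<in> SL2Z" "f B = f A" using A by (auto simp: B_def R_def inv_into_into f_inv_into_f)
    have "int N dvd A$2$1 * B$2$2 - A$2$2 * B$2$1"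
    proof -
      have "A$2$1 mod int N = B$2$1 mod int N" "A$2$2 mod int N = B$2$2 mod int N" using B(3) by (auto simp: f_def)
      then have "(A$2$1 * B$2$2) mod int N = (B$2$1 * A$2$2) mod int N" by (metis mod_mult_cong)
      then show ?thesis by (simp add: mod_eq_dvd_iff mult.commute)
    qed
    then have "A ** inv2 B \<in> Gamma0 N"
      using SL2Z_mult[OF A SL2Z_inv2[OF B(2)]] by (simp add: Gamma0_def mul2_nth inv2_def)
    moreover have "A = (A ** inv2 B) ** B" using inv2_mult[OF B(2)] by (simp flip: matrix_mul_assoc)
    ultimately show ?thesis using B(1) by blast
  qed
  ultimately show ?thesis by blast
qed

definition cusp_box :: "(complex \<times> complex) set" where
  "cusp_box = {p. \<bar>Re (fst p)\<bar> \<le> 1/2 \<and> Im (fst p) \<ge> 3/4 \<and> 0 \<le> Re (snd p) \<and> Re (snd p) \<le> 1 \<and> 0 \<le> Im (snd p) \<and> Im (snd p) \<le> Im (fst p)}"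

lemma sets_cusp_box [measurable]: "cusp_box \<in> sets borel"
proof -
  have "{p \<in> space (borel :: (complex \<times> complex) measure). \<bar>Re (fst p)\<bar> \<le> 1/2 \<and> Im (fst p) \<ge> 3/4 \<and> 0 \<le> Re (snd p) \<and> Re (snd p) \<le> 1 \<and> 0 \<le> Im (snd p) \<and> Im (snd p) \<le> Im (fst p)} \<in> sets borel" by measurable
  then show ?thesis by (simp add: cusp_box_def)
qed

lemma cusp_box_cover:
  assumes p: "p \<in> jacobi_domain"
  obtains g where "fst g \<in> SL2Z" "jact g p \<in> cusp_box" "cmod (fst (jact g p)) \<ge> 1"
proof -
  obtain \<tau> z where pe: "p = (\<tau>, z)" by (cases p)
  have t: "Im \<tau> > 0" using p pe by simp
  obtain A where A: "A \<in> SL2Z" "\<bar>Re (mob A \<tau>)\<bar> \<le> 1/2" "cmod (mob A \<tau>) \<ge> 1" using SL2Z_reduction[OF t] .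
  have v: "Im (mob A \<tau>) > 0" by (rule Im_mob_pos[OF A(1) t])
  define T where "T = mob A \<tau>"
  define Z where "Z = z / mob_den A \<tau>"
  define l where "l = - \<lfloor>Im Z / Im T\<rfloor>"
  define m where "m = - \<lfloor>Re (Z + of_int l * T)\<rfloor>"
  have y: "0 \<le> Im Z + of_int l * Im T" "Im Z + of_int l * Im T \<le> Im T"
  proof -
    have "of_int (- l) \<le> Im Z / Im T" "Im Z / Im T < of_int (- l) + 1" unfolding l_def by (simp_all add: floor_correct)
    then show "0 \<le> Im Z + of_int l * Im T" "Im Z + of_int l * Im T \<le> Im T"
      using v unfolding T_def[symmetric] by (simp_all add: field_simps)
  qed
  have x: "0 \<le> Re (Z + of_int l * T) + of_int m" "Re (Z + of_int l * T) + of_int m \<le> 1"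
    unfolding m_def by linarith+
  have "jact (jmul (mat 1, l, m) (A, 0, 0)) p = jact (mat 1, l, m) (jact (A, 0, 0) p)"
    using A p SL2Z_one by (intro jact_jmul) auto
  also have "\<dots> = (T, Z + of_int l * T + of_int m)" by (simp add: pe jact_Pair T_def Z_def)
  finally have e: "jact (jmul (mat 1, l, m) (A, 0, 0)) p = (T, Z + of_int l * T + of_int m)" .
  have "Im T \<ge> 3/4" unfolding T_def by (rule Im_ge_of_reduced) (use A v in auto)
  show ?thesis
  proof (rule that[of "jmul (mat 1, l, m) (A, 0, 0)"])
    show "fst (jmul (mat 1, l, m) (A, 0, 0)) \<in> SL2Z" using A SL2Z_one by (intro fst_jmul) auto
    show "jact (jmul (mat 1, l, m) (A, 0, 0)) p \<in> cusp_box"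
      unfolding e cusp_box_def using x y A \<open>Im T \<ge> 3/4\<close> by (simp add: T_def[symmetric])
    show "1 \<le> cmod (fst (jact (jmul (mat 1, l, m) (A, 0, 0)) p))"
      unfolding e using A by (simp add: T_def)
  qed
qed

lemma emeasure_cusp_box: "emeasure jmeas cusp_box < \<infinity>"
proof -
  have "emeasure jmeas cusp_box = (\<integral>\<^sup>+p. indicator cusp_box p \<partial>jmeas)" by simp
  also have "\<dots> = (\<integral>\<^sup>+\<tau>. indicator {\<tau>. Im \<tau> > 0} \<tau> * ennreal (1 / Im \<tau> ^ 3) * (\<integral>\<^sup>+z. indicator cusp_box (\<tau>, z) \<partial>lborel) \<partial>lborel)"
    by (rule nn_integral_jmeas) measurable
  also have "\<dots> \<le> (\<integral>\<^sup>+\<tau>. indicator {\<tau>. \<bar>Re \<tau>\<bar> \<le> 1/2} \<tau> * (ennreal (1 / Im \<tau> ^ 2) * indicator {\<tau>. 3/4 \<le> Im \<tau>} \<tau>) \<partial>lborel)"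
  proof (intro nn_integral_mono)
    fix \<tau> :: complex
    show "indicator {\<tau>. Im \<tau> > 0} \<tau> * ennreal (1 / Im \<tau> ^ 3) * (\<integral>\<^sup>+z. indicator cusp_box (\<tau>, z) \<partial>lborel)
       \<le> indicator {\<tau>. \<bar>Re \<tau>\<bar> \<le> 1/2} \<tau> * (ennreal (1 / Im \<tau> ^ 2) * indicator {\<tau>. 3/4 \<le> Im \<tau>} \<tau>)"
    proof (cases "\<bar>Re \<tau>\<bar> \<le> 1/2 \<and> 3/4 \<le> Im \<tau>")
      case True
      have "(\<integral>\<^sup>+z. indicator cusp_box (\<tau>, z) \<partial>lborel) \<le> (\<integral>\<^sup>+z. indicator (cbox 0 (Complex 1 (Im \<tau>))) z \<partial>lborel)"
        by (intro nn_integral_mono) (auto simp: indicator_def cusp_box_def in_cbox_complex_iff)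
      also have "\<dots> = emeasure lborel (cbox 0 (Complex 1 (Im \<tau>)))" by simp
      also have "\<dots> = ennreal (Im \<tau>)"
        using True by (subst emeasure_lborel_cbox) (auto simp: Basis_complex_def)
      finally have "ennreal (1 / Im \<tau> ^ 3) * (\<integral>\<^sup>+z. indicator cusp_box (\<tau>, z) \<partial>lborel) \<le> ennreal (1 / Im \<tau> ^ 3) * ennreal (Im \<tau>)"
        by (rule mult_left_mono) simp
      also have "\<dots> = ennreal (1 / Im \<tau> ^ 2)"
        using True by (subst ennreal_mult[symmetric]) (auto simp: field_simps power2_eq_square power3_eq_cube)
      finally show ?thesis using True by (simp add: mult.assoc)
    next
      case False
      then have "indicator cusp_box (\<tau>, z) = (0 :: ennreal)" for z by (auto simp: cusp_box_def)
      then show ?thesis by simp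
    qed
  qed
  also have "\<dots> = (\<integral>\<^sup>+(x :: real). \<integral>\<^sup>+(y :: real). indicator {-1/2..1/2} x * (ennreal (1 / y ^ 2) * indicator {3/4..} y) \<partial>lborel \<partial>lborel)"
  proof -
    have m: "(\<lambda>\<tau>. indicator {\<tau>. \<bar>Re \<tau>\<bar> \<le> 1/2} \<tau> * (ennreal (1 / Im \<tau> ^ 2) * indicator {\<tau>. 3/4 \<le> Im \<tau>} \<tau>)) \<in> borel_measurable borel"
      by measurable
    show ?thesis
      unfolding nn_integral_complex[OF m]
      by (intro nn_integral_cong arg_cong2[where f = "(*)"]) (auto simp: indicator_def)
  qed
  also have "\<dots> = (\<integral>\<^sup>+(x :: real). indicator {-1/2..1/2} x * (\<integral>\<^sup>+(y :: real). ennreal (1 / y ^ 2) * indicator {3/4..} y \<partial>lborel) \<partial>lborel)"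
    by (rule nn_integral_cong, rule nn_integral_cmult) measurable
  also have "(\<integral>\<^sup>+(y :: real). ennreal (1 / y ^ 2) * indicator {3/4..} y \<partial>lborel) = ennreal (0 - (- 1 / (3/4 :: real)))"
  proof (rule nn_integral_FTC_atLeast)
    show "((\<lambda>y :: real. - 1 / y) \<longlongrightarrow> 0) at_top" by real_asymp
    show "DERIV (\<lambda>y. - 1 / y) y :> 1 / y ^ 2" if "3/4 \<le> y" for y :: real
      using that by (auto intro!: derivative_eq_intros simp: power2_eq_square field_simps)
  qed auto
  also have "(\<integral>\<^sup>+x. indicator {-1/2..1/2} x * ennreal (0 - (- 1 / (3/4 :: real))) \<partial>(lborel :: real measure)) < \<infinity>"
    by (subst nn_integral_multc) (auto simp: ennreal_mult_less_top)
  finally show ?thesis .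
qed

lemma emeasure_fundamental_domain:
  assumes F: "jacobi_fundamental_domain N F" and N: "N > 0"
  shows "emeasure jmeas F < \<infinity>"
proof -
  have [measurable]: "F \<in> sets borel" using F by (simp add: jacobi_fundamental_domain_def)
  obtain R where R: "finite R" "R \<subseteq> SL2Z" "\<forall>A\<in>SL2Z. \<exists>B\<in>R. \<exists>G\<in>Gamma0 N. A = G ** B"
    using coset_reps[OF N] by blast
  define S where "S = (\<Union>B\<in>R. jact (inv2 B, 0, 0) -` cusp_box)"
  have S [measurable]: "S \<in> sets borel" unfolding S_def using R by (intro sets.finite_UN) auto
  have cov: "\<exists>g\<in>JG N. jact g p \<in> S" if p: "p \<in> jacobi_domain" for p
  proof -
    obtain g where g: "fst g \<in> SL2Z" "jact g p \<in> cusp_box" using cusp_box_cover[OF p] by blast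
    obtain A l m where ge: "g = (A, l, m)" by (metis prod.exhaust)
    have A: "A \<in> SL2Z" using g ge by simp
    obtain B G where B: "B \<in> R" "G \<in> Gamma0 N" "inv2 A = G ** B" using R(3) SL2Z_inv2[OF A] by blast
    have BS: "B \<in> SL2Z" "G \<in> SL2Z" using B R Gamma0_SL2Z by auto
    have "A = inv2 (inv2 A)" by (simp add: inv2_def mat2_eq_iff)
    also have "\<dots> = inv2 B ** inv2 G" unfolding B(3) by (simp add: inv2_def mat2_eq_iff mul2_nth algebra_simps)
    finally have "g = jmul (inv2 B, 0, 0) (inv2 G, l, m)" by (simp add: ge jmul_def)
    then have "jact (inv2 B, 0, 0) (jact (inv2 G, l, m) p) \<in> cusp_box"
      using g(2) jact_jmul[of "(inv2 B, 0, 0)" "(inv2 G, l, m)" p] p BS SL2Z_inv2 by auto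
    then show ?thesis using B Gamma0_inv2[OF B(2)] by (intro bexI[of _ "(inv2 G, l, m)"]) (auto simp: S_def JG_def)
  qed
  have "emeasure jmeas F = (\<integral>\<^sup>+p. indicator F p * 1 \<partial>jmeas)" by simp
  also have "\<dots> \<le> (\<integral>\<^sup>+p. indicator S p * 1 \<partial>jmeas)"
    by (rule fundamental_domain_le[OF F S cov]) auto
  also have "\<dots> = emeasure jmeas S" by simp
  also have "\<dots> \<le> (\<Sum>B\<in>R. emeasure jmeas (jact (inv2 B, 0, 0) -` cusp_box))"
    unfolding S_def using R by (intro emeasure_subadditive_finite) auto
  also have "\<dots> = (\<Sum>B\<in>R. emeasure jmeas cusp_box)"
  proof (intro sum.cong refl)
    fix B assume "B \<in> R"
    then have "fst (inv2 B, 0 :: int, 0 :: int) \<in> SL2Z" using R SL2Z_inv2 by auto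
    then have "(\<integral>\<^sup>+p. indicator cusp_box (jact (inv2 B, 0, 0) p) \<partial>jmeas) = (\<integral>\<^sup>+p. indicator cusp_box p \<partial>jmeas)"
      by (rule nn_integral_jact) measurable
    moreover have "(\<integral>\<^sup>+p. indicator cusp_box (jact (inv2 B, 0, 0) p) \<partial>jmeas) = (\<integral>\<^sup>+p. indicator (jact (inv2 B, 0, 0) -` cusp_box) p \<partial>jmeas)"
      by (intro nn_integral_cong) (auto simp: indicator_def)
    ultimately show "emeasure jmeas (jact (inv2 B, 0, 0) -` cusp_box) = emeasure jmeas cusp_box" by simp
  qed
  also have "\<dots> < \<infinity>" using emeasure_cusp_box by (simp add: ennreal_mult_less_top of_nat_less_top)
  finally show ?thesis .
qed

section \<open>Holomorphic functions of two variables\<close>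

lemma continuous_on_deriv_snd:
  fixes f :: "complex \<Rightarrow> complex \<Rightarrow> complex"
  assumes U: "open U" and V: "open V" and c: "continuous_on (U \<times> V) (\<lambda>(u, z). f u z)"
    and h: "\<And>u. u \<in> U \<Longrightarrow> f u holomorphic_on V"
  shows "continuous_on (U \<times> V) (\<lambda>(u, z). deriv (f u) z)"
proof (rule continuous_at_imp_continuous_on, rule ballI)
  fix p assume p: "p \<in> U \<times> V"
  obtain u0 z0 where pe: "p = (u0, z0)" by (cases p)
  have u0: "u0 \<in> U" and z0: "z0 \<in> V" using p pe by auto
  obtain r where r: "r > 0" "cball z0 r \<subseteq> V" using V z0 open_contains_cball by blast
  define s where "s = r / 2"
  have s: "s > 0" using r by (simp add: s_def)
  have sub: "cball z s \<subseteq> cball z0 r" if "z \<in> ball z0 s" for z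
  proof
    fix x assume "x \<in> cball z s"
    then show "x \<in> cball z0 r" using that dist_triangle[of z0 x z] by (simp add: s_def)
  qed
  have dc: "continuous_on V (deriv (f u0))"
    using h[OF u0] V by (intro holomorphic_on_imp_continuous_on holomorphic_deriv)
  have "\<exists>d>0. \<forall>q. dist q p < d \<longrightarrow> dist (case q of (u, z) \<Rightarrow> deriv (f u) z) (deriv (f u0) z0) < e" if e: "e > 0" for e
  proof -
    define e' where "e' = e * s / 4"
    have e': "e' > 0" using e s by (simp add: e'_def)
    have c': "continuous_on (U \<times> cball z0 r) (\<lambda>(u, z). f u z)"
      using c by (rule continuous_on_subset) (use r in auto)
    obtain X0 where X0: "u0 \<in> X0" "open X0" "\<forall>u\<in>X0 \<inter> U. \<forall>t\<in>cball z0 r. dist (f u t) (f u0 t) \<le> e'"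
      using continuous_on_prod_compactE[OF c' compact_cball u0 e'] by auto
    obtain d1 where d1: "d1 > 0" "ball u0 d1 \<subseteq> X0 \<inter> U"
      using X0 U u0 by (metis IntI open_Int openE)
    obtain d2 where d2: "d2 > 0" "\<And>z. z \<in> V \<Longrightarrow> dist z z0 < d2 \<Longrightarrow> dist (deriv (f u0) z) (deriv (f u0) z0) < e / 2"
      using dc z0 e unfolding continuous_on_iff by (metis half_gt_zero)
    show ?thesis
    proof (intro exI[of _ "min d1 (min d2 s)"] conjI allI impI)
      show "0 < min d1 (min d2 s)" using d1 d2 s by simp
      fix q assume q: "dist q p < min d1 (min d2 s)"
      obtain u z where qe: "q = (u, z)" by (cases q)
      have "dist u u0 < min d1 (min d2 s)" "dist z z0 < min d1 (min d2 s)"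
        using q dist_fst_le[of q p] dist_snd_le[of q p] by (auto simp: qe pe)
      then have u: "u \<in> X0 \<inter> U" and z: "z \<in> ball z0 s" and zd: "dist z z0 < d2"
        using d1(2) by (auto simp: dist_commute)
      have zV: "cball z s \<subseteq> V" using sub[OF z] r by blast
      have zin: "z \<in> V" using zV s by auto
      have hd: "(\<lambda>w. f u w - f u0 w) holomorphic_on V" using h u u0 by (intro holomorphic_intros) auto
      have "norm ((deriv ^^ 1) (\<lambda>w. f u w - f u0 w) z) \<le> fact 1 * e' / s ^ 1"
      proof (rule Cauchy_inequality)
        show "(\<lambda>w. f u w - f u0 w) holomorphic_on ball z s" using hd by (rule holomorphic_on_subset) (use zV ball_subset_cball in blast)
        show "continuous_on (cball z s) (\<lambda>w. f u w - f u0 w)"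
          using holomorphic_on_imp_continuous_on[OF hd] by (rule continuous_on_subset) (rule zV)
        show "cmod (f u x - f u0 x) \<le> e'" if "cmod (z - x) = s" for x
        proof -
          have "x \<in> cball z0 r" using sub[OF z] that by (auto simp: dist_norm)
          then show ?thesis using X0(3) u by (auto simp: dist_norm)
        qed
      qed (rule s)
      moreover have "deriv (\<lambda>w. f u w - f u0 w) z = deriv (f u) z - deriv (f u0) z"
        using h u u0 V zin by (intro deriv_diff) (auto intro: holomorphic_on_imp_differentiable_at)
      ultimately have "dist (deriv (f u) z) (deriv (f u0) z) \<le> e / 4"
        using s by (simp add: dist_norm e'_def)
      moreover have "dist (deriv (f u0) z) (deriv (f u0) z0) < e / 2" by (rule d2(2)[OF zin zd])
      ultimately have "dist (deriv (f u) z) (deriv (f u0) z0) < e"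
        using dist_triangle[of "deriv (f u) z" "deriv (f u0) z0" "deriv (f u0) z"] e by linarith
      then show "dist (case q of (u, z) \<Rightarrow> deriv (f u) z) (deriv (f u0) z0) < e" by (simp add: qe)
    qed
  qed
  then show "isCont (\<lambda>(u, z). deriv (f u) z) p"
    unfolding continuous_at_eps_delta by (simp add: pe)
qed

lemma holomorphic2_onI_separate:
  assumes S: "open S" and c: "continuous_on S f"
    and h1: "\<And>\<tau> z. (\<tau>, z) \<in> S \<Longrightarrow> (\<lambda>s. f (s, z)) field_differentiable (at \<tau>)"
    and h2: "\<And>\<tau> z. (\<tau>, z) \<in> S \<Longrightarrow> (\<lambda>w. f (\<tau>, w)) field_differentiable (at z)"
  shows "holomorphic2_on f S"
  unfolding holomorphic2_on_def
proof
  fix p assume p: "p \<in> S"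
  obtain \<tau> z where pe: "p = (\<tau>, z)" by (cases p)
  obtain U V where UV': "open U" "open V" "p \<in> U \<times> V" "U \<times> V \<subseteq> S"
    by (rule open_prod_elim[OF S p])
  then have UV: "open U" "open V" "\<tau> \<in> U" "z \<in> V" "U \<times> V \<subseteq> S" by (auto simp: pe)
  obtain r where r: "r > 0" "ball z r \<subseteq> V" using UV openE by blast
  let ?V = "ball z r"
  have sub: "U \<times> ?V \<subseteq> S" using UV r by auto
  have c': "continuous_on (U \<times> ?V) (\<lambda>(u, z). f (u, z))" using c continuous_on_subset sub by (auto simp: split_beta)
  have hol: "(\<lambda>w. f (u, w)) holomorphic_on ?V" if "u \<in> U" for u
    using h2 that sub by (auto simp: holomorphic_on_open open_ball field_differentiable_def)
  have dc: "continuous_on (U \<times> ?V) (\<lambda>(u, w). deriv (\<lambda>w. f (u, w)) w)"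
    by (rule continuous_on_deriv_snd[OF UV(1) open_ball c' hol])
  obtain D where D: "((\<lambda>s. f (s, z)) has_field_derivative D) (at \<tau>)"
    using h1 p pe by (auto simp: field_differentiable_def)
  have "((\<lambda>(x, y). f (x, y)) has_derivative (\<lambda>(tx, ty). D * tx + blinfun_apply (blinfun_mult_right (deriv (\<lambda>w. f (\<tau>, w)) z)) ty)) (at (\<tau>, z) within U \<times> ?V)"
  proof (rule has_derivative_partialsI)
    show "((\<lambda>x. f (x, z)) has_derivative (*) D) (at \<tau> within U)"
      using D by (auto simp: has_field_derivative_def intro: has_derivative_at_withinI)
    show "((\<lambda>y. f (x, y)) has_derivative blinfun_apply (blinfun_mult_right (deriv (\<lambda>w. f (x, w)) y))) (at y within ?V)"
      if "x \<in> U" "y \<in> ?V" for x y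
    proof -
      have "((\<lambda>y. f (x, y)) has_field_derivative deriv (\<lambda>w. f (x, w)) y) (at y)"
        using hol[OF that(1)] that(2) by (simp add: holomorphic_derivI)
      then show ?thesis by (auto simp: has_field_derivative_def intro: has_derivative_at_withinI)
    qed
    have "continuous_on (U \<times> ?V) (\<lambda>p. blinfun_mult_right (case p of (u, w) \<Rightarrow> deriv (\<lambda>w. f (u, w)) w))"
      using dc by (rule bounded_linear.continuous_on[OF bounded_linear_blinfun_mult_right])
    then show "continuous (at (\<tau>, z) within U \<times> ?V) (\<lambda>(x, y). blinfun_mult_right (deriv (\<lambda>w. f (x, w)) y))"
      using UV r by (auto simp: continuous_on_eq_continuous_within case_prod_beta')
  qed (use r in auto)
  then have "((\<lambda>(x, y). f (x, y)) has_derivative (\<lambda>(tx, ty). D * tx + deriv (\<lambda>w. f (\<tau>, w)) z * ty)) (at (\<tau>, z))"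
    using UV r by (subst (asm) at_within_open) (auto simp: open_Times)
  then have "(f has_derivative (\<lambda>(tx, ty). D * tx + deriv (\<lambda>w. f (\<tau>, w)) z * ty)) (at p within S)"
    unfolding pe by (auto intro: has_derivative_at_withinI)
  then show "\<exists>a b. (f has_derivative (\<lambda>(s, t). a * s + b * t)) (at p within S)" by blast
qed

lemma holomorphic2_imp_continuous_on: "holomorphic2_on f S \<Longrightarrow> continuous_on S f"
  unfolding holomorphic2_on_def continuous_on_eq_continuous_within
  by (meson has_derivative_continuous)

lemma holomorphic2_slices:
  assumes f: "holomorphic2_on f S" and S: "open S" and p: "(\<tau>, z) \<in> S"
  shows "(\<lambda>s. f (s, z)) field_differentiable (at \<tau>)" "(\<lambda>w. f (\<tau>, w)) field_differentiable (at z)"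
proof -
  obtain a b where "(f has_derivative (\<lambda>(s, t). a * s + b * t)) (at (\<tau>, z) within S)"
    using f p by (auto simp: holomorphic2_on_def)
  then have d: "(f has_derivative (\<lambda>(s, t). a * s + b * t)) (at (\<tau>, z))"
    by (simp only: at_within_open[OF p S])
  have "((\<lambda>s. (s, z)) has_derivative (\<lambda>h. (h, 0))) (at \<tau>)" by (auto intro!: derivative_eq_intros)
  from has_derivative_compose[OF this d]
  show "(\<lambda>s. f (s, z)) field_differentiable (at \<tau>)"
    by (auto simp: field_differentiable_def has_field_derivative_def intro!: exI[of _ a])
  have "((\<lambda>w. (\<tau>, w)) has_derivative (\<lambda>h. (0, h))) (at z)" by (auto intro!: derivative_eq_intros)
  from has_derivative_compose[OF this d]
  show "(\<lambda>w. f (\<tau>, w)) field_differentiable (at z)"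
    by (auto simp: field_differentiable_def has_field_derivative_def intro!: exI[of _ b])
qed

lemma holomorphic2_on_transform:
  assumes "holomorphic2_on f S" "\<And>p. p \<in> S \<Longrightarrow> g p = f p"
  shows "holomorphic2_on g S"
  unfolding holomorphic2_on_def
proof
  fix p assume p: "p \<in> S"
  obtain a b where "(f has_derivative (\<lambda>(s, t). a * s + b * t)) (at p within S)"
    using assms(1) p unfolding holomorphic2_on_def by blast
  from has_derivative_transform[OF p assms(2) this]
  show "\<exists>a b. (g has_derivative (\<lambda>(s, t). a * s + b * t)) (at p within S)" by blast
qed

lemma uniform_limit_slice:
  assumes "uniform_limit V f g F" "\<And>x. x \<in> T \<Longrightarrow> h x \<in> V"
  shows "uniform_limit T (\<lambda>X x. f X (h x)) (\<lambda>x. g (h x)) F"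
proof (rule uniform_limitI)
  fix e :: real assume "e > 0"
  from uniform_limitD[OF assms(1) this]
  show "\<forall>\<^sub>F X in F. \<forall>x\<in>T. dist (f X (h x)) (g (h x)) < e"
    by (rule eventually_mono) (use assms(2) in blast)
qed

lemma holomorphic2_infsum:
  assumes S: "open S" and f: "\<And>i. i \<in> I \<Longrightarrow> holomorphic2_on (f i) S"
    and M: "\<And>p. p \<in> S \<Longrightarrow> \<exists>V M. open V \<and> p \<in> V \<and> M summable_on I \<and> (\<forall>i\<in>I. \<forall>q\<in>V \<inter> S. cmod (f i q) \<le> M i)"
  shows "holomorphic2_on (\<lambda>p. \<Sum>\<^sub>\<infinity>i\<in>I. f i p) S"
proof -
  let ?F = "\<lambda>p. \<Sum>\<^sub>\<infinity>i\<in>I. f i p"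
  have loc: "\<exists>V. open V \<and> p \<in> V \<and> V \<subseteq> S \<and> uniform_limit V (\<lambda>X q. \<Sum>i\<in>X. f i q) ?F (finite_subsets_at_top I)" if pS: "p \<in> S" for p
  proof -
    obtain V M where V: "open V" "p \<in> V" "M summable_on I" "\<forall>i\<in>I. \<forall>q\<in>V \<inter> S. cmod (f i q) \<le> M i" using M[OF pS] by blast
    have "uniform_limit (V \<inter> S) (\<lambda>X q. \<Sum>i\<in>X. f i q) ?F (finite_subsets_at_top I)"
      by (rule Weierstrass_m_test_general[OF _ V(3)]) (use V(4) in auto)
    then show ?thesis using V S pS by (intro exI[of _ "V \<inter> S"]) auto
  qed
  have cs: "continuous_on S (\<lambda>q. \<Sum>i\<in>X. f i q)" if "finite X" "X \<subseteq> I" for X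
    using that f by (intro continuous_intros holomorphic2_imp_continuous_on) auto
  show ?thesis
  proof (rule holomorphic2_onI_separate[OF S])
    show "continuous_on S ?F"
    proof (rule continuous_at_imp_continuous_on, rule ballI)
      fix p assume "p \<in> S"
      then obtain V where V: "open V" "p \<in> V" "V \<subseteq> S" "uniform_limit V (\<lambda>X q. \<Sum>i\<in>X. f i q) ?F (finite_subsets_at_top I)" using loc by blast
      have "continuous_on V ?F"
        by (rule uniform_limit_theorem[OF _ V(4)])
          (use V cs in \<open>auto intro!: eventually_finite_subsets_at_top_weakI intro: continuous_on_subset\<close>)
      then show "isCont ?F p" using V by (simp add: continuous_on_eq_continuous_at)
    qed
  next
    fix \<tau> z assume p: "(\<tau>, z) \<in> S"
    obtain V where V: "open V" "(\<tau>, z) \<in> V" "V \<subseteq> S" "uniform_limit V (\<lambda>X q. \<Sum>i\<in>X. f i q) ?F (finite_subsets_at_top I)" using loc[OF p] by blast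
    obtain A B where "open A" "open B" "(\<tau>, z) \<in> A \<times> B" "A \<times> B \<subseteq> V" by (rule open_prod_elim[OF V(1,2)])
    then have AB: "open A" "open B" "\<tau> \<in> A" "z \<in> B" "A \<times> B \<subseteq> V" by auto
    obtain r where r: "r > 0" "cball \<tau> r \<subseteq> A" using AB open_contains_cball by blast
    obtain r' where r': "r' > 0" "cball z r' \<subseteq> B" using AB open_contains_cball by blast
    have u1: "uniform_limit (cball \<tau> r) (\<lambda>X s. \<Sum>i\<in>X. f i (s, z)) (\<lambda>s. ?F (s, z)) (finite_subsets_at_top I)"
      by (rule uniform_limit_slice[OF V(4)]) (use r AB in auto)
    have h1: "(\<lambda>s. \<Sum>i\<in>X. f i (s, z)) holomorphic_on A" if "finite X" "X \<subseteq> I" for X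
    proof (intro holomorphic_on_sum)
      fix i assume "i \<in> X"
      then have i: "i \<in> I" using that by auto
      have "(\<lambda>s. f i (s, z)) field_differentiable at s" if "s \<in> A" for s
        using holomorphic2_slices(1)[OF f[OF i] S, of s z] that AB V by auto
      then show "(\<lambda>s. f i (s, z)) holomorphic_on A"
        by (auto simp: holomorphic_on_def intro: field_differentiable_at_within)
    qed
    have "(\<lambda>s. ?F (s, z)) holomorphic_on ball \<tau> r"
    proof (rule holomorphic_uniform_limit[OF _ u1])
      show "\<forall>\<^sub>F X in finite_subsets_at_top I. continuous_on (cball \<tau> r) (\<lambda>s. \<Sum>i\<in>X. f i (s, z)) \<and> (\<lambda>s. \<Sum>i\<in>X. f i (s, z)) holomorphic_on ball \<tau> r"
        using r ball_subset_cball[of \<tau> r] order_trans[OF ball_subset_cball r(2)]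
        by (auto intro!: eventually_finite_subsets_at_top_weakI intro: holomorphic_on_subset[OF h1] continuous_on_subset[OF holomorphic_on_imp_continuous_on[OF h1]])
    qed auto
    then show "(\<lambda>s. ?F (s, z)) field_differentiable at \<tau>"
      using r by (intro holomorphic_on_imp_differentiable_at[of _ "ball \<tau> r"]) auto
    have u2: "uniform_limit (cball z r') (\<lambda>X s. \<Sum>i\<in>X. f i (\<tau>, s)) (\<lambda>s. ?F (\<tau>, s)) (finite_subsets_at_top I)"
      by (rule uniform_limit_slice[OF V(4)]) (use r' AB in auto)
    have h2: "(\<lambda>s. \<Sum>i\<in>X. f i (\<tau>, s)) holomorphic_on B" if "finite X" "X \<subseteq> I" for X
    proof (intro holomorphic_on_sum)
      fix i assume "i \<in> X"
      then have i: "i \<in> I" using that by auto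
      have "(\<lambda>s. f i (\<tau>, s)) field_differentiable at s" if "s \<in> B" for s
        using holomorphic2_slices(2)[OF f[OF i] S, of \<tau> s] that AB V by auto
      then show "(\<lambda>s. f i (\<tau>, s)) holomorphic_on B"
        by (auto simp: holomorphic_on_def intro: field_differentiable_at_within)
    qed
    have "(\<lambda>s. ?F (\<tau>, s)) holomorphic_on ball z r'"
    proof (rule holomorphic_uniform_limit[OF _ u2])
      show "\<forall>\<^sub>F X in finite_subsets_at_top I. continuous_on (cball z r') (\<lambda>s. \<Sum>i\<in>X. f i (\<tau>, s)) \<and> (\<lambda>s. \<Sum>i\<in>X. f i (\<tau>, s)) holomorphic_on ball z r'"
        using r' ball_subset_cball[of z r'] order_trans[OF ball_subset_cball r'(2)]
        by (auto intro!: eventually_finite_subsets_at_top_weakI intro: holomorphic_on_subset[OF h2] continuous_on_subset[OF holomorphic_on_imp_continuous_on[OF h2]])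
    qed auto
    then show "(\<lambda>s. ?F (\<tau>, s)) field_differentiable at z"
      using r' by (intro holomorphic_on_imp_differentiable_at[of _ "ball z r'"]) auto
  qed
qed

section \<open>Fourier expansions\<close>

lemma ee_plus_int [simp]: "ee (w + of_int n) = ee w"
  by (simp add: ee_add)

lemma ee_plus_1 [simp]: "ee (w + 1) = ee w"
  using ee_plus_int[of w 1] by simp

lemma ee_eq_1_iff: "ee w = 1 \<longleftrightarrow> (\<exists>n. w = of_int n)"
proof
  assume "ee w = 1"
  then obtain n :: int where "Im (2 * of_real pi * \<i> * w) = of_int (2 * n) * pi" "Re (2 * of_real pi * \<i> * w) = 0"
    unfolding ee_def exp_eq_1 by auto
  then have "w = of_int n" by (auto simp: complex_eq_iff)
  then show "\<exists>n. w = of_int n" by blast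
qed auto

lemma ee_holomorphic [holomorphic_intros]: "f holomorphic_on S \<Longrightarrow> (\<lambda>w. ee (f w)) holomorphic_on S"
  unfolding ee_def by (intro holomorphic_intros)

lemma ee_continuous [continuous_intros]: "continuous_on S f \<Longrightarrow> continuous_on S (\<lambda>w. ee (f w))"
  unfolding ee_def by (intro continuous_intros)

lemma ee_deriv: "(ee has_field_derivative 2 * of_real pi * \<i> * ee w) (at w)"
  unfolding ee_def by (auto intro!: derivative_eq_intros)

lemma ee_has_integral:
  "((\<lambda>t :: real. ee (of_int n * (z0 + of_real t))) has_integral (if n = 0 then 1 else 0)) {0..1}"
proof (cases "n = 0")
  case True
  then show ?thesis using has_integral_const_real[of "1 :: complex" 0 1] by simp
next
  case False
  let ?c = "of_int n * (2 * of_real pi * \<i>)"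
  have "((\<lambda>t :: real. ee (of_int n * (z0 + of_real t))) has_integral
     (ee (of_int n * (z0 + of_real 1)) / ?c - ee (of_int n * (z0 + of_real 0)) / ?c)) {0..1}"
  proof (rule fundamental_theorem_of_calculus)
    fix t :: real
    have "((\<lambda>w. of_int n * (z0 + w)) has_field_derivative of_int n) (at (of_real t))"
      by (auto intro!: derivative_eq_intros)
    from DERIV_cdivide[OF DERIV_chain2[OF ee_deriv this], of ?c]
    have "((\<lambda>w. ee (of_int n * (z0 + w)) / ?c) has_field_derivative ee (of_int n * (z0 + of_real t))) (at (of_real t))"
      using False by (simp add: field_simps)
    from has_vector_derivative_real_field[OF this]
    show "((\<lambda>t. ee (of_int n * (z0 + of_real t)) / ?c) has_vector_derivative ee (of_int n * (z0 + of_real t))) (at t within {0..1})" .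
  qed simp
  moreover have "ee (of_int n * (z0 + 1)) = ee (of_int n * z0)"
    using ee_plus_int[of "of_int n * z0" n] by (simp add: algebra_simps)
  ultimately show ?thesis using False by simp
qed

lemma geometric_int_summable:
  assumes "0 < q" "q < (1 :: real)"
  shows "(\<lambda>n :: int. q ^ nat \<bar>n\<bar>) summable_on UNIV"
proof -
  have g: "(\<lambda>n. q ^ n) summable_on (UNIV :: nat set)"
    using assms by (intro norm_summable_imp_summable_on) (auto intro: summable_geometric)
  have 1: "(\<lambda>n :: int. q ^ nat \<bar>n\<bar>) summable_on int ` UNIV"
    using g by (subst summable_on_reindex) (auto simp: o_def)
  have 2: "(\<lambda>n :: int. q ^ nat \<bar>n\<bar>) summable_on (\<lambda>n. - int n) ` UNIV"
    using g by (subst summable_on_reindex) (auto simp: o_def inj_on_def)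
  have "(UNIV :: int set) = int ` UNIV \<union> (\<lambda>n. - int n) ` UNIV"
  proof -
    have "n \<in> int ` UNIV \<union> (\<lambda>n. - int n) ` UNIV" for n by (cases n rule: int_cases2) auto
    then show ?thesis by blast
  qed
  then show ?thesis using summable_on_union[OF 1 2] by simp
qed

definition fcoeff :: "(complex \<Rightarrow> complex) \<Rightarrow> complex \<Rightarrow> int \<Rightarrow> complex" where
  "fcoeff F z0 n = integral {0..1} (\<lambda>t. F (z0 + of_real t) * ee (- of_int n * (z0 + of_real t)))"

locale periodic_strip =
  fixes S :: "complex set"
  assumes open_S: "open S" and convex_S: "convex S"
    and shift_S: "\<And>z t. z \<in> S \<Longrightarrow> z + of_real t \<in> S"
begin

lemma shift_S_1: "z \<in> S \<Longrightarrow> z + 1 \<in> S"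
  using shift_S[of z 1] by simp

lemma period_integral_const:
  assumes H: "H holomorphic_on S" and per: "\<And>z. z \<in> S \<Longrightarrow> H (z + 1) = H z"
    and z: "z0 \<in> S" "z1 \<in> S"
  shows "integral {0..1} (\<lambda>t. H (z0 + of_real t)) = integral {0..1} (\<lambda>t. H (z1 + of_real t))"
proof -
  obtain P where P: "\<And>x. x \<in> S \<Longrightarrow> (P has_field_derivative H x) (at x within S)"
    using holomorphic_convex_primitive'[OF convex_S open_S H] by blast
  have P': "(P has_field_derivative H x) (at x)" if "x \<in> S" for x
    using P[OF that] by (simp only: at_within_open[OF that open_S])
  have int: "integral {0..1} (\<lambda>t. H (z + of_real t)) = P (z + 1) - P z" if z: "z \<in> S" for z
  proof -
    have "((\<lambda>t. H (z + of_real t)) has_integral (P (z + of_real 1) - P (z + of_real 0))) {0..1}"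
    proof (rule fundamental_theorem_of_calculus)
      fix t :: real
      have "((\<lambda>w. z + w) has_field_derivative 1) (at (of_real t))"
        by (auto intro!: derivative_eq_intros)
      from DERIV_chain2[OF P'[OF shift_S[OF z, of t]] this]
      have "((\<lambda>w. P (z + w)) has_field_derivative H (z + of_real t)) (at (of_real t))" by simp
      from has_vector_derivative_real_field[OF this]
      show "((\<lambda>t. P (z + of_real t)) has_vector_derivative H (z + of_real t)) (at t within {0..1})" .
    qed simp
    then show ?thesis by (simp add: integral_unique)
  qed
  have "\<exists>c. \<forall>z\<in>S. P (z + 1) - P z = c"
  proof (rule has_field_derivative_zero_constant[OF convex_S])
    fix z assume z: "z \<in> S"
    have "((\<lambda>z. z + 1) has_field_derivative 1) (at z)" by (auto intro!: derivative_eq_intros)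
    from DERIV_chain2[OF P'[OF shift_S_1[OF z]] this]
    have "((\<lambda>z. P (z + 1)) has_field_derivative H (z + 1)) (at z)" by simp
    then have "((\<lambda>z. P (z + 1) - P z) has_field_derivative H (z + 1) - H z) (at z)"
      by (intro DERIV_diff P'[OF z])
    then show "((\<lambda>z. P (z + 1) - P z) has_field_derivative 0) (at z within S)"
      using per[OF z] by (auto intro: has_field_derivative_at_within)
  qed
  then show ?thesis using int z by metis
qed

lemma fcoeff_const:
  assumes F: "F holomorphic_on S" and per: "\<And>z. z \<in> S \<Longrightarrow> F (z + 1) = F z"
    and z: "z0 \<in> S" "z1 \<in> S"
  shows "fcoeff F z0 n = fcoeff F z1 n"
  unfolding fcoeff_def
proof (rule period_integral_const[of "\<lambda>w. F w * ee (- of_int n * w)", OF _ _ z])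
  show "(\<lambda>w. F w * ee (- of_int n * w)) holomorphic_on S" by (intro holomorphic_intros F)
  show "F (z + 1) * ee (- of_int n * (z + 1)) = F z * ee (- of_int n * z)" if "z \<in> S" for z
    using per[OF that] ee_plus_int[of "- of_int n * z" "- n"] by (simp add: algebra_simps)
qed

lemma fcoeff_integrable:
  assumes F: "F holomorphic_on S" and z: "z0 \<in> S"
  shows "(\<lambda>t. F (z0 + of_real t) * ee (- of_int n * (z0 + of_real t))) integrable_on {0..1}"
proof (rule integrable_continuous_real)
  have "continuous_on {0..1} (\<lambda>t :: real. F (z0 + of_real t))"
    by (rule continuous_on_compose2[OF holomorphic_on_imp_continuous_on[OF F]])
      (use shift_S[OF z] in \<open>auto intro!: continuous_intros\<close>)
  then show "continuous_on {0..1} (\<lambda>t. F (z0 + of_real t) * ee (- of_int n * (z0 + of_real t)))"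
    by (intro continuous_intros)
qed

lemma fcoeff_bound:
  assumes F: "F holomorphic_on S" and z: "z0 \<in> S"
    and B: "\<And>t. t \<in> {0..1} \<Longrightarrow> cmod (F (z0 + of_real t)) \<le> B"
  shows "cmod (fcoeff F z0 n) \<le> B * exp (2 * pi * of_int n * Im z0)"
proof -
  have B0: "B \<ge> 0" using order_trans[OF norm_ge_zero, OF B[of 0]] by simp
  have "norm (integral (cbox 0 1) (\<lambda>t. F (z0 + of_real t) * ee (- of_int n * (z0 + of_real t)))) \<le> (B * exp (2 * pi * of_int n * Im z0)) * Henstock_Kurzweil_Integration.content (cbox 0 (1::real))"
  proof (rule integrable_bound)
    fix t :: real assume "t \<in> cbox 0 1"
    then have "cmod (F (z0 + of_real t)) \<le> B" using B by simp
    then show "norm (F (z0 + of_real t) * ee (- of_int n * (z0 + of_real t))) \<le> B * exp (2 * pi * of_int n * Im z0)"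
      by (simp add: norm_mult norm_ee mult_right_mono mult.assoc)
  qed (use B0 fcoeff_integrable[OF F z] in auto)
  then show ?thesis by (simp add: fcoeff_def)
qed

lemma fcoeff_decay:
  assumes F: "F holomorphic_on S" and per: "\<And>z. z \<in> S \<Longrightarrow> F (z + 1) = F z" and z: "z0 \<in> S"
  obtains B q where "0 < q" "q < 1" "\<And>n. cmod (fcoeff F z0 n * ee (of_int n * z0)) \<le> B * q ^ nat \<bar>n\<bar>"
proof -
  obtain e where e: "e > 0" "cball z0 e \<subseteq> S" using open_S z open_contains_cball by blast
  let ?u = "z0 + \<i> * of_real e" and ?l = "z0 - \<i> * of_real e"
  have u: "?u \<in> S" "?l \<in> S" using e by (auto intro!: subsetD[OF e(2)] simp: dist_norm norm_mult)
  have bd: "\<exists>B. \<forall>t\<in>{0..1}. cmod (F (w + of_real t)) \<le> B" if "w \<in> S" for w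
  proof -
    have "continuous_on {0..1} (\<lambda>t :: real. F (w + of_real t))"
      by (rule continuous_on_compose2[OF holomorphic_on_imp_continuous_on[OF F]])
        (use shift_S[OF that] in \<open>auto intro!: continuous_intros\<close>)
    then have "compact ((\<lambda>t :: real. F (w + of_real t)) ` {0..1})" by (rule compact_continuous_image) simp
    then show ?thesis using compact_imp_bounded bounded_iff by (metis imageI)
  qed
  obtain B1 where B1: "\<And>t. t \<in> {0..1} \<Longrightarrow> cmod (F (?u + of_real t)) \<le> B1" using bd[OF u(1)] by blast
  obtain B2 where B2: "\<And>t. t \<in> {0..1} \<Longrightarrow> cmod (F (?l + of_real t)) \<le> B2" using bd[OF u(2)] by blast
  define B where "B = max B1 B2"
  define q where "q = exp (- 2 * pi * e)"
  have "cmod (fcoeff F z0 n * ee (of_int n * z0)) \<le> B * q ^ nat \<bar>n\<bar>" for n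
  proof (cases "n \<ge> 0")
    case True
    have "cmod (fcoeff F ?l n) \<le> B * exp (2 * pi * of_int n * Im ?l)"
      by (rule fcoeff_bound[OF F u(2)]) (use B2 in \<open>force simp: B_def\<close>)
    then have "cmod (fcoeff F z0 n) \<le> B * exp (2 * pi * of_int n * Im ?l)"
      using fcoeff_const[OF F per z u(2)] by simp
    then have "cmod (fcoeff F z0 n) * exp (- 2 * pi * (of_int n * Im z0)) \<le> B * exp (2 * pi * of_int n * Im ?l) * exp (- 2 * pi * (of_int n * Im z0))"
      by (rule mult_right_mono) simp
    also have "\<dots> = B * exp (- 2 * pi * e * of_int n)" by (simp add: algebra_simps flip: exp_add)
    also have "exp (- 2 * pi * e * of_int n) = q ^ nat \<bar>n\<bar>" using True by (simp add: q_def mult_ac flip: exp_of_nat_mult)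
    finally show ?thesis by (simp add: norm_mult norm_ee)
  next
    case False
    have "cmod (fcoeff F ?u n) \<le> B * exp (2 * pi * of_int n * Im ?u)"
      by (rule fcoeff_bound[OF F u(1)]) (use B1 in \<open>force simp: B_def\<close>)
    then have "cmod (fcoeff F z0 n) \<le> B * exp (2 * pi * of_int n * Im ?u)"
      using fcoeff_const[OF F per z u(1)] by simp
    then have "cmod (fcoeff F z0 n) * exp (- 2 * pi * (of_int n * Im z0)) \<le> B * exp (2 * pi * of_int n * Im ?u) * exp (- 2 * pi * (of_int n * Im z0))"
      by (rule mult_right_mono) simp
    also have "\<dots> = B * exp (2 * pi * e * of_int n)" by (simp add: algebra_simps flip: exp_add)
    also have "exp (2 * pi * e * of_int n) = q ^ nat \<bar>n\<bar>" using False by (simp add: q_def mult_ac flip: exp_of_nat_mult)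
    finally show ?thesis by (simp add: norm_mult norm_ee)
  qed
  moreover have "0 < q" "q < 1" using e by (auto simp: q_def)
  ultimately show ?thesis using that by blast
qed

lemma difference_quotient:
  assumes F: "F holomorphic_on S" and per: "\<And>z. z \<in> S \<Longrightarrow> F (z + 1) = F z" and z0: "z0 \<in> S"
  obtains G where "G holomorphic_on S" "\<And>z. z \<in> S \<Longrightarrow> G (z + 1) = G z"
    "\<And>z. z \<in> S \<Longrightarrow> F z - F z0 = (ee (z - z0) - 1) * G z"
proof -
  have shift_int: "z + of_int n \<in> S" if "z \<in> S" for z n using shift_S[OF that, of "of_int n"] by simp
  have per_nat: "F (z + of_nat n) = F z" if "z \<in> S" for z n
  proof (induction n)
    case (Suc n)
    have "F (z + of_nat (Suc n)) = F ((z + of_nat n) + 1)" by (simp add: algebra_simps)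
    then show ?case using per[OF shift_int[OF that, of "int n"]] Suc by simp
  qed simp
  have per_int: "F (z + of_int n) = F z" if "z \<in> S" for z n
  proof (cases "n \<ge> 0")
    case True then show ?thesis using per_nat[OF that, of "nat n"] by simp
  next
    case False then show ?thesis using per_nat[OF shift_int[OF that, of n], of "nat (- n)"] by simp
  qed
  define G where "G = (\<lambda>z. if ee (z - z0) = 1 then deriv F z / (2 * of_real pi * \<i>) else (F z - F z0) / (ee (z - z0) - 1))"
  have eq: "F z - F z0 = (ee (z - z0) - 1) * G z" if "z \<in> S" for z
  proof (cases "ee (z - z0) = 1")
    case True
    then obtain n where "z - z0 = of_int n" using ee_eq_1_iff by blast
    then have "z = z0 + of_int n" by (simp add: algebra_simps)
    then show ?thesis using per_int[OF z0] True by simp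
  qed (simp add: G_def)
  have hol: "G field_differentiable at z1" if z1: "z1 \<in> S" for z1
  proof (cases "ee (z1 - z0) = 1")
    case False
    have "open {z \<in> S. ee (z - z0) \<in> - {1}}"
      by (rule continuous_open_preimage[OF _ open_S, unfolded vimage_def Int_def, simplified]) (auto intro!: continuous_intros)
    then have o: "open {z \<in> S. ee (z - z0) \<noteq> 1}" by simp
    have "(\<lambda>z. (F z - F z0) / (ee (z - z0) - 1)) holomorphic_on {z \<in> S. ee (z - z0) \<noteq> 1}"
      using F by (intro holomorphic_intros holomorphic_on_subset[OF F]) auto
    then have "G holomorphic_on {z \<in> S. ee (z - z0) \<noteq> 1}"
      by (rule holomorphic_transform) (auto simp: G_def)
    then show ?thesis using o False z1 by (auto intro: holomorphic_on_imp_differentiable_at)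
  next
    case True
    obtain n where n: "z1 - z0 = of_int n" using True ee_eq_1_iff by blast
    have Fz1: "F z1 = F z0" using per_int[OF z0, of n] n by (metis add.commute diff_add_cancel)
    define A where "A = (\<lambda>z. if z = z1 then deriv F z1 else (F z - F z1) / (z - z1))"
    define B where "B = (\<lambda>z. if z = z1 then deriv (\<lambda>z. ee (z - z0)) z1 else (ee (z - z0) - ee (z1 - z0)) / (z - z1))"
    have hA: "A holomorphic_on S" unfolding A_def by (rule pole_lemma_open[OF F open_S])
    have hB: "B holomorphic_on UNIV" unfolding B_def by (rule pole_lemma_open) (auto intro!: holomorphic_intros)
    have db: "deriv (\<lambda>z. ee (z - z0)) z1 = 2 * of_real pi * \<i>"
    proof (rule DERIV_imp_deriv)
      have "((\<lambda>z. z - z0) has_field_derivative 1) (at z1)" by (auto intro!: derivative_eq_intros)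
      from DERIV_chain2[OF ee_deriv this] show "((\<lambda>z. ee (z - z0)) has_field_derivative 2 * of_real pi * \<i>) (at z1)"
        using True by simp
    qed
    obtain r where r: "r > 0" "ball z1 r \<subseteq> S" using open_S z1 openE by blast
    define D where "D = ball z1 (min r (1/2))"
    have ne: "ee (z - z0) \<noteq> 1" if "z \<in> D" "z \<noteq> z1" for z
    proof
      assume "ee (z - z0) = 1"
      then obtain k where "z - z0 = of_int k" using ee_eq_1_iff by blast
      then have zz: "z - z1 = of_int (k - n)" using n by (simp add: algebra_simps)
      have "cmod (z - z1) < 1/2" using that by (auto simp: D_def dist_norm norm_minus_commute)
      then have "\<bar>real_of_int (k - n)\<bar> < 1/2" unfolding zz norm_of_int .
      then have "k = n" by linarith
      then show False using zz that by simp
    qed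
    have Bnz: "B z \<noteq> 0" if "z \<in> D" for z
      using ne[OF that] True by (auto simp: B_def db)
    have DS: "D \<subseteq> S" using r by (auto simp: D_def)
    have "(\<lambda>z. A z / B z) holomorphic_on D"
      using Bnz by (intro holomorphic_on_divide holomorphic_on_subset[OF hA DS] holomorphic_on_subset[OF hB]) auto
    then have "G holomorphic_on D"
    proof (rule holomorphic_transform)
      fix z assume z: "z \<in> D"
      show "A z / B z = G z"
        using ne[OF z] True by (cases "z = z1") (auto simp: A_def B_def G_def db Fz1)
    qed
    then show ?thesis using r by (auto simp: D_def intro: holomorphic_on_imp_differentiable_at)
  qed
  have "G holomorphic_on S" using hol by (auto simp: holomorphic_on_def intro: field_differentiable_at_within)
  moreover have "G (z + 1) = G z" if z: "z \<in> S" for z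
  proof -
    have "deriv F (z + 1) = deriv F z"
    proof -
      have "((\<lambda>z. z + 1) has_field_derivative 1) (at z)" by (auto intro!: derivative_eq_intros)
      from DERIV_chain2[OF holomorphic_derivI[OF F open_S shift_S_1[OF z]] this]
      have "((\<lambda>w. F (w + 1)) has_field_derivative deriv F (z + 1)) (at z)" by simp
      then have "(F has_field_derivative deriv F (z + 1)) (at z)"
        by (rule has_field_derivative_transform_within_open[OF _ open_S z]) (use per in auto)
      then show ?thesis by (metis DERIV_imp_deriv)
    qed
    moreover have "ee (z + 1 - z0) = ee (z - z0)" using ee_plus_1[of "z - z0"] by (simp add: algebra_simps)
    ultimately show ?thesis using per[OF z] by (simp add: G_def)
  qed
  ultimately show ?thesis using that eq by blast
qed

lemma fourier_has_sum:
  assumes F: "F holomorphic_on S" and per: "\<And>z. z \<in> S \<Longrightarrow> F (z + 1) = F z" and z0: "z0 \<in> S"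
  shows "((\<lambda>n. fcoeff F z0 n * ee (of_int n * z0)) has_sum F z0) UNIV"
proof -
  obtain G where G: "G holomorphic_on S" "\<And>z. z \<in> S \<Longrightarrow> G (z + 1) = G z"
    "\<And>z. z \<in> S \<Longrightarrow> F z - F z0 = (ee (z - z0) - 1) * G z"
    using difference_quotient[OF F per z0] by blast
  define f where "f = (\<lambda>n. fcoeff F z0 n * ee (of_int n * z0))"
  define b where "b = (\<lambda>n. fcoeff G z0 n * ee (of_int n * z0))"
  have tele: "f n = (if n = 0 then F z0 else 0) + b (n - 1) - b n" for n
  proof -
    have *: "F (z0 + of_real t) * ee (- of_int n * (z0 + of_real t)) =
      F z0 * ee (- of_int n * (z0 + of_real t)) + ee (- z0) * (G (z0 + of_real t) * ee (- of_int (n - 1) * (z0 + of_real t)))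
        - G (z0 + of_real t) * ee (- of_int n * (z0 + of_real t))" for t :: real
    proof -
      have "F (z0 + of_real t) = F z0 + (ee (of_real t) - 1) * G (z0 + of_real t)"
        using G(3)[OF shift_S[OF z0, of t]] by (simp add: algebra_simps)
      moreover have "ee (of_real t) * ee (- of_int n * (z0 + of_real t)) = ee (- z0) * ee (- of_int (n - 1) * (z0 + of_real t))"
        by (simp add: algebra_simps flip: ee_add)
      ultimately show ?thesis by algebra
    qed
    have i1: "(\<lambda>t :: real. F z0 * ee (- of_int n * (z0 + of_real t))) integrable_on {0..1}"
      by (intro integrable_continuous_real continuous_intros)
    have c: "fcoeff (\<lambda>_. F z0) z0 n = (if n = 0 then F z0 else 0)"
      unfolding fcoeff_def using has_integral_mult_right[OF ee_has_integral[of "- n" z0], of "F z0"]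
      by (auto dest: integral_unique)
    have "((\<lambda>t. F (z0 + of_real t) * ee (- of_int n * (z0 + of_real t))) has_integral
       (fcoeff (\<lambda>_. F z0) z0 n + ee (- z0) * fcoeff G z0 (n - 1) - fcoeff G z0 n)) {0..1}"
      unfolding * fcoeff_def
      by (intro has_integral_diff has_integral_add has_integral_mult_right integrable_integral i1 fcoeff_integrable[OF G(1) z0])
    then have "fcoeff F z0 n = fcoeff (\<lambda>_. F z0) z0 n + ee (- z0) * fcoeff G z0 (n - 1) - fcoeff G z0 n"
      unfolding fcoeff_def[of F] by (rule integral_unique)
    moreover have "ee (- z0) * ee (of_int n * z0) = ee (of_int (n - 1) * z0)"
      by (simp add: algebra_simps flip: ee_add)
    ultimately have "f n = fcoeff (\<lambda>_. F z0) z0 n * ee (of_int n * z0) + b (n - 1) - b n"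
      unfolding f_def b_def by (simp only: left_diff_distrib distrib_right) (simp add: mult_ac)
    then show ?thesis unfolding c by auto
  qed
  obtain B q where q: "0 < q" "q < 1" "\<And>n. cmod (f n) \<le> B * q ^ nat \<bar>n\<bar>"
    using fcoeff_decay[OF F per z0] unfolding f_def by blast
  obtain B' q' where q': "0 < q'" "q' < 1" "\<And>n. cmod (b n) \<le> B' * q' ^ nat \<bar>n\<bar>"
    using fcoeff_decay[OF G(1,2) z0] unfolding b_def by blast
  have "(\<lambda>n. norm (f n)) summable_on UNIV"
    by (rule summable_on_comparison_test[of "\<lambda>n. B * q ^ nat \<bar>n\<bar>"])
      (use q geometric_int_summable[OF q(1,2)] in \<open>auto intro: summable_on_cmult_right\<close>)
  then have "f summable_on UNIV" by (rule abs_summable_summable)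
  then have hs: "(f has_sum infsum f UNIV) UNIV" by simp
  have fl: "filterlim (\<lambda>M :: nat. {- int M..int M}) (finite_subsets_at_top UNIV) sequentially"
    unfolding filterlim_finite_subsets_at_top
  proof (intro allI impI)
    fix X :: "int set" assume X: "finite X \<and> X \<subseteq> UNIV"
    define K where "K = Max (insert 0 ((\<lambda>n. nat \<bar>n\<bar>) ` X))"
    have K: "nat \<bar>n\<bar> \<le> K" if "n \<in> X" for n using X that by (auto simp: K_def)
    have "finite {- int M..int M} \<and> X \<subseteq> {- int M..int M} \<and> {- int M..int M} \<subseteq> UNIV" if "M \<ge> K" for M
    proof -
      have "n \<in> {- int M..int M}" if "n \<in> X" for n using K[OF that] \<open>M \<ge> K\<close> by auto
      then show ?thesis by auto
    qed
    then show "\<forall>\<^sub>F M in sequentially. finite {- int M..int M} \<and> X \<subseteq> {- int M..int M} \<and> {- int M..int M} \<subseteq> UNIV"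
      by (auto simp: eventually_sequentially)
  qed
  have l1: "(\<lambda>M. \<Sum>n\<in>{- int M..int M}. f n) \<longlonglongrightarrow> infsum f UNIV"
    using filterlim_compose[OF hs[unfolded has_sum_def] fl] by simp
  have part: "(\<Sum>n\<in>{- int M..int M}. f n) = F z0 + b (- 1 - int M) - b (int M)" for M
  proof (induction M)
    case 0
    then show ?case using tele[of 0] by simp
  next
    case (Suc M)
    have e: "{- int (Suc M)..int (Suc M)} = insert (int (Suc M)) (insert (- int (Suc M)) {- int M..int M})"
      by auto
    have i: "int (Suc M) - 1 = int M" "- 1 - int M = - int (Suc M)" "- int (Suc M) - 1 = - 1 - int (Suc M)"
      by simp_all
    have "(\<Sum>n\<in>{- int (Suc M)..int (Suc M)}. f n) = f (int (Suc M)) + (f (- int (Suc M)) + (\<Sum>n\<in>{- int M..int M}. f n))"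
      unfolding e by (subst sum.insert; simp)+
    then show ?case
      using Suc.IH tele[of "int (Suc M)"] tele[of "- int (Suc M)"] unfolding i by simp
  qed
  have b0: "(\<lambda>M. b (- 1 - int M)) \<longlonglongrightarrow> 0"
  proof (rule Lim_null_comparison)
    show "\<forall>\<^sub>F M in sequentially. norm (b (- 1 - int M)) \<le> B' * q' ^ (M + 1)"
    proof (intro always_eventually allI)
      fix M
      have "nat \<bar>- 1 - int M\<bar> = M + 1" by auto
      then show "norm (b (- 1 - int M)) \<le> B' * q' ^ (M + 1)" using q'(3)[of "- 1 - int M"] by simp
    qed
    show "(\<lambda>M. B' * q' ^ (M + 1)) \<longlonglongrightarrow> 0"
      using q' by (intro tendsto_mult_right_zero LIMSEQ_ignore_initial_segment[OF LIMSEQ_power_zero]) auto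
  qed
  have b1: "(\<lambda>M. b (int M)) \<longlonglongrightarrow> 0"
  proof (rule Lim_null_comparison)
    show "\<forall>\<^sub>F M in sequentially. norm (b (int M)) \<le> B' * q' ^ M"
      using q'(3)[of "int _"] by (intro always_eventually allI) auto
    show "(\<lambda>M. B' * q' ^ M) \<longlonglongrightarrow> 0"
      using q' by (intro tendsto_mult_right_zero LIMSEQ_power_zero) auto
  qed
  have "(\<lambda>M. \<Sum>n\<in>{- int M..int M}. f n) \<longlonglongrightarrow> F z0 + 0 - 0"
    unfolding part by (intro tendsto_intros b0 b1)
  then have "infsum f UNIV = F z0" using LIMSEQ_unique[OF l1] by simp
  then show ?thesis using hs by (simp add: f_def)
qed

end

lemma periodic_strip_upper: "periodic_strip {z. Im z > 0}"
  by standard (auto simp: open_halfspace_Im_gt convex_halfspace_Im_gt)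

lemma periodic_strip_UNIV: "periodic_strip UNIV"
  by standard auto

locale periodic2 =
  fixes g :: "complex \<Rightarrow> complex \<Rightarrow> complex" and B :: "real \<Rightarrow> real \<Rightarrow> real"
  assumes cont: "continuous_on ({t. Im t > 0} \<times> UNIV) (\<lambda>(t, z). g t z)"
    and hol1: "\<And>z. (\<lambda>t. g t z) holomorphic_on {t. Im t > 0}"
    and hol2: "\<And>t. Im t > 0 \<Longrightarrow> g t holomorphic_on UNIV"
    and per1: "\<And>t z. Im t > 0 \<Longrightarrow> g (t + 1) z = g t z"
    and per2: "\<And>t z. Im t > 0 \<Longrightarrow> g t (z + 1) = g t z"
    and bound: "\<And>t z. Im t > 0 \<Longrightarrow> cmod (g t z) \<le> B (Im t) (Im z)"
begin

interpretation H: periodic_strip "{z. Im z > 0}" by (rule periodic_strip_upper)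
interpretation C: periodic_strip UNIV by (rule periodic_strip_UNIV)

definition coeff1 :: "int \<Rightarrow> complex \<Rightarrow> complex" where
  "coeff1 n z = fcoeff (\<lambda>t. g t z) \<i> n"

definition coeff2 :: "int \<Rightarrow> int \<Rightarrow> complex" where
  "coeff2 n r = fcoeff (coeff1 n) 0 r"

lemma coeff1_base: "Im t > 0 \<Longrightarrow> coeff1 n z = fcoeff (\<lambda>t. g t z) t n"
  unfolding coeff1_def using per1 by (intro H.fcoeff_const hol1) auto

lemma coeff1_holomorphic: "coeff1 n holomorphic_on UNIV"
proof -
  have "(\<lambda>z. integral (cbox 0 1) (\<lambda>t. g (\<i> + of_real t) z * ee (- of_int n * (\<i> + of_real t)))) holomorphic_on UNIV"
  proof (rule leibniz_rule_holomorphic)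
    show "((\<lambda>z. g (\<i> + of_real t) z * ee (- of_int n * (\<i> + of_real t))) has_field_derivative
      deriv (g (\<i> + of_real t)) z * ee (- of_int n * (\<i> + of_real t))) (at z within UNIV)" for z and t :: real
      using hol2[of "\<i> + of_real t"] by (intro DERIV_cmult_right) (auto intro!: holomorphic_derivI[of _ UNIV])
    show "(\<lambda>t. g (\<i> + of_real t) z * ee (- of_int n * (\<i> + of_real t))) integrable_on cbox 0 1" for z
      using H.fcoeff_integrable[OF hol1, of \<i> z n] by simp
    have c: "continuous_on ({t. Im t > 0} \<times> UNIV) (\<lambda>(t, z). deriv (g t) z)"
      by (rule continuous_on_deriv_snd[OF open_halfspace_Im_gt open_UNIV cont]) (use hol2 in auto)
    have "continuous_on (UNIV \<times> cbox 0 1) (\<lambda>p. (case (\<i> + of_real (snd p), fst p) of (t, z) \<Rightarrow> deriv (g t) z) * ee (- of_int n * (\<i> + of_real (snd p))))"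
      by (intro continuous_intros continuous_on_compose2[OF c]) auto
    then show "continuous_on (UNIV \<times> cbox 0 1) (\<lambda>(z, t :: real). deriv (g (\<i> + of_real t)) z * ee (- of_int n * (\<i> + of_real t)))"
      by (simp add: case_prod_beta')
  qed simp
  then show ?thesis by (rule holomorphic_transform) (simp add: coeff1_def fcoeff_def)
qed

lemma coeff1_periodic: "coeff1 n (z + 1) = coeff1 n z"
  unfolding coeff1_def fcoeff_def using per2 by simp

lemma coeff1_bound: "v > 0 \<Longrightarrow> cmod (coeff1 n z) \<le> B v (Im z) * exp (2 * pi * of_int n * v)"
proof -
  assume v: "v > 0"
  let ?t = "\<i> * of_real v"
  have "cmod (fcoeff (\<lambda>t. g t z) ?t n) \<le> B v (Im z) * exp (2 * pi * of_int n * Im ?t)"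
  proof (rule H.fcoeff_bound[OF hol1])
    fix t :: real
    show "cmod (g (?t + of_real t) z) \<le> B v (Im z)" using bound[of "?t + of_real t" z] v by simp
  qed (use v in simp)
  then show ?thesis using coeff1_base[of ?t n z] v by simp
qed

lemma coeff2_bound: "v > 0 \<Longrightarrow> cmod (coeff2 n r) \<le> B v y * exp (2 * pi * (of_int n * v + of_int r * y))"
proof -
  assume v: "v > 0"
  let ?z = "\<i> * of_real y"
  have "coeff2 n r = fcoeff (coeff1 n) ?z r" unfolding coeff2_def
    using coeff1_periodic by (intro C.fcoeff_const coeff1_holomorphic) auto
  moreover have "cmod (fcoeff (coeff1 n) ?z r) \<le> B v y * exp (2 * pi * of_int n * v) * exp (2 * pi * of_int r * Im ?z)"
  proof (rule C.fcoeff_bound[OF coeff1_holomorphic])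
    fix t :: real
    show "cmod (coeff1 n (?z + of_real t)) \<le> B v y * exp (2 * pi * of_int n * v)"
      using coeff1_bound[OF v, of n "?z + of_real t"] by simp
  qed simp
  ultimately show ?thesis by (simp add: distrib_left exp_add mult.assoc)
qed

lemma coeff2_summable:
  assumes t: "Im t > 0"
  shows "(\<lambda>(n, r). coeff2 n r * ee (of_int n * t + of_int r * z)) summable_on UNIV"
proof -
  define d where "d = Im t / 2"
  have d: "d > 0" using t by (simp add: d_def)
  define q where "q = exp (- 2 * pi * d)"
  have q: "0 < q" "q < 1" using d by (auto simp: q_def)
  define M where "M = Max ((\<lambda>(v, y). \<bar>B v y\<bar>) ` ({Im t - d, Im t + d} \<times> {Im z - d, Im z + d}))"
  have M: "B v y \<le> M" if "v \<in> {Im t - d, Im t + d}" "y \<in> {Im z - d, Im z + d}" for v y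
  proof -
    have "\<bar>B v y\<bar> \<le> M" unfolding M_def using that by (intro Max_ge) auto
    then show ?thesis by simp
  qed
  have le: "cmod (coeff2 n r * ee (of_int n * t + of_int r * z)) \<le> M * (q ^ nat \<bar>n\<bar> * q ^ nat \<bar>r\<bar>)" for n r
  proof -
    define v where "v = (if n \<ge> 0 then Im t - d else Im t + d)"
    define y where "y = (if r \<ge> 0 then Im z - d else Im z + d)"
    have v: "v > 0" using t d by (auto simp: v_def d_def)
    have "cmod (coeff2 n r) \<le> M * exp (2 * pi * (of_int n * v + of_int r * y))"
      using coeff2_bound[OF v, of n r y] M[of v y]
      by (auto simp: v_def y_def intro: order_trans mult_right_mono)
    then have "cmod (coeff2 n r) * exp (- 2 * pi * (of_int n * Im t + of_int r * Im z))
      \<le> M * exp (2 * pi * (of_int n * v + of_int r * y)) * exp (- 2 * pi * (of_int n * Im t + of_int r * Im z))"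
      by (rule mult_right_mono) simp
    also have "\<dots> = M * (exp (2 * pi * (of_int n * (v - Im t))) * exp (2 * pi * (of_int r * (y - Im z))))"
      by (simp add: algebra_simps flip: exp_add)
    also have "exp (2 * pi * (of_int n * (v - Im t))) = q ^ nat \<bar>n\<bar>"
      by (auto simp: q_def v_def mult_ac simp flip: exp_of_nat_mult)
    also have "exp (2 * pi * (of_int r * (y - Im z))) = q ^ nat \<bar>r\<bar>"
      by (auto simp: q_def y_def mult_ac simp flip: exp_of_nat_mult)
    finally show ?thesis by (simp add: norm_mult norm_ee)
  qed
  define s where "s = (\<Sum>\<^sub>\<infinity>r :: int. q ^ nat \<bar>r\<bar>)"
  have g: "((\<lambda>r :: int. q ^ nat \<bar>r\<bar>) has_sum s) UNIV" unfolding s_def using geometric_int_summable[OF q] by simp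
  have "(\<lambda>(n, r). q ^ nat \<bar>n :: int\<bar> * q ^ nat \<bar>r :: int\<bar>) summable_on (UNIV \<times> UNIV)"
  proof (rule summable_on_SigmaI)
    show "((\<lambda>r. case (n, r) of (n, r) \<Rightarrow> q ^ nat \<bar>n :: int\<bar> * q ^ nat \<bar>r :: int\<bar>) has_sum (q ^ nat \<bar>n\<bar> * s)) UNIV" for n
      using has_sum_cmult_right[OF g] by simp
    show "(\<lambda>n :: int. q ^ nat \<bar>n\<bar> * s) summable_on UNIV" by (intro summable_on_cmult_left geometric_int_summable q)
  qed (use q in auto)
  then have "(\<lambda>p. M * (case p of (n, r) \<Rightarrow> q ^ nat \<bar>n :: int\<bar> * q ^ nat \<bar>r :: int\<bar>)) summable_on UNIV"
    by (intro summable_on_cmult_right) simp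
  then have "(\<lambda>p. norm (case p of (n, r) \<Rightarrow> coeff2 n r * ee (of_int n * t + of_int r * z))) summable_on UNIV"
    by (rule summable_on_comparison_test) (use le in auto)
  then show ?thesis by (rule abs_summable_summable)
qed

lemma coeff2_has_sum:
  assumes t: "Im t > 0"
  shows "((\<lambda>(n, r). coeff2 n r * ee (of_int n * t + of_int r * z)) has_sum g t z) UNIV"
proof -
  have r: "((\<lambda>r. coeff2 n r * ee (of_int n * t + of_int r * z)) has_sum coeff1 n z * ee (of_int n * t)) UNIV" for n
  proof -
    have "((\<lambda>r. fcoeff (coeff1 n) z r * ee (of_int r * z)) has_sum coeff1 n z) UNIV"
      using coeff1_periodic by (intro C.fourier_has_sum coeff1_holomorphic) auto
    moreover have "fcoeff (coeff1 n) z r = coeff2 n r" for r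
      unfolding coeff2_def using coeff1_periodic by (intro C.fcoeff_const coeff1_holomorphic) auto
    ultimately have "((\<lambda>r. coeff2 n r * ee (of_int r * z)) has_sum coeff1 n z) UNIV" by simp
    from has_sum_cmult_left[OF this, of "ee (of_int n * t)"] show ?thesis
      by (simp add: ee_add mult_ac)
  qed
  have n: "((\<lambda>n. coeff1 n z * ee (of_int n * t)) has_sum g t z) UNIV"
  proof -
    have "((\<lambda>n. fcoeff (\<lambda>t. g t z) t n * ee (of_int n * t)) has_sum g t z) UNIV"
      using per1 t by (intro H.fourier_has_sum[of "\<lambda>t. g t z"] hol1) auto
    then show ?thesis using coeff1_base[OF t] by simp
  qed
  have "((\<lambda>(n, r). coeff2 n r * ee (of_int n * t + of_int r * z)) has_sum g t z) (UNIV \<times> UNIV)"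
    using r n coeff2_summable[OF t, of z] by (intro has_sum_SigmaI[where g = "\<lambda>n. coeff1 n z * ee (of_int n * t)"]) auto
  then show ?thesis by simp
qed

end

lemma cusp_expansion:
  fixes f :: "complex \<times> complex \<Rightarrow> complex"
  assumes f: "holomorphic2_on f jacobi_domain" and N: "N > 0" and k: "k > 0"
    and p1: "\<And>\<tau> z. Im \<tau> > 0 \<Longrightarrow> f (\<tau> + of_nat N, z) = f (\<tau>, z)"
    and p2: "\<And>\<tau> z. Im \<tau> > 0 \<Longrightarrow> f (\<tau>, z + 1) = f (\<tau>, z)"
    and K: "\<And>p. p \<in> jacobi_domain \<Longrightarrow> jacobi_tilde k 1 f p \<le> K"
  shows "\<exists>a :: int \<Rightarrow> int \<Rightarrow> complex.
        (\<forall>n r. a n r \<noteq> 0 \<longrightarrow> real_of_int (r ^ 2) < 4 * (real_of_int n / real N)) \<and>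
        (\<forall>\<tau> z. Im \<tau> > 0 \<longrightarrow>
           ((\<lambda>(n, r). a n r * ee (of_int n / of_nat N * \<tau> + of_int r * z)) has_sum f (\<tau>, z)) UNIV)"
proof -
  define g where "g = (\<lambda>t z. f (of_nat N * t, z))"
  define B where "B = (\<lambda>v y. K * ((real N * v) powr (- real k / 2) * exp (2 * pi * y\<^sup>2 / (real N * v))))"
  have X: "open jacobi_domain" by (rule open_jacobi_domain)
  have bnd: "cmod (g t z) \<le> B (Im t) (Im z)" if t: "Im t > 0" for t z
  proof -
    let ?v = "real N * Im t"
    have v: "?v > 0" using N t by simp
    have e: "Im (of_nat N * t) = ?v" by simp
    have "?v powr (real k / 2) * exp (- 2 * pi * (Im z)\<^sup>2 / ?v) * cmod (g t z) \<le> K"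
      using K[of "(of_nat N * t, z)"] v unfolding jacobi_tilde_def g_def by simp
    moreover have "?v powr (- real k / 2) * ?v powr (real k / 2) = 1" using v t N by (simp flip: powr_add)
    moreover have "exp (2 * pi * (Im z)\<^sup>2 / ?v) * exp (- 2 * pi * (Im z)\<^sup>2 / ?v) = 1" by (simp flip: exp_add)
    moreover have "G \<le> K * (a * b)" if "c * d * G \<le> K" "a * c = 1" "b * d = 1" "a \<ge> 0" "b \<ge> 0" for a b c d G :: real
    proof -
      have "G = (a * c) * (b * d) * G" using that by simp
      also have "\<dots> = (a * b) * (c * d * G)" by (simp only: mult_ac)
      also have "\<dots> \<le> (a * b) * K" using that by (intro mult_left_mono) auto
      finally show ?thesis by (simp only: mult_ac)
    qed
    ultimately show ?thesis unfolding B_def by (meson exp_ge_zero powr_ge_zero)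
  qed
  interpret P: periodic2 g B
  proof
    have "continuous_on ({t. Im t > 0} \<times> UNIV) (\<lambda>p. f (of_nat N * fst p, snd p))"
      by (rule continuous_on_compose2[OF holomorphic2_imp_continuous_on[OF f]])
        (use N in \<open>auto intro!: continuous_intros\<close>)
    then show "continuous_on ({t. Im t > 0} \<times> UNIV) (\<lambda>(t, z). g t z)" by (simp add: g_def case_prod_beta')
    show "(\<lambda>t. g t z) holomorphic_on {t. Im t > 0}" for z
    proof -
      have "(\<lambda>s. f (s, z)) holomorphic_on {t. Im t > 0}"
        using holomorphic2_slices(1)[OF f X] by (auto simp: holomorphic_on_def intro: field_differentiable_at_within)
      from holomorphic_on_compose_gen[OF _ this, of "\<lambda>t. of_nat N * t" "{t. Im t > 0}"]
      have "(\<lambda>t. f (of_nat N * t, z)) holomorphic_on {t. Im t > 0}"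
        using N by (auto simp: o_def image_subset_iff intro!: holomorphic_intros)
      then show ?thesis by (simp add: g_def)
    qed
    show "g t holomorphic_on UNIV" if "Im t > 0" for t
      using holomorphic2_slices(2)[OF f X, of "of_nat N * t"] that N
      by (auto simp: holomorphic_on_def g_def[abs_def] intro: field_differentiable_at_within)
    show "g (t + 1) z = g t z" if "Im t > 0" for t z
      using p1[of "of_nat N * t" z] that N by (simp add: g_def distrib_left)
    show "g t (z + 1) = g t z" if "Im t > 0" for t z
      using p2[of "of_nat N * t" z] that N by (simp add: g_def)
    show "cmod (g t z) \<le> B (Im t) (Im z)" if "Im t > 0" for t z by (rule bnd[OF that])
  qed
  have van: "P.coeff2 n r = 0" if le: "4 * (real_of_int n / real N) \<le> real_of_int (r\<^sup>2)" for n r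
  proof -
    have b: "cmod (P.coeff2 n r) \<le> \<bar>K\<bar> * (real N * v) powr (- real k / 2)" if v: "v > 0" for v
    proof -
      define y where "y = - real_of_int r * real N * v / 2"
      have "B v y * exp (2 * pi * (of_int n * v + of_int r * y)) = K * (real N * v) powr (- real k / 2) * exp (2 * pi * (y\<^sup>2 / (real N * v) + of_int n * v + of_int r * y))"
        by (simp add: B_def distrib_left exp_add mult.assoc)
      also have "y\<^sup>2 / (real N * v) + of_int n * v + of_int r * y = (4 * (real_of_int n / real N) - of_int (r\<^sup>2)) * (real N * v / 4)"
        using v N by (simp add: y_def field_simps power2_eq_square)
      finally have e: "B v y * exp (2 * pi * (of_int n * v + of_int r * y)) = K * (real N * v) powr (- real k / 2) * exp (2 * pi * ((4 * (real_of_int n / real N) - of_int (r\<^sup>2)) * (real N * v / 4)))" .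
      define X where "X = (4 * (real_of_int n / real N) - of_int (r\<^sup>2)) * (real N * v / 4)"
      have "X \<le> 0" unfolding X_def using le v N by (intro mult_nonpos_nonneg) auto
      then have "exp (2 * pi * X) \<le> 1" by (simp add: mult_nonneg_nonpos)
      then have "\<bar>K\<bar> * (real N * v) powr (- real k / 2) * exp (2 * pi * X) \<le> \<bar>K\<bar> * (real N * v) powr (- real k / 2) * 1"
        by (intro mult_left_mono) auto
      moreover have "K * (real N * v) powr (- real k / 2) * exp (2 * pi * X) \<le> \<bar>K\<bar> * (real N * v) powr (- real k / 2) * exp (2 * pi * X)"
        by (intro mult_right_mono) auto
      ultimately show ?thesis using P.coeff2_bound[OF v, of n r y] e[folded X_def] by linarith
    qed
    have "((\<lambda>v. \<bar>K\<bar> * (real N * v) powr (- real k / 2)) \<longlongrightarrow> 0) at_top"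
    proof -
      have "filterlim (\<lambda>v :: real. real N * v) at_top at_top"
        using N by (intro filterlim_tendsto_pos_mult_at_top[OF tendsto_const]) (auto simp: filterlim_ident)
      then have "((\<lambda>v. (real N * v) powr (- real k / 2)) \<longlongrightarrow> 0) at_top"
        using k by (intro tendsto_neg_powr) auto
      then show ?thesis by (intro tendsto_mult_right_zero)
    qed
    then have "cmod (P.coeff2 n r) \<le> 0"
      by (rule tendsto_lowerbound) (use b in \<open>auto simp: eventually_at_top_dense intro!: exI[of _ 0]\<close>)
    then show ?thesis by simp
  qed
  show ?thesis
  proof (intro exI[of _ P.coeff2] conjI allI impI)
    show "real_of_int (r\<^sup>2) < 4 * (real_of_int n / real N)" if "P.coeff2 n r \<noteq> 0" for n r
      using van[of n r] that by (cases "4 * (real_of_int n / real N) \<le> real_of_int (r\<^sup>2)") auto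
    show "((\<lambda>(n, r). P.coeff2 n r * ee (of_int n / of_nat N * \<tau> + of_int r * z)) has_sum f (\<tau>, z)) UNIV" if t: "Im \<tau> > 0" for \<tau> z
    proof -
      have "Im (\<tau> / of_nat N) > 0" using t N by (simp add: Im_divide_of_nat)
      from P.coeff2_has_sum[OF this, of z] show ?thesis using N by (simp add: g_def)
    qed
  qed
qed

section \<open>Parseval and theta bounds\<close>

lemma parseval1:
  fixes b :: "int \<Rightarrow> complex"
  assumes b: "(\<lambda>r. norm (b r)) summable_on UNIV"
    and g: "\<And>x :: real. ((\<lambda>r. b r * ee (of_int r * of_real x)) has_sum g x) UNIV"
  shows "((\<lambda>x. (cmod (g x))\<^sup>2) has_integral (\<Sum>\<^sub>\<infinity>r. (cmod (b r))\<^sup>2)) {0..1}"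
    and "(\<lambda>r. (cmod (b r))\<^sup>2) summable_on UNIV"
proof -
  define S where "S = (\<lambda>X (x :: real). \<Sum>r\<in>X. b r * ee (of_int r * of_real x))"
  have u: "uniform_limit {0..1} S g (finite_subsets_at_top UNIV)"
    unfolding S_def by (rule Weierstrass_m_test_general'[OF _ g b]) (simp add: norm_mult norm_ee)
  have cS: "continuous_on A (S X)" for A X
    unfolding S_def by (intro continuous_intros)
  have cg: "continuous_on {0..1} g"
    by (rule uniform_limit_theorem[OF _ u]) (auto intro: cS)
  have bg: "bounded (g ` {0..1})" by (intro compact_imp_bounded compact_continuous_image cg) simp
  have u': "uniform_limit {0..1} (\<lambda>X x. cnj (S X x)) (\<lambda>x. cnj (g x)) (finite_subsets_at_top UNIV)"
    by (rule bounded_linear.uniform_limit[OF bounded_linear_cnj u])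
  have bg': "bounded ((\<lambda>x. cnj (g x)) ` {0..1})"
    by (intro compact_imp_bounded compact_continuous_image continuous_on_cnj cg) simp
  have up: "uniform_limit {0..1} (\<lambda>X x. S X x * cnj (S X x)) (\<lambda>x. g x * cnj (g x)) (finite_subsets_at_top UNIV)"
    by (rule uniform_lim_mult[OF u u' bg bg'])
  obtain I J where I: "\<And>X. ((\<lambda>x. S X x * cnj (S X x)) has_integral I X) {0..1}"
    and J: "((\<lambda>x. g x * cnj (g x)) has_integral J) {0..1}" and lim: "(I \<longlongrightarrow> J) (finite_subsets_at_top UNIV)"
    by (rule uniform_limit_integral[OF up]) (auto intro!: continuous_on_mult continuous_on_cnj cS)
  have fin: "((\<lambda>x. S X x * cnj (S X x)) has_integral of_real (\<Sum>r\<in>X. (cmod (b r))\<^sup>2)) {0..1}" if X: "finite X" for X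
  proof -
    have eq: "S X x * cnj (S X x) = (\<Sum>r\<in>X. \<Sum>s\<in>X. (b r * cnj (b s)) * ee (of_int (r - s) * (0 + of_real x)))" for x
    proof -
      have c: "cnj (ee w) = ee (- cnj w)" for w by (simp add: ee_def exp_cnj)
      have e: "ee (of_int r * of_real x) * ee (- (of_int s * of_real x)) = ee (of_int (r - s) * (0 + of_real x))" for r s
        by (simp add: algebra_simps flip: ee_add)
      have "S X x * cnj (S X x) = (\<Sum>r\<in>X. \<Sum>s\<in>X. (b r * ee (of_int r * of_real x)) * (cnj (b s) * ee (- (of_int s * of_real x))))"
        by (simp add: S_def sum_product c)
      also have "\<dots> = (\<Sum>r\<in>X. \<Sum>s\<in>X. (b r * cnj (b s)) * ee (of_int (r - s) * (0 + of_real x)))"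
        unfolding e[symmetric] by (intro sum.cong refl) (simp only: mult_ac)
      finally show ?thesis .
    qed
    have "((\<lambda>x. S X x * cnj (S X x)) has_integral (\<Sum>r\<in>X. \<Sum>s\<in>X. (b r * cnj (b s)) * (if r - s = 0 then 1 else 0))) {0..1}"
      unfolding eq by (intro has_integral_sum has_integral_mult_right ee_has_integral X)
    also have "(\<Sum>r\<in>X. \<Sum>s\<in>X. (b r * cnj (b s)) * (if r - s = 0 then 1 else 0)) = (\<Sum>r\<in>X. b r * cnj (b r))"
      using X by (intro sum.cong refl) (simp add: if_distrib sum.delta cong: if_cong)
    also have "\<dots> = of_real (\<Sum>r\<in>X. (cmod (b r))\<^sup>2)" by (simp only: complex_norm_square of_real_sum)
    finally show ?thesis .
  qed
  have "((\<lambda>X. complex_of_real (\<Sum>r\<in>X. (cmod (b r))\<^sup>2)) \<longlongrightarrow> J) (finite_subsets_at_top UNIV)"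
  proof (rule Lim_transform_eventually[OF lim])
    show "\<forall>\<^sub>F X in finite_subsets_at_top UNIV. I X = complex_of_real (\<Sum>r\<in>X. (cmod (b r))\<^sup>2)"
      using has_integral_unique[OF I fin] by (intro eventually_finite_subsets_at_top_weakI) auto
  qed
  from tendsto_Re[OF this] have hs: "((\<lambda>r. (cmod (b r))\<^sup>2) has_sum Re J) UNIV"
    by (simp add: has_sum_def)
  then show "(\<lambda>r. (cmod (b r))\<^sup>2) summable_on UNIV" by (rule has_sum_imp_summable)
  have "((\<lambda>x. Re (g x * cnj (g x))) has_integral Re J) {0..1}"
    using has_integral_linear[OF J bounded_linear_Re] by (simp add: o_def)
  then show "((\<lambda>x. (cmod (g x))\<^sup>2) has_integral (\<Sum>\<^sub>\<infinity>r. (cmod (b r))\<^sup>2)) {0..1}"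
    using hs by (simp only: infsumI cmod_power2) (simp add: power2_eq_square)
qed

lemma bessel1:
  fixes b :: "int \<Rightarrow> complex"
  assumes b: "(\<lambda>r. norm (b r)) summable_on UNIV"
    and g: "\<And>x :: real. ((\<lambda>r. b r * ee (of_int r * of_real x)) has_sum g x) UNIV"
    and T: "finite T"
  shows "ennreal (\<Sum>r\<in>T. (cmod (b r))\<^sup>2) \<le> (\<integral>\<^sup>+x. ennreal ((cmod (g x))\<^sup>2) * indicator {0..<1} x \<partial>lborel)"
proof -
  have "(\<Sum>r\<in>T. (cmod (b r))\<^sup>2) \<le> (\<Sum>\<^sub>\<infinity>r. (cmod (b r))\<^sup>2)"
    using parseval1(2)[OF b g] T by (intro finite_sum_le_infsum) auto
  then have "ennreal (\<Sum>r\<in>T. (cmod (b r))\<^sup>2) \<le> ennreal (\<Sum>\<^sub>\<infinity>r. (cmod (b r))\<^sup>2)" by (rule ennreal_leI)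
  also have "\<dots> = (\<integral>\<^sup>+x. ennreal ((cmod (g x))\<^sup>2) * indicator {0..1} x \<partial>lborel)"
    using nn_integral_has_integral_lebesgue'[OF _ parseval1(1)[OF b g]] by simp
  also have "\<dots> = (\<integral>\<^sup>+x. ennreal ((cmod (g x))\<^sup>2) * indicator {0..<1} x \<partial>lborel)"
  proof (rule nn_integral_cong_AE)
    show "AE x in lborel. ennreal ((cmod (g x))\<^sup>2) * indicator {0..1} x = ennreal ((cmod (g x))\<^sup>2) * indicator {0..<1} x"
      using AE_lborel_singleton[of "1 :: real"] by (rule eventually_mono) (auto simp: indicator_def)
  qed
  finally show ?thesis .
qed

lemma bessel2:
  fixes a :: "int \<Rightarrow> int \<Rightarrow> complex"
  assumes a: "(\<lambda>(n, r). norm (a n r)) summable_on UNIV"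
    and g: "\<And>s x :: real. ((\<lambda>(n, r). a n r * ee (of_int n * of_real s + of_int r * of_real x)) has_sum g s x) UNIV"
    and T: "finite T"
  shows "ennreal (\<Sum>(n, r)\<in>T. (cmod (a n r))\<^sup>2) \<le>
     (\<integral>\<^sup>+s. (\<integral>\<^sup>+x. ennreal ((cmod (g s x))\<^sup>2) * indicator {0..<1} x \<partial>lborel) * indicator {0..<1} s \<partial>lborel)"
proof -
  have a': "(\<lambda>(r, n). norm (a n r)) summable_on (UNIV \<times> UNIV)"
    using a summable_on_swap[of "\<lambda>(n, r). norm (a n r)" UNIV UNIV] by (simp add: case_prod_beta')
  have sn: "(\<lambda>n. norm (a n r)) summable_on UNIV" for r
    using summable_on_SigmaD1[OF a', of r] by simp
  define c where "c = (\<lambda>r (s :: real). \<Sum>\<^sub>\<infinity>n. a n r * ee (of_int n * of_real s))"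
  have ns: "norm (a n r * ee (of_int n * of_real s)) = norm (a n r)" for n r and s :: real
    by (simp add: norm_mult norm_ee)
  have c: "((\<lambda>n. a n r * ee (of_int n * of_real s)) has_sum c r s) UNIV" for r s
  proof -
    have "(\<lambda>n. norm (a n r * ee (of_int n * of_real s))) summable_on UNIV" unfolding ns by (rule sn)
    then have "(\<lambda>n. a n r * ee (of_int n * of_real s)) summable_on UNIV" by (rule Infinite_Sum.abs_summable_summable)
    then show ?thesis unfolding c_def by (rule has_sum_infsum)
  qed
  have cb: "norm (c r s) \<le> (\<Sum>\<^sub>\<infinity>n. norm (a n r))" for r s
  proof -
    have "(\<lambda>n. norm (a n r * ee (of_int n * of_real s))) summable_on UNIV" unfolding ns by (rule sn)
    from norm_infsum_bound[OF this] show ?thesis unfolding c_def ns .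
  qed
  have sc: "(\<lambda>r. norm (c r s)) summable_on UNIV" for s
  proof (rule summable_on_comparison_test)
    show "(\<lambda>r. \<Sum>\<^sub>\<infinity>n. norm (a n r)) summable_on UNIV"
      using summable_on_Sigma_banach[OF a'] by simp
  qed (use cb in auto)
  have gx: "((\<lambda>r. c r s * ee (of_int r * of_real x)) has_sum g s x) UNIV" for s x
  proof -
    have "((\<lambda>(r, n). a n r * ee (of_int n * of_real s + of_int r * of_real x)) has_sum g s x) (UNIV \<times> UNIV)"
      using g[of s x] by (subst has_sum_swap) (simp add: case_prod_beta')
    moreover have "((\<lambda>n. case (r, n) of (r, n) \<Rightarrow> a n r * ee (of_int n * of_real s + of_int r * of_real x)) has_sum c r s * ee (of_int r * of_real x)) UNIV" for r
      using has_sum_cmult_left[OF c[of r s], where c = "ee (of_int r * of_real x)"] by (simp add: ee_add mult.assoc)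
    ultimately show ?thesis by (rule has_sum_SigmaD)
  qed
  define T1 where "T1 = fst ` T"
  define T2 where "T2 = snd ` T"
  have T12: "finite T1" "finite T2" "T \<subseteq> T1 \<times> T2" using T subset_fst_snd[of T] by (simp_all add: T1_def T2_def)
  have meas: "(\<lambda>s. ennreal ((cmod (c r s))\<^sup>2) * indicator {0..<1} s) \<in> borel_measurable lborel" for r
  proof -
    have "uniform_limit UNIV (\<lambda>X s. \<Sum>n\<in>X. a n r * ee (of_int n * of_real s)) (c r) (finite_subsets_at_top UNIV)"
      by (rule Weierstrass_m_test_general'[OF _ c sn[of r]]) (simp add: ns)
    then have "continuous_on UNIV (c r)"
      by (rule uniform_limit_theorem[rotated]) (auto intro!: always_eventually continuous_intros)
    then have [measurable]: "c r \<in> borel_measurable borel" by (rule borel_measurable_continuous_onI)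
    show ?thesis by measurable
  qed
  have "ennreal (\<Sum>(n, r)\<in>T. (cmod (a n r))\<^sup>2) \<le> ennreal (\<Sum>(n, r)\<in>T1 \<times> T2. (cmod (a n r))\<^sup>2)"
    using T12 by (intro ennreal_leI sum_mono2) auto
  also have "(\<Sum>(n, r)\<in>T1 \<times> T2. (cmod (a n r))\<^sup>2) = (\<Sum>r\<in>T2. \<Sum>n\<in>T1. (cmod (a n r))\<^sup>2)"
    by (subst sum.swap) (simp add: sum.cartesian_product)
  also have "ennreal \<dots> = (\<Sum>r\<in>T2. ennreal (\<Sum>n\<in>T1. (cmod (a n r))\<^sup>2))"
    by (intro sum_ennreal[symmetric] sum_nonneg) auto
  also have "\<dots> \<le> (\<Sum>r\<in>T2. \<integral>\<^sup>+s. ennreal ((cmod (c r s))\<^sup>2) * indicator {0..<1} s \<partial>lborel)"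
    by (intro sum_mono bessel1[OF sn c T12(1)])
  also have "\<dots> = (\<integral>\<^sup>+s. (\<Sum>r\<in>T2. ennreal ((cmod (c r s))\<^sup>2) * indicator {0..<1} s) \<partial>lborel)"
    by (rule nn_integral_sum[symmetric]) (rule meas)
  also have "\<dots> \<le> (\<integral>\<^sup>+s. (\<integral>\<^sup>+x. ennreal ((cmod (g s x))\<^sup>2) * indicator {0..<1} x \<partial>lborel) * indicator {0..<1} s \<partial>lborel)"
  proof (rule nn_integral_mono)
    fix s
    have "(\<Sum>r\<in>T2. ennreal ((cmod (c r s))\<^sup>2)) = ennreal (\<Sum>r\<in>T2. (cmod (c r s))\<^sup>2)"
      by (intro sum_ennreal) auto
    also have "\<dots> \<le> (\<integral>\<^sup>+x. ennreal ((cmod (g s x))\<^sup>2) * indicator {0..<1} x \<partial>lborel)"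
      by (rule bessel1[OF sc gx T12(2)])
    finally show "(\<Sum>r\<in>T2. ennreal ((cmod (c r s))\<^sup>2) * indicator {0..<1} s) \<le> (\<integral>\<^sup>+x. ennreal ((cmod (g s x))\<^sup>2) * indicator {0..<1} x \<partial>lborel) * indicator {0..<1} s"
      by (auto simp: indicator_def)
  qed
  finally show ?thesis .
qed

section \<open>Pointwise bounds from the Fourier expansion at a cusp\<close>

lemma power_le_fact_exp: "x ^ n \<le> fact n * exp x" if "x \<ge> 0" for x :: real
proof -
  have "(\<Sum>i\<in>{n}. x ^ i /\<^sub>R fact i) \<le> (\<Sum>i. x ^ i /\<^sub>R fact i)"
    using that exp_converges[of x] by (intro sum_le_suminf) (auto simp: sums_iff)
  also have "\<dots> = exp x" using exp_converges[of x] by (simp add: sums_iff)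
  finally show ?thesis by (simp add: field_simps)
qed

definition theta_const :: real where
  "theta_const = 2 * (\<Sum>\<^sub>\<infinity>l :: int. (1/2) ^ nat \<bar>l\<bar>)"

lemma theta_const_pos: "theta_const > 0"
proof -
  have "(\<Sum>l\<in>{0 :: int}. (1/2 :: real) ^ nat \<bar>l\<bar>) \<le> (\<Sum>\<^sub>\<infinity>l :: int. (1/2) ^ nat \<bar>l\<bar>)"
    by (intro finite_sum_le_infsum geometric_int_summable) auto
  then show ?thesis by (simp add: theta_const_def)
qed

lemma theta_bound_large:
  assumes v: "v \<ge> 1/2" and L: "finite L"
  shows "(\<Sum>l\<in>L. exp (- 2 * pi * v * (x + real_of_int l)\<^sup>2)) \<le> theta_const"
proof -
  define s where "s = (\<lambda>l :: int. l + \<lfloor>x\<rfloor>)"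
  have "exp (- 2 * pi * v * (x + real_of_int l)\<^sup>2) \<le> 2 * (1/2) ^ nat \<bar>s l\<bar>" for l
  proof -
    define t where "t = x - of_int \<lfloor>x\<rfloor>"
    have t: "0 \<le> t" "t < 1" unfolding t_def by linarith+
    have x: "x + real_of_int l = t + of_int (s l)" by (simp add: t_def s_def)
    have ge: "(x + real_of_int l)\<^sup>2 \<ge> real (nat \<bar>s l\<bar>) - 1"
    proof (cases "s l \<ge> 0")
      case True
      have "real_of_int (s l) \<le> (real_of_int (s l))\<^sup>2" 
        using True by (cases "s l = 0") (auto simp: power2_eq_square)
      also have "\<dots> \<le> (x + real_of_int l)\<^sup>2" unfolding x using t True by (intro power_mono) auto
      finally show ?thesis using True by simp
    next
      case False
      define m where "m = - s l"
      have m: "m \<ge> 1" using False by (simp add: m_def)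
      have "real_of_int (m - 1) \<le> (real_of_int (m - 1))\<^sup>2"
        using m by (cases "m = 1") (auto simp: power2_eq_square)
      also have "\<dots> \<le> (real_of_int m - t)\<^sup>2" using t m by (intro power_mono) auto
      also have "\<dots> = (x + real_of_int l)\<^sup>2" unfolding x by (simp add: m_def power2_eq_square algebra_simps)
      finally show ?thesis using m by (simp add: m_def)
    qed
    have "2 * pi * v \<ge> 1" using mult_mono[of 2 "2 * pi" "1/2" v] v pi_ge_two by simp
    then have "(x + real_of_int l)\<^sup>2 \<le> 2 * pi * v * (x + real_of_int l)\<^sup>2"
      using mult_right_mono[of 1 "2 * pi * v" "(x + real_of_int l)\<^sup>2"] by simp
    then have le: "exp (- 2 * pi * v * (x + real_of_int l)\<^sup>2) \<le> exp (- (real (nat \<bar>s l\<bar>) - 1))"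
      using ge by simp
    show ?thesis
    proof (cases "nat \<bar>s l\<bar>")
      case 0
      have "exp (- 2 * pi * v * (x + real_of_int l)\<^sup>2) \<le> 1" using v by simp
      then show ?thesis unfolding 0 power_0 by linarith
    next
      case (Suc n)
      have "exp (- 1 :: real) \<le> 1/2" using exp_ge_add_one_self[of 1] by (simp add: exp_minus field_simps)
      then have "exp (- 1 :: real) ^ n \<le> (1/2) ^ n" by (intro power_mono) auto
      then have "exp (- real n) \<le> (1/2) ^ n" by (simp flip: exp_of_nat_mult)
      moreover have "exp (- 2 * pi * v * (x + real_of_int l)\<^sup>2) \<le> exp (- real n)"
        using le unfolding Suc by simp
      ultimately show ?thesis unfolding Suc power_Suc by linarith
    qed
  qed
  then have "(\<Sum>l\<in>L. exp (- 2 * pi * v * (x + real_of_int l)\<^sup>2)) \<le> (\<Sum>l\<in>L. 2 * (1/2) ^ nat \<bar>s l\<bar>)"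
    by (rule sum_mono)
  also have "\<dots> = 2 * (\<Sum>l\<in>s ` L. (1/2) ^ nat \<bar>l\<bar>)"
    by (subst sum.reindex) (auto simp: s_def inj_on_def sum_distrib_left)
  also have "(\<Sum>l\<in>s ` L. (1/2) ^ nat \<bar>l\<bar>) \<le> (\<Sum>\<^sub>\<infinity>l :: int. (1/2 :: real) ^ nat \<bar>l\<bar>)"
    using L by (intro finite_sum_le_infsum geometric_int_summable) auto
  finally show ?thesis by (simp add: theta_const_def)
qed

lemma theta_bound:
  assumes v: "v > 0" and L: "finite L"
  shows "(\<Sum>l\<in>L. exp (- 2 * pi * v * (x + real_of_int l)\<^sup>2)) \<le> theta_const * (1 + 1 / sqrt v)"
proof -
  define M where "M = nat \<lceil>1 / sqrt v\<rceil>"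
  have sv: "1 / sqrt v > 0" using v by simp
  have M: "real M \<ge> 1 / sqrt v" "real M \<le> 1 + 1 / sqrt v" "M > 0"
    unfolding M_def using sv by (auto simp: of_nat_ceiling) linarith+
  have vM: "v * (real M)\<^sup>2 \<ge> 1"
  proof -
    have "(1 / sqrt v)\<^sup>2 \<le> (real M)\<^sup>2" using M sv by (intro power_mono) auto
    then show ?thesis using v by (simp add: power_divide field_simps)
  qed
  let ?e = "\<lambda>l. exp (- 2 * pi * v * (x + real_of_int l)\<^sup>2)"
  define Q where "Q = (\<lambda>l. l div int M) ` L"
  have inj: "inj_on (\<lambda>l. (l mod int M, l div int M)) L"
    by (rule inj_onI) (metis fst_conv snd_conv mult_div_mod_eq)
  have sub: "(\<lambda>l. (l mod int M, l div int M)) ` L \<subseteq> {0..<int M} \<times> Q"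
    using M by (auto simp: Q_def)
  have "(\<Sum>l\<in>L. ?e l) = (\<Sum>(i, q)\<in>(\<lambda>l. (l mod int M, l div int M)) ` L. ?e (i + int M * q))"
    by (subst sum.reindex[OF inj]) (simp add: o_def case_prod_beta' del: of_int_add of_int_mult)
  also have "\<dots> \<le> (\<Sum>(i, q)\<in>{0..<int M} \<times> Q. ?e (i + int M * q))"
    using L by (intro sum_mono2 sub) (auto simp: Q_def)
  also have "\<dots> = (\<Sum>i\<in>{0..<int M}. \<Sum>q\<in>Q. ?e (i + int M * q))"
    by (simp add: sum.cartesian_product)
  also have "\<dots> \<le> (\<Sum>i\<in>{0..<int M}. theta_const)"
  proof (rule sum_mono)
    fix i
    have "?e (i + int M * q) = exp (- 2 * pi * (v * (real M)\<^sup>2) * ((x + of_int i) / real M + of_int q)\<^sup>2)" for q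
    proof -
      have "x + real_of_int (i + int M * q) = real M * ((x + of_int i) / real M + of_int q)"
        using M by (simp add: field_simps)
      then show ?thesis by (simp add: power_mult_distrib mult_ac)
    qed
    then have "(\<Sum>q\<in>Q. ?e (i + int M * q)) = (\<Sum>q\<in>Q. exp (- 2 * pi * (v * (real M)\<^sup>2) * ((x + of_int i) / real M + of_int q)\<^sup>2))"
      by (simp only:)
    also have "\<dots> \<le> theta_const" using vM L by (intro theta_bound_large) (auto simp: Q_def)
    finally show "(\<Sum>q\<in>Q. ?e (i + int M * q)) \<le> theta_const" .
  qed
  also have "\<dots> = theta_const * real M" by simp
  also have "\<dots> \<le> theta_const * (1 + 1 / sqrt v)" using M theta_const_pos by (intro mult_left_mono) auto
  finally show ?thesis .
qed

definition zeta32 :: real where "zeta32 = (\<Sum>j. real j powr (- 3/2))"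

lemma zeta32_bound: "finite J \<Longrightarrow> (\<Sum>j\<in>J. real j powr (- 3/2)) \<le> zeta32"
  unfolding zeta32_def by (intro sum_le_suminf) (auto simp: summable_real_powr_iff)

lemma zeta32_ge_1: "zeta32 \<ge> 1"
  using zeta32_bound[of "{1}"] by simp

definition siegel_const :: real where "siegel_const = exp (- 3 * pi) / 4"

definition upper_const :: "nat \<Rightarrow> real" where
  "upper_const k = (3 * theta_const)\<^sup>2 * (2 * fact k * zeta32 / siegel_const)"

text \<open>A form at a cusp of width \<open>w\<close>; \<open>disc m r\<close> is the exponent that remains
  after completing the square.\<close>

locale cusp_series =
  fixes k w :: nat and f :: "complex \<times> complex \<Rightarrow> complex" and b :: "int \<Rightarrow> int \<Rightarrow> complex"
  assumes w: "w > 0" and k: "k \<ge> 3"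
    and supp: "\<And>m r. b m r \<noteq> 0 \<Longrightarrow> real_of_int (r ^ 2) < 4 * (real_of_int m / real w)"
    and expansion: "\<And>\<tau> z. Im \<tau> > 0 \<Longrightarrow>
           ((\<lambda>(m, r). b m r * ee (of_int m / of_nat w * \<tau> + of_int r * z)) has_sum f (\<tau>, z)) UNIV"
    and shift: "\<And>m r l. b (m - int w * (r * l - l ^ 2)) (r - 2 * l) = b m r"
    and measurable_f [measurable]: "f \<in> borel_measurable borel"
begin

definition disc :: "int \<Rightarrow> int \<Rightarrow> real" where
  "disc m r = 4 * of_int m / real w - (of_int r)\<^sup>2"

lemma disc_pos: "b m r \<noteq> 0 \<Longrightarrow> disc m r > 0"
  using supp[of m r] by (simp add: disc_def)

lemma disc_shift: "disc (m - int w * (r * l - l ^ 2)) (r - 2 * l) = disc m r"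
  using w by (simp add: disc_def field_simps power2_eq_square)

lemma term_eq:
  assumes "Im \<tau> > 0"
  shows "cmod (b m r * ee (of_int m / of_nat w * \<tau> + of_int r * z)) * exp (- 2 * pi * (Im z)\<^sup>2 / Im \<tau>)
    = cmod (b m r) * exp (- pi * disc m r * Im \<tau> / 2) * exp (- 2 * pi * Im \<tau> * (Im z / Im \<tau> + of_int r / 2)\<^sup>2)"
proof -
  have "Im (of_int m / of_nat w * \<tau> + of_int r * z) = of_int m / real w * Im \<tau> + of_int r * Im z"
  proof -
    define a where "a = of_int m / real w"
    have "of_int m / of_nat w = complex_of_real a" by (simp add: a_def)
    then have "Im (of_int m / of_nat w * \<tau> + of_int r * z) = a * Im \<tau> + of_int r * Im z" by simp
    then show ?thesis by (simp only: a_def)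
  qed
  moreover have "- 2 * pi * (of_int m / real w * Im \<tau> + of_int r * Im z) + - 2 * pi * (Im z)\<^sup>2 / Im \<tau>
     = - pi * disc m r * Im \<tau> / 2 + - 2 * pi * Im \<tau> * (Im z / Im \<tau> + of_int r / 2)\<^sup>2"
    using assms w by (simp add: disc_def field_simps power2_eq_square)
  ultimately show ?thesis
    by (simp only: norm_mult norm_ee mult.assoc exp_add[symmetric])
qed

lemma term_summable:
  assumes "Im \<tau> > 0"
  shows "(\<lambda>(m, r). cmod (b m r) * exp (- pi * disc m r * Im \<tau> / 2) * exp (- 2 * pi * Im \<tau> * (Im z / Im \<tau> + of_int r / 2)\<^sup>2)) summable_on UNIV"
proof -
  have "(\<lambda>p. norm (case p of (m, r) \<Rightarrow> b m r * ee (of_int m / of_nat w * \<tau> + of_int r * z))) summable_on UNIV"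
    using expansion[OF assms, of z] summable_on_iff_abs_summable_on_complex has_sum_imp_summable by blast
  then have "(\<lambda>p. norm (case p of (m, r) \<Rightarrow> b m r * ee (of_int m / of_nat w * \<tau> + of_int r * z)) * exp (- 2 * pi * (Im z)\<^sup>2 / Im \<tau>)) summable_on UNIV"
    by (rule summable_on_cmult_left)
  then show ?thesis using term_eq[OF assms] by (simp add: case_prod_beta')
qed

lemma tilde_le_sums:
  assumes t: "Im \<tau> > 0"
    and B: "\<And>T. finite T \<Longrightarrow> (\<Sum>(m, r)\<in>T. cmod (b m r) * exp (- pi * disc m r * Im \<tau> / 2) * exp (- 2 * pi * Im \<tau> * (Im z / Im \<tau> + of_int r / 2)\<^sup>2)) \<le> B"
  shows "jacobi_tilde k 1 f (\<tau>, z) \<le> Im \<tau> powr (real k / 2) * B"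
proof -
  let ?t = "\<lambda>(m, r). b m r * ee (of_int m / of_nat w * \<tau> + of_int r * z)"
  let ?s = "\<lambda>(m, r). cmod (b m r) * exp (- pi * disc m r * Im \<tau> / 2) * exp (- 2 * pi * Im \<tau> * (Im z / Im \<tau> + of_int r / 2)\<^sup>2)"
  have eq: "norm (?t p) * exp (- 2 * pi * (Im z)\<^sup>2 / Im \<tau>) = ?s p" for p
    using term_eq[OF t] by (cases p) simp
  have sn: "(\<lambda>p. norm (?t p)) summable_on UNIV"
    using expansion[OF t, of z] summable_on_iff_abs_summable_on_complex has_sum_imp_summable by blast
  have "cmod (f (\<tau>, z)) = norm (\<Sum>\<^sub>\<infinity>p. ?t p)" using expansion[OF t, of z] by (simp add: infsumI)
  also have "\<dots> \<le> (\<Sum>\<^sub>\<infinity>p. norm (?t p))" using sn by (rule norm_infsum_bound)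
  finally have "exp (- 2 * pi * (Im z)\<^sup>2 / Im \<tau>) * cmod (f (\<tau>, z)) \<le> (\<Sum>\<^sub>\<infinity>p. norm (?t p)) * exp (- 2 * pi * (Im z)\<^sup>2 / Im \<tau>)"
    by (simp add: mult.commute)
  also have "\<dots> = (\<Sum>\<^sub>\<infinity>p. ?s p)" unfolding infsum_cmult_left'[symmetric] eq ..
  also have "\<dots> \<le> B"
    using term_summable[OF t, of z] B by (intro infsum_le_finite_sums) auto
  finally show ?thesis unfolding jacobi_tilde_def by (simp add: mult.assoc mult_left_mono)
qed

definition red :: "(int \<times> int) set" where
  "red = {(m, r). (r = 0 \<or> r = - 1) \<and> disc m r > 0}"

lemma tilde_le_reduced:
  assumes t: "Im \<tau> > 0"
    and Q: "\<And>T. finite T \<Longrightarrow> T \<subseteq> red \<Longrightarrow> (\<Sum>(m, r)\<in>T. cmod (b m r) * exp (- pi * disc m r * Im \<tau> / 2)) \<le> Q"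
  shows "jacobi_tilde k 1 f (\<tau>, z) \<le> Im \<tau> powr (real k / 2) * (Q * (theta_const * (1 + 1 / sqrt (Im \<tau>))))"
proof (rule tilde_le_sums[OF t])
  fix T :: "(int \<times> int) set" assume T: "finite T"
  define v where "v = Im \<tau>"
  define x where "x = Im z / Im \<tau>"
  let ?u = "\<lambda>m r. cmod (b m r) * exp (- pi * disc m r * v / 2)"
  let ?e = "\<lambda>r. exp (- 2 * pi * v * (x + r / 2)\<^sup>2)"
  have Q0: "Q \<ge> 0" using Q[of "{}"] by simp
  define h where "h = (\<lambda>(m :: int, r :: int). let l = (r + 1) div 2 in ((m - int w * (r * l - l ^ 2), r - 2 * l), l))"
  have inj: "inj_on h T'" for T'
  proof (rule inj_onI)
    fix p q assume "h p = h q"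
    then show "p = q" by (cases p; cases q) (auto simp: h_def Let_def)
  qed
  define T' where "T' = {p \<in> T. b (fst p) (snd p) \<noteq> 0}"
  define T0 where "T0 = fst ` h ` T'"
  define L where "L = snd ` h ` T'"
  have fin: "finite T'" "finite T0" "finite L" using T by (auto simp: T'_def T0_def L_def)
  have T0: "T0 \<subseteq> red"
  proof
    fix q assume "q \<in> T0"
    then obtain m r where mr: "(m, r) \<in> T'" "q = fst (h (m, r))" by (auto simp: T0_def)
    define l where "l = (r + 1) div 2"
    have q: "q = (m - int w * (r * l - l ^ 2), r - 2 * l)" using mr by (simp add: h_def l_def Let_def)
    have "r - 2 * l = 0 \<or> r - 2 * l = - 1" unfolding l_def by presburger
    moreover have "disc m r > 0" using mr by (intro disc_pos) (auto simp: T'_def)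
    ultimately show "q \<in> red" unfolding q red_def by (simp add: disc_shift)
  qed
  have "(\<Sum>(m, r)\<in>T. ?u m r * ?e (of_int r)) = (\<Sum>(m, r)\<in>T'. ?u m r * ?e (of_int r))"
    using T by (intro sum.mono_neutral_right) (auto simp: T'_def)
  also have "\<dots> = (\<Sum>q\<in>h ` T'. case q of ((m, r), l) \<Rightarrow> ?u m r * ?e (of_int r + 2 * of_int l))"
    by (subst sum.reindex[OF inj]) (auto intro!: sum.cong simp: h_def Let_def disc_shift shift)
  also have "\<dots> \<le> (\<Sum>q\<in>T0 \<times> L. case q of ((m, r), l) \<Rightarrow> ?u m r * ?e (of_int r + 2 * of_int l))"
    using fin subset_fst_snd[of "h ` T'"] by (intro sum_mono2) (auto simp: T0_def L_def)
  also have "\<dots> = (\<Sum>(m, r)\<in>T0. ?u m r * (\<Sum>l\<in>L. ?e (of_int r + 2 * of_int l)))"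
    by (simp add: sum.cartesian_product' sum_distrib_left case_prod_beta')
  also have "\<dots> \<le> (\<Sum>(m, r)\<in>T0. ?u m r * (theta_const * (1 + 1 / sqrt v)))"
  proof (rule sum_mono, clarify)
    fix m r
    have "(\<Sum>l\<in>L. ?e (of_int r + 2 * of_int l)) = (\<Sum>l\<in>L. exp (- 2 * pi * v * ((x + of_int r / 2) + of_int l)\<^sup>2))"
      by (intro sum.cong refl) (simp add: add_divide_distrib add.assoc)
    also have "\<dots> \<le> theta_const * (1 + 1 / sqrt v)" using t fin by (intro theta_bound) (auto simp: v_def)
    finally show "?u m r * (\<Sum>l\<in>L. ?e (of_int r + 2 * of_int l)) \<le> ?u m r * (theta_const * (1 + 1 / sqrt v))"
      by (intro mult_left_mono) auto
  qed
  also have "\<dots> = (\<Sum>(m, r)\<in>T0. ?u m r) * (theta_const * (1 + 1 / sqrt v))"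
    by (simp add: sum_distrib_right case_prod_beta')
  also have "\<dots> \<le> Q * (theta_const * (1 + 1 / sqrt v))"
    using Q[OF fin(2) T0] theta_const_pos t by (intro mult_right_mono) (auto simp: v_def)
  finally show "(\<Sum>(m, r)\<in>T. cmod (b m r) * exp (- pi * disc m r * Im \<tau> / 2) * exp (- 2 * pi * Im \<tau> * (Im z / Im \<tau> + of_int r / 2)\<^sup>2)) \<le> Q * (theta_const * (1 + 1 / sqrt (Im \<tau>)))"
    by (simp add: v_def x_def)
qed

lemma disc_ge: "(m, r) \<in> red \<Longrightarrow> disc m r \<ge> 1 / real w"
proof -
  assume "(m, r) \<in> red"
  then have d: "disc m r > 0" by (simp add: red_def)
  define X where "X = 4 * m - int w * r\<^sup>2"
  have e: "disc m r = real_of_int X / real w"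
    using w by (simp add: disc_def X_def field_simps)
  then have "X > 0" using d w by (simp add: zero_less_divide_iff)
  then have "real_of_int X \<ge> 1" by linarith
  then show ?thesis unfolding e using w by (intro divide_right_mono) auto
qed

lemma tilde_bounded: "\<exists>K. \<forall>\<tau> z. Im \<tau> \<ge> 3/4 \<longrightarrow> jacobi_tilde k 1 f (\<tau>, z) \<le> K"
proof -
  let ?t0 = "\<i> * of_real (3/8)" and ?z1 = "\<i> * of_real (3/16)"
  let ?s = "\<lambda>z (m, r). cmod (b m r) * exp (- pi * disc m r * Im ?t0 / 2) * exp (- 2 * pi * Im ?t0 * (Im z / Im ?t0 + of_int r / 2)\<^sup>2)"
  have su: "?s z summable_on UNIV" for z using term_summable[of ?t0 z] by simp
  define S where "S = infsum (?s 0) UNIV + infsum (?s ?z1) UNIV"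
  have S0: "S \<ge> 0" unfolding S_def by (intro add_nonneg_nonneg infsum_nonneg) auto
  have fs: "(\<Sum>(m, r)\<in>T. cmod (b m r) * exp (- pi * disc m r * (3/8) / 2)) \<le> S" if T: "finite T" "T \<subseteq> red" for T
  proof -
    have "(\<Sum>(m, r)\<in>T. cmod (b m r) * exp (- pi * disc m r * (3/8) / 2)) \<le> (\<Sum>p\<in>T. ?s 0 p + ?s ?z1 p)"
    proof (rule sum_mono)
      fix p assume p: "p \<in> T"
      obtain m r where pe: "p = (m, r)" by (cases p)
      have "r = 0 \<or> r = - 1" using p pe T by (auto simp: red_def)
      then show "(case p of (m, r) \<Rightarrow> cmod (b m r) * exp (- pi * disc m r * (3/8) / 2)) \<le> ?s 0 p + ?s ?z1 p"
        unfolding pe by auto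
    qed
    also have "\<dots> = (\<Sum>p\<in>T. ?s 0 p) + (\<Sum>p\<in>T. ?s ?z1 p)" by (rule sum.distrib)
    also have "\<dots> \<le> S" unfolding S_def by (intro add_mono finite_sum_le_infsum su T) auto
    finally show ?thesis .
  qed
  define K1 where "K1 = sqrt (fact k * (2 * real w) ^ k)"
  have pw: "v powr (real k / 2) * exp (- v / (4 * real w)) \<le> K1" if v: "v > 0" for v
  proof -
    have "(v / (2 * real w)) ^ k \<le> fact k * exp (v / (2 * real w))"
      using v w by (intro power_le_fact_exp) auto
    then have "v ^ k * exp (- v / (2 * real w)) \<le> fact k * (2 * real w) ^ k"
      using w by (simp add: power_divide field_simps exp_minus)
    moreover have "(v powr (real k / 2) * exp (- v / (4 * real w)))\<^sup>2 = v ^ k * exp (- v / (2 * real w))"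
    proof -
      have "(v powr (real k / 2))\<^sup>2 = v powr real k"
        by (simp add: power2_eq_square flip: powr_add)
      moreover have "(exp (- v / (4 * real w)))\<^sup>2 = exp (- v / (2 * real w))"
        by (simp add: power2_eq_square flip: exp_add)
      ultimately show ?thesis using v by (simp add: power_mult_distrib powr_realpow)
    qed
    ultimately show ?thesis unfolding K1_def by (intro real_le_rsqrt) simp
  qed
  show ?thesis
  proof (rule exI[of _ "K1 * (S * (theta_const * (1 + 1 / sqrt (3/4))))"], intro allI impI)
    fix \<tau> z :: complex assume v: "3/4 \<le> Im \<tau>"
    define v where "v = Im \<tau>"
    have v0: "v > 0" "v \<ge> 3/4" using v by (auto simp: v_def)
    have "jacobi_tilde k 1 f (\<tau>, z) \<le> Im \<tau> powr (real k / 2) * ((S * exp (- v / (4 * real w))) * (theta_const * (1 + 1 / sqrt (Im \<tau>))))"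
    proof (rule tilde_le_reduced)
      fix T assume T: "finite T" "T \<subseteq> red"
      have "(\<Sum>(m, r)\<in>T. cmod (b m r) * exp (- pi * disc m r * Im \<tau> / 2)) \<le> (\<Sum>(m, r)\<in>T. cmod (b m r) * exp (- pi * disc m r * (3/8) / 2) * exp (- v / (4 * real w)))"
      proof (rule sum_mono, clarify)
        fix m r assume "(m, r) \<in> T"
        then have d: "disc m r \<ge> 1 / real w" "disc m r > 0" using T disc_ge by (blast, auto simp: red_def)
        have "pi * (disc m r * (v - 3/8)) \<ge> 1 * ((1 / real w) * (v / 2))"
          using d v0 w pi_gt3 by (intro mult_mono) auto
        then have "- pi * disc m r * v / 2 \<le> - pi * disc m r * (3/8) / 2 + - v / (4 * real w)"
          by (simp add: field_simps)
        then have "exp (- pi * disc m r * v / 2) \<le> exp (- pi * disc m r * (3/8) / 2) * exp (- v / (4 * real w))"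
          by (simp only: exp_add[symmetric] exp_le_cancel_iff)
        then show "cmod (b m r) * exp (- pi * disc m r * Im \<tau> / 2) \<le> cmod (b m r) * exp (- pi * disc m r * (3/8) / 2) * exp (- v / (4 * real w))"
          unfolding mult.assoc[of "cmod (b m r)"] v_def[symmetric] by (intro mult_left_mono) auto
      qed
      also have "\<dots> = (\<Sum>(m, r)\<in>T. cmod (b m r) * exp (- pi * disc m r * (3/8) / 2)) * exp (- v / (4 * real w))"
        by (simp add: sum_distrib_right case_prod_beta')
      also have "\<dots> \<le> S * exp (- v / (4 * real w))" using fs[OF T] by (intro mult_right_mono) auto
      finally show "(\<Sum>(m, r)\<in>T. cmod (b m r) * exp (- pi * disc m r * Im \<tau> / 2)) \<le> S * exp (- v / (4 * real w))" .
    qed (use v0 v_def in simp)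
    also have "\<dots> = (v powr (real k / 2) * exp (- v / (4 * real w))) * (S * (theta_const * (1 + 1 / sqrt v)))"
      by (simp add: v_def mult_ac)
    also have "\<dots> \<le> K1 * (S * (theta_const * (1 + 1 / sqrt (3/4))))"
    proof (intro mult_mono pw v0 add_mono order_refl)
      show "1 / sqrt v \<le> 1 / sqrt (3/4)" using v0 by (intro divide_left_mono) auto
    qed (use S0 theta_const_pos v0 in \<open>auto simp: K1_def\<close>)
    finally show "jacobi_tilde k 1 f (\<tau>, z) \<le> K1 * (S * (theta_const * (1 + 1 / sqrt (3/4))))" .
  qed
qed

definition weight :: "real \<Rightarrow> real" where
  "weight D = siegel_const * real w * exp (- pi * D / 2) * D powr (3/2 - real k)"

lemma tilde_le_weighted:
  assumes B: "\<And>T. finite T \<Longrightarrow> T \<subseteq> red \<Longrightarrow> (\<Sum>(m, r)\<in>T. (cmod (b m r))\<^sup>2 * weight (disc m r)) \<le> B"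
    and v: "Im \<tau> \<ge> 3/4"
  shows "(jacobi_tilde k 1 f (\<tau>, z))\<^sup>2 \<le> upper_const k * sqrt (real w) * B"
proof -
  define v where "v = Im \<tau>"
  have v0: "v > 0" "v \<ge> 3/4" using v by (auto simp: v_def)
  have B0: "B \<ge> 0" using B[of "{}"] by simp
  have sc: "siegel_const > 0" by (simp add: siegel_const_def)
  define E where "E = 2 * fact k * zeta32 / siegel_const * sqrt (real w) / v ^ k"
  have E0: "E \<ge> 0" unfolding E_def using zeta32_ge_1 sc v0 by (intro divide_nonneg_nonneg mult_nonneg_nonneg) auto
  have wpos: "weight D > 0" if "D > 0" for D using that w sc by (simp add: weight_def)
  have num: "exp (- pi * D * v) / weight D \<le> (fact k / (siegel_const * v ^ k)) / real w * D powr (- 3/2)" if D: "D > 0" for D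
  proof -
    have "exp (- pi * D * v) * exp (pi * D / 2) = exp (- (pi * D * (v - 1/2)))"
      by (simp add: algebra_simps flip: exp_add)
    also have "\<dots> \<le> exp (- (D * v))"
    proof -
      have "v \<le> 3 * (v - 1/2)" using v0 by simp
      also have "\<dots> \<le> pi * (v - 1/2)" using v0 pi_gt3 by (intro mult_right_mono) auto
      finally show ?thesis using mult_left_mono[of v "pi * (v - 1/2)" D] D by (simp add: mult_ac)
    qed
    also have "\<dots> \<le> fact k / (D * v) ^ k"
      using power_le_fact_exp[of "D * v" k] D v0 by (simp add: exp_minus field_simps)
    finally have le: "exp (- pi * D * v) * exp (pi * D / 2) \<le> fact k / (D * v) ^ k" .
    have Dk: "D powr (real k - 3/2) = D ^ k * D powr (- 3/2)"
      using D powr_add[of D "real k" "- 3/2"] by (simp add: powr_realpow)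
    have "exp (- pi * D * v) / weight D = exp (- pi * D * v) * exp (pi * D / 2) * D powr (real k - 3/2) / (siegel_const * real w)"
    proof -
      have "D powr (3/2 - real k) = 1 / D powr (real k - 3/2)" 
        using powr_minus_divide[of D "real k - 3/2"] by simp
      moreover have "exp (- pi * D / 2) = 1 / exp (pi * D / 2)" by (simp add: exp_minus field_simps)
      ultimately show ?thesis unfolding weight_def using D sc w by (simp add: field_simps)
    qed
    also have "\<dots> \<le> fact k / (D * v) ^ k * D powr (real k - 3/2) / (siegel_const * real w)"
      using le sc w by (intro divide_right_mono mult_right_mono) auto
    also have "\<dots> = (fact k / (siegel_const * v ^ k)) / real w * D powr (- 3/2)"
      unfolding Dk using D v0 sc w by (simp add: field_simps power_mult_distrib)
    finally show ?thesis .
  qed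
  have sumD: "(\<Sum>(m, r)\<in>T. exp (- pi * disc m r * v) / weight (disc m r)) \<le> E" if T: "finite T" "T \<subseteq> red" for T
  proof -
    define j where "j = (\<lambda>(m, r). nat (4 * m - int w * r\<^sup>2))"
    have jd: "disc m r = real (j (m, r)) / real w" if "(m, r) \<in> T" for m r
    proof -
      have d: "disc m r > 0" using that T by (auto simp: red_def)
      define X where "X = 4 * m - int w * r\<^sup>2"
      have e: "disc m r = real_of_int X / real w"
        using w by (simp add: disc_def X_def field_simps)
      then have "X > 0" using d w by (simp add: zero_less_divide_iff)
      then show ?thesis using e by (simp add: j_def X_def[symmetric])
    qed
    have part: "(\<Sum>(m, r)\<in>{p\<in>T. snd p = r0}. disc m r powr (- 3/2)) \<le> real w powr (3/2) * zeta32" for r0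
    proof -
      let ?T = "{p\<in>T. snd p = r0}"
      have inj: "inj_on j ?T"
      proof (rule inj_onI)
        fix p q assume pq: "p \<in> ?T" "q \<in> ?T" "j p = j q"
        obtain m m' where e: "p = (m, r0)" "q = (m', r0)" using pq by (cases p; cases q) auto
        have "disc m r0 = disc m' r0" using jd[of m r0] jd[of m' r0] pq e by simp
        then show "p = q" using w e by (simp add: disc_def)
      qed
      have "(\<Sum>(m, r)\<in>?T. disc m r powr (- 3/2)) = (\<Sum>p\<in>?T. real w powr (3/2) * real (j p) powr (- 3/2))"
      proof (intro sum.cong refl, clarify)
        fix m r assume "(m, r) \<in> T"
        note jd' = jd[OF this]
        show "disc m r powr (- 3/2) = real w powr (3/2) * real (j (m, r)) powr (- 3/2)"
          unfolding jd' using w by (simp add: powr_divide powr_minus_divide field_simps)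
      qed
      also have "\<dots> = real w powr (3/2) * (\<Sum>i\<in>j ` ?T. real i powr (- 3/2))"
        by (subst sum.reindex[OF inj]) (simp add: sum_distrib_left)
      also have "\<dots> \<le> real w powr (3/2) * zeta32"
        using T by (intro mult_left_mono zeta32_bound) auto
      finally show ?thesis .
    qed
    have "(\<Sum>(m, r)\<in>T. disc m r powr (- 3/2)) = (\<Sum>(m, r)\<in>{p\<in>T. snd p = 0} \<union> {p\<in>T. snd p = - 1}. disc m r powr (- 3/2))"
      using T by (intro sum.cong) (auto simp: red_def)
    also have "\<dots> = (\<Sum>(m, r)\<in>{p\<in>T. snd p = 0}. disc m r powr (- 3/2)) + (\<Sum>(m, r)\<in>{p\<in>T. snd p = - 1}. disc m r powr (- 3/2))"
      using T by (intro sum.union_disjoint) auto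
    also have "\<dots> \<le> real w powr (3/2) * zeta32 + real w powr (3/2) * zeta32"
      by (intro add_mono part)
    finally have P: "(\<Sum>(m, r)\<in>T. disc m r powr (- 3/2)) \<le> real w powr (3/2) * zeta32 + real w powr (3/2) * zeta32" .
    have "(\<Sum>(m, r)\<in>T. exp (- pi * disc m r * v) / weight (disc m r))
        \<le> (\<Sum>(m, r)\<in>T. (fact k / (siegel_const * v ^ k)) / real w * disc m r powr (- 3/2))"
    proof (rule sum_mono, clarify)
      fix m r assume "(m, r) \<in> T"
      then have "disc m r > 0" using T by (auto simp: red_def)
      then show "exp (- pi * disc m r * v) / weight (disc m r) \<le> (fact k / (siegel_const * v ^ k)) / real w * disc m r powr (- 3/2)"
        by (rule num)
    qed
    also have "\<dots> = (fact k / (siegel_const * v ^ k)) / real w * (\<Sum>(m, r)\<in>T. disc m r powr (- 3/2))"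
      by (simp add: sum_distrib_left case_prod_beta')
    also have "\<dots> \<le> (fact k / (siegel_const * v ^ k)) / real w * (real w powr (3/2) * zeta32 + real w powr (3/2) * zeta32)"
      using sc v0 by (intro mult_left_mono P) simp
    also have "real w powr (3/2) = real w * sqrt (real w)"
      using w powr_add[of "real w" 1 "1/2"] by (simp add: powr_half_sqrt)
    also have "(fact k / (siegel_const * v ^ k)) / real w * (real w * sqrt (real w) * zeta32 + real w * sqrt (real w) * zeta32) = E"
      unfolding E_def using w sc v0 by (simp add: field_simps)
    finally show ?thesis .
  qed
  have Q: "(\<Sum>(m, r)\<in>T. cmod (b m r) * exp (- pi * disc m r * Im \<tau> / 2)) \<le> sqrt (B * E)" if T: "finite T" "T \<subseteq> red" for T
  proof (rule real_le_rsqrt)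
    have "(\<Sum>(m, r)\<in>T. cmod (b m r) * exp (- pi * disc m r * Im \<tau> / 2))
      = (\<Sum>p\<in>T. (cmod (b (fst p) (snd p)) * sqrt (weight (disc (fst p) (snd p)))) * (exp (- pi * disc (fst p) (snd p) * v / 2) / sqrt (weight (disc (fst p) (snd p)))))"
    proof (intro sum.cong refl, clarify)
      fix m r assume "(m, r) \<in> T"
      then have "weight (disc m r) > 0" using T wpos by (auto simp: red_def)
      then show "cmod (b m r) * exp (- pi * disc m r * Im \<tau> / 2) = cmod (b (fst (m, r)) (snd (m, r))) * sqrt (weight (disc (fst (m, r)) (snd (m, r)))) * (exp (- pi * disc (fst (m, r)) (snd (m, r)) * v / 2) / sqrt (weight (disc (fst (m, r)) (snd (m, r)))))"
        by (simp add: v_def)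
    qed
    then have "(\<Sum>(m, r)\<in>T. cmod (b m r) * exp (- pi * disc m r * Im \<tau> / 2))\<^sup>2
      \<le> (\<Sum>p\<in>T. (cmod (b (fst p) (snd p)) * sqrt (weight (disc (fst p) (snd p))))\<^sup>2) * (\<Sum>p\<in>T. (exp (- pi * disc (fst p) (snd p) * v / 2) / sqrt (weight (disc (fst p) (snd p))))\<^sup>2)"
      by (simp only: Cauchy_Schwarz_ineq_sum)
    also have "(\<Sum>p\<in>T. (cmod (b (fst p) (snd p)) * sqrt (weight (disc (fst p) (snd p))))\<^sup>2) = (\<Sum>(m, r)\<in>T. (cmod (b m r))\<^sup>2 * weight (disc m r))"
    proof (intro sum.cong refl, clarify)
      fix m r assume "(m, r) \<in> T"
      then have "weight (disc m r) > 0" using T wpos by (auto simp: red_def)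
      then show "(cmod (b (fst (m, r)) (snd (m, r))) * sqrt (weight (disc (fst (m, r)) (snd (m, r)))))\<^sup>2 = (cmod (b m r))\<^sup>2 * weight (disc m r)"
        by (simp add: power_mult_distrib)
    qed
    also have "(\<Sum>p\<in>T. (exp (- pi * disc (fst p) (snd p) * v / 2) / sqrt (weight (disc (fst p) (snd p))))\<^sup>2) = (\<Sum>(m, r)\<in>T. exp (- pi * disc m r * v) / weight (disc m r))"
    proof (intro sum.cong refl, clarify)
      fix m r assume "(m, r) \<in> T"
      then have "weight (disc m r) > 0" using T wpos by (auto simp: red_def)
      moreover have "(exp (- pi * disc m r * v / 2))\<^sup>2 = exp (- pi * disc m r * v)"
        by (simp add: power2_eq_square flip: exp_add)
      ultimately show "(exp (- pi * disc (fst (m, r)) (snd (m, r)) * v / 2) / sqrt (weight (disc (fst (m, r)) (snd (m, r)))))\<^sup>2 = exp (- pi * disc m r * v) / weight (disc m r)"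
        by (simp add: power_divide)
    qed
    also have "(\<Sum>(m, r)\<in>T. (cmod (b m r))\<^sup>2 * weight (disc m r)) * (\<Sum>(m, r)\<in>T. exp (- pi * disc m r * v) / weight (disc m r)) \<le> B * E"
    proof (intro mult_mono B sumD T B0 sum_nonneg)
      fix p assume "p \<in> T"
      then show "0 \<le> (case p of (m, r) \<Rightarrow> exp (- pi * disc m r * v) / weight (disc m r))"
        using T wpos by (auto simp: red_def less_imp_le)
    qed
    finally show "(\<Sum>(m, r)\<in>T. cmod (b m r) * exp (- pi * disc m r * Im \<tau> / 2))\<^sup>2 \<le> B * E" .
  qed
  have "jacobi_tilde k 1 f (\<tau>, z) \<le> Im \<tau> powr (real k / 2) * (sqrt (B * E) * (theta_const * (1 + 1 / sqrt (Im \<tau>))))"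
    by (rule tilde_le_reduced[OF _ Q]) (use v0 v_def in auto)
  also have "\<dots> \<le> Im \<tau> powr (real k / 2) * (sqrt (B * E) * (theta_const * 3))"
  proof -
    have "sqrt v \<ge> 1/2" using v0 by (intro real_le_rsqrt) (simp add: power2_eq_square)
    then have "1 / sqrt v \<le> 2" using v0 by (simp add: field_simps)
    then show ?thesis using theta_const_pos B0 E0 by (intro mult_left_mono) (auto simp: v_def)
  qed
  finally have "(jacobi_tilde k 1 f (\<tau>, z))\<^sup>2 \<le> (Im \<tau> powr (real k / 2) * (sqrt (B * E) * (theta_const * 3)))\<^sup>2"
    using jacobi_tilde_nonneg by (intro power_mono) auto
  also have "\<dots> = v ^ k * (B * E) * (3 * theta_const)\<^sup>2"
  proof -
    have "(v powr (real k / 2))\<^sup>2 = v ^ k"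
      using v0 by (simp add: power2_eq_square powr_realpow flip: powr_add)
    then show ?thesis using B0 E0 by (simp add: power_mult_distrib v_def[symmetric] mult_ac)
  qed
  also have "\<dots> = upper_const k * sqrt (real w) * B"
    using v0 by (simp add: E_def upper_const_def)
  finally show ?thesis .
qed

end

lemma borel_measurable_Complex [measurable (raw)]:
  assumes [measurable]: "g \<in> borel_measurable M" "h \<in> borel_measurable M"
  shows "(\<lambda>x. Complex (g x) (h x)) \<in> borel_measurable M"
proof -
  have "(\<lambda>x. complex_of_real (g x) + \<i> * complex_of_real (h x)) \<in> borel_measurable M" by measurable
  then show ?thesis by (simp add: complex_eq_iff[symmetric] Complex_eq)
qed

lemma nn_integral_jmeas_real:
  fixes G :: "complex \<times> complex \<Rightarrow> ennreal"
  assumes [measurable]: "G \<in> borel_measurable borel"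
  shows "(\<integral>\<^sup>+p. G p \<partial>jmeas) = (\<integral>\<^sup>+v. \<integral>\<^sup>+y. \<integral>\<^sup>+u. \<integral>\<^sup>+x.
     indicator {0<..} v * ennreal (1 / v ^ 3) * G (Complex u v, Complex x y) \<partial>lborel \<partial>lborel \<partial>lborel \<partial>lborel)"
proof -
  let ?c = "\<lambda>v. indicator {0<..} v * ennreal (1 / v ^ 3) :: ennreal"
  have m [measurable]: "(\<lambda>p. G (Complex (f1 p) (f2 p), Complex (f3 p) (f4 p))) \<in> borel_measurable M"
    if [measurable]: "f1 \<in> borel_measurable M" "f2 \<in> borel_measurable M" "f3 \<in> borel_measurable M" "f4 \<in> borel_measurable M" for f1 f2 f3 f4 and M :: "'b measure"
    by measurable
  have "(\<integral>\<^sup>+p. G p \<partial>jmeas) = (\<integral>\<^sup>+\<tau>. indicator {\<tau>. Im \<tau> > 0} \<tau> * ennreal (1 / Im \<tau> ^ 3) * (\<integral>\<^sup>+z. G (\<tau>, z) \<partial>lborel) \<partial>lborel)"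
    by (rule nn_integral_jmeas) measurable
  also have "\<dots> = (\<integral>\<^sup>+u. \<integral>\<^sup>+v. indicator {\<tau>. Im \<tau> > 0} (Complex u v) * ennreal (1 / Im (Complex u v) ^ 3) * (\<integral>\<^sup>+z. G (Complex u v, z) \<partial>lborel) \<partial>lborel \<partial>lborel)"
  proof (rule nn_integral_complex)
    have [measurable]: "(\<lambda>\<tau>. \<integral>\<^sup>+z. G (\<tau>, z) \<partial>lborel) \<in> borel_measurable borel"
      by (rule borel_measurable_nn_integral_pair) measurable
    show "(\<lambda>\<tau>. indicator {\<tau>. Im \<tau> > 0} \<tau> * ennreal (1 / Im \<tau> ^ 3) * (\<integral>\<^sup>+z. G (\<tau>, z) \<partial>lborel)) \<in> borel_measurable borel"
      by measurable
  qed
  also have "\<dots> = (\<integral>\<^sup>+u. \<integral>\<^sup>+v. ?c v * (\<integral>\<^sup>+x. \<integral>\<^sup>+y. G (Complex u v, Complex x y) \<partial>lborel \<partial>lborel) \<partial>lborel \<partial>lborel)"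
  proof (intro nn_integral_cong arg_cong2[where f = "(*)"])
    show "indicator {\<tau>. Im \<tau> > 0} (Complex u v) = (indicator {0<..} v :: ennreal)" for u v by (auto simp: indicator_def)
    show "(\<integral>\<^sup>+z. G (Complex u v, z) \<partial>lborel) = (\<integral>\<^sup>+x. \<integral>\<^sup>+y. G (Complex u v, Complex x y) \<partial>lborel \<partial>lborel)" for u v
      by (rule nn_integral_complex) (rule borel_measurable_slice, measurable)
  qed simp
  also have "\<dots> = (\<integral>\<^sup>+u. \<integral>\<^sup>+v. \<integral>\<^sup>+y. \<integral>\<^sup>+x. ?c v * G (Complex u v, Complex x y) \<partial>lborel \<partial>lborel \<partial>lborel \<partial>lborel)"
  proof (intro nn_integral_cong)
    fix u v :: real
    have "(\<integral>\<^sup>+x. \<integral>\<^sup>+y. G (Complex u v, Complex x y) \<partial>lborel \<partial>lborel) = (\<integral>\<^sup>+y. \<integral>\<^sup>+x. G (Complex u v, Complex x y) \<partial>lborel \<partial>lborel)"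
      by (rule lborel_pair.Fubini') measurable
    then show "?c v * (\<integral>\<^sup>+x. \<integral>\<^sup>+y. G (Complex u v, Complex x y) \<partial>lborel \<partial>lborel) = (\<integral>\<^sup>+y. \<integral>\<^sup>+x. ?c v * G (Complex u v, Complex x y) \<partial>lborel \<partial>lborel)"
      by (simp add: nn_integral_cmult)
  qed
  also have "\<dots> = (\<integral>\<^sup>+v. \<integral>\<^sup>+u. \<integral>\<^sup>+y. \<integral>\<^sup>+x. ?c v * G (Complex u v, Complex x y) \<partial>lborel \<partial>lborel \<partial>lborel \<partial>lborel)"
    by (rule lborel_pair.Fubini') measurable
  also have "\<dots> = (\<integral>\<^sup>+v. \<integral>\<^sup>+y. \<integral>\<^sup>+u. \<integral>\<^sup>+x. ?c v * G (Complex u v, Complex x y) \<partial>lborel \<partial>lborel \<partial>lborel \<partial>lborel)"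
    by (rule nn_integral_cong, rule lborel_pair.Fubini') measurable
  finally show ?thesis .
qed

context cusp_series
begin

lemma bessel_fibre:
  assumes v: "v > 0" and T: "finite T"
  shows "ennreal (real w * (\<Sum>(m, r)\<in>T. (cmod (b m r))\<^sup>2 * exp (- 4 * pi * (of_int m / real w * v + of_int r * y)))) \<le>
    (\<integral>\<^sup>+u. \<integral>\<^sup>+x. ennreal ((cmod (f (Complex u v, Complex x y)))\<^sup>2) * indicator {0..<real w} u * indicator {0..<1} x \<partial>lborel \<partial>lborel)"
proof -
  define a where "a = (\<lambda>m r. b m r * ee (of_int m / of_nat w * (\<i> * of_real v) + of_int r * (\<i> * of_real y)))"
  define g where "g = (\<lambda>s x. f (Complex (real w * s) v, Complex x y))"
  have na: "(cmod (a m r))\<^sup>2 = (cmod (b m r))\<^sup>2 * exp (- 4 * pi * (of_int m / real w * v + of_int r * y))" for m r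
  proof -
    define q where "q = of_int m / real w"
    have q: "of_int m / of_nat w = complex_of_real q" by (simp add: q_def)
    have "cmod (a m r) = cmod (b m r) * exp (- 2 * pi * (q * v + of_int r * y))"
      unfolding a_def q by (simp add: norm_mult norm_ee)
    moreover have "(exp (- 2 * pi * (q * v + of_int r * y)))\<^sup>2 = exp (- 4 * pi * (q * v + of_int r * y))"
      by (simp add: power2_eq_square algebra_simps flip: exp_add)
    ultimately show ?thesis by (simp only: power_mult_distrib q_def)
  qed
  have hs: "((\<lambda>(m, r). a m r * ee (of_int m * of_real s + of_int r * of_real x)) has_sum g s x) UNIV" for s x :: real
  proof -
    have "b m r * ee (of_int m / of_nat w * Complex (real w * s) v + of_int r * Complex x y) = a m r * ee (of_int m * of_real s + of_int r * of_real x)" for m r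
    proof -
      have "of_int m / of_nat w * Complex (real w * s) v + of_int r * Complex x y
        = (of_int m / of_nat w * (\<i> * of_real v) + of_int r * (\<i> * of_real y)) + (of_int m * of_real s + of_int r * of_real x)"
        using w by (simp add: Complex_eq field_simps)
      then show ?thesis by (simp only: a_def ee_add mult.assoc)
    qed
    then show ?thesis using expansion[of "Complex (real w * s) v" "Complex x y"] v by (simp add: g_def case_prod_beta')
  qed
  have sa: "(\<lambda>(m, r). norm (a m r)) summable_on UNIV"
  proof -
    have "(\<lambda>p. norm (case p of (m, r) \<Rightarrow> a m r * ee (of_int m * of_real 0 + of_int r * of_real 0))) summable_on UNIV"
      using hs[of 0 0] summable_on_iff_abs_summable_on_complex has_sum_imp_summable by blast
    then show ?thesis by (simp add: case_prod_beta')
  qed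
  let ?F = "\<lambda>u. \<integral>\<^sup>+x. ennreal ((cmod (f (Complex u v, Complex x y)))\<^sup>2) * indicator {0..<real w} u * indicator {0..<1} x \<partial>lborel"
  have mF: "?F \<in> borel_measurable borel" by measurable
  have "ennreal (\<Sum>(m, r)\<in>T. (cmod (a m r))\<^sup>2) \<le>
     (\<integral>\<^sup>+s. (\<integral>\<^sup>+x. ennreal ((cmod (g s x))\<^sup>2) * indicator {0..<1} x \<partial>lborel) * indicator {0..<1} s \<partial>lborel)"
    by (rule bessel2[OF sa hs T])
  also have "\<dots> = (\<integral>\<^sup>+s. ?F (0 + real w * s) \<partial>lborel)"
  proof (rule nn_integral_cong)
    fix s :: real
    have "indicator {0..<real w} (real w * s) = (indicator {0..<1} s :: ennreal)"
      using w by (auto simp: indicator_def zero_le_mult_iff)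
    then show "(\<integral>\<^sup>+x. ennreal ((cmod (g s x))\<^sup>2) * indicator {0..<1} x \<partial>lborel) * indicator {0..<1} s = ?F (0 + real w * s)"
      by (auto simp: g_def indicator_def)
  qed
  finally have "ennreal (real w) * ennreal (\<Sum>(m, r)\<in>T. (cmod (a m r))\<^sup>2) \<le> ennreal (real w) * (\<integral>\<^sup>+s. ?F (0 + real w * s) \<partial>lborel)"
    by (rule mult_left_mono) simp
  also have "\<dots> = (\<integral>\<^sup>+u. ?F u \<partial>lborel)"
    using nn_integral_real_affine[OF mF, of "real w" 0] w by simp
  finally show ?thesis
    unfolding na[symmetric] by (subst ennreal_mult) (auto intro!: sum_nonneg)
qed

lemma weight_le_integral:
  assumes r: "r = 0 \<or> r = - 1" and D: "disc m r > 0"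
  shows "ennreal (weight (disc m r)) \<le> (\<integral>\<^sup>+v. \<integral>\<^sup>+y. indicator {1/2<..} v * indicator {0..<v} y *
    ennreal (v powr (real k - 3) * exp (- 4 * pi * y\<^sup>2 / v) * real w * exp (- 4 * pi * (of_int m / real w * v + of_int r * y))) \<partial>lborel \<partial>lborel)"
proof -
  define d where "d = disc m r"
  have d0: "d > 0" using D by (simp add: d_def)
  define I where "I = {1/2 + 1/d..1/2 + 2/d}"
  let ?G = "\<lambda>v y. v powr (real k - 3) * exp (- 4 * pi * y\<^sup>2 / v) * real w * exp (- 4 * pi * (of_int m / real w * v + of_int r * y))"
  define c where "c = exp (- pi * d / 2) * exp (- 3 * pi) / 4 * real w * d powr (5/2 - real k)"
  have inner: "ennreal c * indicator I v \<le> (\<integral>\<^sup>+y. indicator {1/2<..} v * indicator {0..<v} y * ennreal (?G v y) \<partial>lborel)" for v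
  proof (cases "v \<in> I")
    case True
    then have vI: "1/2 + 1/d \<le> v" "v \<le> 1/2 + 2/d" by (auto simp: I_def)
    have "1/d > 0" using d0 by simp
    then have v: "v > 1/2" "v \<ge> 1/d" "v \<le> 1/2 + 2/d" using vI by linarith+
    define y0 where "y0 = - real_of_int r * v / 2"
    define h where "h = sqrt v / 4"
    have h: "h > 0" using v by (simp add: h_def)
    have hv: "h < v / 2"
    proof -
      have "sqrt v < 2 * v"
      proof (rule real_less_lsqrt)
        have "v * 1 < v * (4 * v)" using v by (intro mult_strict_left_mono) auto
        then show "v < (2 * v)\<^sup>2" by (simp add: power2_eq_square)
      qed (use v in auto)
      then show ?thesis by (simp add: h_def)
    qed
    have lb: "v powr (real k - 3) * real w * exp (- pi * d * v) * exp (- pi) \<le> ?G v y" if y: "y \<in> {y0..y0 + h}" for y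
    proof -
      have "- 4 * pi * y\<^sup>2 / v + - 4 * pi * (of_int m / real w * v + of_int r * y) = - pi * d * v + - 4 * pi * ((y - y0)\<^sup>2 / v)"
        using v w unfolding d_def disc_def y0_def by (simp add: field_simps power2_eq_square)
      moreover have "(y - y0)\<^sup>2 / v \<le> 1/4"
      proof -
        have "(y - y0)\<^sup>2 \<le> h\<^sup>2" using y by (intro power_mono) auto
        also have "h\<^sup>2 = v / 16" using v by (simp add: h_def power_divide)
        finally show ?thesis using v by (simp add: field_simps)
      qed
      ultimately have "- pi * d * v + - pi \<le> - 4 * pi * y\<^sup>2 / v + - 4 * pi * (of_int m / real w * v + of_int r * y)"
        using mult_left_mono[of "(y - y0)\<^sup>2 / v" "1/4" "4 * pi"] by simp
      then have "exp (- pi * d * v) * exp (- pi) \<le> exp (- 4 * pi * y\<^sup>2 / v) * exp (- 4 * pi * (of_int m / real w * v + of_int r * y))"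
        by (simp only: exp_add[symmetric] exp_le_cancel_iff)
      then have "(v powr (real k - 3) * real w) * (exp (- pi * d * v) * exp (- pi)) \<le> (v powr (real k - 3) * real w) * (exp (- 4 * pi * y\<^sup>2 / v) * exp (- 4 * pi * (of_int m / real w * v + of_int r * y)))"
        by (intro mult_left_mono) auto
      then show ?thesis by (simp only: mult_ac)
    qed
    have sub: "{y0..y0 + h} \<subseteq> {0..<v}" using r hv h v by (auto simp: y0_def)
    have "c \<le> v powr (real k - 3) * real w * exp (- pi * d * v) * exp (- pi) * h"
    proof -
      have "v powr (real k - 3) * h = v powr (real k - 5/2) / 4"
        using v powr_add[of v "real k - 3" "1/2"] by (simp add: h_def powr_half_sqrt)
      moreover have "(1/d) powr (real k - 5/2) \<le> v powr (real k - 5/2)"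
        using v d0 k by (intro powr_mono2) auto
      moreover have "(1/d) powr (real k - 5/2) = d powr (5/2 - real k)"
        using d0 powr_minus_divide[of d "real k - 5/2"] by (simp add: powr_divide)
      ultimately have 1: "d powr (5/2 - real k) / 4 \<le> v powr (real k - 3) * h" by simp
      have "d * v \<le> d / 2 + 2" using v(3) d0 mult_left_mono[of v "1/2 + 2/d" d] by (simp add: field_simps)
      then have "- pi * d / 2 + - 3 * pi \<le> - pi * d * v + - pi"
        using mult_left_mono[of "d * v" "d / 2 + 2" pi] by (simp add: algebra_simps)
      then have 2: "exp (- pi * d / 2) * exp (- 3 * pi) \<le> exp (- pi * d * v) * exp (- pi)"
        by (simp only: exp_add[symmetric] exp_le_cancel_iff)
      have "(exp (- pi * d / 2) * exp (- 3 * pi)) * (d powr (5/2 - real k) / 4) \<le> (exp (- pi * d * v) * exp (- pi)) * (v powr (real k - 3) * h)"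
        by (rule mult_mono[OF 2 1]) auto
      from mult_left_mono[OF this, of "real w"] show ?thesis by (simp add: c_def mult_ac)
    qed
    then have "ennreal c * indicator I v \<le> ennreal (v powr (real k - 3) * real w * exp (- pi * d * v) * exp (- pi) * h)"
      using True by (simp add: ennreal_leI)
    also have "\<dots> = ennreal (v powr (real k - 3) * real w * exp (- pi * d * v) * exp (- pi)) * emeasure lborel {y0..y0 + h}"
      using h by (simp add: ennreal_mult)
    also have "\<dots> = (\<integral>\<^sup>+y. ennreal (v powr (real k - 3) * real w * exp (- pi * d * v) * exp (- pi)) * indicator {y0..y0 + h} y \<partial>lborel)"
      by (simp add: nn_integral_cmult)
    also have "\<dots> \<le> (\<integral>\<^sup>+y. indicator {1/2<..} v * indicator {0..<v} y * ennreal (?G v y) \<partial>lborel)"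
    proof (rule nn_integral_mono)
      fix y
      show "ennreal (v powr (real k - 3) * real w * exp (- pi * d * v) * exp (- pi)) * indicator {y0..y0 + h} y \<le> indicator {1/2<..} v * indicator {0..<v} y * ennreal (?G v y)"
        using lb[of y] v sub by (cases "y \<in> {y0..y0 + h}") (auto intro: ennreal_leI)
    qed
    finally show ?thesis .
  qed simp
  have "weight d = c * (1 / d)"
  proof -
    have "d powr (3/2 - real k) = d powr (5/2 - real k) * (1 / d)"
      using d0 powr_add[of d "5/2 - real k" "- 1"] by (simp add: powr_minus_divide)
    then show ?thesis by (simp add: weight_def c_def siegel_const_def)
  qed
  moreover have "emeasure lborel I = ennreal (1 / d)"
  proof -
    have "1 / d \<le> 2 / d" using d0 by (intro divide_right_mono) auto
    moreover have "(1/2 + 2/d) - (1/2 + 1/d) = 1 / d" by (simp add: diff_divide_distrib[symmetric])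
    ultimately show ?thesis unfolding I_def by (subst emeasure_lborel_Icc) simp_all
  qed
  moreover have "c \<ge> 0" by (simp add: c_def)
  ultimately have "ennreal (weight d) = ennreal c * emeasure lborel I"
    using d0 by (simp only: ennreal_mult divide_nonneg_pos zero_le_one less_imp_le)
  also have "\<dots> = (\<integral>\<^sup>+v. ennreal c * indicator I v \<partial>lborel)" by (simp add: nn_integral_cmult I_def)
  also have "\<dots> \<le> (\<integral>\<^sup>+v. \<integral>\<^sup>+y. indicator {1/2<..} v * indicator {0..<v} y * ennreal (?G v y) \<partial>lborel \<partial>lborel)"
    by (rule nn_integral_mono) (rule inner)
  finally show ?thesis by (simp add: d_def)
qed

lemma siegel_integral_ge:
  assumes T: "finite T" "T \<subseteq> red"
  shows "ennreal (\<Sum>(m, r)\<in>T. (cmod (b m r))\<^sup>2 * weight (disc m r)) \<le>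
    (\<integral>\<^sup>+p. indicator (siegel w) p * ennreal ((jacobi_tilde k 1 f p)\<^sup>2) \<partial>jmeas)"
proof -
  let ?E = "\<lambda>v y p. real w * ((cmod (b (fst p) (snd p)))\<^sup>2 * exp (- 4 * pi * (of_int (fst p) / real w * v + of_int (snd p) * y)))"
  let ?c = "\<lambda>v y. indicator {1/2<..} v * indicator {0..<v} y * ennreal (v powr (real k - 3) * exp (- 4 * pi * y\<^sup>2 / v)) :: ennreal"
  have mt [measurable]: "jacobi_tilde k 1 f \<in> borel_measurable borel"
    unfolding jacobi_tilde_def case_prod_beta' by measurable
  have wn: "weight D \<ge> 0" for D by (simp add: weight_def siegel_const_def)
  have "ennreal (\<Sum>(m, r)\<in>T. (cmod (b m r))\<^sup>2 * weight (disc m r)) = (\<Sum>(m, r)\<in>T. ennreal ((cmod (b m r))\<^sup>2) * ennreal (weight (disc m r)))"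
    by (subst sum_ennreal[symmetric]) (auto intro!: sum.cong mult_nonneg_nonneg wn simp: ennreal_mult wn)
  also have "\<dots> \<le> (\<Sum>(m, r)\<in>T. ennreal ((cmod (b m r))\<^sup>2) * (\<integral>\<^sup>+v. \<integral>\<^sup>+y. indicator {1/2<..} v * indicator {0..<v} y *
    ennreal (v powr (real k - 3) * exp (- 4 * pi * y\<^sup>2 / v) * real w * exp (- 4 * pi * (of_int m / real w * v + of_int r * y))) \<partial>lborel \<partial>lborel))"
  proof (rule sum_mono)
    fix p assume p: "p \<in> T"
    obtain m r where pe: "p = (m, r)" by (cases p)
    have "r = 0 \<or> r = - 1" "disc m r > 0" using T p pe by (auto simp: red_def)
    from weight_le_integral[OF this]
    have "ennreal ((cmod (b m r))\<^sup>2) * ennreal (weight (disc m r)) \<le> ennreal ((cmod (b m r))\<^sup>2) * (\<integral>\<^sup>+v. \<integral>\<^sup>+y. indicator {1/2<..} v * indicator {0..<v} y *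
    ennreal (v powr (real k - 3) * exp (- 4 * pi * y\<^sup>2 / v) * real w * exp (- 4 * pi * (of_int m / real w * v + of_int r * y))) \<partial>lborel \<partial>lborel)"
      by (rule mult_left_mono) simp
    then show "(case p of (m, r) \<Rightarrow> ennreal ((cmod (b m r))\<^sup>2) * ennreal (weight (disc m r))) \<le> (case p of (m, r) \<Rightarrow> ennreal ((cmod (b m r))\<^sup>2) * (\<integral>\<^sup>+v. \<integral>\<^sup>+y. indicator {1/2<..} v * indicator {0..<v} y *
    ennreal (v powr (real k - 3) * exp (- 4 * pi * y\<^sup>2 / v) * real w * exp (- 4 * pi * (of_int m / real w * v + of_int r * y))) \<partial>lborel \<partial>lborel))"
      unfolding pe by simp
  qed
  also have "\<dots> = (\<Sum>(m, r)\<in>T. \<integral>\<^sup>+v. \<integral>\<^sup>+y. ?c v y * ennreal (?E v y (m, r)) \<partial>lborel \<partial>lborel)"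
  proof -
    have eq: "?c v y * ennreal (?E v y (m, r)) = ennreal ((cmod (b m r))\<^sup>2) * (indicator {1/2<..} v * indicator {0..<v} y *
      ennreal (v powr (real k - 3) * exp (- 4 * pi * y\<^sup>2 / v) * real w * exp (- 4 * pi * (of_int m / real w * v + of_int r * y))))" for v y m r
      by (auto simp: indicator_def mult_ac simp flip: ennreal_mult)
    have i: "(\<integral>\<^sup>+y. ?c v y * ennreal (?E v y (m, r)) \<partial>lborel) = ennreal ((cmod (b m r))\<^sup>2) * (\<integral>\<^sup>+y. indicator {1/2<..} v * indicator {0..<v} y *
      ennreal (v powr (real k - 3) * exp (- 4 * pi * y\<^sup>2 / v) * real w * exp (- 4 * pi * (of_int m / real w * v + of_int r * y))) \<partial>lborel)" for v m r
      unfolding eq by (rule nn_integral_cmult) measurable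
    have "ennreal ((cmod (b m r))\<^sup>2) * (\<integral>\<^sup>+v. \<integral>\<^sup>+y. indicator {1/2<..} v * indicator {0..<v} y *
      ennreal (v powr (real k - 3) * exp (- 4 * pi * y\<^sup>2 / v) * real w * exp (- 4 * pi * (of_int m / real w * v + of_int r * y))) \<partial>lborel \<partial>lborel)
      = (\<integral>\<^sup>+v. \<integral>\<^sup>+y. ?c v y * ennreal (?E v y (m, r)) \<partial>lborel \<partial>lborel)" for m r
      unfolding i by (rule nn_integral_cmult[symmetric]) (unfold atLeastLessThan_iff indicator_def, measurable)
    then show ?thesis by (simp only:)
  qed
  also have "\<dots> = (\<integral>\<^sup>+v. \<integral>\<^sup>+y. (\<Sum>p\<in>T. ?c v y * ennreal (?E v y p)) \<partial>lborel \<partial>lborel)"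
  proof -
    have m1: "(\<lambda>y. ?c v y * ennreal (?E v y p)) \<in> borel_measurable lborel" for v p
      by (unfold atLeastLessThan_iff indicator_def, measurable)
    have m2: "(\<lambda>v. \<integral>\<^sup>+y. ?c v y * ennreal (?E v y p) \<partial>lborel) \<in> borel_measurable lborel" for p
      by (unfold atLeastLessThan_iff indicator_def, measurable)
    have "(\<integral>\<^sup>+v. \<integral>\<^sup>+y. (\<Sum>p\<in>T. ?c v y * ennreal (?E v y p)) \<partial>lborel \<partial>lborel)
      = (\<integral>\<^sup>+v. (\<Sum>p\<in>T. \<integral>\<^sup>+y. ?c v y * ennreal (?E v y p) \<partial>lborel) \<partial>lborel)"
      by (rule nn_integral_cong, rule nn_integral_sum) (rule m1)
    also have "\<dots> = (\<Sum>p\<in>T. \<integral>\<^sup>+v. \<integral>\<^sup>+y. ?c v y * ennreal (?E v y p) \<partial>lborel \<partial>lborel)"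
      by (rule nn_integral_sum) (rule m2)
    finally show ?thesis by (simp add: case_prod_beta')
  qed
  also have "\<dots> \<le> (\<integral>\<^sup>+v. \<integral>\<^sup>+y. \<integral>\<^sup>+u. \<integral>\<^sup>+x.
     indicator {0<..} v * ennreal (1 / v ^ 3) * (indicator (siegel w) (Complex u v, Complex x y) * ennreal ((jacobi_tilde k 1 f (Complex u v, Complex x y))\<^sup>2)) \<partial>lborel \<partial>lborel \<partial>lborel \<partial>lborel)"
  proof (intro nn_integral_mono)
    fix v y :: real
    show "(\<Sum>p\<in>T. ?c v y * ennreal (?E v y p)) \<le> (\<integral>\<^sup>+u. \<integral>\<^sup>+x.
     indicator {0<..} v * ennreal (1 / v ^ 3) * (indicator (siegel w) (Complex u v, Complex x y) * ennreal ((jacobi_tilde k 1 f (Complex u v, Complex x y))\<^sup>2)) \<partial>lborel \<partial>lborel)"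
    proof (cases "v > 1/2 \<and> 0 \<le> y \<and> y < v")
      case True
      let ?C = "ennreal (v powr (real k - 3) * exp (- 4 * pi * y\<^sup>2 / v))"
      have "(\<Sum>p\<in>T. ?c v y * ennreal (?E v y p)) = ?C * (\<Sum>p\<in>T. ennreal (?E v y p))"
        using True by (simp add: sum_distrib_left del: sum_ennreal)
      also have "(\<Sum>p\<in>T. ennreal (?E v y p)) = ennreal (\<Sum>p\<in>T. ?E v y p)"
        by (intro sum_ennreal) auto
      also have "(\<Sum>p\<in>T. ?E v y p) = real w * (\<Sum>(m, r)\<in>T. (cmod (b m r))\<^sup>2 * exp (- 4 * pi * (of_int m / real w * v + of_int r * y)))"
        by (simp add: sum_distrib_left case_prod_beta')
      also have "?C * ennreal \<dots> \<le> ?C * (\<integral>\<^sup>+u. \<integral>\<^sup>+x. ennreal ((cmod (f (Complex u v, Complex x y)))\<^sup>2) * indicator {0..<real w} u * indicator {0..<1} x \<partial>lborel \<partial>lborel)"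
        using True T by (intro mult_left_mono bessel_fibre) auto
      also have "\<dots> = (\<integral>\<^sup>+u. \<integral>\<^sup>+x. ?C * (ennreal ((cmod (f (Complex u v, Complex x y)))\<^sup>2) * indicator {0..<real w} u * indicator {0..<1} x) \<partial>lborel \<partial>lborel)"
      proof -
        have "(\<integral>\<^sup>+x. ?C * (ennreal ((cmod (f (Complex u v, Complex x y)))\<^sup>2) * indicator {0..<real w} u * indicator {0..<1} x) \<partial>lborel)
           = ?C * (\<integral>\<^sup>+x. ennreal ((cmod (f (Complex u v, Complex x y)))\<^sup>2) * indicator {0..<real w} u * indicator {0..<1} x \<partial>lborel)" for u
          by (rule nn_integral_cmult) measurable
        moreover have "(\<integral>\<^sup>+u. ?C * (\<integral>\<^sup>+x. ennreal ((cmod (f (Complex u v, Complex x y)))\<^sup>2) * indicator {0..<real w} u * indicator {0..<1} x \<partial>lborel) \<partial>lborel)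
           = ?C * (\<integral>\<^sup>+u. \<integral>\<^sup>+x. ennreal ((cmod (f (Complex u v, Complex x y)))\<^sup>2) * indicator {0..<real w} u * indicator {0..<1} x \<partial>lborel \<partial>lborel)"
          by (rule nn_integral_cmult) measurable
        ultimately show ?thesis by (simp only:)
      qed
      also have "\<dots> = (\<integral>\<^sup>+u. \<integral>\<^sup>+x.
         indicator {0<..} v * ennreal (1 / v ^ 3) * (indicator (siegel w) (Complex u v, Complex x y) * ennreal ((jacobi_tilde k 1 f (Complex u v, Complex x y))\<^sup>2)) \<partial>lborel \<partial>lborel)"
      proof (intro nn_integral_cong)
        fix u x :: real
        have "(v powr (real k / 2))\<^sup>2 / v ^ 3 = v powr (real k - 3)"
          using True by (simp add: power2_eq_square powr_diff powr_realpow flip: powr_add)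
        moreover have "(exp (- 2 * pi * y\<^sup>2 / v))\<^sup>2 = exp (- 4 * pi * y\<^sup>2 / v)"
          by (simp add: power2_eq_square flip: exp_add)
        moreover have "1 / v ^ 3 * (jacobi_tilde k 1 f (Complex u v, Complex x y))\<^sup>2
          = (v powr (real k / 2))\<^sup>2 / v ^ 3 * (exp (- 2 * pi * y\<^sup>2 / v))\<^sup>2 * (cmod (f (Complex u v, Complex x y)))\<^sup>2"
          by (simp add: jacobi_tilde_def power_mult_distrib)
        ultimately have e: "1 / v ^ 3 * (jacobi_tilde k 1 f (Complex u v, Complex x y))\<^sup>2 = v powr (real k - 3) * exp (- 4 * pi * y\<^sup>2 / v) * (cmod (f (Complex u v, Complex x y)))\<^sup>2"
          by (simp only:)
        show "?C * (ennreal ((cmod (f (Complex u v, Complex x y)))\<^sup>2) * indicator {0..<real w} u * indicator {0..<1} x) =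
          indicator {0<..} v * ennreal (1 / v ^ 3) * (indicator (siegel w) (Complex u v, Complex x y) * ennreal ((jacobi_tilde k 1 f (Complex u v, Complex x y))\<^sup>2))"
          using True e by (auto simp: siegel_def indicator_def simp flip: ennreal_mult)
      qed
      finally show ?thesis .
    qed (auto simp: indicator_def)
  qed
  also have "\<dots> = (\<integral>\<^sup>+p. indicator (siegel w) p * ennreal ((jacobi_tilde k 1 f p)\<^sup>2) \<partial>jmeas)"
    by (rule nn_integral_jmeas_real[symmetric]) measurable
  finally show ?thesis .
qed

end

lemma has_sum_diff:
  fixes f g :: "'a \<Rightarrow> complex"
  assumes "(f has_sum a) A" "(g has_sum b) A"
  shows "((\<lambda>x. f x - g x) has_sum (a - b)) A"
  using has_sum_add[OF assms(1) has_sum_cmult_right[OF assms(2), of "- 1"]] by simp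

lemma expansion_unique:
  fixes a :: "int \<Rightarrow> int \<Rightarrow> complex"
  assumes N: "N > 0"
    and s: "\<And>\<tau> z. Im \<tau> > 0 \<Longrightarrow> ((\<lambda>(n, r). a n r * ee (of_int n / of_nat N * \<tau> + of_int r * z)) has_sum 0) UNIV"
  shows "a n r = 0"
proof -
  define a' where "a' = (\<lambda>n r. a n r * ee (of_int n * \<i>))"
  have hs: "((\<lambda>(n, r). a' n r * ee (of_int n * of_real s + of_int r * of_real x)) has_sum 0) UNIV" for s x :: real
  proof -
    have "a n r * ee (of_int n / of_nat N * (of_nat N * (of_real s + \<i>)) + of_int r * of_real x) = a' n r * ee (of_int n * of_real s + of_int r * of_real x)" for n r
      using N by (simp add: a'_def ee_add distrib_left mult_ac)
    moreover have "Im (of_nat N * (of_real s + \<i>)) > 0" using N by simp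
    ultimately show ?thesis using s[of "of_nat N * (of_real s + \<i>)" "of_real x"] by (simp add: case_prod_beta')
  qed
  have sa: "(\<lambda>(n, r). norm (a' n r)) summable_on UNIV"
  proof -
    have "(\<lambda>p. norm (case p of (n, r) \<Rightarrow> a' n r * ee (of_int n * of_real 0 + of_int r * of_real 0))) summable_on UNIV"
      using hs[of 0 0] summable_on_iff_abs_summable_on_complex has_sum_imp_summable by blast
    then show ?thesis by (simp add: case_prod_beta')
  qed
  have "ennreal ((cmod (a' n r))\<^sup>2) \<le> 0" using bessel2[OF sa hs, of "{(n, r)}"] by simp
  then show ?thesis by (simp add: a'_def)
qed

lemma borel_measurable_jacobi_form:
  assumes "holomorphic2_on \<phi> jacobi_domain" "\<And>p. Im (fst p) \<le> 0 \<Longrightarrow> \<phi> p = 0"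
  shows "\<phi> \<in> borel_measurable borel"
proof -
  have "(\<lambda>p. indicator jacobi_domain p *\<^sub>R \<phi> p) \<in> borel_measurable borel"
    using holomorphic2_imp_continuous_on[OF assms(1)] open_jacobi_domain
    by (intro borel_measurable_continuous_on_indicator) auto
  moreover have "indicator jacobi_domain p *\<^sub>R \<phi> p = \<phi> p" for p
    using assms(2)[of p] by (cases p) (auto simp: indicator_def)
  ultimately show ?thesis by simp
qed

lemma borel_measurable_slash:
  assumes [measurable]: "\<phi> \<in> borel_measurable borel"
  shows "slash k m \<phi> A \<in> borel_measurable borel"
proof -
  have [measurable]: "ee \<in> borel_measurable borel" unfolding ee_def[abs_def] by measurable
  have [measurable]: "mob_den A \<in> borel_measurable borel" unfolding mob_den_def[abs_def] by measurable
  have "slash k m \<phi> A = (\<lambda>p. ee (- of_nat m * of_int (A $ 2 $ 1) * snd p ^ 2 / mob_den A (fst p)) / mob_den A (fst p) ^ k * \<phi> (jact (A, 0, 0) p))"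
    by (auto simp: slash_def jact_def)
  also have "\<dots> \<in> borel_measurable borel" by measurable
  finally show ?thesis .
qed

lemma slash_cong:
  "A \<in> SL2Z \<Longrightarrow> p \<in> jacobi_domain \<Longrightarrow> (\<And>q. q \<in> jacobi_domain \<Longrightarrow> \<phi> q = \<psi> q) \<Longrightarrow> slash k m \<phi> A p = slash k m \<psi> A p"
  using jacobi_act_domain[of A p 0 0] by (cases p) (auto simp: slash_def)

lemma slash_trans2:
  "slash k m \<phi> (trans2 j) (\<tau>, z) = \<phi> (\<tau> + of_int j, z)"
  by (simp add: slash_def jacobi_act_def trans2_def mob_num_def mob_den_def)

lemma cusp_series_slash:
  assumes \<phi>: "\<phi> \<in> jacobi_cusp_forms k 1 N" and A: "A \<in> SL2Z" and N: "N > 0" and k: "k \<ge> 3"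
  obtains b where "cusp_series k (width N A) (slash k 1 \<phi> A) b"
proof -
  define w where "w = width N A"
  let ?f = "slash k 1 \<phi> A"
  obtain h where Nh: "N = w * h" using width_dvd[OF N, of A] by (auto simp: w_def)
  have w0: "w > 0" "h > 0" using N Nh by (metis gr0I mult_is_0 less_irrefl)+
  obtain a where supp: "\<And>n r. a n r \<noteq> 0 \<Longrightarrow> real_of_int (r ^ 2) < 4 * real 1 * (real_of_int n / real N)"
    and ex: "\<And>\<tau> z. Im \<tau> > 0 \<Longrightarrow> ((\<lambda>(n, r). a n r * ee (of_int n / of_nat N * \<tau> + of_int r * z)) has_sum ?f (\<tau>, z)) UNIV"
  proof -
    have "\<forall>A\<in>SL2Z. \<exists>a :: int \<Rightarrow> int \<Rightarrow> complex.
        (\<forall>n r. a n r \<noteq> 0 \<longrightarrow> real_of_int (r ^ 2) < 4 * real 1 * (real_of_int n / real N)) \<and>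
        (\<forall>\<tau>\<in>upper_half_plane. \<forall>z.
           ((\<lambda>(n, r). a n r * ee (of_int n / of_nat N * \<tau> + of_int r * z))
              has_sum slash k 1 \<phi> A (\<tau>, z)) UNIV)"
      using \<phi> unfolding jacobi_cusp_forms_def mem_Collect_eq by (elim conjE)
    from bspec[OF this A] obtain a :: "int \<Rightarrow> int \<Rightarrow> complex" where a:
        "\<forall>n r. a n r \<noteq> 0 \<longrightarrow> real_of_int (r ^ 2) < 4 * real 1 * (real_of_int n / real N)"
        "\<forall>\<tau>\<in>upper_half_plane. \<forall>z.
           ((\<lambda>(n, r). a n r * ee (of_int n / of_nat N * \<tau> + of_int r * z))
              has_sum slash k 1 \<phi> A (\<tau>, z)) UNIV" by (elim exE conjE)
    show ?thesis
    proof (rule that)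
      show "real_of_int (r ^ 2) < 4 * real 1 * (real_of_int n / real N)" if "a n r \<noteq> 0" for n r
        using a(1) that by blast
      show "((\<lambda>(n, r). a n r * ee (of_int n / of_nat N * \<tau> + of_int r * z)) has_sum ?f (\<tau>, z)) UNIV" if "Im \<tau> > 0" for \<tau> z
        using a(2) that by simp
    qed
  qed
  have inv: "slash k 1 \<phi> G p = \<phi> p" if "G \<in> Gamma0 N" "p \<in> jacobi_domain" for G p
    using jacobi_cusp_formsD(3)[OF \<phi> that] .
  have per: "?f (\<tau> + of_nat w, z) = ?f (\<tau>, z)" if t: "Im \<tau> > 0" for \<tau> z
  proof -
    have G: "A ** trans2 (int w) ** inv2 A \<in> Gamma0 N" using width_iff[OF A N] by (simp add: w_def)
    have p: "(\<tau>, z) \<in> jacobi_domain" using t by simp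
    have "?f (\<tau> + of_nat w, z) = slash k 1 ?f (trans2 (int w)) (\<tau>, z)" by (simp add: slash_trans2)
    also have "\<dots> = slash k 1 \<phi> (A ** trans2 (int w)) (\<tau>, z)" by (rule slash_mult[OF A trans2_SL2Z p])
    also have "A ** trans2 (int w) = (A ** trans2 (int w) ** inv2 A) ** A"
      using inv2_mult[OF A] by (simp flip: matrix_mul_assoc)
    also have "slash k 1 \<phi> \<dots> (\<tau>, z) = slash k 1 (slash k 1 \<phi> (A ** trans2 (int w) ** inv2 A)) A (\<tau>, z)"
      using slash_mult[OF Gamma0_SL2Z[OF G] A p] by simp
    also have "\<dots> = ?f (\<tau>, z)" by (rule slash_cong[OF A p inv[OF G]])
    finally show ?thesis .
  qed
  have hdvd: "int h dvd n" if "a n r \<noteq> 0" for n r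
  proof -
    have "(\<lambda>n r. a n r * ee (of_int n / of_nat h) - a n r) n r = 0"
    proof (rule expansion_unique[OF N])
      fix \<tau> z assume t: "Im \<tau> > 0"
      have "((\<lambda>(n, r). a n r * ee (of_int n / of_nat N * (\<tau> + of_nat w) + of_int r * z)) has_sum ?f (\<tau>, z)) UNIV"
        using ex[of "\<tau> + of_nat w" z] t per[OF t] by simp
      from has_sum_diff[OF this ex[OF t, of z]]
      have "((\<lambda>(n, r). a n r * ee (of_int n / of_nat N * (\<tau> + of_nat w) + of_int r * z) - a n r * ee (of_int n / of_nat N * \<tau> + of_int r * z)) has_sum 0) UNIV"
        by (simp add: case_prod_beta')
      moreover have "a n r * ee (of_int n / of_nat N * (\<tau> + of_nat w) + of_int r * z) - a n r * ee (of_int n / of_nat N * \<tau> + of_int r * z)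
        = (a n r * ee (of_int n / of_nat h) - a n r) * ee (of_int n / of_nat N * \<tau> + of_int r * z)" for n r
      proof -
        have "of_int n / of_nat N * of_nat w = (of_int n / of_nat h :: complex)"
          using w0 unfolding Nh by (simp add: field_simps)
        then have arg: "of_int n / of_nat N * (\<tau> + of_nat w) + of_int r * z = (of_int n / of_nat N * \<tau> + of_int r * z) + of_int n / of_nat h"
          by (simp only: distrib_left add_ac)
        show ?thesis unfolding arg ee_add[of "of_int n / of_nat N * \<tau> + of_int r * z" "of_int n / of_nat h"]
          by (simp add: algebra_simps)
      qed
      ultimately show "((\<lambda>(n, r). (a n r * ee (of_int n / of_nat h) - a n r) * ee (of_int n / of_nat N * \<tau> + of_int r * z)) has_sum 0) UNIV"
        by (simp only:)
    qed
    then have "ee (of_int n / of_nat h) = 1" using that by simp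
    then obtain m where "of_int n / of_nat h = complex_of_int m" using ee_eq_1_iff by blast
    then have "complex_of_int n = of_int (m * int h)" using w0 by (simp add: field_simps)
    then have "n = m * int h" by (simp only: of_int_eq_iff)
    then show ?thesis by simp
  qed
  define b where "b = (\<lambda>m r. a (int h * m) r)"
  have lat: "lattice_inv ?f" by (rule lattice_inv_slash[OF jacobi_cusp_formsD(4)[OF \<phi>] A])
  have expb: "((\<lambda>(m, r). b m r * ee (of_int m / of_nat w * \<tau> + of_int r * z)) has_sum ?f (\<tau>, z)) UNIV" if t: "Im \<tau> > 0" for \<tau> z
  proof -
    let ?g = "\<lambda>(m :: int, r :: int). (int h * m, r)"
    let ?t = "\<lambda>(n, r). a n r * ee (of_int n / of_nat N * \<tau> + of_int r * z)"
    have "inj ?g" using w0 by (auto simp: inj_def)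
    moreover have "(?t has_sum ?f (\<tau>, z)) (range ?g)"
    proof -
      have z: "?t p = 0" if "p \<notin> range ?g" for p
      proof -
        obtain n r where p: "p = (n, r)" by (cases p)
        have "a n r = 0"
        proof (rule ccontr)
          assume "a n r \<noteq> 0"
          then obtain m where "n = int h * m" using hdvd by blast
          then have "p = ?g (m, r)" by (simp add: p)
          then show False using that by blast
        qed
        then show ?thesis by (simp add: p)
      qed
      show ?thesis
        using ex[OF t, of z] by (rule has_sum_cong_neutral[THEN iffD1, rotated -1]) (use z in auto)
    qed
    ultimately have "(?t \<circ> ?g has_sum ?f (\<tau>, z)) UNIV" by (subst (asm) has_sum_reindex) auto
    moreover have "(?t \<circ> ?g) = (\<lambda>(m, r). b m r * ee (of_int m / of_nat w * \<tau> + of_int r * z))"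
    proof
      fix p
      have "of_int (int h * m) / of_nat N = (of_int m / of_nat w :: complex)" for m
        using w0 unfolding Nh by (simp add: field_simps)
      then show "(?t \<circ> ?g) p = (case p of (m, r) \<Rightarrow> b m r * ee (of_int m / of_nat w * \<tau> + of_int r * z))"
        by (cases p) (simp only: o_apply prod.case b_def)
    qed
    ultimately show ?thesis by simp
  qed
  have shift: "b (m - int w * (r * l - l ^ 2)) (r - 2 * l) = b m r" for m r l
  proof -
    have "(\<lambda>m r. b (m - int w * (r * l - l ^ 2)) (r - 2 * l) - b m r) m r = 0"
    proof (rule expansion_unique[OF w0(1)])
      fix \<tau> z assume t: "Im \<tau> > 0"
      let ?t = "\<lambda>(m, r). b m r * ee (of_int m / of_nat w * (\<tau>) + of_int r * (z + of_int l * \<tau>))"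
      have "((\<lambda>p. ee (of_int l ^ 2 * \<tau> + 2 * of_int l * z) * ?t p) has_sum (ee (of_int l ^ 2 * \<tau> + 2 * of_int l * z) * ?f (\<tau>, z + of_int l * \<tau>))) UNIV"
        by (rule has_sum_cmult_right[OF expb[OF t]])
      moreover have "ee (of_int l ^ 2 * \<tau> + 2 * of_int l * z) * ?f (\<tau>, z + of_int l * \<tau>) = ?f (\<tau>, z)"
        using lat t unfolding lattice_inv_def by (metis add.right_neutral of_int_0)
      ultimately have 1: "((\<lambda>p. ee (of_int l ^ 2 * \<tau> + 2 * of_int l * z) * ?t p) has_sum ?f (\<tau>, z)) UNIV" by simp
      let ?g = "\<lambda>(m, r). (m - int w * (r * l - l ^ 2), r - 2 * l)"
      have "bij ?g"
        by (rule bij_betw_byWitness[where f' = "\<lambda>(m, r). (m + int w * ((r + 2 * l) * l - l ^ 2), r + 2 * l)"]) auto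
      from has_sum_reindex_bij_betw[OF this, THEN iffD2, OF 1]
      have 2: "((\<lambda>p. ee (of_int l ^ 2 * \<tau> + 2 * of_int l * z) * ?t (?g p)) has_sum ?f (\<tau>, z)) UNIV" .
      have key: "ee (of_int l ^ 2 * \<tau> + 2 * of_int l * z) * ?t (?g (m, r)) = b (m - int w * (r * l - l ^ 2)) (r - 2 * l) * ee (of_int m / of_nat w * \<tau> + of_int r * z)" for m r
      proof -
        have "of_int l ^ 2 * \<tau> + 2 * of_int l * z + (of_int (m - int w * (r * l - l ^ 2)) / of_nat w * \<tau> + of_int (r - 2 * l) * (z + of_int l * \<tau>))
          = of_int m / of_nat w * \<tau> + of_int r * z"
          using w0 by (simp add: field_simps power2_eq_square)
        then show ?thesis by (simp add: mult.left_commute flip: ee_add)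
      qed
      have "(\<lambda>p. ee (of_int l ^ 2 * \<tau> + 2 * of_int l * z) * ?t (?g p)) = (\<lambda>(m, r). b (m - int w * (r * l - l ^ 2)) (r - 2 * l) * ee (of_int m / of_nat w * \<tau> + of_int r * z))"
      proof
        fix p :: "int \<times> int"
        obtain m r where p: "p = (m, r)" by (cases p)
        show "ee (of_int l ^ 2 * \<tau> + 2 * of_int l * z) * ?t (?g p) = (case p of (m, r) \<Rightarrow> b (m - int w * (r * l - l ^ 2)) (r - 2 * l) * ee (of_int m / of_nat w * \<tau> + of_int r * z))"
          using key[of m r] unfolding p by simp
      qed
      from 2[unfolded this]
      have "((\<lambda>(m, r). b (m - int w * (r * l - l ^ 2)) (r - 2 * l) * ee (of_int m / of_nat w * \<tau> + of_int r * z)) has_sum ?f (\<tau>, z)) UNIV" .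
      from has_sum_diff[OF this expb[OF t, of z]]
      show "((\<lambda>(m, r). (b (m - int w * (r * l - l ^ 2)) (r - 2 * l) - b m r) * ee (of_int m / of_nat w * \<tau> + of_int r * z)) has_sum 0) UNIV"
        by (simp add: case_prod_beta' left_diff_distrib)
    qed
    then show ?thesis by simp
  qed
  have "cusp_series k w ?f b"
  proof
    show "real_of_int (r\<^sup>2) < 4 * (real_of_int m / real w)" if "b m r \<noteq> 0" for m r
    proof -
      have "real_of_int (int h * m) / real N = real_of_int m / real w"
        using w0 unfolding Nh by (simp add: field_simps)
      moreover have "real_of_int (r ^ 2) < 4 * real 1 * (real_of_int (int h * m) / real N)"
        using supp that unfolding b_def by blast
      ultimately show ?thesis by (simp only: of_nat_1 mult_1_right)
    qed
    show "?f \<in> borel_measurable borel"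
      using jacobi_cusp_formsD(1,2)[OF \<phi>] by (intro borel_measurable_slash borel_measurable_jacobi_form) auto
  qed (use w0 k expb shift in auto)
  then show ?thesis using that by (simp add: w_def)
qed

lemma tilde_transfer:
  assumes \<phi>: "lattice_inv \<phi>" and g: "fst g \<in> SL2Z" and p: "p \<in> jacobi_domain"
  shows "jacobi_tilde k 1 (slash k 1 \<phi> (inv2 (fst g))) (jact g p) = jacobi_tilde k 1 \<phi> p"
proof -
  obtain A l m \<tau> z where e: "g = (A, l, m)" "p = (\<tau>, z)" by (metis prod.exhaust)
  have A: "A \<in> SL2Z" and t: "Im \<tau> > 0" using g p e by auto
  have iA: "inv2 A \<in> SL2Z" by (rule SL2Z_inv2[OF A])
  have "jacobi_tilde k 1 (slash k 1 \<phi> (inv2 A)) (jact g p) = jacobi_tilde k 1 \<phi> (jacobi_act (inv2 A) 0 0 (jact g p))"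
    by (rule tilde_slash[OF iA jact_domain[OF g p]])
  also have "jacobi_act (inv2 A) 0 0 (jact g p) = jact (jmul (inv2 A, 0, 0) g) p"
    using jact_jmul[of "(inv2 A, 0, 0)" g p] iA g p by (simp add: jact_def)
  also have "\<dots> = (\<tau>, z + of_int l * \<tau> + of_int m)"
    using inv2_mult(1)[OF A] by (simp add: e jmul_def jact_Pair)
  finally show ?thesis using tilde_lattice[OF \<phi> t] by (simp add: e)
qed

lemma borel_measurable_tilde [measurable]:
  assumes [measurable]: "f \<in> borel_measurable borel"
  shows "jacobi_tilde k m f \<in> borel_measurable borel"
  unfolding jacobi_tilde_def case_prod_beta' by measurable

lemma tilde_jact_form:
  assumes "\<phi> \<in> jacobi_cusp_forms k 1 N" "g \<in> JG N" "p \<in> jacobi_domain"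
  shows "jacobi_tilde k 1 \<phi> (jact g p) = jacobi_tilde k 1 \<phi> p"
  using assms jacobi_cusp_formsD(3,4)[OF assms(1)] JG_SL2Z[OF assms(2)]
  by (intro tilde_jact) (auto simp: JG_def)

lemma tilde_pointwise_bound:
  assumes \<phi>: "\<phi> \<in> jacobi_cusp_forms k 1 N" and N: "N > 0" and k: "k \<ge> 3"
    and F: "jacobi_fundamental_domain N F" and p: "p \<in> jacobi_domain"
    and I: "(\<integral>\<^sup>+q. indicator F q * ennreal ((jacobi_tilde k 1 \<phi> q)\<^sup>2) \<partial>jmeas) \<le> ennreal I" "I \<ge> 0"
  shows "(jacobi_tilde k 1 \<phi> p)\<^sup>2 \<le> 8 * upper_const k * sqrt (real N) * I"
proof -
  have m\<phi> [measurable]: "\<phi> \<in> borel_measurable borel"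
    using jacobi_cusp_formsD(1,2)[OF \<phi>] by (intro borel_measurable_jacobi_form) auto
  have uc: "upper_const k \<ge> 0"
    unfolding upper_const_def siegel_const_def using zeta32_ge_1 by (intro mult_nonneg_nonneg divide_nonneg_nonneg) auto
  obtain g where g: "fst g \<in> SL2Z" "jact g p \<in> cusp_box" using cusp_box_cover[OF p] by blast
  define A where "A = inv2 (fst g)"
  have A: "A \<in> SL2Z" unfolding A_def by (rule SL2Z_inv2[OF g(1)])
  obtain b where b: "cusp_series k (width N A) (slash k 1 \<phi> A) b" using cusp_series_slash[OF \<phi> A N k] .
  interpret cusp_series k "width N A" "slash k 1 \<phi> A" b by (rule b)
  let ?w = "width N A"
  define S where "S = jact (inv2 A, 0, 0) -` siegel ?w"
  have S [measurable]: "S \<in> sets borel" unfolding S_def by measurable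
  have "(\<integral>\<^sup>+q. indicator (siegel ?w) q * ennreal ((jacobi_tilde k 1 (slash k 1 \<phi> A) q)\<^sup>2) \<partial>jmeas)
     = (\<integral>\<^sup>+q. indicator S (jact (A, 0, 0) q) * ennreal ((jacobi_tilde k 1 \<phi> (jact (A, 0, 0) q))\<^sup>2) \<partial>jmeas)"
  proof (rule nn_integral_cong_AE, rule eventually_mono[OF AE_jmeas_domain])
    fix q :: "complex \<times> complex" assume q: "q \<in> jacobi_domain"
    have "jact (inv2 A, 0, 0) (jact (A, 0, 0) q) = q"
      using jact_jinv(1)[of "(A, 0, 0)" q] A q by (simp add: jinv_def)
    then have "indicator S (jact (A, 0, 0) q) = (indicator (siegel ?w) q :: ennreal)" by (simp add: S_def indicator_def)
    moreover have "jacobi_tilde k 1 (slash k 1 \<phi> A) q = jacobi_tilde k 1 \<phi> (jact (A, 0, 0) q)"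
      using tilde_slash[OF A q] by (simp add: jact_def)
    ultimately show "indicator (siegel ?w) q * ennreal ((jacobi_tilde k 1 (slash k 1 \<phi> A) q)\<^sup>2) = indicator S (jact (A, 0, 0) q) * ennreal ((jacobi_tilde k 1 \<phi> (jact (A, 0, 0) q))\<^sup>2)"
      by simp
  qed
  also have "\<dots> = (\<integral>\<^sup>+q. indicator S q * ennreal ((jacobi_tilde k 1 \<phi> q)\<^sup>2) \<partial>jmeas)"
    by (rule nn_integral_jact[of "(A, 0, 0)" "\<lambda>q. indicator S q * ennreal ((jacobi_tilde k 1 \<phi> q)\<^sup>2)"]) (use A in simp, measurable)
  also have "\<dots> \<le> of_nat 8 * (\<integral>\<^sup>+q. indicator F q * ennreal ((jacobi_tilde k 1 \<phi> q)\<^sup>2) \<partial>jmeas)"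
  proof (rule siegel_le_fundamental_domain[OF F S])
    show "ennreal ((jacobi_tilde k 1 \<phi> (jact g p))\<^sup>2) = ennreal ((jacobi_tilde k 1 \<phi> p)\<^sup>2)" if "g \<in> JG N" "p \<in> jacobi_domain" for g p
      using tilde_jact_form[OF \<phi> that] by simp
    have w: "int ?w dvd j" if "A ** trans2 j ** inv2 A \<in> Gamma0 N" for j using width_iff[OF A N] that by blast
    show "finite {g \<in> JG N. jact g p \<in> S}" "card {g \<in> JG N. jact g p \<in> S} \<le> 8" if "p \<in> jacobi_domain" for p
      unfolding S_def by (rule siegel_count[OF A that w]; assumption)+
  qed measurable
  also have "\<dots> \<le> of_nat 8 * ennreal I" by (rule mult_left_mono[OF I(1)]) simp
  also have "\<dots> = ennreal (8 * I)" using I(2) by (simp add: ennreal_mult)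
  finally have S8: "(\<integral>\<^sup>+q. indicator (siegel ?w) q * ennreal ((jacobi_tilde k 1 (slash k 1 \<phi> A) q)\<^sup>2) \<partial>jmeas) \<le> ennreal (8 * I)" .
  have B: "(\<Sum>(m, r)\<in>T. (cmod (b m r))\<^sup>2 * weight (disc m r)) \<le> 8 * I" if "finite T" "T \<subseteq> red" for T
    using order_trans[OF siegel_integral_ge[OF that] S8] I(2) by (subst (asm) ennreal_le_iff) auto
  obtain \<tau> z where q: "jact g p = (\<tau>, z)" by (cases "jact g p")
  have "Im \<tau> \<ge> 3/4" using g(2) q by (simp add: cusp_box_def)
  from tilde_le_weighted[OF B this]
  have "(jacobi_tilde k 1 (slash k 1 \<phi> A) (jact g p))\<^sup>2 \<le> upper_const k * sqrt (real ?w) * (8 * I)" by (simp add: q)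
  also have "jacobi_tilde k 1 (slash k 1 \<phi> A) (jact g p) = jacobi_tilde k 1 \<phi> p"
    unfolding A_def by (rule tilde_transfer[OF jacobi_cusp_formsD(4)[OF \<phi>] g(1) p])
  also have "upper_const k * sqrt (real ?w) * (8 * I) \<le> upper_const k * sqrt (real N) * (8 * I)"
    using dvd_imp_le[OF width_dvd[OF N] N] uc I(2) by (intro mult_right_mono mult_left_mono) auto
  finally show ?thesis by (simp add: mult_ac)
qed

lemma tilde_form_bounded:
  assumes \<phi>: "\<phi> \<in> jacobi_cusp_forms k 1 N" and N: "N > 0" and k: "k \<ge> 3"
  obtains K where "K \<ge> 0" "\<And>p. p \<in> jacobi_domain \<Longrightarrow> jacobi_tilde k 1 \<phi> p \<le> K"
proof -
  obtain R where R: "finite R" "R \<subseteq> SL2Z" "\<forall>A\<in>SL2Z. \<exists>B\<in>R. \<exists>G\<in>Gamma0 N. A = G ** B"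
    using coset_reps[OF N] by blast
  have "\<exists>K. \<forall>\<tau> z. Im \<tau> \<ge> 3/4 \<longrightarrow> jacobi_tilde k 1 (slash k 1 \<phi> B) (\<tau>, z) \<le> K" if "B \<in> R" for B
  proof -
    have B: "B \<in> SL2Z" using that R by blast
    obtain b where b: "cusp_series k (width N B) (slash k 1 \<phi> B) b" using cusp_series_slash[OF \<phi> B N k] .
    show ?thesis by (rule cusp_series.tilde_bounded[OF b])
  qed
  then obtain K where K: "\<And>B \<tau> z. B \<in> R \<Longrightarrow> Im \<tau> \<ge> 3/4 \<Longrightarrow> jacobi_tilde k 1 (slash k 1 \<phi> B) (\<tau>, z) \<le> K B" by metis
  define M where "M = (\<Sum>B\<in>R. \<bar>K B\<bar>)"
  have "jacobi_tilde k 1 \<phi> p \<le> M" if p: "p \<in> jacobi_domain" for p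
  proof -
    obtain g where g: "fst g \<in> SL2Z" "jact g p \<in> cusp_box" using cusp_box_cover[OF p] by blast
    have iA: "inv2 (fst g) \<in> SL2Z" by (rule SL2Z_inv2[OF g(1)])
    obtain B G where BG: "B \<in> R" "G \<in> Gamma0 N" "inv2 (fst g) = G ** B" using R(3) iA by blast
    have B: "B \<in> SL2Z" using BG R by blast
    obtain \<tau> z where q: "jact g p = (\<tau>, z)" by (cases "jact g p")
    have v: "Im \<tau> \<ge> 3/4" using g(2) q by (simp add: cusp_box_def)
    have qX: "(\<tau>, z) \<in> jacobi_domain" using v by simp
    have "slash k 1 \<phi> (G ** B) (\<tau>, z) = slash k 1 (slash k 1 \<phi> G) B (\<tau>, z)"
      using slash_mult[OF Gamma0_SL2Z[OF BG(2)] B qX] by simp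
    also have "\<dots> = slash k 1 \<phi> B (\<tau>, z)"
      by (rule slash_cong[OF B qX]) (rule jacobi_cusp_formsD(3)[OF \<phi> BG(2)])
    finally have "jacobi_tilde k 1 (slash k 1 \<phi> (inv2 (fst g))) (jact g p) = jacobi_tilde k 1 (slash k 1 \<phi> B) (\<tau>, z)"
      by (simp add: q BG(3) jacobi_tilde_def)
    then have "jacobi_tilde k 1 \<phi> p = jacobi_tilde k 1 (slash k 1 \<phi> B) (\<tau>, z)"
      using tilde_transfer[OF jacobi_cusp_formsD(4)[OF \<phi>] g(1) p] by simp
    also have "\<dots> \<le> \<bar>K B\<bar>" using K[OF BG(1) v, of z] by linarith
    also have "\<dots> \<le> M" unfolding M_def using R(1) BG(1) by (intro member_le_sum) auto
    finally show ?thesis .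
  qed
  moreover have "M \<ge> 0" unfolding M_def by (intro sum_nonneg) auto
  ultimately show ?thesis using that by blast
qed

section \<open>Orthonormal bases\<close>

declare One_nat_def [simp del]


lemma holomorphic2_add:
  assumes "holomorphic2_on f S" "holomorphic2_on g S"
  shows "holomorphic2_on (\<lambda>p. f p + c * g p) S"
  unfolding holomorphic2_on_def
proof
  fix p assume p: "p \<in> S"
  obtain a b where 1: "(f has_derivative (\<lambda>(s, t). a * s + b * t)) (at p within S)"
    using assms(1) p unfolding holomorphic2_on_def by blast
  obtain a' b' where 2: "(g has_derivative (\<lambda>(s, t). a' * s + b' * t)) (at p within S)"
    using assms(2) p unfolding holomorphic2_on_def by blast
  have "((\<lambda>p. f p + c * g p) has_derivative (\<lambda>x. (case x of (s, t) \<Rightarrow> a * s + b * t) + c * (case x of (s, t) \<Rightarrow> a' * s + b' * t))) (at p within S)"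
    by (intro has_derivative_add has_derivative_mult_right 1 2)
  moreover have "(\<lambda>x. (case x of (s, t) \<Rightarrow> a * s + b * t) + c * (case x of (s, t) \<Rightarrow> a' * s + b' * t)) = (\<lambda>(s, t). (a + c * a') * s + (b + c * b') * t)"
    by (auto simp: algebra_simps)
  ultimately show "\<exists>a b. ((\<lambda>p. f p + c * g p) has_derivative (\<lambda>(s, t). a * s + b * t)) (at p within S)" by metis
qed

lemma slash_add: "slash k m (\<lambda>p. f p + c * g p) A p = slash k m f A p + c * slash k m g A p"
  by (cases p) (simp add: slash_def distrib_left mult_ac add_divide_distrib distrib_right)

lemma cusp_forms_add:
  assumes "\<phi> \<in> jacobi_cusp_forms k 1 N" "\<psi> \<in> jacobi_cusp_forms k 1 N"
  shows "(\<lambda>p. \<phi> p + c * \<psi> p) \<in> jacobi_cusp_forms k 1 N"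
proof -
  let ?E = "\<lambda>\<phi> A a. (\<forall>n r. a n r \<noteq> 0 \<longrightarrow> real_of_int (r ^ 2) < 4 * real 1 * (real_of_int n / real N)) \<and>
        (\<forall>\<tau>\<in>upper_half_plane. \<forall>z.
           ((\<lambda>(n, r). a n r * ee (of_int n / of_nat N * \<tau> + of_int r * z))
              has_sum slash k 1 \<phi> A (\<tau>, z)) UNIV)"
  have ex: "\<exists>a :: int \<Rightarrow> int \<Rightarrow> complex. ?E (\<lambda>p. \<phi> p + c * \<psi> p) A a" if A: "A \<in> SL2Z" for A
  proof -
    have "\<forall>A\<in>SL2Z. \<exists>a :: int \<Rightarrow> int \<Rightarrow> complex. ?E \<phi> A a"
      using assms(1) unfolding jacobi_cusp_forms_def mem_Collect_eq by (elim conjE)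
    moreover have "\<forall>A\<in>SL2Z. \<exists>a :: int \<Rightarrow> int \<Rightarrow> complex. ?E \<psi> A a"
      using assms(2) unfolding jacobi_cusp_forms_def mem_Collect_eq by (elim conjE)
    ultimately obtain a b :: "int \<Rightarrow> int \<Rightarrow> complex" where a: "?E \<phi> A a" and b: "?E \<psi> A b" using A by blast
    have "?E (\<lambda>p. \<phi> p + c * \<psi> p) A (\<lambda>n r. a n r + c * b n r)"
    proof (intro conjI allI ballI impI)
      fix n r assume "a n r + c * b n r \<noteq> 0"
      then have "a n r \<noteq> 0 \<or> b n r \<noteq> 0" by auto
      then show "real_of_int (r ^ 2) < 4 * real 1 * (real_of_int n / real N)" using a b by blast
    next
      fix \<tau> z assume t: "\<tau> \<in> upper_half_plane"
      have "((\<lambda>p. (case p of (n, r) \<Rightarrow> a n r * ee (of_int n / of_nat N * \<tau> + of_int r * z)) + c * (case p of (n, r) \<Rightarrow> b n r * ee (of_int n / of_nat N * \<tau> + of_int r * z)))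
         has_sum (slash k 1 \<phi> A (\<tau>, z) + c * slash k 1 \<psi> A (\<tau>, z))) UNIV"
        using a b t by (intro has_sum_add has_sum_cmult_right) blast+
      then show "((\<lambda>(n, r). (a n r + c * b n r) * ee (of_int n / of_nat N * \<tau> + of_int r * z)) has_sum slash k 1 (\<lambda>p. \<phi> p + c * \<psi> p) A (\<tau>, z)) UNIV"
        unfolding slash_add by (simp add: case_prod_beta' distrib_right mult.assoc)
    qed
    then show ?thesis by (rule exI[where x = "\<lambda>n r. a n r + c * b n r"])
  qed
  show ?thesis
    unfolding jacobi_cusp_forms_def mem_Collect_eq
  proof (intro conjI)
    show "\<forall>p. p \<notin> jacobi_domain \<longrightarrow> \<phi> p + c * \<psi> p = 0"
      using assms by (simp add: jacobi_cusp_forms_def)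
    show "holomorphic2_on (\<lambda>p. \<phi> p + c * \<psi> p) jacobi_domain"
      using assms jacobi_cusp_formsD(2) by (intro holomorphic2_add) auto
    show "\<forall>A\<in>Gamma0 N. \<forall>p\<in>jacobi_domain. slash k 1 (\<lambda>p. \<phi> p + c * \<psi> p) A p = \<phi> p + c * \<psi> p"
      unfolding slash_add using assms jacobi_cusp_formsD(3) by (intro ballI arg_cong2[where f = "(+)"] arg_cong2[where f = "(*)"]) auto
    show "\<forall>l \<mu>. \<forall>\<tau>\<in>upper_half_plane. \<forall>z. ee (of_nat 1 * (of_int l ^ 2 * \<tau> + 2 * of_int l * z)) * (\<phi> (\<tau>, z + of_int l * \<tau> + of_int \<mu>) + c * \<psi> (\<tau>, z + of_int l * \<tau> + of_int \<mu>)) = \<phi> (\<tau>, z) + c * \<psi> (\<tau>, z)"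
    proof (intro allI ballI)
      fix l \<mu> \<tau> z assume t: "\<tau> \<in> upper_half_plane"
      have "ee (of_int l ^ 2 * \<tau> + 2 * of_int l * z) * \<phi> (\<tau>, z + of_int l * \<tau> + of_int \<mu>) = \<phi> (\<tau>, z)"
        "ee (of_int l ^ 2 * \<tau> + 2 * of_int l * z) * \<psi> (\<tau>, z + of_int l * \<tau> + of_int \<mu>) = \<psi> (\<tau>, z)"
        using t jacobi_cusp_formsD(4)[OF assms(1)] jacobi_cusp_formsD(4)[OF assms(2)] by (auto simp: lattice_inv_def)
      then show "ee (of_nat 1 * (of_int l ^ 2 * \<tau> + 2 * of_int l * z)) * (\<phi> (\<tau>, z + of_int l * \<tau> + of_int \<mu>) + c * \<psi> (\<tau>, z + of_int l * \<tau> + of_int \<mu>)) = \<phi> (\<tau>, z) + c * \<psi> (\<tau>, z)"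
        by (simp add: distrib_left mult.left_commute)
    qed
    show "\<forall>A\<in>SL2Z. \<exists>a :: int \<Rightarrow> int \<Rightarrow> complex. ?E (\<lambda>p. \<phi> p + c * \<psi> p) A a" using ex by blast
  qed
qed

lemma cusp_forms_zero: "(\<lambda>p. 0) \<in> jacobi_cusp_forms k 1 N"
proof -
  have h: "holomorphic2_on (\<lambda>p. 0) jacobi_domain"
    unfolding holomorphic2_on_def by (intro ballI exI[of _ 0]) (simp add: case_prod_beta')
  have s: "slash k m (\<lambda>p. 0) A p = 0" for m A p by (cases p) (simp add: slash_def)
  show ?thesis
    unfolding jacobi_cusp_forms_def mem_Collect_eq
    using h by (auto simp: s case_prod_beta' intro!: exI[of _ "\<lambda>n r. 0"] has_sum_0)
qed

lemma cusp_forms_sum: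
  assumes "finite B" "B \<subseteq> jacobi_cusp_forms k 1 N"
  shows "(\<lambda>p. \<Sum>\<psi>\<in>B. a \<psi> * \<psi> p) \<in> jacobi_cusp_forms k 1 N"
  using assms
proof (induction B rule: finite_induct)
  case (insert x B)
  have "(\<lambda>p. (\<Sum>\<psi>\<in>B. a \<psi> * \<psi> p) + a x * x p) \<in> jacobi_cusp_forms k 1 N"
    using insert by (intro cusp_forms_add) auto
  then show ?case using insert by (simp add: add.commute)
qed (use cusp_forms_zero in simp)

locale petersson_space =
  fixes k N :: nat
  assumes k: "k \<ge> 3" and N: "N > 0"
begin

definition dom :: "(complex \<times> complex) set" where
  "dom = (SOME F. jacobi_fundamental_domain N F)"

lemma dom: "jacobi_fundamental_domain N dom"
  unfolding dom_def using fundamental_domain_exists by (rule someI_ex)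

lemma dom_borel [measurable]: "dom \<in> sets borel"
  using dom by (simp add: jacobi_fundamental_domain_def)

lemma dom_sub: "p \<in> dom \<Longrightarrow> Im (fst p) > 0"
  using dom by (auto simp: jacobi_fundamental_domain_def)

abbreviation J :: "(complex \<times> complex \<Rightarrow> complex) set" where
  "J \<equiv> jacobi_cusp_forms k 1 N"

definition dens :: "complex \<times> complex \<Rightarrow> real" where
  "dens p = Im (fst p) ^ k * exp (- 4 * pi * Im (snd p) ^ 2 / Im (fst p)) / Im (fst p) ^ 3"

definition integrand where
  "integrand \<phi> \<psi> p = \<phi> p * cnj (\<psi> p) * of_real (dens p)"

abbreviation ip where "ip \<equiv> petersson k 1 N"

lemma ip_eq: "ip \<phi> \<psi> = set_lebesgue_integral lborel dom (integrand \<phi> \<psi>)"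
  unfolding petersson_def dom_def integrand_def[abs_def] dens_def by (simp add: case_prod_beta')

lemma J_borel: "\<phi> \<in> J \<Longrightarrow> \<phi> \<in> borel_measurable borel"
  using jacobi_cusp_formsD(1,2) by (intro borel_measurable_jacobi_form) auto

lemma dens_tilde:
  assumes "Im (fst p) > 0"
  shows "(cmod (\<phi> p))\<^sup>2 * dens p = (jacobi_tilde k 1 \<phi> p)\<^sup>2 / Im (fst p) ^ 3"
proof -
  obtain \<tau> z where p: "p = (\<tau>, z)" by (cases p)
  have "(Im \<tau> powr (real k / 2))\<^sup>2 = Im \<tau> ^ k"
    using assms p by (simp add: power2_eq_square powr_realpow flip: powr_add)
  moreover have "(exp (- 2 * pi * (Im z)\<^sup>2 / Im \<tau>))\<^sup>2 = exp (- 4 * pi * (Im z)\<^sup>2 / Im \<tau>)"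
    by (simp add: power2_eq_square flip: exp_add)
  moreover have "(jacobi_tilde k 1 \<phi> p)\<^sup>2 = (Im \<tau> powr (real k / 2))\<^sup>2 * (exp (- 2 * pi * (Im z)\<^sup>2 / Im \<tau>))\<^sup>2 * (cmod (\<phi> p))\<^sup>2"
    by (simp add: p jacobi_tilde_def power_mult_distrib)
  ultimately show ?thesis by (simp add: p dens_def)
qed

definition nrm :: "(complex \<times> complex \<Rightarrow> complex) \<Rightarrow> ennreal" where
  "nrm \<phi> = (\<integral>\<^sup>+q. indicator dom q * ennreal ((jacobi_tilde k 1 \<phi> q)\<^sup>2) \<partial>jmeas)"

lemma nrm_eq:
  assumes "\<phi> \<in> borel_measurable borel"
  shows "nrm \<phi> = (\<integral>\<^sup>+p. ennreal (norm (indicator dom p *\<^sub>R integrand \<phi> \<phi> p)) \<partial>lborel)"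
proof -
  have [measurable]: "\<phi> \<in> borel_measurable borel" by fact
  have "nrm \<phi> = (\<integral>\<^sup>+p. ennreal (if Im (fst p) > 0 then 1 / Im (fst p) ^ 3 else 0) * (indicator dom p * ennreal ((jacobi_tilde k 1 \<phi> p)\<^sup>2)) \<partial>lborel)"
    unfolding nrm_def jmeas_def by (subst nn_integral_density) measurable
  also have "\<dots> = (\<integral>\<^sup>+p. ennreal (norm (indicator dom p *\<^sub>R integrand \<phi> \<phi> p)) \<partial>lborel)"
  proof (rule nn_integral_cong)
    fix p :: "complex \<times> complex"
    show "ennreal (if Im (fst p) > 0 then 1 / Im (fst p) ^ 3 else 0) * (indicator dom p * ennreal ((jacobi_tilde k 1 \<phi> p)\<^sup>2)) = ennreal (norm (indicator dom p *\<^sub>R integrand \<phi> \<phi> p))"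
    proof (cases "p \<in> dom")
      case True
      have v: "Im (fst p) > 0" by (rule dom_sub[OF True])
      have d0: "dens p \<ge> 0" using v by (simp add: dens_def)
      have "norm (integrand \<phi> \<phi> p) = (cmod (\<phi> p))\<^sup>2 * dens p"
        using d0 by (simp add: integrand_def norm_mult power2_eq_square)
      then show ?thesis using True v dens_tilde[OF v] by (simp flip: ennreal_mult)
    qed simp
  qed
  finally show ?thesis .
qed

lemma nrm_finite:
  assumes "\<phi> \<in> J"
  shows "nrm \<phi> < \<infinity>"
proof -
  obtain K where K: "K \<ge> 0" "\<And>p. p \<in> jacobi_domain \<Longrightarrow> jacobi_tilde k 1 \<phi> p \<le> K"
    using tilde_form_bounded[OF assms N k] by blast
  have "nrm \<phi> \<le> (\<integral>\<^sup>+q. ennreal (K\<^sup>2) * indicator dom q \<partial>jmeas)"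
    unfolding nrm_def
  proof (rule nn_integral_mono)
    fix q
    show "indicator dom q * ennreal ((jacobi_tilde k 1 \<phi> q)\<^sup>2) \<le> ennreal (K\<^sup>2) * indicator dom q"
    proof (cases "q \<in> dom")
      case True
      then have "q \<in> jacobi_domain" using dom by (auto simp: jacobi_fundamental_domain_def)
      then have "(jacobi_tilde k 1 \<phi> q)\<^sup>2 \<le> K\<^sup>2" using K jacobi_tilde_nonneg by (intro power_mono) auto
      then show ?thesis using True by (simp add: ennreal_leI)
    qed simp
  qed
  also have "\<dots> = ennreal (K\<^sup>2) * emeasure jmeas dom" by (simp add: nn_integral_cmult)
  also have "\<dots> < \<infinity>" using emeasure_fundamental_domain[OF dom N] by (simp add: ennreal_mult_less_top)
  finally show ?thesis .
qed

lemma integrand_borel: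
  assumes "\<phi> \<in> J" "\<psi> \<in> J"
  shows "integrand \<phi> \<psi> \<in> borel_measurable borel"
proof -
  have [measurable]: "\<phi> \<in> borel_measurable borel" "\<psi> \<in> borel_measurable borel" using assms J_borel by auto
  have "dens \<in> borel_measurable borel" unfolding dens_def[abs_def] by measurable
  then have d: "(\<lambda>p. complex_of_real (dens p)) \<in> borel_measurable borel"
    by (rule borel_measurable_continuous_on[OF continuous_on_of_real[OF continuous_on_id]])
  show ?thesis unfolding integrand_def[abs_def]
    by (intro borel_measurable_times d borel_measurable_continuous_on[OF continuous_on_cnj[OF continuous_on_id]] assms[THEN J_borel])
qed

lemma integrable_diag:
  assumes "\<phi> \<in> J"
  shows "integrable lborel (\<lambda>p. indicator dom p *\<^sub>R integrand \<phi> \<phi> p)"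
proof (rule integrableI_bounded)
  have [measurable]: "integrand \<phi> \<phi> \<in> borel_measurable borel" using integrand_borel assms by auto
  show "(\<lambda>p. indicator dom p *\<^sub>R integrand \<phi> \<phi> p) \<in> borel_measurable lborel" by measurable
  show "(\<integral>\<^sup>+p. ennreal (norm (indicator dom p *\<^sub>R integrand \<phi> \<phi> p)) \<partial>lborel) < \<infinity>"
    using nrm_finite[OF assms] nrm_eq[OF J_borel[OF assms]] by simp
qed

lemma integrable_ip:
  assumes "\<phi> \<in> J" "\<psi> \<in> J"
  shows "integrable lborel (\<lambda>p. indicator dom p *\<^sub>R integrand \<phi> \<psi> p)"
proof (rule Bochner_Integration.integrable_bound)
  have [measurable]: "integrand \<phi> \<psi> \<in> borel_measurable borel" using integrand_borel assms by auto
  show "(\<lambda>p. indicator dom p *\<^sub>R integrand \<phi> \<psi> p) \<in> borel_measurable lborel" by measurable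
  show "integrable lborel (\<lambda>p. norm (indicator dom p *\<^sub>R integrand \<phi> \<phi> p) + norm (indicator dom p *\<^sub>R integrand \<psi> \<psi> p))"
    using assms by (intro Bochner_Integration.integrable_add integrable_norm integrable_diag)
  show "AE p in lborel. norm (indicator dom p *\<^sub>R integrand \<phi> \<psi> p) \<le> norm (norm (indicator dom p *\<^sub>R integrand \<phi> \<phi> p) + norm (indicator dom p *\<^sub>R integrand \<psi> \<psi> p))"
  proof (rule AE_I2)
    fix p :: "complex \<times> complex"
    have "cmod (\<phi> p) * cmod (\<psi> p) \<le> cmod (\<phi> p) * cmod (\<phi> p) + cmod (\<psi> p) * cmod (\<psi> p)"
    proof -
      have "0 \<le> cmod (\<phi> p) * cmod (\<psi> p)" by simp
      moreover have "2 * cmod (\<phi> p) * cmod (\<psi> p) \<le> cmod (\<phi> p) * cmod (\<phi> p) + cmod (\<psi> p) * cmod (\<psi> p)"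
        using sum_squares_bound[of "cmod (\<phi> p)" "cmod (\<psi> p)"] by (simp only: power2_eq_square)
      ultimately show ?thesis by linarith
    qed
    from mult_right_mono[OF this, of "\<bar>dens p\<bar>"]
    show "norm (indicator dom p *\<^sub>R integrand \<phi> \<psi> p) \<le> norm (norm (indicator dom p *\<^sub>R integrand \<phi> \<phi> p) + norm (indicator dom p *\<^sub>R integrand \<psi> \<psi> p))"
      by (simp add: integrand_def norm_mult indicator_def distrib_right)
  qed
qed

lemma ip_add_left:
  assumes "\<phi> \<in> J" "\<psi> \<in> J" "\<omega> \<in> J"
  shows "ip (\<lambda>p. \<phi> p + c * \<psi> p) \<omega> = ip \<phi> \<omega> + c * ip \<psi> \<omega>"
proof -
  have "(\<lambda>p. indicator dom p *\<^sub>R integrand (\<lambda>p. \<phi> p + c * \<psi> p) \<omega> p)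
    = (\<lambda>p. indicator dom p *\<^sub>R integrand \<phi> \<omega> p + c * (indicator dom p *\<^sub>R integrand \<psi> \<omega> p))"
    by (auto simp: integrand_def indicator_def algebra_simps)
  then show ?thesis unfolding ip_eq set_lebesgue_integral_def
    using assms by (simp add: integrable_ip del: mult_scaleR_right scaleR_conv_of_real)
qed

lemma ip_cnj: "ip \<psi> \<phi> = cnj (ip \<phi> \<psi>)"
proof -
  have "integral\<^sup>L lborel (\<lambda>p. cnj (indicator dom p *\<^sub>R integrand \<phi> \<psi> p)) = cnj (integral\<^sup>L lborel (\<lambda>p. indicator dom p *\<^sub>R integrand \<phi> \<psi> p))"
    by (rule Bochner_Integration.integral_cnj)
  moreover have "cnj (indicator dom p *\<^sub>R integrand \<phi> \<psi> p) = indicator dom p *\<^sub>R integrand \<psi> \<phi> p" for p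
    by (simp add: integrand_def mult_ac)
  ultimately show ?thesis unfolding ip_eq set_lebesgue_integral_def by (simp only:)
qed

lemma ip_zero_left: "ip (\<lambda>p. 0) \<omega> = 0"
  unfolding ip_eq set_lebesgue_integral_def integrand_def by simp

lemma ip_sum_left:
  assumes "finite B" "B \<subseteq> J" "\<omega> \<in> J"
  shows "ip (\<lambda>p. \<Sum>\<psi>\<in>B. a \<psi> * \<psi> p) \<omega> = (\<Sum>\<psi>\<in>B. a \<psi> * ip \<psi> \<omega>)"
  using assms
proof (induction B rule: finite_induct)
  case (insert x B)
  have "(\<lambda>p. \<Sum>\<psi>\<in>insert x B. a \<psi> * \<psi> p) = (\<lambda>p. (\<Sum>\<psi>\<in>B. a \<psi> * \<psi> p) + a x * x p)"
    using insert by (simp add: add.commute)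
  then have "ip (\<lambda>p. \<Sum>\<psi>\<in>insert x B. a \<psi> * \<psi> p) \<omega> = ip (\<lambda>p. \<Sum>\<psi>\<in>B. a \<psi> * \<psi> p) \<omega> + a x * ip x \<omega>"
    using ip_add_left[OF cusp_forms_sum[of B k N a], of x \<omega> "a x"] insert by simp
  then show ?case using insert by (simp add: add.commute)
qed (simp add: ip_zero_left)

lemma nrm_ip:
  assumes "\<phi> \<in> J"
  shows "ip \<phi> \<phi> = of_real (enn2real (nrm \<phi>))"
proof -
  have e: "indicator dom p *\<^sub>R integrand \<phi> \<phi> p = of_real (norm (indicator dom p *\<^sub>R integrand \<phi> \<phi> p))" for p
  proof (cases "p \<in> dom")
    case True
    have d0: "dens p \<ge> 0" using dom_sub[OF True] by (simp add: dens_def)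
    have "integrand \<phi> \<phi> p = of_real ((cmod (\<phi> p))\<^sup>2 * dens p)"
      by (simp only: integrand_def complex_norm_square of_real_mult)
    moreover have "norm (complex_of_real ((cmod (\<phi> p))\<^sup>2 * dens p)) = (cmod (\<phi> p))\<^sup>2 * dens p"
      unfolding norm_of_real using d0 by simp
    ultimately show ?thesis using True by simp
  qed simp
  have "ip \<phi> \<phi> = (\<integral>p. complex_of_real (norm (indicator dom p *\<^sub>R integrand \<phi> \<phi> p)) \<partial>lborel)"
    unfolding ip_eq set_lebesgue_integral_def by (subst e) (rule refl)
  also have "\<dots> = of_real (\<integral>p. norm (indicator dom p *\<^sub>R integrand \<phi> \<phi> p) \<partial>lborel)"
    by (rule integral_complex_of_real)
  also have "(\<integral>p. norm (indicator dom p *\<^sub>R integrand \<phi> \<phi> p) \<partial>lborel) = enn2real (\<integral>\<^sup>+p. ennreal (norm (indicator dom p *\<^sub>R integrand \<phi> \<phi> p)) \<partial>lborel)"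
    using integrable_norm[OF integrable_diag[OF assms]] by (intro integral_eq_nn_integral) auto
  finally show ?thesis using nrm_eq[OF J_borel[OF assms]] by simp
qed

lemma nrm_eq_ip: "\<phi> \<in> J \<Longrightarrow> nrm \<phi> = ennreal (Re (ip \<phi> \<phi>))"
  using nrm_ip[of \<phi>] nrm_finite[of \<phi>] by (simp add: less_top)

lemma Re_ip_nonneg: "\<phi> \<in> J \<Longrightarrow> Re (ip \<phi> \<phi>) \<ge> 0"
  using nrm_ip[of \<phi>] by simp

definition ub :: real where "ub = 8 * upper_const k * sqrt (real N)"

lemma ub_nonneg: "ub \<ge> 0"
  unfolding ub_def upper_const_def siegel_const_def using zeta32_ge_1
  by (intro mult_nonneg_nonneg divide_nonneg_nonneg) auto

lemma tilde_le_ip: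
  assumes "\<phi> \<in> J" "p \<in> jacobi_domain"
  shows "(jacobi_tilde k 1 \<phi> p)\<^sup>2 \<le> ub * Re (ip \<phi> \<phi>)"
  unfolding ub_def
  by (rule tilde_pointwise_bound[OF assms(1) N k dom assms(2)])
    (use nrm_eq_ip[OF assms(1)] Re_ip_nonneg[OF assms(1)] in \<open>auto simp: nrm_def\<close>)

definition wgt :: "complex \<times> complex \<Rightarrow> real" where
  "wgt p = Im (fst p) powr (real k / 2) * exp (- 2 * pi * Im (snd p) ^ 2 / Im (fst p))"

lemma tilde_wgt: "jacobi_tilde k 1 \<phi> p = wgt p * cmod (\<phi> p)"
  by (cases p) (simp add: jacobi_tilde_def wgt_def)

lemma ip_definite:
  assumes "\<phi> \<in> J" "ip \<phi> \<phi> = 0"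
  shows "\<phi> = (\<lambda>p. 0)"
proof
  fix p :: "complex \<times> complex"
  show "\<phi> p = 0"
  proof (cases "p \<in> jacobi_domain")
    case True
    then have "wgt p > 0" by (cases p) (simp add: wgt_def)
    moreover have "(jacobi_tilde k 1 \<phi> p)\<^sup>2 \<le> 0" using tilde_le_ip[OF assms(1) True] assms(2) by simp
    ultimately show ?thesis by (simp add: tilde_wgt)
  next
    case False
    then show ?thesis using jacobi_cusp_formsD(1)[OF assms(1), of p] by (cases p) auto
  qed
qed

definition orthonormal where
  "orthonormal B \<longleftrightarrow> finite B \<and> B \<subseteq> J \<and> (\<forall>\<phi>\<in>B. \<forall>\<psi>\<in>B. ip \<phi> \<psi> = (if \<phi> = \<psi> then 1 else 0))"

lemma ip_sum_sum:
  assumes "orthonormal B"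
  shows "ip (\<lambda>p. \<Sum>\<psi>\<in>B. a \<psi> * \<psi> p) (\<lambda>p. \<Sum>\<psi>\<in>B. a \<psi> * \<psi> p) = of_real (\<Sum>\<psi>\<in>B. (cmod (a \<psi>))\<^sup>2)"
proof -
  have B: "finite B" "B \<subseteq> J" using assms by (auto simp: orthonormal_def)
  let ?s = "\<lambda>p. \<Sum>\<psi>\<in>B. a \<psi> * \<psi> p"
  have sJ: "?s \<in> J" by (rule cusp_forms_sum[OF B])
  have 1: "ip \<psi> ?s = cnj (a \<psi>)" if "\<psi> \<in> B" for \<psi>
  proof -
    have "ip ?s \<psi> = (\<Sum>\<omega>\<in>B. a \<omega> * ip \<omega> \<psi>)" using B that by (intro ip_sum_left) auto
    also have "\<dots> = (\<Sum>\<omega>\<in>B. if \<omega> = \<psi> then a \<omega> else 0)"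
      using assms that by (intro sum.cong) (auto simp: orthonormal_def)
    also have "\<dots> = a \<psi>" using B that by simp
    finally show ?thesis using ip_cnj[of \<psi> ?s] by simp
  qed
  have "ip ?s ?s = (\<Sum>\<psi>\<in>B. a \<psi> * ip \<psi> ?s)" by (rule ip_sum_left[OF B sJ])
  also have "\<dots> = (\<Sum>\<psi>\<in>B. a \<psi> * cnj (a \<psi>))" using 1 by simp
  also have "\<dots> = of_real (\<Sum>\<psi>\<in>B. (cmod (a \<psi>))\<^sup>2)" by (simp only: complex_norm_square of_real_sum)
  finally show ?thesis .
qed

lemma orthonormal_sum_le:
  assumes B: "orthonormal B" and p: "p \<in> jacobi_domain"
  shows "(\<Sum>\<phi>\<in>B. (jacobi_tilde k 1 \<phi> p)\<^sup>2) \<le> ub"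
proof -
  have fB: "finite B" "B \<subseteq> J" using B by (auto simp: orthonormal_def)
  define s where "s = (\<lambda>q. \<Sum>\<psi>\<in>B. cnj (\<psi> p) * \<psi> q)"
  define X where "X = (\<Sum>\<psi>\<in>B. (cmod (\<psi> p))\<^sup>2)"
  have X0: "X \<ge> 0" unfolding X_def by (intro sum_nonneg) auto
  have sJ: "s \<in> J" unfolding s_def by (rule cusp_forms_sum[OF fB])
  have "ip s s = of_real (\<Sum>\<psi>\<in>B. (cmod (cnj (\<psi> p)))\<^sup>2)" unfolding s_def by (rule ip_sum_sum[OF B])
  then have "Re (ip s s) = X" by (simp add: X_def)
  moreover have "s p = of_real X"
    unfolding s_def X_def of_real_sum by (intro sum.cong refl) (metis complex_norm_square mult.commute)
  ultimately have "(wgt p * X)\<^sup>2 \<le> ub * X"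
    using tilde_le_ip[OF sJ p] X0 by (simp add: tilde_wgt)
  then have "((wgt p)\<^sup>2 * X) * X \<le> ub * X" by (simp add: power_mult_distrib power2_eq_square mult_ac)
  then have "(wgt p)\<^sup>2 * X \<le> ub"
    using X0 ub_nonneg by (cases "X = 0") auto
  then show ?thesis by (simp add: X_def tilde_wgt power_mult_distrib sum_distrib_left)
qed

lemma orthonormal_card:
  assumes B: "orthonormal B"
  shows "of_nat (card B) \<le> ennreal ub * emeasure jmeas dom"
proof -
  have fB: "finite B" "B \<subseteq> J" using B by (auto simp: orthonormal_def)
  have m: "(\<lambda>q. indicator dom q * ennreal ((jacobi_tilde k 1 \<phi> q)\<^sup>2)) \<in> borel_measurable jmeas" if "\<phi> \<in> B" for \<phi>
  proof -
    have [measurable]: "\<phi> \<in> borel_measurable borel" using that fB J_borel by blast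
    show ?thesis by measurable
  qed
  have "of_nat (card B) = (\<Sum>\<phi>\<in>B. nrm \<phi>)"
    using B fB nrm_eq_ip by (simp add: orthonormal_def subset_iff)
  also have "\<dots> = (\<integral>\<^sup>+q. (\<Sum>\<phi>\<in>B. indicator dom q * ennreal ((jacobi_tilde k 1 \<phi> q)\<^sup>2)) \<partial>jmeas)"
    unfolding nrm_def by (rule nn_integral_sum[symmetric]) (rule m)
  also have "\<dots> \<le> (\<integral>\<^sup>+q. ennreal ub * indicator dom q \<partial>jmeas)"
  proof (rule nn_integral_mono)
    fix q
    show "(\<Sum>\<phi>\<in>B. indicator dom q * ennreal ((jacobi_tilde k 1 \<phi> q)\<^sup>2)) \<le> ennreal ub * indicator dom q"
    proof (cases "q \<in> dom")
      case True
      then have "q \<in> jacobi_domain" using dom by (auto simp: jacobi_fundamental_domain_def)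
      then show ?thesis using True orthonormal_sum_le[OF B] by (simp add: ennreal_leI)
    qed simp
  qed
  also have "\<dots> = ennreal ub * emeasure jmeas dom" by (simp add: nn_integral_cmult)
  finally show ?thesis .
qed

lemma basis_exists: "\<exists>B. jacobi_orthonormal_basis k 1 N B"
proof -
  have "ennreal ub * emeasure jmeas dom < top"
    using emeasure_fundamental_domain[OF dom N] by (simp add: ennreal_mult_less_top)
  then obtain M where M: "ennreal ub * emeasure jmeas dom = ennreal M" "M \<ge> 0"
    by (cases "ennreal ub * emeasure jmeas dom") auto
  have bd: "card B \<le> nat \<lceil>M\<rceil>" if "orthonormal B" for B
  proof -
    have "ennreal (real (card B)) \<le> ennreal M"
      using orthonormal_card[OF that] unfolding M(1) ennreal_of_nat_eq_real_of_nat .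
    then have "real (card B) \<le> M" using M by (simp add: ennreal_le_iff)
    then show ?thesis by linarith
  qed
  have "orthonormal {}" by (simp add: orthonormal_def)
  then have "\<exists>B. orthonormal B \<and> (\<forall>C. orthonormal C \<longrightarrow> card C \<le> card B)"
    using ex_has_greatest_nat[of orthonormal "{}" card "Suc (nat \<lceil>M\<rceil>)"] bd by (simp add: less_Suc_eq_le)
  then obtain B where B: "orthonormal B" "\<And>C. orthonormal C \<Longrightarrow> card C \<le> card B" by blast
  have fB: "finite B" "B \<subseteq> J" using B(1) by (auto simp: orthonormal_def)
  have span: "\<exists>a. \<phi> = (\<lambda>p. \<Sum>\<psi>\<in>B. a \<psi> * \<psi> p)" if \<phi>: "\<phi> \<in> J" for \<phi>
  proof -
    define a where "a = (\<lambda>\<psi>. ip \<phi> \<psi>)"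
    define s where "s = (\<lambda>p. \<Sum>\<psi>\<in>B. a \<psi> * \<psi> p)"
    have sJ: "s \<in> J" unfolding s_def by (rule cusp_forms_sum[OF fB])
    define d where "d = (\<lambda>p. \<phi> p + (- 1) * s p)"
    have dJ: "d \<in> J" unfolding d_def by (rule cusp_forms_add[OF \<phi> sJ])
    have orth: "ip d \<psi> = 0" if "\<psi> \<in> B" for \<psi>
    proof -
      have pJ: "\<psi> \<in> J" using that fB by blast
      have "ip s \<psi> = (\<Sum>\<omega>\<in>B. a \<omega> * ip \<omega> \<psi>)" unfolding s_def by (rule ip_sum_left[OF fB pJ])
      also have "\<dots> = (\<Sum>\<omega>\<in>B. if \<omega> = \<psi> then a \<omega> else 0)"
        using B(1) that by (intro sum.cong) (auto simp: orthonormal_def)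
      also have "\<dots> = a \<psi>" using fB that by simp
      finally show ?thesis unfolding d_def ip_add_left[OF \<phi> sJ pJ] by (simp add: a_def)
    qed
    have "d = (\<lambda>p. 0)"
    proof (rule ccontr)
      assume nz: "d \<noteq> (\<lambda>p. 0)"
      then have "ip d d \<noteq> 0" using ip_definite[OF dJ] by blast
      moreover have re: "ip d d = of_real (Re (ip d d))" using nrm_ip[OF dJ] by (metis Re_complex_of_real)
      ultimately have pos: "Re (ip d d) > 0" using Re_ip_nonneg[OF dJ] by (metis less_eq_real_def of_real_0)
      define c where "c = complex_of_real (1 / sqrt (Re (ip d d)))"
      define e where "e = (\<lambda>p. 0 + c * d p)"
      have eJ: "e \<in> J" unfolding e_def by (rule cusp_forms_add[OF cusp_forms_zero dJ])
      have eleft: "ip e \<omega> = c * ip d \<omega>" if "\<omega> \<in> J" for \<omega>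
        unfolding e_def ip_add_left[OF cusp_forms_zero dJ that] ip_zero_left by simp
      have "ip e e = c * cnj (ip e d)" using eleft[OF eJ] ip_cnj[of d e] by simp
      also have "\<dots> = c * cnj (c * ip d d)" using eleft[OF dJ] by simp
      also have "\<dots> = c * cnj c * cnj (ip d d)" by simp
      also have "\<dots> = 1"
      proof -
        have "c * cnj c = of_real (1 / Re (ip d d))"
          using pos by (simp add: c_def flip: of_real_mult)
        then show ?thesis using pos by (subst re) (simp flip: of_real_mult)
      qed
      finally have ee: "ip e e = 1" .
      have eB: "ip e \<psi> = 0" "ip \<psi> e = 0" if "\<psi> \<in> B" for \<psi>
        using eleft[of \<psi>] orth[OF that] that fB ip_cnj[of \<psi> e] by auto
      have "e \<notin> B" using eB(1)[of e] ee by auto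
      have "orthonormal (insert e B)"
        using B(1) eJ ee eB \<open>e \<notin> B\<close> unfolding orthonormal_def by auto
      from B(2)[OF this] show False using \<open>e \<notin> B\<close> fB by simp
    qed
    then have "\<phi> p = s p" for p unfolding d_def by (metis add.right_inverse add_cancel_right_right mult_minus1 add_eq_0_iff eq_neg_iff_add_eq_0 minus_minus)
    then show ?thesis unfolding s_def by blast
  qed
  show ?thesis
    using B(1) span by (auto simp: jacobi_orthonormal_basis_def orthonormal_def intro!: exI[of _ B])
qed

lemma basis: "jacobi_orthonormal_basis k 1 N (SOME B. jacobi_orthonormal_basis k 1 N B)"
  using basis_exists by (rule someI_ex)

lemma jacobi_sup_le: "jacobi_sup k 1 N \<le> ereal ub"
proof -
  let ?B = "SOME B. jacobi_orthonormal_basis k 1 N B"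
  have "orthonormal ?B" using basis unfolding jacobi_orthonormal_basis_def orthonormal_def by blast
  then show ?thesis unfolding jacobi_sup_def using orthonormal_sum_le by (intro SUP_least) auto
qed

lemma jacobi_sup_ge:
  assumes P: "P \<in> J" and p: "p \<in> jacobi_domain" and n: "nrm P \<le> ennreal I" "I > 0"
  shows "ereal ((jacobi_tilde k 1 P p)\<^sup>2 / I) \<le> jacobi_sup k 1 N"
proof -
  let ?B = "SOME B. jacobi_orthonormal_basis k 1 N B"
  have oB: "orthonormal ?B" using basis unfolding jacobi_orthonormal_basis_def orthonormal_def by blast
  obtain a where a: "P = (\<lambda>p. \<Sum>\<psi>\<in>?B. a \<psi> * \<psi> p)"
    using basis P unfolding jacobi_orthonormal_basis_def by blast
  let ?A = "\<Sum>\<psi>\<in>?B. (cmod (a \<psi>))\<^sup>2"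
  have "ip P P = of_real ?A" unfolding a by (rule ip_sum_sum[OF oB])
  then have "nrm P = ennreal ?A" using nrm_eq_ip[OF P] by simp
  then have AI: "?A \<le> I" using n by (simp add: ennreal_le_iff)
  have "cmod (P p) \<le> (\<Sum>\<psi>\<in>?B. cmod (a \<psi>) * cmod (\<psi> p))"
    unfolding a using norm_sum[of "\<lambda>\<psi>. a \<psi> * \<psi> p" ?B] by (simp add: norm_mult)
  then have "(cmod (P p))\<^sup>2 \<le> (\<Sum>\<psi>\<in>?B. cmod (a \<psi>) * cmod (\<psi> p))\<^sup>2" by (intro power_mono) auto
  also have "\<dots> \<le> ?A * (\<Sum>\<psi>\<in>?B. (cmod (\<psi> p))\<^sup>2)" by (rule Cauchy_Schwarz_ineq_sum)
  also have "\<dots> \<le> I * (\<Sum>\<psi>\<in>?B. (cmod (\<psi> p))\<^sup>2)" using AI by (intro mult_right_mono sum_nonneg) auto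
  finally have "(wgt p)\<^sup>2 * (cmod (P p))\<^sup>2 \<le> (wgt p)\<^sup>2 * (I * (\<Sum>\<psi>\<in>?B. (cmod (\<psi> p))\<^sup>2))"
    by (rule mult_left_mono) simp
  then have "(jacobi_tilde k 1 P p)\<^sup>2 \<le> I * (\<Sum>\<psi>\<in>?B. (jacobi_tilde k 1 \<psi> p)\<^sup>2)"
    by (simp add: tilde_wgt power_mult_distrib sum_distrib_left mult_ac)
  then have "(jacobi_tilde k 1 P p)\<^sup>2 / I \<le> (\<Sum>\<psi>\<in>?B. (jacobi_tilde k 1 \<psi> p)\<^sup>2)"
    using n(2) by (simp add: field_simps)
  then have "ereal ((jacobi_tilde k 1 P p)\<^sup>2 / I) \<le> ereal (\<Sum>\<psi>\<in>?B. (jacobi_tilde k 1 \<psi> p)\<^sup>2)" by simp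
  also have "\<dots> \<le> jacobi_sup k 1 N" unfolding jacobi_sup_def by (rule SUP_upper[OF p])
  finally show ?thesis .
qed

end

section \<open>A Poincare series\<close>

lemma summable_on_bounded:
  fixes f :: "'a \<Rightarrow> real"
  assumes "\<And>x. x \<in> A \<Longrightarrow> f x \<ge> 0" "\<And>F. finite F \<Longrightarrow> F \<subseteq> A \<Longrightarrow> sum f F \<le> C"
  shows "f summable_on A" "infsum f A \<le> C"
proof -
  show s: "f summable_on A"
    by (rule nonneg_bdd_above_summable_on[OF assms(1)]) (auto intro!: bdd_aboveI2 assms(2))
  show "infsum f A \<le> C" by (rule infsum_le_finite_sums[OF s assms(2)])
qed

lemma theta_summable:
  assumes "v > 0"
  shows "(\<lambda>l :: int. exp (- 2 * pi * v * (x + real_of_int l)\<^sup>2)) summable_on UNIV"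
    "(\<Sum>\<^sub>\<infinity>l :: int. exp (- 2 * pi * v * (x + real_of_int l)\<^sup>2)) \<le> theta_const * (1 + 1 / sqrt v)"
  using theta_bound[OF assms] by (auto intro!: summable_on_bounded)

lemma holomorphic2_compose_curve:
  assumes f: "holomorphic2_on f S" and S: "open S" and p: "(g x, h x) \<in> S"
    and g: "g field_differentiable (at x)" and h: "h field_differentiable (at x)"
  shows "(\<lambda>x. f (g x, h x)) field_differentiable (at x)"
proof -
  obtain a b where "(f has_derivative (\<lambda>(s, t). a * s + b * t)) (at (g x, h x) within S)"
    using f p by (auto simp: holomorphic2_on_def)
  then have d: "(f has_derivative (\<lambda>(s, t). a * s + b * t)) (at (g x, h x))"
    by (simp only: at_within_open[OF p S])
  obtain g' h' where "(g has_field_derivative g') (at x)" "(h has_field_derivative h') (at x)"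
    using g h by (auto simp: field_differentiable_def)
  then have "((\<lambda>x. (g x, h x)) has_derivative (\<lambda>y. (g' * y, h' * y))) (at x)"
    by (auto simp: has_field_derivative_def intro!: has_derivative_Pair)
  from has_derivative_compose[OF this d]
  have "((\<lambda>x. f (g x, h x)) has_derivative (\<lambda>y. (a * g' + b * h') * y)) (at x)"
    by (simp add: algebra_simps)
  then show ?thesis by (auto simp: field_differentiable_def has_field_derivative_def)
qed

lemma continuous_on_mob_den [continuous_intros]:
  "continuous_on S f \<Longrightarrow> continuous_on S (\<lambda>x. mob_den A (f x))"
  "continuous_on S f \<Longrightarrow> continuous_on S (\<lambda>x. mob_num A (f x))"
  unfolding mob_den_def mob_num_def by (intro continuous_intros; assumption)+

lemma continuous_on_mob:
  assumes "A \<in> SL2Z"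
  shows "continuous_on jacobi_domain (\<lambda>p. mob A (fst p))"
  using mob_den_nonzero[OF assms] by (intro continuous_intros) auto

lemma ee_compose_differentiable:
  "f field_differentiable (at x) \<Longrightarrow> (\<lambda>x. ee (f x)) field_differentiable (at x)"
  using field_differentiable_compose[of f x ee] ee_deriv by (auto simp: field_differentiable_def o_def)

lemma mob_differentiable:
  "mob_den A field_differentiable (at x)" "mob_num A field_differentiable (at x)"
  unfolding mob_den_def[abs_def] mob_num_def[abs_def]
  by (intro field_differentiable_add field_differentiable_mult field_differentiable_const field_differentiable_ident)+

lemma holomorphic2_slash:
  assumes f: "holomorphic2_on f jacobi_domain" and A: "A \<in> SL2Z"
  shows "holomorphic2_on (slash k m f A) jacobi_domain"
proof (rule holomorphic2_onI_separate[OF open_jacobi_domain])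
  have dn: "mob_den A \<tau> \<noteq> 0" if "Im \<tau> > 0" for \<tau> using mob_den_nonzero[OF A that] .
  have im: "Im (mob A \<tau>) > 0" if "Im \<tau> > 0" for \<tau> using Im_mob_pos[OF A that] .
  have c: "continuous_on jacobi_domain (\<lambda>p. f (mob A (fst p), snd p / mob_den A (fst p)))"
  proof (rule continuous_on_compose2[OF holomorphic2_imp_continuous_on[OF f]])
    show "continuous_on jacobi_domain (\<lambda>p. (mob A (fst p), snd p / mob_den A (fst p)))"
      using dn by (intro continuous_intros) auto
  qed (use im in auto)
  have sl: "slash k m f A = (\<lambda>p. ee (- of_nat m * of_int (A $ 2 $ 1) * snd p ^ 2 / mob_den A (fst p)) / mob_den A (fst p) ^ k * f (mob A (fst p), snd p / mob_den A (fst p)))"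
    by (auto simp: slash_def jacobi_act_def)
  show "continuous_on jacobi_domain (slash k m f A)"
    unfolding sl using dn by (intro continuous_intros c) auto
  fix \<tau> z assume "(\<tau>, z) \<in> jacobi_domain"
  then have t: "Im \<tau> > 0" by simp
  have S: "(mob A \<tau>, z / mob_den A \<tau>) \<in> jacobi_domain" using im[OF t] by simp
  show "(\<lambda>s. slash k m f A (s, z)) field_differentiable (at \<tau>)"
    unfolding sl fst_conv snd_conv
    using dn[OF t] S
    by (intro field_differentiable_mult field_differentiable_divide ee_compose_differentiable field_differentiable_power field_differentiable_const
        mob_differentiable holomorphic2_compose_curve[OF f open_jacobi_domain, where g = "mob A"]) auto
  show "(\<lambda>w. slash k m f A (\<tau>, w)) field_differentiable (at z)"
    unfolding sl fst_conv snd_conv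
    using dn[OF t] S
    by (intro field_differentiable_mult field_differentiable_divide ee_compose_differentiable field_differentiable_power field_differentiable_const field_differentiable_ident
        holomorphic2_compose_curve[OF f open_jacobi_domain, where g = "\<lambda>_. mob A \<tau>"]) auto
qed

definition theta_form :: "complex \<times> complex \<Rightarrow> complex" where
  "theta_form p = (if Im (fst p) > 0 then
     ee (fst p) * (\<Sum>\<^sub>\<infinity>l. ee (of_int l ^ 2 * fst p + 2 * of_int l * snd p)) else 0)"

lemma norm_theta_term:
  assumes "Im \<tau> > 0"
  shows "cmod (ee (of_int l ^ 2 * \<tau> + 2 * of_int l * z)) =
    exp (2 * pi * (Im z)\<^sup>2 / Im \<tau>) * exp (- 2 * pi * Im \<tau> * (Im z / Im \<tau> + of_int l)\<^sup>2)"
proof -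
  have "- 2 * pi * Im (of_int l ^ 2 * \<tau> + 2 * of_int l * z) = - 2 * pi * (of_int l ^ 2 * Im \<tau> + 2 * of_int l * Im z)"
    by (simp flip: of_int_power)
  also have "\<dots> = 2 * pi * (Im z)\<^sup>2 / Im \<tau> + - 2 * pi * Im \<tau> * (Im z / Im \<tau> + of_int l)\<^sup>2"
    using assms by (simp add: field_simps power2_eq_square)
  finally show ?thesis by (simp only: norm_ee exp_add)
qed

lemma theta_term_summable:
  assumes "Im \<tau> > 0"
  shows "(\<lambda>l. norm (ee (of_int l ^ 2 * \<tau> + 2 * of_int l * z))) summable_on UNIV"
  unfolding norm_theta_term[OF assms] by (intro summable_on_cmult_right theta_summable assms)

lemma holomorphic2_theta_form: "holomorphic2_on theta_form jacobi_domain"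
proof (rule holomorphic2_on_transform)
  let ?t = "\<lambda>l p. ee (fst p) * ee (of_int l ^ 2 * fst p + 2 * of_int l * snd p)"
  show "holomorphic2_on (\<lambda>p. \<Sum>\<^sub>\<infinity>l. ?t l p) jacobi_domain"
  proof (rule holomorphic2_infsum[OF open_jacobi_domain])
    fix l :: int
    show "holomorphic2_on (?t l) jacobi_domain"
    proof (rule holomorphic2_onI_separate[OF open_jacobi_domain])
      show "continuous_on jacobi_domain (?t l)" by (intro continuous_intros)
      show "(\<lambda>s. ?t l (s, z)) field_differentiable (at \<tau>)" "(\<lambda>w. ?t l (\<tau>, w)) field_differentiable (at z)" for \<tau> z
        unfolding fst_conv snd_conv
        by (intro field_differentiable_mult field_differentiable_add ee_compose_differentiable field_differentiable_const field_differentiable_ident)+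
    qed
  next
    fix p :: "complex \<times> complex" assume "p \<in> jacobi_domain"
    then obtain \<tau>0 z0 where p: "p = (\<tau>0, z0)" "Im \<tau>0 > 0" by (cases p) auto
    define \<delta> where "\<delta> = Im \<tau>0 / 2"
    define Y where "Y = \<bar>Im z0\<bar> + 1"
    have d: "\<delta> > 0" "Y > 0" using p by (auto simp: \<delta>_def Y_def)
    define V where "V = {\<tau>. Im \<tau> > \<delta>} \<times> ({z. Im z < Y} \<inter> {z. Im z > - Y})"
    define E where "E = (\<lambda>x (l :: int). exp (- 2 * pi * \<delta> * (x + real_of_int l)\<^sup>2))"
    define M where "M = (\<lambda>l. exp (2 * pi * Y\<^sup>2 / \<delta>) * (E (Y / \<delta>) l + E (- (Y / \<delta>)) l))"
    have "open V" unfolding V_def by (intro open_Times open_Int open_halfspace_Im_gt open_halfspace_Im_lt)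
    moreover have "p \<in> V" using p d by (auto simp: V_def \<delta>_def Y_def)
    moreover have "M summable_on UNIV"
      unfolding M_def E_def by (intro summable_on_cmult_right summable_on_add theta_summable d)
    moreover have "cmod (?t l q) \<le> M l" if "q \<in> V" for l q
    proof -
      obtain \<tau> z where q: "q = (\<tau>, z)" "Im \<tau> > \<delta>" "\<bar>Im z\<bar> \<le> Y" using \<open>q \<in> V\<close> by (cases q) (auto simp: V_def)
      let ?L = "\<bar>real_of_int l\<bar>"
      have "- (of_int l * Im z) \<le> ?L * Y" using q(3) mult_left_mono[OF q(3), of ?L] by (simp flip: abs_mult)
      moreover have "?L\<^sup>2 * \<delta> \<le> ?L\<^sup>2 * Im \<tau>" using q(2) by (intro mult_left_mono) auto
      moreover have "- 2 * pi * Im (of_int l ^ 2 * \<tau> + 2 * of_int l * z) = 2 * pi * (- (?L\<^sup>2 * Im \<tau>) + 2 * (- (of_int l * Im z)))"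
        by (simp add: algebra_simps flip: of_int_power)
      ultimately have "- 2 * pi * Im (of_int l ^ 2 * \<tau> + 2 * of_int l * z) \<le> 2 * pi * (- (?L\<^sup>2 * \<delta>) + 2 * (?L * Y))"
        by simp
      also have "\<dots> = 2 * pi * Y\<^sup>2 / \<delta> + - 2 * pi * \<delta> * (?L - Y / \<delta>)\<^sup>2"
        using d by (simp add: field_simps power2_eq_square)
      finally have "cmod (ee (of_int l ^ 2 * \<tau> + 2 * of_int l * z)) \<le> exp (2 * pi * Y\<^sup>2 / \<delta>) * exp (- 2 * pi * \<delta> * (?L - Y / \<delta>)\<^sup>2)"
        unfolding norm_ee exp_add[symmetric] by simp
      also have "exp (- 2 * pi * \<delta> * (?L - Y / \<delta>)\<^sup>2) \<le> E (Y / \<delta>) l + E (- (Y / \<delta>)) l"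
      proof (cases "l \<ge> 0")
        case True
        then have "exp (- 2 * pi * \<delta> * (?L - Y / \<delta>)\<^sup>2) = E (- (Y / \<delta>)) l" by (simp add: E_def)
        moreover have "E (Y / \<delta>) l \<ge> 0" by (simp add: E_def)
        ultimately show ?thesis by linarith
      next
        case False
        then have "(?L - Y / \<delta>)\<^sup>2 = (Y / \<delta> + real_of_int l)\<^sup>2"
          by (simp add: power2_eq_square algebra_simps)
        then have "exp (- 2 * pi * \<delta> * (?L - Y / \<delta>)\<^sup>2) = E (Y / \<delta>) l" by (simp only: E_def)
        moreover have "E (- (Y / \<delta>)) l \<ge> 0" by (simp add: E_def)
        ultimately show ?thesis by linarith
      qed
      finally have "cmod (ee (of_int l ^ 2 * \<tau> + 2 * of_int l * z)) \<le> M l" by (simp add: M_def)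
      moreover have "cmod (ee \<tau>) \<le> 1" using q d by (simp add: norm_ee)
      ultimately have "cmod (ee \<tau>) * cmod (ee (of_int l ^ 2 * \<tau> + 2 * of_int l * z)) \<le> 1 * M l" by (intro mult_mono) auto
      then show ?thesis by (simp add: q norm_mult)
    qed
    ultimately show "\<exists>V M. open V \<and> p \<in> V \<and> M summable_on UNIV \<and> (\<forall>i\<in>UNIV. \<forall>q\<in>V \<inter> jacobi_domain. cmod (?t i q) \<le> M i)" by blast
  qed
  fix p :: "complex \<times> complex" assume "p \<in> jacobi_domain"
  then have "Im (fst p) > 0" by (cases p) simp
  then show "theta_form p = (\<Sum>\<^sub>\<infinity>l. ?t l p)" by (simp add: theta_form_def infsum_cmult_right')
qed

lemma theta_form_shift: "theta_form (\<tau> + of_int j, z) = theta_form (\<tau>, z)"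
proof -
  have "ee (of_int l ^ 2 * (\<tau> + of_int j) + 2 * of_int l * z) = ee (of_int l ^ 2 * \<tau> + 2 * of_int l * z)" for l :: int
    using ee_plus_int[of "of_int l ^ 2 * \<tau> + 2 * of_int l * z" "l ^ 2 * j"] by (simp add: algebra_simps)
  then show ?thesis by (simp add: theta_form_def)
qed

lemma lattice_inv_theta_form: "lattice_inv theta_form"
  unfolding lattice_inv_def
proof (intro allI impI)
  fix l \<mu> :: int and \<tau> z :: complex assume t: "Im \<tau> > 0"
  let ?e = "\<lambda>n :: int. ee (of_int n ^ 2 * \<tau> + 2 * of_int n * z)"
  have e: "ee (of_int l ^ 2 * \<tau> + 2 * of_int l * z) * ee (of_int n ^ 2 * \<tau> + 2 * of_int n * (z + of_int l * \<tau> + of_int \<mu>)) = ?e (n + l)" for n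
    using ee_plus_int[of "of_int (n + l) ^ 2 * \<tau> + 2 * of_int (n + l) * z" "2 * n * \<mu>"]
    by (simp add: algebra_simps power2_eq_square flip: ee_add)
  have "bij (\<lambda>n. n + l)" by (rule bij_betw_byWitness[where f' = "\<lambda>n. n - l"]) auto
  then have "(\<Sum>\<^sub>\<infinity>n. ?e (n + l)) = (\<Sum>\<^sub>\<infinity>n. ?e n)" by (rule infsum_reindex_bij_betw)
  then have "ee (of_int l ^ 2 * \<tau> + 2 * of_int l * z) * (\<Sum>\<^sub>\<infinity>n. ee (of_int n ^ 2 * \<tau> + 2 * of_int n * (z + of_int l * \<tau> + of_int \<mu>))) = (\<Sum>\<^sub>\<infinity>n. ?e n)"
    by (simp only: e flip: infsum_cmult_right')
  then show "ee (of_int l ^ 2 * \<tau> + 2 * of_int l * z) * theta_form (\<tau>, z + of_int l * \<tau> + of_int \<mu>) = theta_form (\<tau>, z)"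
    using t by (simp add: theta_form_def mult.left_commute)
qed

definition theta_form_const :: "nat \<Rightarrow> real" where
  "theta_form_const k = 2 * theta_const * fact k"

lemma theta_form_const_pos: "theta_form_const k > 0"
  using theta_const_pos by (simp add: theta_form_const_def)

lemma theta_decay:
  fixes v :: real
  assumes v: "v > 0" and k: "k \<ge> 4"
  shows "v powr (real k / 2) * exp (- 2 * pi * v) * (theta_const * (1 + 1 / sqrt v)) \<le> theta_form_const k * min 1 (v powr (3/2))"
proof (cases "v \<le> 1")
  case True
  have a: "v powr (real k / 2) * (1 + 1 / sqrt v) \<le> 2 * v powr (3/2)"
  proof -
    have "1 + 1 / sqrt v \<le> 2 * v powr (- 1/2)"
      using v True real_le_rsqrt[of v v] mult_left_mono[of v 1 v]
      by (simp add: powr_minus powr_half_sqrt power2_eq_square field_simps)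
    then have "v powr (real k / 2) * (1 + 1 / sqrt v) \<le> v powr (real k / 2) * (2 * v powr (- 1/2))"
      by (rule mult_left_mono) simp
    also have "\<dots> = 2 * v powr (real k / 2 - 1/2)" using powr_add[of v "real k / 2" "- 1/2"] by simp
    also have "v powr (real k / 2 - 1/2) \<le> v powr (3/2)" using v True k by (intro powr_mono') auto
    finally show ?thesis by simp
  qed
  have b: "exp (- 2 * pi * v) \<le> 1" using v by simp
  have "exp (- 2 * pi * v) * (v powr (real k / 2) * (1 + 1 / sqrt v)) \<le> 1 * (2 * v powr (3/2))"
    by (rule mult_mono[OF b a]) (use v in auto)
  then have "theta_const * (exp (- 2 * pi * v) * (v powr (real k / 2) * (1 + 1 / sqrt v))) \<le> theta_const * (fact k * (2 * v powr (3/2)))"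
  proof -
    assume a: "exp (- 2 * pi * v) * (v powr (real k / 2) * (1 + 1 / sqrt v)) \<le> 1 * (2 * v powr (3/2))"
    have "1 * (2 * v powr (3/2)) \<le> fact k * (2 * v powr (3/2))" by (intro mult_right_mono) (auto simp: fact_ge_1)
    with a show ?thesis using theta_const_pos by (intro mult_left_mono) auto
  qed
  moreover have "v powr (3/2) \<le> 1" using v True by (intro powr_le1) auto
  ultimately show ?thesis by (simp add: theta_form_const_def min_def mult_ac)
next
  case False
  have "v powr (real k / 2) \<le> v powr real k" using False by (intro powr_mono) auto
  also have "\<dots> = v ^ k" using v by (simp add: powr_realpow)
  also have "\<dots> \<le> fact k * exp v" using v by (intro power_le_fact_exp) auto
  finally have "v powr (real k / 2) * exp (- 2 * pi * v) \<le> fact k * exp v * exp (- 2 * pi * v)" by (rule mult_right_mono) simp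
  also have "\<dots> = fact k * exp (v - 2 * pi * v)" by (simp add: exp_diff exp_minus field_simps)
  also have "\<dots> \<le> fact k * 1" 
  proof (rule mult_left_mono)
    have "1 * v \<le> 2 * pi * v" using v pi_gt3 by (intro mult_right_mono) auto
    then show "exp (v - 2 * pi * v) \<le> 1" by simp
  qed simp
  finally have 1: "v powr (real k / 2) * exp (- 2 * pi * v) \<le> fact k" by simp
  have "theta_const * (1 + 1 / sqrt v) \<le> theta_const * 2" using False theta_const_pos by (intro mult_left_mono) auto
  with 1 have "v powr (real k / 2) * exp (- 2 * pi * v) * (theta_const * (1 + 1 / sqrt v)) \<le> fact k * (theta_const * 2)"
    using theta_const_pos v by (intro mult_mono) auto
  moreover have "1 \<le> v powr (3/2)" using False by (intro ge_one_powr_ge_zero) auto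
  ultimately show ?thesis by (simp add: theta_form_const_def min_def mult_ac)
qed

lemma tilde_theta_form:
  assumes p: "Im (fst p) > 0" and k: "k \<ge> 4"
  shows "jacobi_tilde k 1 theta_form p \<le> theta_form_const k * min 1 (Im (fst p) powr (3/2))"
proof -
  obtain \<tau> z where e: "p = (\<tau>, z)" by (cases p)
  let ?v = "Im \<tau>"
  have v: "?v > 0" using p e by simp
  let ?t = "\<lambda>l :: int. ee (of_int l ^ 2 * \<tau> + 2 * of_int l * z)"
  have "cmod (\<Sum>\<^sub>\<infinity>l. ?t l) \<le> (\<Sum>\<^sub>\<infinity>l. norm (?t l))"
    by (rule norm_infsum_bound[OF theta_term_summable[OF v]])
  also have "\<dots> = exp (2 * pi * (Im z)\<^sup>2 / ?v) * (\<Sum>\<^sub>\<infinity>l :: int. exp (- 2 * pi * ?v * (Im z / ?v + of_int l)\<^sup>2))"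
    unfolding norm_theta_term[OF v] by (rule infsum_cmult_right')
  also have "\<dots> \<le> exp (2 * pi * (Im z)\<^sup>2 / ?v) * (theta_const * (1 + 1 / sqrt ?v))"
    by (intro mult_left_mono theta_summable v) auto
  finally have s: "cmod (\<Sum>\<^sub>\<infinity>l. ?t l) \<le> exp (2 * pi * (Im z)\<^sup>2 / ?v) * (theta_const * (1 + 1 / sqrt ?v))" .
  have "jacobi_tilde k 1 theta_form p = ?v powr (real k / 2) * exp (- 2 * pi * ?v) * (exp (- 2 * pi * (Im z)\<^sup>2 / ?v) * cmod (\<Sum>\<^sub>\<infinity>l. ?t l))"
    using v by (simp add: jacobi_tilde_def theta_form_def e norm_mult norm_ee mult_ac)
  also have "exp (- 2 * pi * (Im z)\<^sup>2 / ?v) * cmod (\<Sum>\<^sub>\<infinity>l. ?t l) \<le> exp (- 2 * pi * (Im z)\<^sup>2 / ?v) * (exp (2 * pi * (Im z)\<^sup>2 / ?v) * (theta_const * (1 + 1 / sqrt ?v)))"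
    by (intro mult_left_mono s) auto
  also have "\<dots> = theta_const * (1 + 1 / sqrt ?v)"
    by (simp add: mult.assoc[symmetric] flip: exp_add)
  finally have "jacobi_tilde k 1 theta_form p \<le> ?v powr (real k / 2) * exp (- 2 * pi * ?v) * (theta_const * (1 + 1 / sqrt ?v))"
    by (simp add: mult_left_mono)
  also have "\<dots> \<le> theta_form_const k * min 1 (?v powr (3/2))" by (rule theta_decay[OF v k])
  finally show ?thesis by (simp add: e)
qed

lemma theta_form_i: "cmod (theta_form (\<i>, 0)) \<ge> exp (- 2 * pi)"
proof -
  have r: "ee (of_int l ^ 2 * \<i> + 2 * of_int l * 0) = of_real (exp (- 2 * pi * (of_int l)\<^sup>2))" for l :: int
  proof -
    have "2 * of_real pi * \<i> * (of_int l ^ 2 * \<i> + 2 * of_int l * 0) = complex_of_real (- 2 * pi * (of_int l)\<^sup>2)"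
      by (simp add: complex_eq_iff flip: of_int_power)
    then show ?thesis by (simp only: ee_def exp_of_real)
  qed
  have s: "(\<lambda>l :: int. exp (- 2 * pi * (real_of_int l)\<^sup>2)) summable_on UNIV" using theta_summable(1)[of 1 0] by simp
  have "(\<Sum>l\<in>{0 :: int}. exp (- 2 * pi * (real_of_int l)\<^sup>2)) \<le> (\<Sum>\<^sub>\<infinity>l :: int. exp (- 2 * pi * (real_of_int l)\<^sup>2))"
    by (rule finite_sum_le_infsum[OF s]) auto
  then have 1: "1 \<le> (\<Sum>\<^sub>\<infinity>l :: int. exp (- 2 * pi * (real_of_int l)\<^sup>2))" by simp
  have "theta_form (\<i>, 0) = ee \<i> * of_real (\<Sum>\<^sub>\<infinity>l :: int. exp (- 2 * pi * (real_of_int l)\<^sup>2))"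
    unfolding theta_form_def fst_conv snd_conv r infsumI[OF has_sum_of_real[OF has_sum_infsum[OF s]]] by simp
  then have "cmod (theta_form (\<i>, 0)) = exp (- 2 * pi) * \<bar>\<Sum>\<^sub>\<infinity>l :: int. exp (- 2 * pi * (real_of_int l)\<^sup>2)\<bar>"
    by (simp only: norm_mult norm_of_real norm_ee imaginary_unit.sel mult_1_right)
  moreover have "exp (- 2 * pi) * 1 \<le> exp (- 2 * pi) * \<bar>\<Sum>\<^sub>\<infinity>l :: int. exp (- 2 * pi * (real_of_int l)\<^sup>2)\<bar>"
    using 1 by (intro mult_left_mono) auto
  ultimately show ?thesis by simp
qed

abbreviation primitive_rows :: "nat \<Rightarrow> (int \<times> int) set" where
  "primitive_rows N \<equiv> {(c, d). coprime c d \<and> int N dvd c}"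

definition row_rep :: "int \<times> int \<Rightarrow> int ^ 2 ^ 2" where
  "row_rep r = (SOME A. A \<in> SL2Z \<and> A$2$1 = fst r \<and> A$2$2 = snd r)"

definition row_mult :: "int \<times> int \<Rightarrow> int ^ 2 ^ 2 \<Rightarrow> int \<times> int" where
  "row_mult = (\<lambda>(c, d) A. (c * A$1$1 + d * A$2$1, c * A$1$2 + d * A$2$2))"

lemma row_rep:
  assumes "coprime (fst r) (snd r)"
  shows "row_rep r \<in> SL2Z" "row_rep r $ 2 $ 1 = fst r" "row_rep r $ 2 $ 2 = snd r"
proof -
  have "\<exists>A. A \<in> SL2Z \<and> A$2$1 = fst r \<and> A$2$2 = snd r" using SL2Z_bottom_row[OF assms] by metis
  from someI_ex[OF this] show "row_rep r \<in> SL2Z" "row_rep r $ 2 $ 1 = fst r" "row_rep r $ 2 $ 2 = snd r"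
    unfolding row_rep_def by blast+
qed

lemma row_rep_mult:
  assumes "coprime (fst r) (snd r)"
  shows "((row_rep r ** A) $ 2 $ 1, (row_rep r ** A) $ 2 $ 2) = row_mult r A"
  using row_rep[OF assms] by (simp add: mul2_nth row_mult_def case_prod_beta')

lemma coprime_row_mult:
  assumes "coprime (fst r) (snd r)" "A \<in> SL2Z"
  shows "coprime (fst (row_mult r A)) (snd (row_mult r A))"
  using SL2Z_coprime[OF SL2Z_mult[OF row_rep(1)[OF assms(1)] assms(2)]] row_rep_mult[OF assms(1), of A]
  by (metis fst_conv snd_conv)

lemma row_mult_inv2:
  assumes "A \<in> SL2Z"
  shows "row_mult (row_mult r A) (inv2 A) = r" "row_mult (row_mult r (inv2 A)) A = r"
proof -
  obtain c d where r: "r = (c, d)" by (cases r)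
  have "A$1$1 * A$2$2 - A$1$2 * A$2$1 = 1" using assms by (simp add: SL2Z_iff)
  moreover have "(c * A$1$1 + d * A$2$1) * A$2$2 + (c * A$1$2 + d * A$2$2) * (- A$2$1) = c * (A$1$1 * A$2$2 - A$1$2 * A$2$1)"
    "(c * A$1$1 + d * A$2$1) * (- A$1$2) + (c * A$1$2 + d * A$2$2) * A$1$1 = d * (A$1$1 * A$2$2 - A$1$2 * A$2$1)"
    "(c * A$2$2 + d * (- A$2$1)) * A$1$1 + (c * (- A$1$2) + d * A$1$1) * A$2$1 = c * (A$1$1 * A$2$2 - A$1$2 * A$2$1)"
    "(c * A$2$2 + d * (- A$2$1)) * A$1$2 + (c * (- A$1$2) + d * A$1$1) * A$2$2 = d * (A$1$1 * A$2$2 - A$1$2 * A$2$1)"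
    by (simp_all add: algebra_simps)
  ultimately show "row_mult (row_mult r A) (inv2 A) = r" "row_mult (row_mult r (inv2 A)) A = r"
    by (simp_all add: r row_mult_def inv2_def)
qed

lemma bij_row_mult:
  assumes "A \<in> Gamma0 N"
  shows "bij_betw (\<lambda>r. row_mult r A) (primitive_rows N) (primitive_rows N)"
proof (rule bij_betw_byWitness[where f' = "\<lambda>r. row_mult r (inv2 A)"])
  have A: "A \<in> SL2Z" "inv2 A \<in> Gamma0 N" using assms Gamma0_SL2Z Gamma0_inv2 by auto
  have *: "row_mult r B \<in> primitive_rows N" if "r \<in> primitive_rows N" "B \<in> Gamma0 N" for r B
  proof -
    have r: "coprime (fst r) (snd r)" "int N dvd fst r" using that by auto
    have "int N dvd B$2$1" using that(2) by (simp add: Gamma0_def)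
    then have "int N dvd fst (row_mult r B)" using r(2) by (simp add: row_mult_def case_prod_beta')
    then show ?thesis using coprime_row_mult[OF r(1) Gamma0_SL2Z[OF that(2)]] by (simp add: case_prod_beta')
  qed
  show "\<forall>r\<in>primitive_rows N. row_mult (row_mult r A) (inv2 A) = r" "\<forall>r\<in>primitive_rows N. row_mult (row_mult r (inv2 A)) A = r"
    using row_mult_inv2[OF A(1)] by auto
  show "(\<lambda>r. row_mult r A) ` primitive_rows N \<subseteq> primitive_rows N" "(\<lambda>r. row_mult r (inv2 A)) ` primitive_rows N \<subseteq> primitive_rows N"
    by (rule image_subsetI, rule *, assumption, rule assms A)+
qed

definition row_weight :: "int \<times> int \<Rightarrow> real" where
  "row_weight = (\<lambda>(c, d). of_bool ((c, d) \<in> {(0, 1), (0, - 1), (1, 0), (- 1, 0)}) + 8 * (\<bar>of_int c\<bar> powr (- 3/2) * \<bar>of_int d\<bar> powr (- 3/2)))"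

lemma sum_int_powr:
  assumes "finite X"
  shows "(\<Sum>c\<in>X. \<bar>real_of_int c\<bar> powr (- 3/2)) \<le> 2 * zeta32"
proof -
  have half: "(\<Sum>c\<in>Y. \<bar>real_of_int c\<bar> powr (- 3/2)) \<le> zeta32" if "finite Y" "inj_on (\<lambda>c. nat \<bar>c\<bar>) Y" for Y
  proof -
    have "(\<Sum>c\<in>Y. \<bar>real_of_int c\<bar> powr (- 3/2)) = (\<Sum>j\<in>(\<lambda>c. nat \<bar>c\<bar>) ` Y. real j powr (- 3/2))"
      using that(2) by (simp add: sum.reindex)
    also have "\<dots> \<le> zeta32" using that(1) by (intro zeta32_bound) simp
    finally show ?thesis .
  qed
  have "X = {c\<in>X. c \<ge> 0} \<union> {c\<in>X. c < 0}" by auto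
  then have "(\<Sum>c\<in>X. \<bar>real_of_int c\<bar> powr (- 3/2)) = (\<Sum>c\<in>{c\<in>X. c \<ge> 0} \<union> {c\<in>X. c < 0}. \<bar>real_of_int c\<bar> powr (- 3/2))" by simp
  also have "\<dots> = (\<Sum>c\<in>{c\<in>X. c \<ge> 0}. \<bar>real_of_int c\<bar> powr (- 3/2)) + (\<Sum>c\<in>{c\<in>X. c < 0}. \<bar>real_of_int c\<bar> powr (- 3/2))"
    using assms by (intro sum.union_disjoint) auto
  also have "\<dots> \<le> zeta32 + zeta32"
    using assms by (intro add_mono half) (auto simp: inj_on_def)
  finally show ?thesis by simp
qed

lemma sum_rows_powr:
  assumes "finite X"
  shows "(\<Sum>(c, d)\<in>X. \<bar>real_of_int c\<bar> powr (- 3/2) * \<bar>real_of_int d\<bar> powr (- 3/2)) \<le> 4 * zeta32\<^sup>2"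
proof -
  have "(\<Sum>(c, d)\<in>X. \<bar>real_of_int c\<bar> powr (- 3/2) * \<bar>real_of_int d\<bar> powr (- 3/2))
     \<le> (\<Sum>(c, d)\<in>fst ` X \<times> snd ` X. \<bar>real_of_int c\<bar> powr (- 3/2) * \<bar>real_of_int d\<bar> powr (- 3/2))"
    using assms by (intro sum_mono2) force+
  also have "\<dots> = (\<Sum>c\<in>fst ` X. \<bar>real_of_int c\<bar> powr (- 3/2)) * (\<Sum>d\<in>snd ` X. \<bar>real_of_int d\<bar> powr (- 3/2))"
    by (simp add: sum_product sum.cartesian_product)
  also have "\<dots> \<le> (2 * zeta32) * (2 * zeta32)"
    using assms zeta32_ge_1 by (intro mult_mono sum_int_powr sum_nonneg) auto
  finally show ?thesis by (simp add: power2_eq_square)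
qed

lemma row_weight_nonneg: "row_weight r \<ge> 0"
  unfolding row_weight_def case_prod_beta' by (simp del: insert_iff)

lemma row_weight_sum:
  assumes "finite X"
  shows "sum row_weight X \<le> 4 + 32 * zeta32\<^sup>2"
proof -
  let ?Q = "{(0, 1), (0, - 1), (1, 0), (- 1, 0)} :: (int \<times> int) set"
  have "row_weight p = of_bool (p \<in> ?Q) + 8 * (case p of (c, d) \<Rightarrow> \<bar>real_of_int c\<bar> powr (- 3/2) * \<bar>real_of_int d\<bar> powr (- 3/2))" for p
    by (cases p) (simp add: row_weight_def)
  then have "sum row_weight X = (\<Sum>p\<in>X. of_bool (p \<in> ?Q) + 8 * (case p of (c, d) \<Rightarrow> \<bar>real_of_int c\<bar> powr (- 3/2) * \<bar>real_of_int d\<bar> powr (- 3/2)))"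
    by (rule sum.cong[OF refl])
  also have "\<dots> = (\<Sum>p\<in>X. of_bool (p \<in> ?Q)) + 8 * (\<Sum>(c, d)\<in>X. \<bar>real_of_int c\<bar> powr (- 3/2) * \<bar>real_of_int d\<bar> powr (- 3/2))"
    by (simp only: sum.distrib sum_distrib_left)
  also have "(\<Sum>p\<in>X. of_bool (p \<in> ?Q)) = (\<Sum>p\<in>X \<inter> ?Q. 1 :: real)"
    using assms by (subst sum.inter_restrict) (auto intro!: sum.cong)
  also have "\<dots> = real (card (X \<inter> ?Q))" by simp
  also have "card (X \<inter> ?Q) \<le> card ?Q" by (intro card_mono) auto
  also have "card ?Q = 4" by simp
  finally show ?thesis using sum_rows_powr[OF assms] by simp
qed

lemma row_decay:
  assumes c: "coprime c d" and \<tau>: "\<bar>Re \<tau>\<bar> < 1" "Im \<tau> > 1/2"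
  shows "min 1 ((Im \<tau> / (cmod (of_int c * \<tau> + of_int d))\<^sup>2) powr (3/2)) \<le> row_weight (c, d)"
proof (cases "c = 0 \<or> d = 0")
  case True
  then have "(c, d) \<in> {(0, 1), (0, - 1), (1, 0), (- 1, 0)}" using c by (auto simp: abs_if split: if_splits)
  then show ?thesis by (auto simp: row_weight_def)
next
  case False
  define X where "X = (cmod (of_int c * \<tau> + of_int d))\<^sup>2"
  define v u where "v = Im \<tau>" and "u = Re \<tau>"
  define C D where "C = \<bar>real_of_int c\<bar>" and "D = \<bar>real_of_int d\<bar>"
  have pos: "C > 0" "D > 0" "v > 0" using False \<tau> by (auto simp: C_def D_def v_def)
  have X: "X = (of_int c * u + of_int d)\<^sup>2 + C\<^sup>2 * v\<^sup>2"
    by (simp add: X_def cmod_power2 u_def v_def C_def power_mult_distrib)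
  have X0: "X > 0" unfolding X using pos by (intro add_nonneg_pos) auto
  have "D\<^sup>2 \<le> 2 * (of_int c * u + of_int d)\<^sup>2 + 2 * (of_int c * u)\<^sup>2"
    using zero_le_power2[of "(of_int c * u + of_int d) + of_int c * u"] by (simp add: D_def power2_eq_square algebra_simps)
  moreover have "(of_int c * u)\<^sup>2 \<le> 4 * (C\<^sup>2 * v\<^sup>2)"
  proof -
    have "u\<^sup>2 \<le> 1\<^sup>2" using \<tau>(1) by (intro power2_le_iff_abs_le[THEN iffD2]) (auto simp: u_def)
    moreover have "(1/2)\<^sup>2 \<le> v\<^sup>2" using \<tau>(2) by (intro power_mono) (auto simp: v_def)
    ultimately have "u\<^sup>2 \<le> 4 * v\<^sup>2" by (simp add: power2_eq_square)
    from mult_left_mono[OF this, of "(of_int c)\<^sup>2"] show ?thesis by (simp add: C_def power_mult_distrib)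
  qed
  moreover have "0 \<le> (of_int c * u + of_int d)\<^sup>2" by (rule zero_le_power2)
  ultimately have D: "D\<^sup>2 \<le> 8 * X" unfolding X distrib_left by linarith
  have CX: "C\<^sup>2 * v\<^sup>2 \<le> X" unfolding X by simp
  have "(C * v * D)\<^sup>2 = C\<^sup>2 * v\<^sup>2 * D\<^sup>2" by (simp add: power_mult_distrib)
  also have "\<dots> \<le> X * (8 * X)" using X0 by (intro mult_mono CX D) auto
  also have "\<dots> \<le> (4 * X)\<^sup>2" by (simp add: power2_eq_square)
  finally have "C * v * D \<le> 4 * X" by (rule power2_le_imp_le) (use X0 in simp)
  then have "v * (C * D) \<le> 4 * X" by (simp only: mult_ac)
  then have "v \<le> 4 * X / (C * D)" using pos by (simp only: pos_le_divide_eq mult_pos_pos)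
  then have "v / X \<le> 4 * X / (C * D) / X" using X0 by (intro divide_right_mono) auto
  also have "\<dots> = 4 * (1 / (C * D))" using X0 by simp
  finally have "v / X \<le> 4 * (1 / (C * D))" .
  then have "(v / X) powr (3/2) \<le> (4 * (1 / (C * D))) powr (3/2)"
    using pos X0 by (intro powr_mono2) auto
  also have "\<dots> = 4 powr (3/2) * (1 / (C * D)) powr (3/2)" using pos by (intro powr_mult) 
  also have "(4 :: real) powr (3/2) = 8"
    using powr_powr[of 2 2 "3/2 :: real"] by (simp flip: powr_numeral)
  also have "(1 / (C * D)) powr (3/2) = C powr (- 3/2) * D powr (- 3/2)"
    using pos by (simp add: powr_divide powr_mult powr_minus_divide)
  also have "8 * (C powr (- 3/2) * D powr (- 3/2)) \<le> row_weight (c, d)"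
    unfolding row_weight_def prod.case C_def D_def by (simp del: insert_iff)
  finally show ?thesis unfolding X_def v_def by (rule min.coboundedI2)
qed

definition poincare_term :: "nat \<Rightarrow> int \<times> int \<Rightarrow> complex \<times> complex \<Rightarrow> complex" where
  "poincare_term k r = slash k 1 theta_form (row_rep r)"

lemma poincare_term_eq:
  assumes A: "A \<in> SL2Z" and p: "p \<in> jacobi_domain"
  shows "poincare_term k (A$2$1, A$2$2) p = slash k 1 theta_form A p"
proof -
  let ?B = "row_rep (A$2$1, A$2$2)"
  have B: "?B \<in> SL2Z" "A$2$1 = ?B$2$1" "A$2$2 = ?B$2$2"
    using row_rep[of "(A$2$1, A$2$2)"] SL2Z_coprime[OF A] by auto
  obtain j where j: "?B = trans2 j ** A" using SL2Z_same_row[OF A B] .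
  have "slash k 1 theta_form (trans2 j ** A) p = slash k 1 (slash k 1 theta_form (trans2 j)) A p"
    using slash_mult[OF trans2_SL2Z A p] by simp
  also have "\<dots> = slash k 1 theta_form A p"
    by (rule slash_cong[OF A p]) (metis prod.exhaust slash_trans2 theta_form_shift)
  finally show ?thesis by (simp only: poincare_term_def j)
qed

lemma poincare_term_slash:
  assumes r: "coprime (fst r) (snd r)" and A: "A \<in> SL2Z" and p: "p \<in> jacobi_domain"
  shows "slash k 1 (poincare_term k r) A p = poincare_term k (row_mult r A) p"
proof -
  have "slash k 1 (poincare_term k r) A p = slash k 1 theta_form (row_rep r ** A) p"
    unfolding poincare_term_def by (rule slash_mult[OF row_rep(1)[OF r] A p])
  also have "\<dots> = poincare_term k (row_mult r A) p"
    using poincare_term_eq[OF SL2Z_mult[OF row_rep(1)[OF r] A] p] row_rep_mult[OF r, of A] by simp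
  finally show ?thesis .
qed

lemma poincare_term_lattice: "coprime (fst r) (snd r) \<Longrightarrow> lattice_inv (poincare_term k r)"
  unfolding poincare_term_def by (intro lattice_inv_slash lattice_inv_theta_form row_rep)

lemma poincare_term_transfer:
  assumes r: "coprime (fst r) (snd r)" and g: "fst g \<in> SL2Z" and p: "p \<in> jacobi_domain"
  shows "jacobi_tilde k 1 (poincare_term k r) p = jacobi_tilde k 1 (poincare_term k (row_mult r (inv2 (fst g)))) (jact g p)"
proof -
  have "slash k 1 (poincare_term k r) (inv2 (fst g)) (jact g p) = poincare_term k (row_mult r (inv2 (fst g))) (jact g p)"
    by (rule poincare_term_slash[OF r SL2Z_inv2[OF g] jact_domain[OF g p]])
  then have "jacobi_tilde k 1 (slash k 1 (poincare_term k r) (inv2 (fst g))) (jact g p) = jacobi_tilde k 1 (poincare_term k (row_mult r (inv2 (fst g)))) (jact g p)"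
    by (cases "jact g p") (simp add: jacobi_tilde_def)
  then show ?thesis using tilde_transfer[OF poincare_term_lattice[OF r, of k] g p] by simp
qed

lemma poincare_term_box:
  assumes r: "coprime (fst r) (snd r)" and k: "k \<ge> 4" and p: "\<bar>Re (fst p)\<bar> < 1" "Im (fst p) > 1/2"
  shows "jacobi_tilde k 1 (poincare_term k r) p \<le> theta_form_const k * row_weight r"
proof -
  obtain \<tau> z where e: "p = (\<tau>, z)" by (cases p)
  have t: "Im \<tau> > 0" using p e by simp
  note R = row_rep[OF r]
  have "jacobi_tilde k 1 (poincare_term k r) p = jacobi_tilde k 1 theta_form (jacobi_act (row_rep r) 0 0 p)"
    unfolding poincare_term_def using t e by (intro tilde_slash R) auto
  also have "\<dots> \<le> theta_form_const k * min 1 (Im (mob (row_rep r) \<tau>) powr (3/2))"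
    using tilde_theta_form[of "jacobi_act (row_rep r) 0 0 p" k] Im_mob_pos[OF R(1) t] k by (simp add: e jacobi_act_def)
  also have "Im (mob (row_rep r) \<tau>) = Im \<tau> / (cmod (of_int (fst r) * \<tau> + of_int (snd r)))\<^sup>2"
    using Im_mob[OF R(1) t] by (simp add: mob_den_def R)
  also have "theta_form_const k * min 1 ((Im \<tau> / (cmod (of_int (fst r) * \<tau> + of_int (snd r)))\<^sup>2) powr (3/2)) \<le> theta_form_const k * row_weight r"
    using row_decay[OF r, of \<tau>] p theta_form_const_pos[of k] by (intro mult_left_mono) (auto simp: e)
  finally show ?thesis .
qed

definition poincare_const :: "nat \<Rightarrow> real" where
  "poincare_const k = theta_form_const k * (4 + 32 * zeta32\<^sup>2)"

lemma poincare_const_pos: "poincare_const k > 0"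
  unfolding poincare_const_def using theta_form_const_pos by (intro mult_pos_pos add_pos_nonneg) auto

lemma row_mult_inj: "B \<in> SL2Z \<Longrightarrow> inj_on (\<lambda>r. row_mult r B) X"
  by (rule inj_on_inverseI[where g = "\<lambda>r. row_mult r (inv2 B)"]) (rule row_mult_inv2)

lemma poincare_sum_bound:
  assumes X: "finite X" "\<And>r. r \<in> X \<Longrightarrow> coprime (fst r) (snd r)" and k: "k \<ge> 4" and p: "p \<in> jacobi_domain"
  shows "(\<Sum>r\<in>X. jacobi_tilde k 1 (poincare_term k r) p) \<le> poincare_const k"
proof -
  obtain g where g: "fst g \<in> SL2Z" "jact g p \<in> cusp_box" using cusp_box_cover[OF p] by blast
  let ?B = "inv2 (fst g)"
  have B: "?B \<in> SL2Z" by (rule SL2Z_inv2[OF g(1)])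
  have W: "\<bar>Re (fst (jact g p))\<bar> < 1" "Im (fst (jact g p)) > 1/2" using g(2) by (auto simp: cusp_box_def)
  have "(\<Sum>r\<in>X. jacobi_tilde k 1 (poincare_term k r) p) \<le> (\<Sum>r\<in>X. theta_form_const k * row_weight (row_mult r ?B))"
  proof (rule sum_mono)
    fix r assume "r \<in> X"
    then have r: "coprime (fst r) (snd r)" by (rule X(2))
    show "jacobi_tilde k 1 (poincare_term k r) p \<le> theta_form_const k * row_weight (row_mult r ?B)"
      unfolding poincare_term_transfer[OF r g(1) p] by (rule poincare_term_box[OF coprime_row_mult[OF r B] k W])
  qed
  also have "\<dots> = theta_form_const k * sum row_weight ((\<lambda>r. row_mult r ?B) ` X)"
    by (simp add: sum.reindex[OF row_mult_inj[OF B]] sum_distrib_left)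
  also have "\<dots> \<le> poincare_const k"
    unfolding poincare_const_def using X(1) theta_form_const_pos[of k] by (intro mult_left_mono row_weight_sum) auto
  finally show ?thesis .
qed

lemma tilde_eq:
  "jacobi_tilde k 1 f p = (Im (fst p) powr (real k / 2) * exp (- 2 * pi * Im (snd p) ^ 2 / Im (fst p))) * cmod (f p)"
  by (cases p) (simp add: jacobi_tilde_def)

definition poincare :: "nat \<Rightarrow> nat \<Rightarrow> complex \<times> complex \<Rightarrow> complex" where
  "poincare k N p = (if Im (fst p) > 0 then \<Sum>\<^sub>\<infinity>r\<in>primitive_rows N. poincare_term k r p else 0)"

lemma poincare_term_summable:
  assumes k: "k \<ge> 4" and p: "p \<in> jacobi_domain"
  shows "(\<lambda>r. jacobi_tilde k 1 (poincare_term k r) p) summable_on primitive_rows N"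
    "(\<Sum>\<^sub>\<infinity>r\<in>primitive_rows N. jacobi_tilde k 1 (poincare_term k r) p) \<le> poincare_const k"
    "(\<lambda>r. norm (poincare_term k r p)) summable_on primitive_rows N"
    "jacobi_tilde k 1 (poincare k N) p \<le> (\<Sum>\<^sub>\<infinity>r\<in>primitive_rows N. jacobi_tilde k 1 (poincare_term k r) p)"
proof -
  have f: "(\<Sum>r\<in>X. jacobi_tilde k 1 (poincare_term k r) p) \<le> poincare_const k" if "finite X" "X \<subseteq> primitive_rows N" for X
    using that by (intro poincare_sum_bound k p) auto
  show s: "(\<lambda>r. jacobi_tilde k 1 (poincare_term k r) p) summable_on primitive_rows N"
    and "(\<Sum>\<^sub>\<infinity>r\<in>primitive_rows N. jacobi_tilde k 1 (poincare_term k r) p) \<le> poincare_const k"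
    by (rule summable_on_bounded[OF jacobi_tilde_nonneg f]; assumption)+
  let ?w = "Im (fst p) powr (real k / 2) * exp (- 2 * pi * Im (snd p) ^ 2 / Im (fst p))"
  have v: "Im (fst p) > 0" using p by (cases p) simp
  then have w: "?w > 0" by simp
  have "(\<lambda>r. (1 / ?w) * jacobi_tilde k 1 (poincare_term k r) p) summable_on primitive_rows N"
    by (rule summable_on_cmult_right[OF s])
  moreover have "(1 / ?w) * jacobi_tilde k 1 (poincare_term k r) p = norm (poincare_term k r p)" for r
    unfolding tilde_eq using v by simp
  ultimately show n: "(\<lambda>r. norm (poincare_term k r p)) summable_on primitive_rows N" by simp
  have "cmod (poincare k N p) \<le> (\<Sum>\<^sub>\<infinity>r\<in>primitive_rows N. norm (poincare_term k r p))"
    using norm_infsum_bound[OF n] v by (simp add: poincare_def)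
  then have "?w * cmod (poincare k N p) \<le> ?w * (\<Sum>\<^sub>\<infinity>r\<in>primitive_rows N. norm (poincare_term k r p))"
    using w by (intro mult_left_mono) auto
  then show "jacobi_tilde k 1 (poincare k N) p \<le> (\<Sum>\<^sub>\<infinity>r\<in>primitive_rows N. jacobi_tilde k 1 (poincare_term k r) p)"
    unfolding tilde_eq by (simp only: infsum_cmult_right')
qed

lemma tilde_poincare: "k \<ge> 4 \<Longrightarrow> p \<in> jacobi_domain \<Longrightarrow> jacobi_tilde k 1 (poincare k N) p \<le> poincare_const k"
  using poincare_term_summable(2,4) order_trans by blast

lemma holomorphic2_poincare:
  assumes k: "k \<ge> 4"
  shows "holomorphic2_on (poincare k N) jacobi_domain"
proof (rule holomorphic2_on_transform)
  show "holomorphic2_on (\<lambda>p. \<Sum>\<^sub>\<infinity>r\<in>primitive_rows N. poincare_term k r p) jacobi_domain"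
  proof (rule holomorphic2_infsum[OF open_jacobi_domain])
    fix r assume "r \<in> primitive_rows N"
    then show "holomorphic2_on (poincare_term k r) jacobi_domain"
      unfolding poincare_term_def by (intro holomorphic2_slash holomorphic2_theta_form row_rep) auto
  next
    fix p :: "complex \<times> complex" assume p: "p \<in> jacobi_domain"
    obtain g where g: "fst g \<in> SL2Z" "jact g p \<in> cusp_box" using cusp_box_cover[OF p] by blast
    define A where "A = fst g"
    have fj: "fst (jact g q) = mob A (fst q)" for q by (cases g; cases q) (simp add: jact_Pair A_def)
    let ?B = "inv2 (fst g)"
    have B: "?B \<in> SL2Z" by (rule SL2Z_inv2[OF g(1)])
    define wt where "wt = (\<lambda>q :: complex \<times> complex. Im (fst q) powr (real k / 2) * exp (- 2 * pi * Im (snd q) ^ 2 / Im (fst q)))"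
    have wp: "wt p > 0" using p by (cases p) (simp add: wt_def)
    have cw: "continuous_on jacobi_domain wt" unfolding wt_def by (intro continuous_intros) auto
    define W where "W = {\<tau>. Re \<tau> < 1} \<inter> {\<tau>. Re \<tau> > - 1} \<inter> {\<tau>. Im \<tau> > 1/2}"
    have W: "open W" unfolding W_def by (intro open_Int open_halfspace_Im_gt open_halfspace_Re_gt open_halfspace_Re_lt)
    define V where "V = (jacobi_domain \<inter> (\<lambda>q. mob A (fst q)) -` W) \<inter> (jacobi_domain \<inter> wt -` {wt p / 2<..})"
    have "open V"
      unfolding V_def using g(1) W cw
      by (intro open_Int continuous_open_preimage open_jacobi_domain continuous_on_mob) (auto simp: A_def)
    moreover have "p \<in> V"
      using p wp g(2) fj[of p] by (auto simp: V_def W_def cusp_box_def)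
    moreover have "(\<lambda>r. (2 / wt p) * (theta_form_const k * row_weight (row_mult r ?B))) summable_on primitive_rows N"
    proof (intro summable_on_cmult_right summable_on_bounded(1))
      fix X :: "(int \<times> int) set" assume "finite X"
      then have "sum row_weight ((\<lambda>r. row_mult r ?B) ` X) \<le> 4 + 32 * zeta32\<^sup>2" by (intro row_weight_sum) simp
      then show "(\<Sum>r\<in>X. row_weight (row_mult r ?B)) \<le> 4 + 32 * zeta32\<^sup>2"
        by (simp add: sum.reindex[OF row_mult_inj[OF B]])
    qed (rule row_weight_nonneg)
    moreover have "cmod (poincare_term k r q) \<le> (2 / wt p) * (theta_form_const k * row_weight (row_mult r ?B))"
      if "r \<in> primitive_rows N" "q \<in> V" for r q
    proof -
      have r: "coprime (fst r) (snd r)" using that by auto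
      have q: "q \<in> jacobi_domain" "mob A (fst q) \<in> W" "wt q > wt p / 2" using that(2) by (auto simp: V_def)
      have "\<bar>Re (fst (jact g q))\<bar> < 1" "Im (fst (jact g q)) > 1/2" unfolding fj using q(2) by (auto simp: W_def)
      from poincare_term_box[OF coprime_row_mult[OF r B] k this]
      have "jacobi_tilde k 1 (poincare_term k r) q \<le> theta_form_const k * row_weight (row_mult r ?B)"
        unfolding poincare_term_transfer[OF r g(1) q(1)] .
      then have "wt q * cmod (poincare_term k r q) \<le> theta_form_const k * row_weight (row_mult r ?B)"
        unfolding tilde_eq wt_def .
      moreover have "wt p / 2 * cmod (poincare_term k r q) \<le> wt q * cmod (poincare_term k r q)"
        using q(3) by (intro mult_right_mono) auto
      ultimately have "wt p / 2 * cmod (poincare_term k r q) \<le> theta_form_const k * row_weight (row_mult r ?B)" by linarith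
      then show ?thesis using wp by (simp add: field_simps)
    qed
    ultimately show "\<exists>V M. open V \<and> p \<in> V \<and> M summable_on primitive_rows N \<and> (\<forall>r\<in>primitive_rows N. \<forall>q\<in>V \<inter> jacobi_domain. cmod (poincare_term k r q) \<le> M r)" by blast
  qed
qed (auto simp: poincare_def)

lemma slash_poincare:
  assumes A: "A \<in> SL2Z" and p: "p \<in> jacobi_domain"
  shows "slash k 1 (poincare k N) A p = (\<Sum>\<^sub>\<infinity>r\<in>primitive_rows N. poincare_term k (row_mult r A) p)"
proof -
  obtain \<tau> z where e: "p = (\<tau>, z)" by (cases p)
  let ?q = "jacobi_act A 0 0 (\<tau>, z)"
  have q: "Im (fst ?q) > 0" using jacobi_act_domain[OF A p, of 0 0] by (cases ?q) (simp add: e)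
  have "slash k 1 (poincare k N) A p = (\<Sum>\<^sub>\<infinity>r\<in>primitive_rows N. slash k 1 (poincare_term k r) A p)"
  proof -
    have "poincare k N ?q = (\<Sum>\<^sub>\<infinity>r\<in>primitive_rows N. poincare_term k r ?q)" using q by (simp add: poincare_def)
    then show ?thesis by (simp only: e slash_def prod.case infsum_cmult_right')
  qed
  also have "\<dots> = (\<Sum>\<^sub>\<infinity>r\<in>primitive_rows N. poincare_term k (row_mult r A) p)"
    using A p by (intro infsum_cong poincare_term_slash) auto
  finally show ?thesis .
qed

lemma lattice_inv_poincare: "lattice_inv (poincare k N)"
  unfolding lattice_inv_def
proof (intro allI impI)
  fix l \<mu> :: int and \<tau> z :: complex assume t: "Im \<tau> > 0"
  have "ee (of_int l ^ 2 * \<tau> + 2 * of_int l * z) * poincare k N (\<tau>, z + of_int l * \<tau> + of_int \<mu>)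
     = (\<Sum>\<^sub>\<infinity>r\<in>primitive_rows N. ee (of_int l ^ 2 * \<tau> + 2 * of_int l * z) * poincare_term k r (\<tau>, z + of_int l * \<tau> + of_int \<mu>))"
    using t by (simp add: poincare_def infsum_cmult_right')
  also have "\<dots> = (\<Sum>\<^sub>\<infinity>r\<in>primitive_rows N. poincare_term k r (\<tau>, z))"
    using t poincare_term_lattice by (intro infsum_cong) (auto simp: lattice_inv_def)
  finally show "ee (of_int l ^ 2 * \<tau> + 2 * of_int l * z) * poincare k N (\<tau>, z + of_int l * \<tau> + of_int \<mu>) = poincare k N (\<tau>, z)"
    using t by (simp add: poincare_def)
qed

lemma slash_poincare_Gamma0:
  assumes "A \<in> Gamma0 N" "p \<in> jacobi_domain"
  shows "slash k 1 (poincare k N) A p = poincare k N p"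
proof -
  have "slash k 1 (poincare k N) A p = (\<Sum>\<^sub>\<infinity>r\<in>primitive_rows N. poincare_term k r p)"
    unfolding slash_poincare[OF Gamma0_SL2Z[OF assms(1)] assms(2)]
    by (rule infsum_reindex_bij_betw[OF bij_row_mult[OF assms(1)]])
  then show ?thesis using assms(2) by (cases p) (simp add: poincare_def)
qed

lemma poincare_cusp_form:
  assumes k: "k \<ge> 4" and N: "N > 0"
  shows "poincare k N \<in> jacobi_cusp_forms k 1 N"
proof -
  have exp: "\<exists>a :: int \<Rightarrow> int \<Rightarrow> complex. (\<forall>n r. a n r \<noteq> 0 \<longrightarrow> real_of_int (r ^ 2) < 4 * (real_of_int n / real N)) \<and>
        (\<forall>\<tau> z. Im \<tau> > 0 \<longrightarrow> ((\<lambda>(n, r). a n r * ee (of_int n / of_nat N * \<tau> + of_int r * z)) has_sum slash k 1 (poincare k N) A (\<tau>, z)) UNIV)"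
    if A: "A \<in> SL2Z" for A
  proof (rule cusp_expansion[OF _ N])
    let ?f = "slash k 1 (poincare k N) A"
    show "holomorphic2_on ?f jacobi_domain" by (rule holomorphic2_slash[OF holomorphic2_poincare[OF k] A])
    show "k > 0" using k by simp
    show "jacobi_tilde k 1 ?f p \<le> poincare_const k" if p: "p \<in> jacobi_domain" for p
      unfolding tilde_slash[OF A p] by (rule tilde_poincare[OF k jacobi_act_domain[OF A p]])
    fix \<tau> z :: complex assume t: "Im \<tau> > 0"
    then have p: "(\<tau>, z) \<in> jacobi_domain" by simp
    have "lattice_inv ?f" by (rule lattice_inv_slash[OF lattice_inv_poincare A])
    from this[unfolded lattice_inv_def, rule_format, OF t, of 0 z 1] show "?f (\<tau>, z + 1) = ?f (\<tau>, z)" by simp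
    have G: "A ** trans2 (int N) ** inv2 A \<in> Gamma0 N"
      unfolding width_iff[OF A N] using width_dvd[OF N] by simp
    have "?f (\<tau> + of_nat N, z) = slash k 1 ?f (trans2 (int N)) (\<tau>, z)" by (simp add: slash_trans2)
    also have "\<dots> = slash k 1 (poincare k N) (A ** trans2 (int N)) (\<tau>, z)" by (rule slash_mult[OF A trans2_SL2Z p])
    also have "A ** trans2 (int N) = (A ** trans2 (int N) ** inv2 A) ** A"
      using inv2_mult[OF A] by (simp flip: matrix_mul_assoc)
    also have "slash k 1 (poincare k N) \<dots> (\<tau>, z) = slash k 1 (slash k 1 (poincare k N) (A ** trans2 (int N) ** inv2 A)) A (\<tau>, z)"
      using slash_mult[OF Gamma0_SL2Z[OF G] A p] by simp
    also have "\<dots> = ?f (\<tau>, z)" by (rule slash_cong[OF A p slash_poincare_Gamma0[OF G]])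
    finally show "?f (\<tau> + of_nat N, z) = ?f (\<tau>, z)" .
  qed
  show ?thesis
    unfolding jacobi_cusp_forms_def mem_Collect_eq
  proof (intro conjI)
    show "\<forall>p. p \<notin> jacobi_domain \<longrightarrow> poincare k N p = 0" by (auto simp: poincare_def)
    show "holomorphic2_on (poincare k N) jacobi_domain" by (rule holomorphic2_poincare[OF k])
    show "\<forall>A\<in>Gamma0 N. \<forall>p\<in>jacobi_domain. slash k 1 (poincare k N) A p = poincare k N p"
      using slash_poincare_Gamma0 by blast
    show "\<forall>l \<mu>. \<forall>\<tau>\<in>upper_half_plane. \<forall>z. ee (of_nat 1 * (of_int l ^ 2 * \<tau> + 2 * of_int l * z)) * poincare k N (\<tau>, z + of_int l * \<tau> + of_int \<mu>) = poincare k N (\<tau>, z)"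
      using lattice_inv_poincare[of k N] by (simp add: lattice_inv_def)
    show "\<forall>A\<in>SL2Z. \<exists>a :: int \<Rightarrow> int \<Rightarrow> complex.
        (\<forall>n r. a n r \<noteq> 0 \<longrightarrow> real_of_int (r ^ 2) < 4 * real 1 * (real_of_int n / real N)) \<and>
        (\<forall>\<tau>\<in>upper_half_plane. \<forall>z. ((\<lambda>(n, r). a n r * ee (of_int n / of_nat N * \<tau> + of_int r * z)) has_sum slash k 1 (poincare k N) A (\<tau>, z)) UNIV)"
      unfolding of_nat_1 mult_1_right Ball_def upper_half_plane_iff using exp by blast
  qed
qed

section \<open>The two bounds\<close>

lemma nn_integral_decay:
  "(\<integral>\<^sup>+v. indicator {0<..} v * ennreal (1 / v ^ 2 * min 1 (v powr (3/2))) \<partial>lborel) \<le> ennreal 3"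
proof -
  have "(\<integral>\<^sup>+v. indicator {0<..} v * ennreal (1 / v ^ 2 * min 1 (v powr (3/2))) \<partial>lborel)
    \<le> (\<integral>\<^sup>+v. ennreal (v powr (- 1/2)) * indicator {0..1} v + ennreal (v powr (- 2)) * indicator {1..} v \<partial>lborel)"
  proof (rule nn_integral_mono)
    fix v :: real
    show "indicator {0<..} v * ennreal (1 / v ^ 2 * min 1 (v powr (3/2))) \<le> ennreal (v powr (- 1/2)) * indicator {0..1} v + ennreal (v powr (- 2)) * indicator {1..} v"
    proof (cases "v > 0")
      case v: True
      have v2: "1 / v ^ 2 = v powr (- 2)" using v by (simp add: powr_minus_divide powr_numeral)
      show ?thesis
      proof (cases "v \<le> 1")
        case True
        have "v powr (- 2) * min 1 (v powr (3/2)) \<le> v powr (- 2) * v powr (3/2)" by (intro mult_left_mono) auto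
        also have "\<dots> = v powr (- 1/2)" by (simp flip: powr_add)
        finally have "ennreal (1 / v ^ 2 * min 1 (v powr (3/2))) \<le> ennreal (v powr (- 1/2))" unfolding v2 by (rule ennreal_leI)
        then show ?thesis using v True by (simp add: add_increasing2)
      next
        case False
        have "v powr (- 2) * min 1 (v powr (3/2)) \<le> v powr (- 2) * 1" by (intro mult_left_mono) auto
        then have "ennreal (1 / v ^ 2 * min 1 (v powr (3/2))) \<le> ennreal (v powr (- 2))" unfolding v2 by (intro ennreal_leI) simp
        then show ?thesis using v False by simp
      qed
    qed simp
  qed
  also have "\<dots> = (\<integral>\<^sup>+v. ennreal (v powr (- 1/2)) * indicator {0..1} v \<partial>lborel) + (\<integral>\<^sup>+v. ennreal (v powr (- 2)) * indicator {1..} v \<partial>lborel)"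
    by (rule nn_integral_add) auto
  also have "(\<integral>\<^sup>+v. ennreal (v powr (- 1/2)) * indicator {0..1} v \<partial>lborel) = ennreal 2"
    using has_integral_powr_from_0[of "- 1/2" 1] by (intro nn_integral_has_integral_lebesgue') auto
  also have "(\<integral>\<^sup>+v. ennreal (v powr (- 2)) * indicator {1..} v \<partial>lborel) = ennreal 1"
    using has_integral_powr_to_inf[of "- 2" 1] by (intro nn_integral_has_integral_lebesgue') auto
  also have "ennreal 2 + ennreal 1 = ennreal 3" by (simp flip: ennreal_plus)
  finally show ?thesis .
qed

definition jacobi_strip :: "(complex \<times> complex) set" where
  "jacobi_strip = {p. 0 \<le> Re (fst p) \<and> Re (fst p) < 1 \<and> Im (fst p) > 0 \<and>
      0 \<le> Re (snd p) \<and> Re (snd p) < 1 \<and> 0 \<le> Im (snd p) \<and> Im (snd p) < Im (fst p)}"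

lemma sets_jacobi_strip [measurable]: "jacobi_strip \<in> sets borel"
proof -
  have "{p \<in> space borel. 0 \<le> Re (fst p) \<and> Re (fst p) < 1 \<and> Im (fst p) > 0 \<and>
      0 \<le> Re (snd p) \<and> Re (snd p) < 1 \<and> 0 \<le> Im (snd p) \<and> Im (snd p) < Im (fst p)} \<in> sets (borel :: (complex \<times> complex) measure)" by measurable
  then show ?thesis by (simp add: jacobi_strip_def)
qed

lemma theta_form_borel [measurable]: "theta_form \<in> borel_measurable borel"
  by (rule borel_measurable_jacobi_form[OF holomorphic2_theta_form]) (simp add: theta_form_def)

lemma nn_integral_theta_strip:
  assumes k: "k \<ge> 4"
  shows "(\<integral>\<^sup>+q. indicator jacobi_strip q * ennreal (jacobi_tilde k 1 theta_form q) \<partial>jmeas) \<le> ennreal (3 * theta_form_const k)"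
proof -
  let ?H = "theta_form_const k"
  let ?K = "\<lambda>v. indicator {0<..} v * ennreal (1 / v ^ 3 * (?H * min 1 (v powr (3/2)))) :: ennreal"
  have H: "?H > 0" by (rule theta_form_const_pos)
  have "(\<integral>\<^sup>+q. indicator jacobi_strip q * ennreal (jacobi_tilde k 1 theta_form q) \<partial>jmeas)
    = (\<integral>\<^sup>+v. \<integral>\<^sup>+y. \<integral>\<^sup>+u. \<integral>\<^sup>+x. indicator {0<..} v * ennreal (1 / v ^ 3) * (indicator jacobi_strip (Complex u v, Complex x y) * ennreal (jacobi_tilde k 1 theta_form (Complex u v, Complex x y))) \<partial>lborel \<partial>lborel \<partial>lborel \<partial>lborel)"
    by (rule nn_integral_jmeas_real) measurable
  also have "\<dots> \<le> (\<integral>\<^sup>+v. \<integral>\<^sup>+y. \<integral>\<^sup>+u. \<integral>\<^sup>+x. ?K v * indicator {0..v} y * indicator {0..1::real} u * indicator {0..1::real} x \<partial>lborel \<partial>lborel \<partial>lborel \<partial>lborel)"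
  proof (intro nn_integral_mono)
    fix v y u x :: real
    show "indicator {0<..} v * ennreal (1 / v ^ 3) * (indicator jacobi_strip (Complex u v, Complex x y) * ennreal (jacobi_tilde k 1 theta_form (Complex u v, Complex x y)))
      \<le> ?K v * indicator {0..v} y * indicator {0..1::real} u * indicator {0..1::real} x"
    proof (cases "(Complex u v, Complex x y) \<in> jacobi_strip")
      case True
      then have v: "v > 0" and yux: "y \<in> {0..v}" "u \<in> {0..1}" "x \<in> {0..1}" by (auto simp: jacobi_strip_def)
      have "ennreal (1 / v ^ 3) * ennreal (jacobi_tilde k 1 theta_form (Complex u v, Complex x y)) \<le> ennreal (1 / v ^ 3) * ennreal (?H * min 1 (v powr (3/2)))"
        using tilde_theta_form[of "(Complex u v, Complex x y)" k] v k by (intro mult_left_mono ennreal_leI) auto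
      also have "\<dots> = ennreal (1 / v ^ 3 * (?H * min 1 (v powr (3/2))))"
        using v H by (intro ennreal_mult[symmetric]) auto
      finally show ?thesis using True v yux by simp
    qed simp
  qed
  also have "\<dots> = (\<integral>\<^sup>+v. \<integral>\<^sup>+y. ?K v * indicator {0..v} y \<partial>lborel \<partial>lborel)"
    by (simp add: nn_integral_cmult_indicator)
  also have "\<dots> = (\<integral>\<^sup>+v. ennreal ?H * (indicator {0<..} v * ennreal (1 / v ^ 2 * min 1 (v powr (3/2)))) \<partial>lborel)"
  proof (rule nn_integral_cong)
    fix v :: real
    show "(\<integral>\<^sup>+y. ?K v * indicator {0..v} y \<partial>lborel) = ennreal ?H * (indicator {0<..} v * ennreal (1 / v ^ 2 * min 1 (v powr (3/2))))"
    proof (cases "v > 0")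
      case True
      have "(\<integral>\<^sup>+y. ?K v * indicator {0..v} y \<partial>lborel) = ennreal (1 / v ^ 3 * (?H * min 1 (v powr (3/2)))) * ennreal v"
        using True by (simp add: nn_integral_cmult_indicator)
      also have "\<dots> = ennreal (1 / v ^ 3 * (?H * min 1 (v powr (3/2))) * v)"
        using True H by (intro ennreal_mult[symmetric]) auto
      also have "1 / v ^ 3 * (?H * min 1 (v powr (3/2))) * v = ?H * (1 / v ^ 2 * min 1 (v powr (3/2)))"
        using True by (simp add: power2_eq_square power3_eq_cube)
      also have "ennreal \<dots> = ennreal ?H * ennreal (1 / v ^ 2 * min 1 (v powr (3/2)))"
        using H by (intro ennreal_mult) auto
      finally show ?thesis using True by simp
    qed simp
  qed
  also have "\<dots> = ennreal ?H * (\<integral>\<^sup>+v. indicator {0<..} v * ennreal (1 / v ^ 2 * min 1 (v powr (3/2))) \<partial>lborel)"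
    by (rule nn_integral_cmult) measurable
  also have "\<dots> \<le> ennreal ?H * ennreal 3" by (intro mult_left_mono nn_integral_decay) simp
  also have "\<dots> = ennreal (3 * ?H)" using H by (subst ennreal_mult[symmetric]) (auto simp: mult.commute)
  finally show ?thesis .
qed

lemma tilde_theta_jact:
  assumes g: "fst g \<in> SL2Z" and p: "p \<in> jacobi_domain"
  shows "jacobi_tilde k 1 theta_form (jact g p) = jacobi_tilde k 1 (poincare_term k (fst g $ 2 $ 1, fst g $ 2 $ 2)) p"
proof -
  obtain A l m \<tau> z where e: "g = (A, l, m)" "p = (\<tau>, z)" by (metis prod.exhaust)
  have A: "A \<in> SL2Z" and t: "Im \<tau> > 0" using g p e by auto
  let ?q = "(\<tau>, z + of_int l * \<tau> + of_int m)"
  have "jacobi_tilde k 1 theta_form (jact g p) = jacobi_tilde k 1 theta_form (jacobi_act A 0 0 ?q)"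
    by (simp add: e jact_Pair jacobi_act_def)
  also have "\<dots> = jacobi_tilde k 1 (slash k 1 theta_form A) ?q"
    using t by (intro tilde_slash[symmetric] A) auto
  also have "\<dots> = jacobi_tilde k 1 (slash k 1 theta_form A) p"
    unfolding e by (rule tilde_lattice[OF lattice_inv_slash[OF lattice_inv_theta_form A] t])
  also have "\<dots> = jacobi_tilde k 1 (poincare_term k (A $ 2 $ 1, A $ 2 $ 2)) p"
    unfolding tilde_eq poincare_term_eq[OF A p] ..
  finally show ?thesis by (simp add: e)
qed

lemma strip_representative:
  assumes r: "r \<in> primitive_rows N" and p: "p \<in> jacobi_domain"
  obtains g where "g \<in> JG N" "(fst g $ 2 $ 1, fst g $ 2 $ 2) = r" "jact g p \<in> jacobi_strip"
proof -
  have c: "coprime (fst r) (snd r)" "int N dvd fst r" using r by auto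
  note R = row_rep[OF c(1)]
  obtain \<tau> z where e: "p = (\<tau>, z)" by (cases p)
  have t: "Im \<tau> > 0" using p e by simp
  define A where "A = trans2 (- \<lfloor>Re (mob (row_rep r) \<tau>)\<rfloor>) ** row_rep r"
  have A: "A \<in> SL2Z" unfolding A_def by (intro SL2Z_mult trans2_SL2Z R)
  have row: "A $ 2 $ 1 = fst r" "A $ 2 $ 2 = snd r" by (simp_all add: A_def mul2_nth trans2_def R)
  have AG: "(A, 0, 0) \<in> JG N" using A row c by (simp add: JG_def Gamma0_def)
  define \<tau>' z' where "\<tau>' = mob A \<tau>" and "z' = z / mob_den A \<tau>"
  have "\<tau>' = mob (row_rep r) \<tau> + of_int (- \<lfloor>Re (mob (row_rep r) \<tau>)\<rfloor>)"
    unfolding \<tau>'_def A_def by (rule mob_trans2[OF R(1) t])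
  then have re: "0 \<le> Re \<tau>'" "Re \<tau>' < 1" by (simp; linarith)+
  have im: "Im \<tau>' > 0" unfolding \<tau>'_def by (rule Im_mob_pos[OF A t])
  define n where "n = \<lfloor>Im z' / Im \<tau>'\<rfloor>"
  define l where "l = - n"
  define m where "m = - \<lfloor>Re (z' + of_int l * \<tau>')\<rfloor>"
  define g where "g = jmul (mat 1, l, m) (A, 0, 0)"
  have gJ: "g \<in> JG N" unfolding g_def using AG Gamma0_one by (intro jmul_JG) (auto simp: JG_def)
  have fg: "fst g = A" by (simp add: g_def jmul_def)
  have "jact g p = jact (mat 1, l, m) (jact (A, 0, 0) p)"
    unfolding g_def using A SL2Z_one p by (intro jact_jmul) auto
  also have "\<dots> = (\<tau>', z' + of_int l * \<tau>' + of_int m)"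
    by (simp add: e jact_Pair \<tau>'_def z'_def)
  finally have jp: "jact g p = (\<tau>', z' + of_int l * \<tau>' + of_int m)" .
  have x: "0 \<le> Re (z' + of_int l * \<tau>' + of_int m)" "Re (z' + of_int l * \<tau>' + of_int m) < 1"
    by (simp_all add: m_def; linarith)+
  have "real_of_int n \<le> Im z' / Im \<tau>'" "Im z' / Im \<tau>' < real_of_int n + 1" unfolding n_def by linarith+
  then have y: "0 \<le> Im (z' + of_int l * \<tau>' + of_int m)" "Im (z' + of_int l * \<tau>' + of_int m) < Im \<tau>'"
    using im by (simp_all add: l_def field_simps)
  have "jact g p \<in> jacobi_strip" unfolding jp using re im x y by (simp add: jacobi_strip_def)
  with gJ fg row show ?thesis by (intro that[of g]) auto
qed

lemma tilde_poincare_le_unfolded: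
  assumes k: "k \<ge> 4" and p: "p \<in> jacobi_domain"
  shows "ennreal (jacobi_tilde k 1 (poincare k N) p)
    \<le> (\<integral>\<^sup>+g. indicator jacobi_strip (jact g p) * ennreal (jacobi_tilde k 1 theta_form (jact g p)) \<partial>count_space (JG N))"
    (is "_ \<le> ?T")
proof (cases "?T = top")
  case False
  then obtain t where t: "?T = ennreal t" "t \<ge> 0" by (cases ?T) auto
  let ?G = "\<lambda>g. indicator jacobi_strip (jact g p) * ennreal (jacobi_tilde k 1 theta_form (jact g p)) :: ennreal"
  define \<gamma> where "\<gamma> = (\<lambda>r. SOME g. g \<in> JG N \<and> (fst g $ 2 $ 1, fst g $ 2 $ 2) = r \<and> jact g p \<in> jacobi_strip)"
  have \<gamma>: "\<gamma> r \<in> JG N \<and> (fst (\<gamma> r) $ 2 $ 1, fst (\<gamma> r) $ 2 $ 2) = r \<and> jact (\<gamma> r) p \<in> jacobi_strip" if "r \<in> primitive_rows N" for r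
    unfolding \<gamma>_def
  proof (rule someI_ex)
    from strip_representative[OF that p]
    show "\<exists>g. g \<in> JG N \<and> (fst g $ 2 $ 1, fst g $ 2 $ 2) = r \<and> jact g p \<in> jacobi_strip" by blast
  qed
  have "(\<Sum>r\<in>X. jacobi_tilde k 1 (poincare_term k r) p) \<le> t" if X: "finite X" "X \<subseteq> primitive_rows N" for X
  proof -
    have inj: "inj_on \<gamma> X"
    proof (rule inj_onI)
      fix r s assume "r \<in> X" "s \<in> X" "\<gamma> r = \<gamma> s"
      then show "r = s" using \<gamma>[of r] \<gamma>[of s] X(2) by auto
    qed
    have "ennreal (\<Sum>r\<in>X. jacobi_tilde k 1 (poincare_term k r) p) = (\<Sum>r\<in>X. ennreal (jacobi_tilde k 1 (poincare_term k r) p))"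
      by (rule sum_ennreal[symmetric]) (rule jacobi_tilde_nonneg)
    also have "\<dots> = (\<Sum>r\<in>X. ?G (\<gamma> r))"
    proof (rule sum.cong[OF refl])
      fix r assume "r \<in> X"
      then have *: "\<gamma> r \<in> JG N" "(fst (\<gamma> r) $ 2 $ 1, fst (\<gamma> r) $ 2 $ 2) = r" "jact (\<gamma> r) p \<in> jacobi_strip" using \<gamma> X(2) by blast+
      show "ennreal (jacobi_tilde k 1 (poincare_term k r) p) = ?G (\<gamma> r)"
        using *(3) tilde_theta_jact[OF JG_SL2Z[OF *(1)] p, of k] by (simp only: *(2) indicator_simps mult_1_left)
    qed
    also have "\<dots> = (\<Sum>g\<in>\<gamma> ` X. ?G g)" by (simp add: sum.reindex[OF inj])
    also have "\<dots> = (\<integral>\<^sup>+g. ?G g \<partial>count_space (\<gamma> ` X))" using X(1) by (simp add: nn_integral_count_space_finite)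
    also have "\<dots> = (\<integral>\<^sup>+g. ?G g * indicator (\<gamma> ` X) g \<partial>count_space UNIV)" by (rule nn_integral_count_space_indicator) simp
    also have "\<dots> \<le> (\<integral>\<^sup>+g. ?G g * indicator (JG N) g \<partial>count_space UNIV)"
    proof (rule nn_integral_mono)
      fix g
      have "indicator (\<gamma> ` X) g \<le> (indicator (JG N) g :: ennreal)" using \<gamma> X(2) by (auto simp: indicator_def)
      then show "?G g * indicator (\<gamma> ` X) g \<le> ?G g * indicator (JG N) g" by (rule mult_left_mono) simp
    qed
    also have "\<dots> = ?T" by (rule nn_integral_count_space_indicator[symmetric]) simp
    finally show ?thesis using t by (simp add: ennreal_le_iff)
  qed
  then have "(\<Sum>\<^sub>\<infinity>r\<in>primitive_rows N. jacobi_tilde k 1 (poincare_term k r) p) \<le> t"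
    by (intro infsum_le_finite_sums poincare_term_summable(1)[OF k p])
  then have "jacobi_tilde k 1 (poincare k N) p \<le> t" using poincare_term_summable(4)[OF k p, of N] by linarith
  then show ?thesis unfolding t(1) by (rule ennreal_leI)
qed simp

lemma (in petersson_space) nrm_poincare:
  assumes k4: "k \<ge> 4"
  shows "nrm (poincare k N) \<le> ennreal (poincare_const k * (3 * theta_form_const k))"
proof -
  let ?C = "poincare_const k"
  let ?G = "\<lambda>q. ennreal ?C * (indicator jacobi_strip q * ennreal (jacobi_tilde k 1 theta_form q)) :: ennreal"
  have "nrm (poincare k N) \<le> (\<integral>\<^sup>+p. indicator dom p * (\<integral>\<^sup>+g. ?G (jact g p) \<partial>count_space (JG N)) \<partial>jmeas)"
    unfolding nrm_def
  proof (rule nn_integral_mono)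
    fix p
    show "indicator dom p * ennreal ((jacobi_tilde k 1 (poincare k N) p)\<^sup>2) \<le> indicator dom p * (\<integral>\<^sup>+g. ?G (jact g p) \<partial>count_space (JG N))"
    proof (cases "p \<in> dom")
      case True
      then have p: "p \<in> jacobi_domain" using dom_sub[OF True] by (cases p) simp
      let ?t = "jacobi_tilde k 1 (poincare k N) p"
      have "?t\<^sup>2 \<le> ?C * ?t"
        unfolding power2_eq_square by (rule mult_right_mono[OF tilde_poincare[OF k4 p] jacobi_tilde_nonneg])
      then have "ennreal (?t\<^sup>2) \<le> ennreal (?C * ?t)" by (rule ennreal_leI)
      also have "\<dots> = ennreal ?C * ennreal ?t"
        using poincare_const_pos[of k] jacobi_tilde_nonneg by (intro ennreal_mult) auto
      also have "\<dots> \<le> ennreal ?C * (\<integral>\<^sup>+g. indicator jacobi_strip (jact g p) * ennreal (jacobi_tilde k 1 theta_form (jact g p)) \<partial>count_space (JG N))"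
        by (intro mult_left_mono tilde_poincare_le_unfolded[OF k4 p]) simp
      also have "\<dots> = (\<integral>\<^sup>+g. ?G (jact g p) \<partial>count_space (JG N))" by (rule nn_integral_cmult[symmetric]) simp
      finally show ?thesis using True by simp
    qed simp
  qed
  also have "\<dots> \<le> (\<integral>\<^sup>+p. ?G p \<partial>jmeas)" by (rule unfold_upper[OF dom]) measurable
  also have "\<dots> = ennreal ?C * (\<integral>\<^sup>+p. indicator jacobi_strip p * ennreal (jacobi_tilde k 1 theta_form p) \<partial>jmeas)"
    by (rule nn_integral_cmult) measurable
  also have "\<dots> \<le> ennreal ?C * ennreal (3 * theta_form_const k)"
    by (intro mult_left_mono nn_integral_theta_strip k4) simp
  also have "\<dots> = ennreal (?C * (3 * theta_form_const k))"
    using poincare_const_pos[of k] theta_form_const_pos[of k] by (intro ennreal_mult[symmetric]) auto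
  finally show ?thesis .
qed

lemma poincare_at_i:
  assumes k: "k \<ge> 4" "even k" and N: "N \<ge> 2"
  shows "cmod (poincare k N (\<i>, 0)) \<ge> 2 * exp (- 2 * pi) - 32 * theta_form_const k * zeta32\<^sup>2 * real N powr (- 3/2)"
proof -
  let ?p = "(\<i>, 0) :: complex \<times> complex"
  let ?T = "\<lambda>r. poincare_term k r ?p"
  define R where "R = {r \<in> primitive_rows N. fst r \<noteq> 0}"
  define Q where "Q = ({(0, 1), (0, - 1)} :: (int \<times> int) set)"
  have p: "?p \<in> jacobi_domain" by simp
  have split: "primitive_rows N = Q \<union> R" "Q \<inter> R = {}"
    by (auto simp: Q_def R_def abs_if split: if_splits)
  have norm_tilde: "jacobi_tilde k 1 f ?p = cmod (f ?p)" for f by (simp add: tilde_eq)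
  have sn: "(\<lambda>r. norm (?T r)) summable_on R"
    by (rule summable_on_subset_banach[OF poincare_term_summable(3)[OF k(1) p, of N]]) (auto simp: R_def)
  have t1: "?T (0, 1) = theta_form ?p"
    using poincare_term_eq[OF SL2Z_one p, of k] by simp
  have t2: "?T (0, - 1) = theta_form ?p"
  proof -
    have m: "mat2 (- 1) 0 0 (- 1) \<in> SL2Z" by (simp add: SL2Z_iff)
    have "?T (0, - 1) = slash k 1 theta_form (mat2 (- 1) 0 0 (- 1)) ?p"
      using poincare_term_eq[OF m p, of k] by simp
    also have "\<dots> = theta_form ?p"
      using k(2) by (simp add: slash_def jacobi_act_def mob_num_def mob_den_def)
    finally show ?thesis .
  qed
  have tail: "cmod (infsum ?T R) \<le> 32 * theta_form_const k * zeta32\<^sup>2 * real N powr (- 3/2)"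
  proof -
    have "cmod (infsum ?T R) \<le> (\<Sum>\<^sub>\<infinity>r\<in>R. norm (?T r))" by (rule norm_infsum_bound[OF sn])
    also have "\<dots> \<le> 32 * theta_form_const k * zeta32\<^sup>2 * real N powr (- 3/2)"
    proof (rule infsum_le_finite_sums[OF sn])
      fix X assume X: "finite X" "X \<subseteq> R"
      let ?s = "\<lambda>(c, d). \<bar>real_of_int c\<bar> powr (- 3/2) * \<bar>real_of_int d\<bar> powr (- 3/2)"
      let ?h = "\<lambda>(c, d). (c div int N, d) :: int \<times> int"
      have "(\<Sum>r\<in>X. norm (?T r)) \<le> (\<Sum>r\<in>X. 8 * theta_form_const k * real N powr (- 3/2) * ?s (?h r))"
      proof (rule sum_mono)
        fix r assume "r \<in> X"
        then have "r \<in> R" using X by blast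
        then obtain c d where cd: "r = (c, d)" "coprime c d" "int N dvd c" "c \<noteq> 0" by (cases r) (auto simp: R_def)
        obtain c' where c': "c = int N * c'" using cd(3) by (elim dvdE)
        have "\<bar>c\<bar> \<noteq> 1" 
        proof
          assume "\<bar>c\<bar> = 1"
          then have "int N dvd 1" using cd(3) by (metis dvd_abs_iff)
          then show False using N by simp
        qed
        then have "(c, d) \<notin> {(0, 1), (0, - 1), (1, 0), (- 1, 0)}" using cd(4) by auto
        then have w: "row_weight r = 8 * ?s (c, d)" by (simp only: row_weight_def cd(1) prod.case of_bool_eq add_0_left if_False)
        have "\<bar>real_of_int c\<bar> powr (- 3/2) = real N powr (- 3/2) * \<bar>real_of_int c'\<bar> powr (- 3/2)"
          using N by (simp add: c' abs_mult powr_mult)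
        then have s: "?s (c, d) = real N powr (- 3/2) * ?s (?h r)" using N by (simp add: cd(1) c')
        have "norm (?T r) = jacobi_tilde k 1 (poincare_term k r) ?p" by (simp only: norm_tilde)
        also have "\<dots> \<le> theta_form_const k * row_weight r"
          using cd by (intro poincare_term_box k) auto
        also have "\<dots> = 8 * theta_form_const k * real N powr (- 3/2) * ?s (?h r)" unfolding w s by (simp only: mult_ac)
        finally show "norm (?T r) \<le> 8 * theta_form_const k * real N powr (- 3/2) * ?s (?h r)" .
      qed
      also have "\<dots> = 8 * theta_form_const k * real N powr (- 3/2) * (\<Sum>r\<in>?h ` X. ?s r)"
      proof -
        have "inj_on ?h X"
        proof (rule inj_onI)
          fix r r' assume rr: "r \<in> X" "r' \<in> X" "?h r = ?h r'"
          have "int N dvd fst r" "int N dvd fst r'" using rr(1,2) X(2) by (auto simp: R_def)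
          then show "r = r'" using rr(3) N by (cases r; cases r') (auto elim!: dvdE)
        qed
        then show ?thesis by (simp only: sum.reindex o_def sum_distrib_left)
      qed
      also have "\<dots> \<le> 8 * theta_form_const k * real N powr (- 3/2) * (4 * zeta32\<^sup>2)"
        using X(1) theta_form_const_pos[of k] by (intro mult_left_mono sum_rows_powr) auto
      finally show "(\<Sum>r\<in>X. norm (?T r)) \<le> 32 * theta_form_const k * zeta32\<^sup>2 * real N powr (- 3/2)" by (simp add: mult_ac)
    qed
    finally show ?thesis .
  qed
  have "poincare k N ?p = infsum ?T (Q \<union> R)" by (simp add: poincare_def flip: split(1))
  also have "\<dots> = infsum ?T Q + infsum ?T R"
    by (intro infsum_Un_disjoint split(2) abs_summable_summable[OF sn]) (simp add: Q_def)
  also have "infsum ?T Q = 2 * theta_form ?p" by (simp add: Q_def t1 t2)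
  finally have "poincare k N ?p = 2 * theta_form ?p + infsum ?T R" .
  then have "cmod (2 * theta_form ?p) - cmod (infsum ?T R) \<le> cmod (poincare k N ?p)"
    using norm_diff_ineq[of "2 * theta_form ?p" "infsum ?T R"] by simp
  moreover have "cmod (2 * theta_form ?p) \<ge> 2 * exp (- 2 * pi)" using theta_form_i by (simp add: norm_mult)
  ultimately show ?thesis using tail by linarith
qed

theorem theorem1p3:
  fixes k :: nat
  assumes "4 \<le> k" and "even k"
  shows "\<exists>c C :: real. 0 < c \<and> 0 < C \<and>
    (\<forall>\<^sub>F N :: nat in sequentially. squarefree N \<longrightarrow> ereal c \<le> jacobi_sup k 1 N) \<and>
    (\<forall>N :: nat. squarefree N \<longrightarrow> jacobi_sup k 1 N \<le> ereal (C * sqrt (real N)))"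
proof (intro exI conjI)
  define I where "I = poincare_const k * (3 * theta_form_const k)"
  have I: "I > 0" unfolding I_def using poincare_const_pos theta_form_const_pos by (intro mult_pos_pos) auto
  have space: "petersson_space k N" if "N > 0" for N using assms that by unfold_locales auto
  show "0 < (exp (- 2 * pi))\<^sup>2 / I" using I by simp
  have "((\<lambda>N :: nat. 32 * theta_form_const k * zeta32\<^sup>2 * real N powr (- 3/2)) \<longlongrightarrow> 0) sequentially"
    by real_asymp
  then have "\<forall>\<^sub>F N :: nat in sequentially. 32 * theta_form_const k * zeta32\<^sup>2 * real N powr (- 3/2) < exp (- 2 * pi)"
    by (rule order_tendstoD) simp
  then show "\<forall>\<^sub>F N :: nat in sequentially. squarefree N \<longrightarrow> ereal ((exp (- 2 * pi))\<^sup>2 / I) \<le> jacobi_sup k 1 N"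
    using eventually_ge_at_top[of 2]
  proof eventually_elim
    case (elim N)
    interpret petersson_space k N by (rule space) (use elim in simp)
    have "exp (- 2 * pi) \<le> cmod (poincare k N (\<i>, 0))" using poincare_at_i[OF assms elim(2)] elim(1) by linarith
    then have "(exp (- 2 * pi))\<^sup>2 \<le> (jacobi_tilde k 1 (poincare k N) (\<i>, 0))\<^sup>2" by (intro power_mono) (auto simp: tilde_eq)
    then have "ereal ((exp (- 2 * pi))\<^sup>2 / I) \<le> ereal ((jacobi_tilde k 1 (poincare k N) (\<i>, 0))\<^sup>2 / I)"
      using I by (simp add: divide_right_mono)
    also have "\<dots> \<le> jacobi_sup k 1 N"
      using nrm_poincare[OF assms(1)] I unfolding I_def[symmetric]
      by (intro jacobi_sup_ge poincare_cusp_form assms N) auto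
    finally show ?case by simp
  qed
  show "0 < 8 * upper_const k + 1"
    unfolding upper_const_def siegel_const_def using zeta32_ge_1
    by (intro add_nonneg_pos mult_nonneg_nonneg divide_nonneg_nonneg) auto
  show "\<forall>N :: nat. squarefree N \<longrightarrow> jacobi_sup k 1 N \<le> ereal ((8 * upper_const k + 1) * sqrt (real N))"
  proof (intro allI impI)
    fix N :: nat assume "squarefree N"
    then have "N > 0" by (intro Nat.gr0I) auto
    then interpret petersson_space k N by (rule space)
    have "jacobi_sup k 1 N \<le> ereal ub" by (rule jacobi_sup_le)
    also have "\<dots> \<le> ereal ((8 * upper_const k + 1) * sqrt (real N))" by (simp add: ub_def algebra_simps)
    finally show "jacobi_sup k 1 N \<le> ereal ((8 * upper_const k + 1) * sqrt (real N))" .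
  qed
qed

end
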